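(* Let $s>-\tfrac12$, $r_0\ge0$, $\varepsilon>0$ and $r_1\ge r_0+|s|$, with $r_1>\tfrac12$ so that point values of functions in $H^{r_1}_{2r_1}(\mathbb{R})$ are defined. Then there is a constant $c>0$, independent of $n$ and $f$, such that for all $n=2p-1$, $p\in\mathbb{N}$, and all $f\in H^{r_1}_{2r_1}(\mathbb{R})$ $$\|(\mathcal{I}-\mathcal{I}_n)[f]\|_{H^{s}_{r_0}(\mathbb{R})}\le c\bigl(\tfrac{\ell n}{2}\bigr)^{\frac32+\varepsilon+r_0+|s|-\min\{0,2s\}-r_1}\|f\|_{H^{r_1}_{2r_1}(\mathbb{R})}.$$
   Context: Fourier transform: $\mathcal{F}[f](\xi)=\hat f(\xi)=\frac{1}{\sqrt{2\pi}}\int_{\mathbb{R}}e^{-i\xi x}f(x)\,dx$. A scaling parameter $\ell>0$ is fixed. Variable weight Sobolev spaces. For $r\ge 0$ let $\kappa^-_{r,\ell}(x)=\frac{1}{\sqrt{2\pi}}(i\ell-x)^r$ (principal branch). For $s>-\tfrac12$, $r\ge0$, $H^s_r(\mathbb{R})$ consists of all real valued tempered distributions $f$ with $\|f\|_{H^s_r(\mathbb{R})}<\infty$, where $$\|f\|_{H^s_r(\mathbb{R})}^2=\tfrac12\|f\|_{L^2(\mathbb{R})}^2+\int_0^\infty \xi^{2s}\,\bigl|\mathcal{F}[\kappa^-_{r,\ell}f](\xi)\bigr|^2d\xi ,$$ finiteness meaning that $f\in L^2(\mathbb{R})$ and that the restriction of the distribution $\mathcal{F}[\kappa^-_{r,\ell}f]$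 to $(0,\infty)$ is a function for which the integral is finite. MTC functions: for $k\ge0$, $\phi_{2k}(x)=2\sqrt{\tfrac{\ell}{\pi}}\,\operatorname{Im}\tfrac{(2x+i\ell)^k}{(2x-i\ell)^{k+1}}$, $\phi_{2k+1}(x)=2\sqrt{\tfrac{\ell}{\pi}}\,\operatorname{Re}\tfrac{(2x+i\ell)^k}{(2x-i\ell)^{k+1}}$; they form a complete orthonormal system in $L^2(\mathbb{R})$. $\mathbb{P}_n=\operatorname{span}\{\phi_0,\dots,\phi_n\}$. Interpolation operator: for $n=2p-1$ and nodes $x_m=\tfrac{\ell}{2}\cot\bigl(\tfrac{2m+1}{4p}\pi\bigr)$, $0\le m\le 2p-1$, $$\mathcal{I}_n[f]=\sum_{k=0}^n\bar f_k\phi_k,\qquad \bar f_k=\tfrac{\pi}{4\ell p}\sum_{m=0}^{2p-1}(\ell^2+4x_m^2)\phi_k(x_m)f(x_m);$$ it satisfies $\mathcal{I}_n[f](x_m)=f(x_m)$ for $0\le m\le 2p-1$. $\mathcal{I}$ is the identity. *)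

theory Defs
  imports "HOL-Analysis.Analysis"
begin

definition fourier :: "(real \<Rightarrow> complex) \<Rightarrow> real \<Rightarrow> complex" where
  "fourier f \<xi> = complex_of_real (1 / sqrt (2 * pi)) *
     (LINT x|lborel. exp (- (\<i> * complex_of_real (\<xi> * x))) * f x)"

definition smooth :: "(real \<Rightarrow> complex) \<Rightarrow> bool" where
  "smooth \<psi> \<longleftrightarrow> (\<exists>D :: nat \<Rightarrow> real \<Rightarrow> complex.
     D 0 = \<psi> \<and> (\<forall>k x. (D k has_vector_derivative D (Suc k) x) (at x)))"

definition test_functions :: "real set \<Rightarrow> (real \<Rightarrow> complex) set" where
  "test_functions U = {\<psi>. smooth \<psi> \<and>
     (\<exists>K. compact K \<and> K \<subseteq> U \<and> (\<forall>x. x \<notin> K \<longrightarrow> \<psi> x = 0))}"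

text \<open>
  Distributions are represented by their action on test functions. The functional
  \<open>distr_of g\<close> is a tempered distribution for every \<open>g\<close> that is the product of a
  square integrable function and a function of polynomial growth; these are the only
  \<open>g\<close> used below.
\<close>

definition distr_of :: "(real \<Rightarrow> complex) \<Rightarrow> (real \<Rightarrow> complex) \<Rightarrow> complex" where
  "distr_of g \<psi> = (LINT x|lborel. g x * \<psi> x)"

definition distr_fourier ::
    "((real \<Rightarrow> complex) \<Rightarrow> complex) \<Rightarrow> (real \<Rightarrow> complex) \<Rightarrow> complex" where
  "distr_fourier T \<psi> = T (fourier \<psi>)"

text \<open>
  The restriction of the distribution \<open>T\<close> to \<open>(0, \<infinity>)\<close> is the locally integrable
  function \<open>G\<close>. Values of \<open>G\<close> outside \<open>(0, \<infinity>)\<close> are irrelevant, and \<open>G\<close> is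
  determined by \<open>T\<close> almost everywhere on \<open>(0, \<infinity>)\<close>.
\<close>

definition restricts_to_fun ::
    "((real \<Rightarrow> complex) \<Rightarrow> complex) \<Rightarrow> (real \<Rightarrow> complex) \<Rightarrow> bool" where
  "restricts_to_fun T G \<longleftrightarrow>
     (\<forall>a b. 0 < a \<and> a \<le> b \<longrightarrow> set_integrable lborel {a..b} G) \<and>
     (\<forall>\<psi>\<in>test_functions {0<..}. T \<psi> = (LINT \<xi>:{0<..}|lborel. G \<xi> * \<psi> \<xi>))"

definition kappa_minus :: "real \<Rightarrow> real \<Rightarrow> real \<Rightarrow> complex" where
  "kappa_minus l r x = complex_of_real (1 / sqrt (2 * pi)) *
     (\<i> * complex_of_real l - complex_of_real x) powr complex_of_real r"

definition weighted_fourier :: "real \<Rightarrow> real \<Rightarrow> (real \<Rightarrow> real) \<Rightarrow> (real \<Rightarrow> complex) \<Rightarrow> complex" where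
  "weighted_fourier l r f =
     distr_fourier (distr_of (\<lambda>x. kappa_minus l r x * complex_of_real (f x)))"

text \<open>
  Elements of the space are represented by Borel measurable functions; two of them that
  agree almost everywhere stand for the same element.
\<close>

definition sobolev_space :: "real \<Rightarrow> real \<Rightarrow> real \<Rightarrow> (real \<Rightarrow> real) set" where
  "sobolev_space l s r = {f.
     f \<in> borel_measurable lborel \<and> integrable lborel (\<lambda>x. (f x)\<^sup>2) \<and>
     (\<exists>G. restricts_to_fun (weighted_fourier l r f) G \<and>
        set_integrable lborel {0<..} (\<lambda>\<xi>. \<xi> powr (2 * s) * (cmod (G \<xi>))\<^sup>2))}"

text \<open>Meaningful for members of \<open>sobolev_space l s r\<close> only; the integrals are real valued.\<close>

definition sobolev_norm :: "real \<Rightarrow> real \<Rightarrow> real \<Rightarrow> (real \<Rightarrow> real) \<Rightarrow> real" where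
  "sobolev_norm l s r f =
     (let G = (SOME G. restricts_to_fun (weighted_fourier l r f) G)
      in sqrt (1 / 2 * (LINT x|lborel. (f x)\<^sup>2) +
               (LINT \<xi>:{0<..}|lborel. \<xi> powr (2 * s) * (cmod (G \<xi>))\<^sup>2)))"

definition mtc :: "real \<Rightarrow> nat \<Rightarrow> real \<Rightarrow> real" where
  "mtc l j x =
     (let k = j div 2;
          z = (complex_of_real (2 * x) + \<i> * complex_of_real l) ^ k /
              (complex_of_real (2 * x) - \<i> * complex_of_real l) ^ (k + 1)
      in 2 * sqrt (l / pi) * (if even j then Im z else Re z))"

definition mtc_node :: "real \<Rightarrow> nat \<Rightarrow> nat \<Rightarrow> real" where
  "mtc_node l p m = l / 2 * cot (real (2 * m + 1) / real (4 * p) * pi)"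

definition mtc_coeff :: "real \<Rightarrow> nat \<Rightarrow> (real \<Rightarrow> real) \<Rightarrow> nat \<Rightarrow> real" where
  "mtc_coeff l p f k = pi / (4 * l * real p) *
     (\<Sum>m = 0..2 * p - 1. (l\<^sup>2 + 4 * (mtc_node l p m)\<^sup>2) * mtc l k (mtc_node l p m) * f (mtc_node l p m))"

text \<open>The operator \<open>\<I>\<^sub>n\<close> with \<open>n = 2 * p - 1\<close>, for \<open>p \<ge> 1\<close>.\<close>

definition mtc_interp :: "real \<Rightarrow> nat \<Rightarrow> (real \<Rightarrow> real) \<Rightarrow> real \<Rightarrow> real" where
  "mtc_interp l p f x = (\<Sum>k = 0..2 * p - 1. mtc_coeff l p f k * mtc l k x)"

text \<open>
  Point values of an element of the space are those of its continuous representative,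
  which is unique if it exists.
\<close>

definition cont_rep :: "(real \<Rightarrow> real) \<Rightarrow> real \<Rightarrow> real" where
  "cont_rep f = (SOME g. continuous_on UNIV g \<and> (AE x in lborel. g x = f x))"

end

theory Submission
  imports Defs "HOL-Probability.Probability"
begin

text \<open>
  Weighted Fourier transforms of elements of the space have densities \<open>G\<close> on \<open>(0, \<infinity>)\<close>, and the
  norms are weighted \<open>L\<^sup>2\<close> norms of \<open>G\<close>. Changing the weight exponent \<open>r\<close>, or the scaling
  parameter from \<open>l\<close> to \<open>l / 2\<close>, multiplies the function by the Fourier transform of a kernel on the
  half line dominated by \<open>t powr (b - 1) * exp (- c * t)\<close>; such kernels act on the weighted
  \<open>L\<^sup>2\<close> spaces by the Schur test. With parameter \<open>l / 2\<close> and weight exponent \<open>2 * r\<close>, the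
  densities of the MTC functions are Laguerre functions orthogonal for the weight
  \<open>t powr (2 * r)\<close>. Bessel's inequality turns the norm of \<open>f\<close> into a weighted \<open>\<ell>\<^sup>2\<close> bound for its
  MTC coefficients \<open>a\<^sub>j\<close>, hence into a bound for the sum of \<open>(j + 1) powr \<mu> * \<bar>a\<^sub>j\<bar>\<close> for every
  \<open>\<mu> < r\<^sub>1 - 1 / 2\<close>. The nodes are equidistant on the circle after a Cayley transform, so that the
  coefficients of the interpolant differ from \<open>a\<^sub>j\<close> by at most twice the tail of the coefficient
  sum. The norm of the \<open>j\<close>-th MTC function in the target space grows at most like
  \<open>(j + 1) powr \<rho>\<close> for every \<open>\<rho> > r\<^sub>0 + \<bar>s\<bar>\<close>, and summation yields the exponent \<open>1 + \<rho> - \<mu>\<close>.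
\<close>

text \<open>The MTC functions have their poles at distance \<open>l / 2\<close> from the line, the
  weight of the space has its branch point at distance \<open>l\<close>. Orthogonality thus lives at
  parameter \<open>l / 2\<close> and the norms at \<open>l\<close>, and the weights must be
  exchanged in both directions. Their quotient contains a power of
  \<open>1 - (l / 2) / (l + i x)\<close>, whose binomial series converges uniformly because the
  correction has modulus at most 1/2. The space only offers tests with compact support in
  \<open>(0, \<infinity>)\<close>, whereas kernels and Laguerre functions merely vanish at 0 and
  decay exponentially; \<open>extended_testing\<close> bridges this gap, and both the change of
  weights and the coefficient formula rest on it. The bound \<open>s > - 1 / 2\<close> is what makes
  Hardy's kernel bounded. The exponent 3/2 is 1/2 + 1: Cauchy-Schwarz for the sum of the
  coefficients costs 1/2, and an error bounded by a tail in each of \<open>2 * p\<close>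
  coefficients costs 1. If the target weight grows faster than the coefficients allow
  (\<open>\<rho> > \<mu>\<close>), the error series need not converge in weighted norm; then
  \<open>f\<close> and its interpolant are bounded separately.\<close>

section \<open>Integrals depending on a parameter\<close>

lemma continuous_LINT:
  fixes f :: "real \<Rightarrow> real \<Rightarrow> complex"
  assumes [measurable]: "\<And>x. f x \<in> borel_measurable lborel"
    and B: "integrable lborel B" and bd: "\<And>x t. norm (f x t) \<le> B t"
    and c: "\<And>t. continuous_on UNIV (\<lambda>x. f x t)"
  shows "continuous_on UNIV (\<lambda>x. LINT t|lborel. f x t)"
proof -
  have "continuous (at x) (\<lambda>x. LINT t|lborel. f x t)" for x
    unfolding continuous_at_sequentially o_def
  proof (intro allI impI)
    fix X assume X: "X \<longlonglongrightarrow> x"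
    show "(\<lambda>n. LINT t|lborel. f (X n) t) \<longlonglongrightarrow> (LINT t|lborel. f x t)"
    proof (rule integral_dominated_convergence[where w = B])
      have "(\<lambda>n. f (X n) t) \<longlonglongrightarrow> f x t" for t
      proof -
        have "isCont (\<lambda>x. f x t) x" using c[of t] by (simp add: continuous_on_eq_continuous_at)
        then show ?thesis using X by (rule isCont_tendsto_compose)
      qed
      then show "AE t in lborel. (\<lambda>n. f (X n) t) \<longlonglongrightarrow> f x t" by simp
    qed (use B bd in auto)
  qed
  then show ?thesis by (simp add: continuous_on_eq_continuous_at)
qed

text \<open>Dominated convergence for the difference quotients: the mean value inequality bounds the
  quotient of the remainder by \<open>2 * B t\<close>, uniformly in the increment.\<close>

lemma has_vector_derivative_LINT:
  fixes f :: "real \<Rightarrow> real \<Rightarrow> complex"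
  assumes int: "\<And>x. integrable lborel (f x)"
    and [measurable]: "\<And>x. f' x \<in> borel_measurable lborel"
    and B: "integrable lborel B" and bd: "\<And>x t. norm (f' x t) \<le> B t"
    and d: "\<And>x t. ((\<lambda>x. f x t) has_vector_derivative f' x t) (at x)"
  shows "((\<lambda>x. LINT t|lborel. f x t) has_vector_derivative (LINT t|lborel. f' x t)) (at x)"
proof -
  have int': "integrable lborel (f' x)" for x
    by (rule Bochner_Integration.integrable_bound[OF B]) (use bd in \<open>auto intro!: AE_I2 intro: order_trans[OF _ abs_ge_self]\<close>)
  have [measurable]: "f x \<in> borel_measurable lborel" for x using int by auto
  have lip: "norm (f (x + h) t - f x t) \<le> norm h * B t" for x h t
  proof -
    have "norm (f (x + h) t - f x t) \<le> B t * norm (x + h - x)"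
    proof (rule differentiable_bound[of UNIV])
      show "((\<lambda>x. f x t) has_derivative (\<lambda>h. h *\<^sub>R f' y t)) (at y within UNIV)" for y
        using d[where x=y and t=t] by (simp add: has_vector_derivative_def)
      show "onorm (\<lambda>h. h *\<^sub>R f' y t) \<le> B t" for y
        by (rule onorm_le) (use bd[of y t] in \<open>auto intro: mult_left_mono simp: mult.commute[of "B t"]\<close>)
    qed auto
    then show ?thesis by (simp add: mult.commute)
  qed
  have "(\<lambda>h. norm ((LINT t|lborel. f (x + h) t) - (LINT t|lborel. f x t) - h *\<^sub>R (LINT t|lborel. f' x t)) / norm h) \<midarrow>0\<rightarrow> 0"
    unfolding tendsto_at_iff_sequentially o_def
  proof (intro allI impI)
    fix X :: "nat \<Rightarrow> real" assume X: "\<forall>i. X i \<in> UNIV - {0}" "X \<longlonglongrightarrow> 0"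
    then have nz: "X i \<noteq> 0" for i by auto
    define q where "q i t = (f (x + X i) t - f x t - X i *\<^sub>R f' x t) / of_real (X i)" for i t
    have [measurable]: "q i \<in> borel_measurable lborel" for i unfolding q_def[abs_def] by measurable
    have lim: "(\<lambda>i. q i t) \<longlonglongrightarrow> 0" for t
    proof -
      have "(\<lambda>h. norm (f (x + h) t - f x t - h *\<^sub>R f' x t) / norm h) \<midarrow>0\<rightarrow> 0"
        using d[of t x] by (simp add: has_vector_derivative_def has_derivative_at)
      then have "(\<lambda>i. norm (f (x + X i) t - f x t - X i *\<^sub>R f' x t) / norm (X i)) \<longlonglongrightarrow> 0"
        using X unfolding tendsto_at_iff_sequentially o_def by blast
      then show ?thesis by (subst tendsto_norm_zero_iff[symmetric]) (simp add: q_def norm_divide)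
    qed
    have "(\<lambda>i. LINT t|lborel. q i t) \<longlonglongrightarrow> (LINT t::real|lborel. 0)"
    proof (rule integral_dominated_convergence[where s = q and f = "\<lambda>_. 0" and w = "\<lambda>t. 2 * B t"])
      show "AE t in lborel. norm (q i t) \<le> 2 * B t" for i
      proof (rule AE_I2)
        fix t
        have "norm (f (x + X i) t - f x t - X i *\<^sub>R f' x t) \<le> norm (X i) * B t + norm (X i) * B t"
          by (rule order_trans[OF norm_triangle_ineq4]) (use lip[of x "X i" t] mult_left_mono[OF bd[of x t], of "norm (X i)"] in \<open>simp add: mult.commute\<close>)
        then show "norm (q i t) \<le> 2 * B t"
          using nz[of i] by (simp add: q_def norm_divide divide_le_eq mult.commute mult.left_commute)
      qed
    qed (use B lim in auto)
    moreover have "(LINT t|lborel. q i t) = ((LINT t|lborel. f (x + X i) t) - (LINT t|lborel. f x t) - X i *\<^sub>R (LINT t|lborel. f' x t)) / of_real (X i)" for i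
      unfolding q_def using int int' by (simp add: scaleR_conv_of_real)
    ultimately have "(\<lambda>i. norm (((LINT t|lborel. f (x + X i) t) - (LINT t|lborel. f x t) - X i *\<^sub>R (LINT t|lborel. f' x t)) / of_real (X i))) \<longlonglongrightarrow> 0"
      using tendsto_norm_zero by fastforce
    then show "(\<lambda>i. norm ((LINT t|lborel. f (x + X i) t) - (LINT t|lborel. f x t) - X i *\<^sub>R (LINT t|lborel. f' x t)) / norm (X i)) \<longlonglongrightarrow> 0"
      by (simp add: norm_divide)
  qed
  then show ?thesis
    by (simp add: has_vector_derivative_def has_derivative_at bounded_linear_scaleR_left)
qed

section \<open>The Fourier integral\<close>

text \<open>Left unnormalised so that convolutions become plain products (\<open>ft_conv\<close>);
  the factor of \<open>fourier\<close> is restored only in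
  \<open>weighted_fourier_eq\<close>.\<close>

definition ft :: "(real \<Rightarrow> complex) \<Rightarrow> real \<Rightarrow> complex" where
  "ft g x = (LINT t|lborel. exp (- (\<i> * of_real (x * t))) * g t)"

lemma fourier_eq_ft: "fourier g x = of_real (1 / sqrt (2 * pi)) * ft g x"
  unfolding fourier_def ft_def ..

lemma norm_exp_ii [simp]: "norm (exp (- (\<i> * complex_of_real x))) = 1" "norm (exp (\<i> * complex_of_real x)) = 1"
  "norm (exp (- (\<i> * (complex_of_real x * complex_of_real y)))) = 1"
  "norm (exp (\<i> * (complex_of_real x * complex_of_real y))) = 1"
  by (simp_all add: norm_exp_eq_Re)

lemma measurable_exp_ii [measurable]:
  "(\<lambda>t. exp (- (\<i> * complex_of_real (x * t)))) \<in> borel_measurable borel"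
  "(\<lambda>t. exp (\<i> * complex_of_real (x * t))) \<in> borel_measurable borel"
  by measurable

lemma integrable_exp_mult:
  assumes "integrable lborel g"
  shows "integrable lborel (\<lambda>t. exp (- (\<i> * of_real (x * t))) * g t)"
    "integrable lborel (\<lambda>t. exp (\<i> * of_real (x * t)) * g t)"
  by (rule Bochner_Integration.integrable_bound[OF assms]; use assms in \<open>auto simp: norm_mult simp del: of_real_mult\<close>)+

lemma norm_ft_le: "norm (ft g x) \<le> (LINT t|lborel. norm (g t))"
proof -
  have "norm (ft g x) \<le> (LINT t|lborel. norm (exp (- (\<i> * of_real (x * t))) * g t))"
    unfolding ft_def by (rule integral_norm_bound)
  then show ?thesis by (simp add: norm_mult)
qed

lemma continuous_ft:
  assumes "integrable lborel g"
  shows "continuous_on UNIV (ft g)"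
  unfolding ft_def[abs_def]
proof (rule continuous_LINT[where B = "\<lambda>t. norm (g t)"])
  show "(\<lambda>t. exp (- (\<i> * complex_of_real (x * t))) * g t) \<in> borel_measurable lborel" for x
    using integrable_exp_mult(1)[OF assms, of x] by (rule borel_measurable_integrable)
  show "continuous_on UNIV (\<lambda>x. exp (- (\<i> * complex_of_real (x * t))) * g t)" for t
    by (intro continuous_intros)
qed (use assms in \<open>auto simp: norm_mult simp del: of_real_mult\<close>)

lemma measurable_ft: "integrable lborel g \<Longrightarrow> ft g \<in> borel_measurable borel"
  using continuous_ft by (rule borel_measurable_continuous_onI)

lemma ft_add: "integrable lborel f \<Longrightarrow> integrable lborel g \<Longrightarrow> ft (\<lambda>t. f t + g t) x = ft f x + ft g x"
  unfolding ft_def using integrable_exp_mult(1)[of f x] integrable_exp_mult(1)[of g x]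
  by (simp add: distrib_left del: of_real_mult)

lemma ft_cmult: "ft (\<lambda>t. c * g t) x = c * ft g x"
proof -
  have "ft (\<lambda>t. c * g t) x = (LINT t|lborel. c * (exp (- (\<i> * of_real (x * t))) * g t))"
    unfolding ft_def by (intro Bochner_Integration.integral_cong) (simp_all add: algebra_simps)
  then show ?thesis by (simp add: ft_def)
qed

subsection \<open>Test functions\<close>

text \<open>\<open>smooth\<close> asks for a whole sequence of derivatives. A class of functions
  that contains a derivative of each of its members yields such a sequence by iteration, so no
  formula for the \<open>k\<close>-th derivative is ever written down.\<close>

lemma smooth_coinduct:
  assumes "f \<in> X" and "\<And>g. g \<in> X \<Longrightarrow> \<exists>g'\<in>X. \<forall>x. (g has_vector_derivative g' x) (at x)"
  shows "smooth f"
proof -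
  obtain d where d: "\<And>g. g \<in> X \<Longrightarrow> d g \<in> X \<and> (\<forall>x. (g has_vector_derivative d g x) (at x))"
    using assms(2) by metis
  have "(d ^^ k) f \<in> X" for k by (induction k) (use assms(1) d in auto)
  then show ?thesis unfolding smooth_def
    by (intro exI[of _ "\<lambda>k. (d ^^ k) f"]) (use d in auto)
qed

lemma smooth_derivative:
  assumes "smooth f" obtains f' where "smooth f'" "\<And>x. (f has_vector_derivative f' x) (at x)"
proof -
  obtain D where D: "D 0 = f" "\<And>k x. (D k has_vector_derivative D (Suc k) x) (at x)"
    using assms unfolding smooth_def by blast
  have "smooth (D 1)" unfolding smooth_def
    by (intro exI[of _ "\<lambda>k. D (Suc k)"]) (use D in auto)
  with D show ?thesis using that by (metis One_nat_def)
qed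

text \<open>Products of smooth functions are not closed under differentiation, finite sums of
  products are; this is the class to which \<open>smooth_coinduct\<close> is applied for
  \<open>smooth_mult\<close>.\<close>

inductive_set prod_sums :: "(real \<Rightarrow> complex) set" where
  "smooth f \<Longrightarrow> smooth g \<Longrightarrow> (\<lambda>x. f x * g x) \<in> prod_sums"
| "f \<in> prod_sums \<Longrightarrow> g \<in> prod_sums \<Longrightarrow> (\<lambda>x. f x + g x) \<in> prod_sums"

lemma smooth_mult:
  assumes "smooth f" "smooth g" shows "smooth (\<lambda>x. f x * g x)"
proof (rule smooth_coinduct[where X = prod_sums])
  show "(\<lambda>x. f x * g x) \<in> prod_sums" using assms by (rule prod_sums.intros)
  show "\<exists>g'\<in>prod_sums. \<forall>x. (g has_vector_derivative g' x) (at x)" if "g \<in> prod_sums" for g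
    using that
  proof induction
    case (1 f g)
    obtain f' where f': "smooth f'" "\<And>x. (f has_vector_derivative f' x) (at x)" using smooth_derivative[OF 1(1)] by blast
    obtain g' where g': "smooth g'" "\<And>x. (g has_vector_derivative g' x) (at x)" using smooth_derivative[OF 1(2)] by blast
    show ?case
      by (rule bexI[of _ "\<lambda>x. f x * g' x + f' x * g x"])
        (use 1 f' g' in \<open>auto intro!: prod_sums.intros has_vector_derivative_mult\<close>)
  next
    case (2 f g)
    then obtain f' g' where "f' \<in> prod_sums" "g' \<in> prod_sums"
      "\<forall>x. (f has_vector_derivative f' x) (at x)" "\<forall>x. (g has_vector_derivative g' x) (at x)" by blast
    then show ?case
      by (intro bexI[of _ "\<lambda>x. f' x + g' x"]) (auto intro!: prod_sums.intros has_vector_derivative_add)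
  qed
qed

lemma smooth_add:
  assumes "smooth f" "smooth g" shows "smooth (\<lambda>x. f x + g x)"
proof (rule smooth_coinduct[where X = "{h. \<exists>f g. smooth f \<and> smooth g \<and> h = (\<lambda>x. f x + g x)}"])
  fix h assume "h \<in> {h. \<exists>f g. smooth f \<and> smooth g \<and> h = (\<lambda>x. f x + g x)}"
  then obtain f g where fg: "smooth f" "smooth g" "h = (\<lambda>x. f x + g x)" by blast
  obtain f' where f': "smooth f'" "\<And>x. (f has_vector_derivative f' x) (at x)" using smooth_derivative[OF fg(1)] by blast
  obtain g' where g': "smooth g'" "\<And>x. (g has_vector_derivative g' x) (at x)" using smooth_derivative[OF fg(2)] by blast
  show "\<exists>g'\<in>{h. \<exists>f g. smooth f \<and> smooth g \<and> h = (\<lambda>x. f x + g x)}. \<forall>x. (h has_vector_derivative g' x) (at x)"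
  proof (rule bexI[of _ "\<lambda>x. f' x + g' x"])
    show "\<forall>x. (h has_vector_derivative f' x + g' x) (at x)"
      unfolding fg(3) using f'(2) g'(2) has_vector_derivative_add by blast
    show "(\<lambda>x. f' x + g' x) \<in> {h. \<exists>f g. smooth f \<and> smooth g \<and> h = (\<lambda>x. f x + g x)}"
      using f'(1) g'(1) by blast
  qed
qed (use assms in blast)

lemma smooth_const: "smooth (\<lambda>x. c)"
  by (rule smooth_coinduct[where X = "range (\<lambda>c x. c)"]) (auto intro!: exI[of _ 0] has_vector_derivative_const)

lemma smooth_affine:
  assumes "smooth f" shows "smooth (\<lambda>x. f (a * x + b))"
\<comment> \<open>The constant \<open>c\<close> absorbs the powers of \<open>a\<close> produced by
  the chain rule.\<close>
proof (rule smooth_coinduct[where X = "{h. \<exists>f c. smooth f \<and> h = (\<lambda>x. c * f (a * x + b))}"])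
  show "(\<lambda>x. f (a * x + b)) \<in> {h. \<exists>f c. smooth f \<and> h = (\<lambda>x. c * f (a * x + b))}"
    using assms by (auto intro!: exI[of _ f] exI[of _ 1])
  fix h assume "h \<in> {h. \<exists>f c. smooth f \<and> h = (\<lambda>x. c * f (a * x + b))}"
  then obtain f c where fg: "smooth f" "h = (\<lambda>x. c * f (a * x + b))" by blast
  obtain f' where f': "smooth f'" "\<And>x. (f has_vector_derivative f' x) (at x)" using smooth_derivative[OF fg(1)] by blast
  have "((\<lambda>x. f (a * x + b)) has_vector_derivative a *\<^sub>R f' (a * x + b)) (at x)" for x
  proof -
    have "((\<lambda>x. a * x + b) has_vector_derivative a) (at x)"
      unfolding has_real_derivative_iff_has_vector_derivative[symmetric] by (auto intro!: derivative_eq_intros)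
    from vector_diff_chain_at[OF this, of f "f' (a * x + b)"] f'(2) show ?thesis by (simp add: o_def)
  qed
  then have "(h has_vector_derivative (c * of_real a) * f' (a * x + b)) (at x)" for x
    unfolding fg by (auto intro!: derivative_eq_intros has_vector_derivative_mult_right simp: scaleR_conv_of_real mult.assoc)
  then show "\<exists>g'\<in>{h. \<exists>f c. smooth f \<and> h = (\<lambda>x. c * f (a * x + b))}. \<forall>x. (h has_vector_derivative g' x) (at x)"
    using f'(1) by (intro bexI[of _ "\<lambda>x. (c * of_real a) * f' (a * x + b)"]) auto
qed

lemma smooth_continuous: "smooth f \<Longrightarrow> continuous_on UNIV f"
  by (meson continuous_on_vector_derivative has_vector_derivative_at_within smooth_derivative)

lemma test_functions_cases:
  assumes "\<psi> \<in> test_functions {0<..}"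
  obtains a b where "0 < a" "a < b" "\<And>x. x < a \<or> b < x \<Longrightarrow> \<psi> x = 0"
proof -
  obtain K where K: "compact K" "K \<subseteq> {0<..}" "\<And>x. x \<notin> K \<Longrightarrow> \<psi> x = 0"
    using assms unfolding test_functions_def by blast
  show ?thesis
  proof (cases "K = {}")
    case True
    then show ?thesis using K that[of 1 2] by auto
  next
    case False
    obtain a where a: "a \<in> K" "\<And>x. x \<in> K \<Longrightarrow> a \<le> x" using compact_attains_inf[OF K(1) False] by blast
    obtain b where b: "b \<in> K" "\<And>x. x \<in> K \<Longrightarrow> x \<le> b" using compact_attains_sup[OF K(1) False] by blast
    show ?thesis
    proof (rule that[of a "b + 1"])
      show "0 < a" using a K by auto
      show "a < b + 1" using a b by fastforce
      show "\<psi> x = 0" if "x < a \<or> b + 1 < x" for x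
        by (rule K(3)) (use a(2)[of x] b(2)[of x] that in force)
    qed
  qed
qed

lemma test_functionsI:
  assumes "smooth \<psi>" "0 < a" "\<And>x. x < a \<or> b < x \<Longrightarrow> \<psi> x = 0"
  shows "\<psi> \<in> test_functions {0<..}"
  unfolding test_functions_def using assms by (auto intro!: exI[of _ "{a..b}"])

lemma vector_derivative_zero_outside:
  assumes d: "\<And>x. (f has_vector_derivative f' x) (at x)"
    and z: "\<And>x. x < a \<or> b < x \<Longrightarrow> f x = 0" and x: "x < a \<or> b < (x::real)"
  shows "f' x = 0"
proof -
  have "open ({..<a} \<union> {b<..})" by auto
  moreover have "x \<in> {..<a} \<union> {b<..}" using x by auto
  ultimately have "(f has_vector_derivative 0) (at x)"
    using z by (intro has_vector_derivative_transform_within_open[OF has_vector_derivative_const[of 0], of "{..<a} \<union> {b<..}"]) auto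
  then show ?thesis using d vector_derivative_at by metis
qed

lemma test_functions_derivative:
  assumes "\<psi> \<in> test_functions {0<..}"
  obtains \<psi>' where "\<psi>' \<in> test_functions {0<..}" "\<And>x. (\<psi> has_vector_derivative \<psi>' x) (at x)"
proof -
  obtain a b where ab: "0 < a" "a < b" "\<And>x. x < a \<or> b < x \<Longrightarrow> \<psi> x = 0" using test_functions_cases[OF assms] by blast
  have "smooth \<psi>" using assms by (simp add: test_functions_def)
  then obtain f' where f': "smooth f'" "\<And>x. (\<psi> has_vector_derivative f' x) (at x)" using smooth_derivative by blast
  have "f' \<in> test_functions {0<..}"
    by (rule test_functionsI[of _ a b]) (use ab f' vector_derivative_zero_outside[OF f'(2), of a b] in auto)
  then show ?thesis using f' that by blast
qed

lemma test_functions_continuous: "\<psi> \<in> test_functions U \<Longrightarrow> continuous_on UNIV \<psi>"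
  by (simp add: test_functions_def smooth_continuous)

lemma test_functions_measurable: "\<psi> \<in> test_functions U \<Longrightarrow> \<psi> \<in> borel_measurable borel"
  by (rule borel_measurable_continuous_onI[OF test_functions_continuous])

lemma test_functions_integrable:
  assumes "\<psi> \<in> test_functions {0<..}" shows "integrable lborel \<psi>"
proof -
  obtain a b where ab: "0 < a" "a < b" "\<And>x. x < a \<or> b < x \<Longrightarrow> \<psi> x = 0" using test_functions_cases[OF assms] by blast
  have "integrable lborel (\<lambda>x. indicator {a..b} x *\<^sub>R \<psi> x)"
    by (rule borel_integrable_compact) (use test_functions_continuous[OF assms] in \<open>auto intro: continuous_on_subset\<close>)
  moreover have "(\<lambda>x. indicator {a..b} x *\<^sub>R \<psi> x) = \<psi>"
    using ab(3) by (auto simp: fun_eq_iff indicator_def)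
  ultimately show ?thesis by simp
qed

lemma test_functions_bounded:
  assumes "\<psi> \<in> test_functions {0<..}" obtains B where "0 < B" "\<And>x. norm (\<psi> x) \<le> B"
proof -
  obtain a b where ab: "0 < a" "a < b" "\<And>x. x < a \<or> b < x \<Longrightarrow> \<psi> x = 0" using test_functions_cases[OF assms] by blast
  have "compact (\<psi> ` {a..b})"
    by (intro compact_continuous_image) (use test_functions_continuous[OF assms] in \<open>auto intro: continuous_on_subset\<close>)
  then obtain B where B: "0 < B" "\<And>x. x \<in> {a..b} \<Longrightarrow> norm (\<psi> x) \<le> B"
    using compact_imp_bounded bounded_pos by (metis (no_types, lifting) imageI)
  have "norm (\<psi> x) \<le> B" for x using B ab(3)[of x] by (cases "x \<in> {a..b}") auto
  then show ?thesis using B that by blast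
qed

lemma integral_derivative_zero:
  fixes f :: "real \<Rightarrow> complex"
  assumes "a < b" and d: "\<And>x. (f has_vector_derivative f' x) (at x)" and "continuous_on UNIV f'"
    and z: "\<And>x. x < a \<or> b < x \<Longrightarrow> f x = 0"
  shows "(LINT x|lborel. f' x) = 0"
proof -
  have z': "f' x = 0" if "x < a \<or> b < x" for x by (rule vector_derivative_zero_outside[OF d z that])
  \<comment> \<open>The interval is enlarged by 1 on either side because \<open>f\<close> is known
    to vanish only strictly outside \<open>[a, b]\<close>.\<close>
  have "(LINT x|lborel. f' x) = (LINT x|lborel. indicator {a - 1..b + 1} x *\<^sub>R f' x)"
    by (intro Bochner_Integration.integral_cong) (use z' in \<open>auto simp: indicator_def\<close>)
  also have "\<dots> = f (b + 1) - f (a - 1)"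
    by (rule integral_FTC_Icc) (use assms in \<open>auto intro: has_vector_derivative_at_within continuous_on_subset\<close>)
  finally show ?thesis using z[of "b+1"] z[of "a-1"] by simp
qed

lemma ft_derivative:
  assumes "\<psi> \<in> test_functions {0<..}" "\<psi>' \<in> test_functions {0<..}"
    and d: "\<And>x. (\<psi> has_vector_derivative \<psi>' x) (at x)"
  shows "ft \<psi>' x = \<i> * of_real x * ft \<psi> x"
proof -
  obtain a b where ab: "0 < a" "a < b" "\<And>x. x < a \<or> b < x \<Longrightarrow> \<psi> x = 0" using test_functions_cases[OF assms(1)] by blast
  define e where "e t = exp (- (\<i> * complex_of_real (x * t)))" for t
  have e: "(e has_vector_derivative - \<i> * of_real x * e t) (at t)" for t
  proof -
    have "((\<lambda>z. exp (- (\<i> * (of_real x * z)))) has_field_derivative - \<i> * of_real x * e t) (at (of_real t))"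
      by (auto intro!: derivative_eq_intros simp: e_def)
    from has_vector_derivative_real_field[OF this] show ?thesis by (simp add: e_def[abs_def])
  qed
  have "((\<lambda>t. e t * \<psi> t) has_vector_derivative (e t * \<psi>' t + (- \<i> * of_real x * e t) * \<psi> t)) (at t)" for t
    by (rule has_vector_derivative_mult[OF e d])
  then have "(LINT t|lborel. e t * \<psi>' t + (- \<i> * of_real x * e t) * \<psi> t) = 0"
    by (rule integral_derivative_zero[OF ab(2), where f = "\<lambda>t. e t * \<psi> t"])
      (use ab(3) in \<open>auto intro!: continuous_intros test_functions_continuous[OF assms(1)] test_functions_continuous[OF assms(2)] simp: e_def[abs_def]\<close>)
  also have "(LINT t|lborel. e t * \<psi>' t + (- \<i> * of_real x * e t) * \<psi> t) =
      (LINT t|lborel. e t * \<psi>' t + (- \<i> * of_real x) * (e t * \<psi> t))" by (simp add: mult.assoc)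
  also have "\<dots> = ft \<psi>' x + (- \<i> * of_real x) * ft \<psi> x"
    unfolding ft_def e_def
    using integrable_exp_mult(1)[OF test_functions_integrable[OF assms(1)]] integrable_exp_mult(1)[OF test_functions_integrable[OF assms(2)]]
    by (subst Bochner_Integration.integral_add) auto
  finally show ?thesis by simp
qed

lemma test_functions_add: "f \<in> test_functions {0<..} \<Longrightarrow> g \<in> test_functions {0<..} \<Longrightarrow> (\<lambda>x. f x + g x) \<in> test_functions {0<..}"
proof -
  assume f: "f \<in> test_functions {0<..}" and g: "g \<in> test_functions {0<..}"
  obtain a b where ab: "0 < a" "a < b" "\<And>x. x < a \<or> b < x \<Longrightarrow> f x = 0" using test_functions_cases[OF f] by blast
  obtain c d where cd: "0 < c" "c < d" "\<And>x. x < c \<or> d < x \<Longrightarrow> g x = 0" using test_functions_cases[OF g] by blast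
  show ?thesis
    by (rule test_functionsI[of _ "min a c" "max b d"])
      (use f g ab cd in \<open>auto simp: test_functions_def intro!: smooth_add\<close>)
qed

lemma test_functions_cmult: "f \<in> test_functions {0<..} \<Longrightarrow> (\<lambda>x. c * f x) \<in> test_functions {0<..}"
proof -
  assume f: "f \<in> test_functions {0<..}"
  obtain a b where ab: "0 < a" "a < b" "\<And>x. x < a \<or> b < x \<Longrightarrow> f x = 0" using test_functions_cases[OF f] by blast
  show ?thesis
    by (rule test_functionsI[of _ a b])
      (use f ab in \<open>auto simp: test_functions_def intro!: smooth_mult smooth_const\<close>)
qed

text \<open>Multiplication by \<open>d + i x\<close> on the Fourier side is the operator
  \<open>d + D\<close>, which maps test functions to test functions; \<zeta> is its
  \<open>n\<close>-th iterate applied to \<psi>.\<close>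

lemma ft_multiplier:
  assumes "\<psi> \<in> test_functions {0<..}"
  obtains \<zeta> where "\<zeta> \<in> test_functions {0<..}" "\<And>x. ft \<zeta> x = Complex d x ^ n * ft \<psi> x"
proof -
  have "\<exists>\<zeta>\<in>test_functions {0<..}. \<forall>x. ft \<zeta> x = Complex d x ^ n * ft \<psi> x"
  proof (induction n)
    case 0 then show ?case using assms by (intro bexI[of _ \<psi>]) auto
  next
    case (Suc n)
    then obtain \<zeta> where c: "\<zeta> \<in> test_functions {0<..}" "\<And>x. ft \<zeta> x = Complex d x ^ n * ft \<psi> x" by blast
    obtain \<zeta>' where c': "\<zeta>' \<in> test_functions {0<..}" "\<And>x. (\<zeta> has_vector_derivative \<zeta>' x) (at x)"
      using test_functions_derivative[OF c(1)] by blast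
    have "ft (\<lambda>t. of_real d * \<zeta> t + \<zeta>' t) x = Complex d x ^ Suc n * ft \<psi> x" for x
    proof -
      have "ft (\<lambda>t. of_real d * \<zeta> t + \<zeta>' t) x = ft (\<lambda>t. of_real d * \<zeta> t) x + ft \<zeta>' x"
        using test_functions_integrable[OF c(1)] test_functions_integrable[OF c'(1)] by (intro ft_add) auto
      also have "\<dots> = (of_real d + \<i> * of_real x) * ft \<zeta> x"
        by (simp add: ft_cmult ft_derivative[OF c(1) c'] distrib_right)
      also have "of_real d + \<i> * of_real x = Complex d x" by (simp add: complex_eq_iff)
      finally show ?thesis by (simp add: c(2))
    qed
    then show ?case using test_functions_add[OF test_functions_cmult[OF c(1)] c'(1)] by blast
  qed
  then show ?thesis using that by blast
qed

text \<open>For an integer \<open>n \<ge> r\<close>, the transform of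
  \<open>(d + D)^n \<psi>\<close> is bounded, which gives decay of order \<open>n\<close>. The real
  exponent \<open>r\<close> follows since \<open>norm (Complex d x)\<close> is bounded below by
  \<open>d\<close>; this costs the factor \<open>d powr (r - n)\<close>.\<close>

lemma ft_decay:
  assumes "\<psi> \<in> test_functions {0<..}" "d > 0"
  obtains C where "0 < C" "\<And>x. norm (ft \<psi> x) \<le> C * norm (Complex d x) powr (- r)"
proof -
  obtain n :: nat where n: "r \<le> n" using real_arch_simple by blast
  obtain \<zeta> where c: "\<zeta> \<in> test_functions {0<..}" "\<And>x. ft \<zeta> x = Complex d x ^ n * ft \<psi> x"
    using ft_multiplier[OF assms(1)] by blast
  define B where "B = (LINT t|lborel. norm (\<zeta> t)) + 1"
  have B: "norm (ft \<zeta> x) \<le> B" "B > 0" for x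
    using norm_ft_le[of \<zeta> x] by (auto simp: B_def intro!: add_nonneg_pos)
  have wd: "norm (Complex d x) \<ge> d" for x
    using complex_Re_le_cmod[of "Complex d x"] by simp
  show ?thesis
  proof (rule that[of "B * d powr (r - n)"])
    show "B * d powr (r - n) > 0" using B assms by simp
    fix x
    let ?w = "norm (Complex d x)"
    have w: "?w > 0" using wd[of x] assms by linarith
    have "?w ^ n * norm (ft \<psi> x) \<le> B" using B(1)[of x] c(2)[of x] by (simp add: norm_mult norm_power)
    then have "norm (ft \<psi> x) \<le> B * ?w powr (- real n)"
      using w by (simp add: powr_minus powr_realpow field_simps)
    also have "\<dots> = B * (?w powr (r - n) * ?w powr (- r))" using w by (simp add: powr_add[symmetric])
    also have "\<dots> \<le> B * (d powr (r - n) * ?w powr (- r))"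
      using B(2) n wd[of x] assms(2) by (intro mult_left_mono mult_right_mono powr_mono2') auto
    finally show "norm (ft \<psi> x) \<le> B * d powr (r - n) * ?w powr (- r)" by simp
  qed
qed

section \<open>Fubini's theorem and translation invariance\<close>

lemma LINT_swap:
  fixes f :: "real \<Rightarrow> real \<Rightarrow> complex"
  assumes [measurable]: "(\<lambda>(x, y). f x y) \<in> borel_measurable (lborel \<Otimes>\<^sub>M lborel)"
    and fin: "(\<integral>\<^sup>+x. \<integral>\<^sup>+y. ennreal (norm (f x y)) \<partial>lborel \<partial>lborel) < \<infinity>"
  shows "(LINT y|lborel. LINT x|lborel. f x y) = (LINT x|lborel. LINT y|lborel. f x y)"
    and "integrable lborel (\<lambda>y. LINT x|lborel. f x y)"
    and "integrable lborel (\<lambda>x. LINT y|lborel. f x y)"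
proof -
  have i: "integrable (lborel \<Otimes>\<^sub>M lborel) (\<lambda>(x, y). f x y)"
  proof (rule integrableI_bounded)
    have "(\<integral>\<^sup>+z. ennreal (norm ((\<lambda>(x, y). f x y) z)) \<partial>(lborel \<Otimes>\<^sub>M lborel)) = (\<integral>\<^sup>+x. \<integral>\<^sup>+y. ennreal (norm (f x y)) \<partial>lborel \<partial>lborel)"
      by (subst lborel.nn_integral_fst[symmetric]) (auto simp: split_beta)
    then show "(\<integral>\<^sup>+z. ennreal (norm ((\<lambda>(x, y). f x y) z)) \<partial>(lborel \<Otimes>\<^sub>M lborel)) < \<infinity>" using fin by simp
  qed simp
  show "(LINT y|lborel. LINT x|lborel. f x y) = (LINT x|lborel. LINT y|lborel. f x y)"
    by (rule lborel_pair.Fubini_integral[OF i])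
  show "integrable lborel (\<lambda>y. LINT x|lborel. f x y)" by (rule lborel_pair.integrable_snd[OF i])
  show "integrable lborel (\<lambda>x. LINT y|lborel. f x y)" by (rule lborel_pair.integrable_fst[OF i])
qed

lemma nn_integral_shift:
  fixes f :: "real \<Rightarrow> ennreal" assumes "f \<in> borel_measurable borel"
  shows "(\<integral>\<^sup>+x. f (x - a) \<partial>lborel) = (\<integral>\<^sup>+x. f x \<partial>lborel)"
    "(\<integral>\<^sup>+x. f (x + a) \<partial>lborel) = (\<integral>\<^sup>+x. f x \<partial>lborel)"
    "(\<integral>\<^sup>+x. f (a - x) \<partial>lborel) = (\<integral>\<^sup>+x. f x \<partial>lborel)"
  using nn_integral_real_affine[OF assms, of 1 "-a"] nn_integral_real_affine[OF assms, of 1 a]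
    nn_integral_real_affine[OF assms, of "-1" a] by (simp_all add: add.commute)

lemma LINT_shift:
  fixes f :: "real \<Rightarrow> complex"
  shows "(LINT x|lborel. f (x - a)) = (LINT x|lborel. f x)"
    "(LINT x|lborel. f (a - x)) = (LINT x|lborel. f x)"
  using lborel_integral_real_affine[of 1 f "-a"] lborel_integral_real_affine[of "-1" f a] by simp_all

lemma nn_integral_norm_finite:
  fixes f :: "'a \<Rightarrow> complex" shows "integrable M f \<Longrightarrow> (\<integral>\<^sup>+x. ennreal (norm (f x)) \<partial>M) < \<infinity>"
  by (simp add: integrable_iff_bounded)

subsection \<open>Bump functions\<close>

text \<open>The derivative of \<open>P(1/x) exp(-1/x)\<close> has the same shape, with
  \<open>X^2 (P - P')\<close> in place of \<open>P\<close>. Carrying an arbitrary polynomial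
  therefore gives a class closed under differentiation, as \<open>smooth_coinduct\<close>
  requires.\<close>

definition flat_exp :: "real poly \<Rightarrow> real \<Rightarrow> real" where
  "flat_exp P x = (if x > 0 then poly P (inverse x) * exp (- inverse x) else 0)"

lemma poly_exp_decay: "((\<lambda>y. y ^ k * poly P y * exp (- y)) \<longlongrightarrow> 0) at_top" for P :: "real poly"
proof (induction P arbitrary: k)
  case (pCons a P)
  have "((\<lambda>y. a * (y ^ k / exp y) + y ^ Suc k * poly P y * exp (- y)) \<longlongrightarrow> a * 0 + 0) at_top"
    by (intro tendsto_intros tendsto_power_div_exp_0 pCons)
  then show ?case by (simp add: algebra_simps exp_minus divide_inverse)
qed simp

lemma flat_exp_derivative:
  "(flat_exp P has_real_derivative flat_exp ([:0, 0, 1:] * (P - pderiv P)) x) (at x)"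
proof -
  consider "x < 0" | "x = 0" | "x > 0" by linarith
  then show ?thesis
  proof cases
    case 1
    then have "((\<lambda>_. 0) has_real_derivative 0) (at x)" by simp
    then have "(flat_exp P has_real_derivative 0) (at x)"
      by (rule has_field_derivative_transform_within_open[of _ _ _ "{..<0}"]) (use 1 in \<open>auto simp: flat_exp_def\<close>)
    then show ?thesis using 1 by (simp add: flat_exp_def)
  next
    case 3
    have "((\<lambda>x. poly P (inverse x) * exp (- inverse x)) has_real_derivative flat_exp ([:0, 0, 1:] * (P - pderiv P)) x) (at x)"
      using 3 by (auto intro!: derivative_eq_intros poly_DERIV[THEN DERIV_chain2] simp: flat_exp_def field_simps power2_eq_square)
    then show ?thesis
      by (rule has_field_derivative_transform_within_open[of _ _ _ "{0<..}"]) (use 3 in \<open>auto simp: flat_exp_def\<close>)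
  next
    case 2
    \<comment> \<open>With \<open>y = 1 / h\<close> the difference quotient at 0 from the right is
      \<open>y * P(y) * exp (- y)\<close>, which tends to 0.\<close>
    have "((\<lambda>h. flat_exp P h / h) \<longlongrightarrow> 0) (at_right 0)"
      unfolding filterlim_at_right_to_top
    proof (rule Lim_transform_eventually[OF poly_exp_decay[of 1 P]])
      show "\<forall>\<^sub>F y in at_top. y ^ 1 * poly P y * exp (- y) = flat_exp P (inverse y) / inverse y"
        using eventually_gt_at_top[of 0] by eventually_elim (simp add: flat_exp_def divide_inverse)
    qed
    moreover have "((\<lambda>h. flat_exp P h / h) \<longlongrightarrow> 0) (at_left 0)"
    proof (rule Lim_transform_eventually[OF tendsto_const])
      show "\<forall>\<^sub>F y in at_left 0. 0 = flat_exp P y / y"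
        by (auto simp: eventually_at_filter flat_exp_def)
    qed
    ultimately have "((\<lambda>h. flat_exp P h / h) \<longlongrightarrow> 0) (at 0)" by (intro filterlim_split_at)
    then show ?thesis using 2 by (simp add: DERIV_def flat_exp_def)
  qed
qed

lemma smooth_flat_exp: "smooth (\<lambda>x. of_real (flat_exp P x))"
proof (rule smooth_coinduct[where X = "range (\<lambda>P x. of_real (flat_exp P x))"])
  fix g assume "g \<in> range (\<lambda>P x. complex_of_real (flat_exp P x))"
  then obtain P where P: "g = (\<lambda>x. complex_of_real (flat_exp P x))" by auto
  have "(g has_vector_derivative of_real (flat_exp ([:0, 0, 1:] * (P - pderiv P)) x)) (at x)" for x
    unfolding P using flat_exp_derivative[of P x, unfolded has_real_derivative_iff_has_vector_derivative]
    by (rule bounded_linear.has_vector_derivative[OF bounded_linear_of_real])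
  then show "\<exists>g'\<in>range (\<lambda>P x. complex_of_real (flat_exp P x)). \<forall>x. (g has_vector_derivative g' x) (at x)"
    by (intro bexI[of _ "\<lambda>x. complex_of_real (flat_exp ([:0, 0, 1:] * (P - pderiv P)) x)"]) blast+
qed auto

lemma bump_exists:
  assumes "0 < a" "a < b"
  obtains \<rho> :: "real \<Rightarrow> real" where "(\<lambda>x. of_real (\<rho> x)) \<in> test_functions {0<..}"
    "\<And>x. 0 \<le> \<rho> x" "\<And>x. x < a \<or> b < x \<Longrightarrow> \<rho> x = 0" "(LINT x|lborel. \<rho> x) = 1" "integrable lborel \<rho>"
proof -
  \<comment> \<open>One factor is flat at \<open>a\<close> and vanishes to the left of it, the
    reflected factor does the same at \<open>b\<close>.\<close>
  define \<phi> where "\<phi> x = flat_exp 1 (1 * x + (- a)) * flat_exp 1 ((- 1) * x + b)" for x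
  have pos: "\<phi> x > 0" if "a < x" "x < b" for x using that by (auto simp: \<phi>_def flat_exp_def)
  have nn: "\<phi> x \<ge> 0" for x by (auto simp: \<phi>_def flat_exp_def)
  have z: "\<phi> x = 0" if "x < a \<or> b < x" for x using that by (auto simp: \<phi>_def flat_exp_def)
  have sm: "smooth (\<lambda>x. of_real (\<phi> x))" unfolding \<phi>_def of_real_mult
    by (intro smooth_mult smooth_affine[OF smooth_flat_exp])
  have t: "(\<lambda>x. of_real (\<phi> x)) \<in> test_functions {0<..}"
    by (rule test_functionsI[of _ a b]) (use sm assms z in auto)
  have int: "integrable lborel \<phi>"
    using test_functions_integrable[OF t] integrable_Re[of lborel "\<lambda>x. complex_of_real (\<phi> x)"] by simp
  have "(LINT x|lborel. \<phi> x) \<noteq> 0"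
  proof
    assume "(LINT x|lborel. \<phi> x) = 0"
    then have "AE x in lborel. \<phi> x = 0" using integral_nonneg_eq_0_iff_AE[OF int] nn by simp
    then have "AE x in lborel. x \<notin> {a<..<b}" by eventually_elim (use pos in force)
    then have "emeasure lborel {a<..<b} = 0" by (subst (asm) AE_iff_measurable[OF _ refl]) (auto simp: greaterThanLessThan_def Int_def)
    then show False using assms by simp
  qed
  moreover have "(LINT x|lborel. \<phi> x) \<ge> 0" using nn by simp
  ultimately have pos: "(LINT x|lborel. \<phi> x) > 0" by linarith
  define c where "c = 1 / (LINT x|lborel. \<phi> x)"
  show ?thesis
  proof (rule that[of "\<lambda>x. c * \<phi> x"])
    show "(\<lambda>x. complex_of_real (c * \<phi> x)) \<in> test_functions {0<..}"
      using test_functions_cmult[OF t, of "of_real c"] by simp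
  qed (use pos nn z int in \<open>auto simp: c_def\<close>)
qed

subsection \<open>Convolution\<close>

definition conv :: "(real \<Rightarrow> complex) \<Rightarrow> (real \<Rightarrow> complex) \<Rightarrow> real \<Rightarrow> complex" where
  "conv m \<psi> x = (LINT t|lborel. m t * \<psi> (x - t))"

lemma conv_commute: "conv m \<psi> x = (LINT t|lborel. m (x - t) * \<psi> t)"
  unfolding conv_def using LINT_shift(2)[of "\<lambda>t. m t * \<psi> (x - t)" x] by simp

lemma integrable_mult_bounded:
  fixes m :: "real \<Rightarrow> complex"
  assumes "integrable lborel m" "f \<in> borel_measurable lborel" "\<And>x. norm (f x) \<le> B"
  shows "integrable lborel (\<lambda>t. m t * f t)"
proof (rule Bochner_Integration.integrable_bound)
  show "integrable lborel (\<lambda>t. of_real B * m t)" using assms(1) by simp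
  have B: "B \<ge> 0" using assms(3)[of 0] norm_ge_zero order_trans by blast
  show "AE t in lborel. norm (m t * f t) \<le> norm (of_real B * m t)"
  proof (rule AE_I2)
    fix t
    show "norm (m t * f t) \<le> norm (of_real B * m t)"
      using mult_right_mono[OF assms(3)[of t] norm_ge_zero[of "m t"]] B by (simp add: norm_mult mult.commute)
  qed
qed (use assms in auto)

lemma continuous_conv:
  assumes m: "integrable lborel m" and c: "continuous_on UNIV \<psi>" and B: "\<And>x. norm (\<psi> x) \<le> B"
  shows "continuous_on UNIV (conv m \<psi>)"
  unfolding conv_def[abs_def]
proof (rule continuous_LINT[where B = "\<lambda>t. B * norm (m t)"])
  have [measurable]: "\<psi> \<in> borel_measurable borel" using c by (rule borel_measurable_continuous_onI)
  have [measurable]: "m \<in> borel_measurable borel" using m by auto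
  show "(\<lambda>t. m t * \<psi> (x - t)) \<in> borel_measurable lborel" for x by measurable
  show "integrable lborel (\<lambda>t. B * norm (m t))" using m by simp
  show "norm (m t * \<psi> (x - t)) \<le> B * norm (m t)" for x t
    using mult_right_mono[OF B norm_ge_zero] by (simp add: norm_mult mult.commute)
  show "continuous_on UNIV (\<lambda>x. m t * \<psi> (x - t))" for t
    by (intro continuous_intros continuous_on_compose2[OF c]) auto
qed

lemma norm_conv_le:
  assumes m: "integrable lborel m" and B: "\<And>x. norm (\<psi> x) \<le> B"
  shows "norm (conv m \<psi> x) \<le> B * (LINT t|lborel. norm (m t))"
proof (cases "integrable lborel (\<lambda>t. m t * \<psi> (x - t))")
  case True
  have "norm (conv m \<psi> x) \<le> (LINT t|lborel. norm (m t * \<psi> (x - t)))"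
    unfolding conv_def by (rule integral_norm_bound)
  also have "\<dots> \<le> (LINT t|lborel. B * norm (m t))"
  proof (rule integral_mono)
    show "norm (m t * \<psi> (x - t)) \<le> B * norm (m t)" for t
      using mult_right_mono[OF B[of "x - t"] norm_ge_zero[of "m t"]] by (simp add: norm_mult mult.commute)
  qed (use True m in auto)
  finally show ?thesis by simp
next
  case False
  have "B \<ge> 0" using B[of 0] norm_ge_zero order_trans by blast
  then show ?thesis using False by (simp add: conv_def not_integrable_integral_eq)
qed

text \<open>A kernel that lives on \<open>[0, R]\<close> moves supports to the right by at most
  \<open>R\<close>: they stay compact and never reach 0. Kernels are causal throughout for this
  reason.\<close>

lemma conv_test_functions:
  assumes m: "integrable lborel m" and z: "\<And>t. t < 0 \<or> R < t \<Longrightarrow> m t = 0"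
    and \<psi>: "\<psi> \<in> test_functions {0<..}"
  shows "conv m \<psi> \<in> test_functions {0<..}"
proof -
  obtain a b where ab: "0 < a" "a < b" "\<And>x. x < a \<or> b < x \<Longrightarrow> \<psi> x = 0" using test_functions_cases[OF \<psi>] by blast
  have [measurable]: "m \<in> borel_measurable borel" using m by auto
  show ?thesis
  proof (rule test_functionsI[of _ a "R + b"])
    show "conv m \<psi> x = 0" if "x < a \<or> R + b < x" for x
    proof -
      have "m t * \<psi> (x - t) = 0" for t
        using z[of t] ab(3)[of "x - t"] that by (cases "t < 0 \<or> R < t") auto
      then show ?thesis unfolding conv_def by (simp only:) simp
    qed
    show "smooth (conv m \<psi>)"
    \<comment> \<open>Derivatives fall on the test function only, so the convolutions of
      \<open>m\<close> with all test functions form a class closed under differentiation.\<close>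
    proof (rule smooth_coinduct[where X = "conv m ` test_functions {0<..}"])
      fix g assume "g \<in> conv m ` test_functions {0<..}"
      then obtain \<phi> where \<phi>: "\<phi> \<in> test_functions {0<..}" "g = conv m \<phi>" by auto
      obtain \<phi>' where \<phi>': "\<phi>' \<in> test_functions {0<..}" "\<And>x. (\<phi> has_vector_derivative \<phi>' x) (at x)"
        using test_functions_derivative[OF \<phi>(1)] by blast
      obtain B where B: "\<And>x. norm (\<phi> x) \<le> B" using test_functions_bounded[OF \<phi>(1)] by blast
      obtain B' where B': "\<And>x. norm (\<phi>' x) \<le> B'" using test_functions_bounded[OF \<phi>'(1)] by blast
      have [measurable]: "\<phi> \<in> borel_measurable borel" "\<phi>' \<in> borel_measurable borel"
        using \<phi> \<phi>' by (auto intro: test_functions_measurable)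
      have "(conv m \<phi> has_vector_derivative conv m \<phi>' x) (at x)" for x
        unfolding conv_def[abs_def]
      proof (rule has_vector_derivative_LINT[where B = "\<lambda>t. B' * norm (m t)"])
        show "integrable lborel (\<lambda>t. m t * \<phi> (x - t))" for x
          by (rule integrable_mult_bounded[OF m]) (use B in auto)
        show "norm (m t * \<phi>' (x - t)) \<le> B' * norm (m t)" for x t
          using mult_right_mono[OF B' norm_ge_zero] by (simp add: norm_mult mult.commute)
        show "((\<lambda>x. m t * \<phi> (x - t)) has_vector_derivative m t * \<phi>' (x - t)) (at x)" for x t
        proof (rule has_vector_derivative_mult_right)
          have "((\<lambda>x. x - t) has_vector_derivative 1) (at x)"
            unfolding has_real_derivative_iff_has_vector_derivative[symmetric] by (auto intro!: derivative_eq_intros)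
          from vector_diff_chain_at[OF this, of \<phi> "\<phi>' (x - t)"] \<phi>'(2)
          show "((\<lambda>x. \<phi> (x - t)) has_vector_derivative \<phi>' (x - t)) (at x)" by (simp add: o_def)
        qed
      qed (use m in auto)
      then show "\<exists>g'\<in>conv m ` test_functions {0<..}. \<forall>x. (g has_vector_derivative g' x) (at x)"
        using \<phi>' \<phi> by blast
    qed (use \<psi> in auto)
  qed (use ab in auto)
qed

lemma ft_conv:
  assumes m: "integrable lborel m" and p: "integrable lborel \<psi>"
  shows "ft (conv m \<psi>) x = ft m x * ft \<psi> x" "integrable lborel (conv m \<psi>)"
proof -
  have [measurable]: "m \<in> borel_measurable borel" "\<psi> \<in> borel_measurable borel" using m p by auto
  define e where "e t = exp (- (\<i> * complex_of_real (x * t)))" for t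
  have [measurable]: "e \<in> borel_measurable borel" unfolding e_def[abs_def] by measurable
  have ne: "norm (e t) = 1" for t by (simp add: e_def)
  have ee: "e t = e u * e (t - u)" for t u by (simp add: e_def exp_add[symmetric] algebra_simps)
  have fin: "(\<integral>\<^sup>+u. \<integral>\<^sup>+t. ennreal (norm (m u * \<psi> (t - u))) \<partial>lborel \<partial>lborel) < \<infinity>"
  proof -
    have "(\<integral>\<^sup>+t. ennreal (norm (m u * \<psi> (t - u))) \<partial>lborel) = ennreal (norm (m u)) * (\<integral>\<^sup>+t. ennreal (norm (\<psi> t)) \<partial>lborel)" for u
      using nn_integral_shift(1)[of "\<lambda>t. ennreal (norm (\<psi> t))" u] by (simp add: norm_mult ennreal_mult nn_integral_cmult)
    then show ?thesis using nn_integral_norm_finite[OF m] nn_integral_norm_finite[OF p]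
      by (simp add: nn_integral_multc ennreal_mult_less_top)
  qed
  have c: "conv m \<psi> = (\<lambda>t. LINT u|lborel. m u * \<psi> (t - u))" by (simp add: conv_def fun_eq_iff)
  show "integrable lborel (conv m \<psi>)" unfolding c by (rule LINT_swap(2)[OF _ fin]) measurable
  have "ft (conv m \<psi>) x = (LINT t|lborel. LINT u|lborel. e t * (m u * \<psi> (t - u)))"
    unfolding ft_def c e_def by simp
  also have "\<dots> = (LINT u|lborel. LINT t|lborel. e t * (m u * \<psi> (t - u)))"
    by (rule LINT_swap(1)) (use fin in \<open>simp_all add: norm_mult ne\<close>)
  also have "\<dots> = (LINT u|lborel. (e u * m u) * ft \<psi> x)"
  proof (rule Bochner_Integration.integral_cong[OF refl])
    fix u
    have "(LINT t|lborel. e t * (m u * \<psi> (t - u))) = (LINT t|lborel. (e u * m u) * (e (t - u) * \<psi> (t - u)))"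
      by (subst ee[of _ u]) (simp add: mult_ac)
    also have "\<dots> = (e u * m u) * (LINT t|lborel. e t * \<psi> t)"
      using LINT_shift(1)[of "\<lambda>t. e t * \<psi> t" u] by simp
    finally show "(LINT t|lborel. e t * (m u * \<psi> (t - u))) = (e u * m u) * ft \<psi> x" by (simp add: ft_def e_def)
  qed
  also have "\<dots> = ft m x * ft \<psi> x" by (simp add: ft_def e_def)
  finally show "ft (conv m \<psi>) x = ft m x * ft \<psi> x" .
qed

subsection \<open>Uniqueness of densities\<close>

text \<open>Half-open intervals are closed under intersection and generate the Borel sets; Dynkin's
  argument extends the vanishing of the integrals to all Borel sets, hence the density is
  zero.\<close>

lemma AE_zero_if_intervals:
  fixes K :: "real \<Rightarrow> complex"
  assumes K: "integrable lborel K" and z: "\<And>c d. c \<le> d \<Longrightarrow> (LINT x:{c<..d}|lborel. K x) = 0"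
  shows "AE x in lborel. K x = 0"
proof (rule sigma_finite_measure.density_zero[OF sigma_finite_lborel K])
  have Ki: "set_integrable lborel A K" if "A \<in> sets borel" for A
    unfolding set_integrable_def using K that by (intro integrable_mult_indicator) auto
  \<comment> \<open>The whole line has to be treated separately: the complement step of the
    induction subtracts from it.\<close>
  have univ: "(LINT x:UNIV|lborel. K x) = 0"
  proof -
    have "(\<lambda>n. LINT x:{- real n<..real n}|lborel. K x) \<longlonglongrightarrow> (LINT x:(\<Union>n. {- real n<..real n})|lborel. K x)"
    proof (rule set_integral_cont_up)
      show "incseq (\<lambda>n. {- real n<..real n})" by (auto simp: incseq_def)
      show "set_integrable lborel (\<Union>n. {- real n<..real n}) K" by (rule Ki) auto
    qed auto
    moreover have "(\<Union>n. {- real n<..real n}) = UNIV"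
    proof -
      have "x \<in> (\<Union>n. {- real n<..real n})" for x :: real
      proof -
        obtain n :: nat where "\<bar>x\<bar> < n" using reals_Archimedean2 by blast
        then show ?thesis by (auto intro!: exI[of _ n])
      qed
      then show ?thesis by blast
    qed
    ultimately show ?thesis using z by (simp add: LIMSEQ_const_iff)
  qed
  have sb: "sets borel = sigma_sets UNIV (range (\<lambda>(a, b). {a<..b :: real}))"
    by (subst borel_sigma_sets_Ioc) (simp add: sets_measure_of)
  fix A :: "real set" assume "A \<in> sets lborel"
  then have A: "A \<in> sigma_sets UNIV (range (\<lambda>(a, b). {a<..b}))"
    using sb by simp
  have st: "Int_stable (range (\<lambda>(a, b). {a<..b :: real}))"
    by (auto simp: Int_stable_def image_iff split: prod.splits)
  show "(LINT x:A|lborel. K x) = 0"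
    using st Pow_UNIV[THEN equalityD2, THEN subset_trans[OF subset_UNIV]] A
  proof (induction rule: sigma_sets_induct_disjoint)
    case (basic A)
    then obtain c d where A: "A = {c<..d}" by auto
    show ?case unfolding A using z[of c d] by (cases "c \<le> d") (auto simp: set_lebesgue_integral_def)
  next
    case (compl A)
    then have A[measurable]: "A \<in> sets borel" using sb by simp
    have "(LINT x:UNIV|lborel. K x) = (LINT x:(UNIV - A) \<union> A|lborel. K x)" by simp
    also have "\<dots> = (LINT x:UNIV - A|lborel. K x) + (LINT x:A|lborel. K x)"
      by (rule set_integral_Un) (auto intro!: Ki)
    finally show ?case using univ compl by simp
  next
    case (union A)
    then have A[measurable]: "A i \<in> sets borel" for i using sb by auto
    have "(LINT x:(\<Union>i. A i)|lborel. K x) = (\<Sum>i. LINT x:A i|lborel. K x)"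
      by (rule lebesgue_integral_countable_add) (use union(1) in \<open>auto intro!: Ki simp: disjoint_family_on_def\<close>)
    then show ?case using union by simp
  qed (auto simp: set_lebesgue_integral_def)
qed

text \<open>One-sided approximate identities: the mass sits in \<open>(0, 1 / (n + 1)]\<close>.
  Convolution then never pushes a support across 0, and its limit at \<open>x\<close> depends only
  on values to the left of \<open>x\<close>, so that left continuity is enough in
  \<open>conv_mollifier_tendsto\<close>.\<close>

definition mollifier :: "(nat \<Rightarrow> real \<Rightarrow> real) \<Rightarrow> bool" where
  "mollifier \<rho> \<longleftrightarrow> (\<forall>n. (\<lambda>x. complex_of_real (\<rho> n x)) \<in> test_functions {0<..} \<and> (\<forall>x. 0 \<le> \<rho> n x) \<and>
     (\<forall>x. x \<le> 0 \<or> inverse (real (Suc n)) < x \<longrightarrow> \<rho> n x = 0) \<and> (LINT x|lborel. \<rho> n x) = 1 \<and> integrable lborel (\<rho> n))"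

lemma mollifier_exists: obtains \<rho> where "mollifier \<rho>"
proof -
  have "\<exists>\<rho> :: real \<Rightarrow> real. (\<lambda>x. complex_of_real (\<rho> x)) \<in> test_functions {0<..} \<and> (\<forall>x. 0 \<le> \<rho> x) \<and>
     (\<forall>x. x \<le> 0 \<or> inverse (real (Suc n)) < x \<longrightarrow> \<rho> x = 0) \<and> (LINT x|lborel. \<rho> x) = 1 \<and> integrable lborel \<rho>" for n
  proof -
    have "0 < inverse (real (Suc n)) / 2" "inverse (real (Suc n)) / 2 < inverse (real (Suc n))" by auto
    from bump_exists[OF this] obtain \<rho> :: "real \<Rightarrow> real" where r: "(\<lambda>x. complex_of_real (\<rho> x)) \<in> test_functions {0<..}"
      "\<And>x. 0 \<le> \<rho> x" "\<And>x. x < inverse (real (Suc n)) / 2 \<or> inverse (real (Suc n)) < x \<Longrightarrow> \<rho> x = 0"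
      "(LINT x|lborel. \<rho> x) = 1" "integrable lborel \<rho>" by metis
    have "\<rho> x = 0" if x: "x \<le> 0 \<or> inverse (real (Suc n)) < x" for x
    proof (rule r(3))
      have "0 < inverse (real (Suc n)) / 2" by simp
      then show "x < inverse (real (Suc n)) / 2 \<or> inverse (real (Suc n)) < x" using x by linarith
    qed
    then show ?thesis using r by blast
  qed
  then show ?thesis using that unfolding mollifier_def by metis
qed

lemma mollifierD:
  assumes "mollifier \<rho>"
  shows "(\<lambda>x. complex_of_real (\<rho> n x)) \<in> test_functions {0<..}" "0 \<le> \<rho> n x"
    "x \<le> 0 \<or> inverse (real (Suc n)) < x \<Longrightarrow> \<rho> n x = 0" "(LINT x|lborel. \<rho> n x) = 1" "integrable lborel (\<rho> n)"
    "integrable lborel (\<lambda>x. complex_of_real (\<rho> n x))" "\<rho> n \<in> borel_measurable borel"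
proof -
  show i: "integrable lborel (\<rho> n)" using assms unfolding mollifier_def by blast
  then show "integrable lborel (\<lambda>x. complex_of_real (\<rho> n x))" "\<rho> n \<in> borel_measurable borel" by auto
qed (use assms in \<open>unfold mollifier_def, blast+\<close>)

text \<open>Since \<open>\<rho> n\<close> has mass 1, the deviation from \<open>z\<close> is an
  average of \<open>m (x - t) - z\<close> over the short interval carrying the mollifier.\<close>

lemma conv_mollifier_close:
  assumes r: "mollifier \<rho>" and [measurable]: "m \<in> borel_measurable borel"
    and e: "\<And>t. 0 < t \<Longrightarrow> t \<le> inverse (real (Suc n)) \<Longrightarrow> norm (m (x - t) - z) \<le> e"
  shows "norm (conv m (\<lambda>t. of_real (\<rho> n t)) x - z) \<le> e"
proof -
  note [measurable] = mollifierD(7)[OF r]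
  have e': "norm ((m (x - t) - z) * of_real (\<rho> n t)) \<le> e * \<rho> n t" for t
  proof (cases "0 < t \<and> t \<le> inverse (real (Suc n))")
    case True
    then show ?thesis using e[of t] mollifierD(2)[OF r, of n t] by (simp add: norm_mult mult_right_mono)
  next
    case False
    then have "\<rho> n t = 0" using mollifierD(3)[OF r, of t n] by auto
    then show ?thesis by simp
  qed
  have i1: "integrable lborel (\<lambda>t. (m (x - t) - z) * of_real (\<rho> n t))"
    by (rule Bochner_Integration.integrable_bound[of _ "\<lambda>t. e * \<rho> n t"])
      (use mollifierD(5)[OF r] in \<open>auto intro!: AE_I2 order_trans[OF e'] abs_ge_self\<close>)
  have i2: "integrable lborel (\<lambda>t. z * complex_of_real (\<rho> n t))" using mollifierD(6)[OF r] by simp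
  have "conv m (\<lambda>t. of_real (\<rho> n t)) x = (LINT t|lborel. m (x - t) * of_real (\<rho> n t))"
    by (rule conv_commute)
  also have "\<dots> = (LINT t|lborel. (m (x - t) - z) * of_real (\<rho> n t) + z * of_real (\<rho> n t))"
    by (simp add: algebra_simps)
  also have "\<dots> = (LINT t|lborel. (m (x - t) - z) * of_real (\<rho> n t)) + z"
    using mollifierD(4)[OF r, of n] by (simp add: Bochner_Integration.integral_add[OF i1 i2])
  finally have "norm (conv m (\<lambda>t. of_real (\<rho> n t)) x - z) \<le> (LINT t|lborel. norm ((m (x - t) - z) * of_real (\<rho> n t)))"
    by (simp add: integral_norm_bound)
  also have "\<dots> \<le> (LINT t|lborel. e * \<rho> n t)"
    by (rule integral_mono) (use i1 mollifierD(5)[OF r] e' in auto)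
  finally show ?thesis using mollifierD(4)[OF r, of n] by simp
qed

lemma conv_mollifier_tendsto:
  assumes r: "mollifier \<rho>" and m: "m \<in> borel_measurable borel" and l: "(m \<longlongrightarrow> m x) (at_left x)"
  shows "(\<lambda>n. conv m (\<lambda>t. of_real (\<rho> n t)) x) \<longlonglongrightarrow> m x"
proof (rule LIMSEQ_I)
  fix e :: real assume "0 < e"
  then have "eventually (\<lambda>y. dist (m y) (m x) < e / 2) (at_left x)" using l tendstoD half_gt_zero by blast
  then obtain y0 where y0: "y0 < x" "\<And>y. y0 < y \<Longrightarrow> y < x \<Longrightarrow> dist (m y) (m x) < e / 2"
    using eventually_at_left_field by (metis eventually_at_left_field)
  obtain N where N: "inverse (real (Suc N)) < x - y0" using reals_Archimedean[of "x - y0"] y0 by auto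
  have "norm (conv m (\<lambda>t. of_real (\<rho> n t)) x - m x) < e" if "n \<ge> N" for n
  proof -
    have "inverse (real (Suc n)) \<le> inverse (real (Suc N))" using that by simp
    with N have "inverse (real (Suc n)) < x - y0" by linarith
    then have "norm (conv m (\<lambda>t. of_real (\<rho> n t)) x - m x) \<le> e / 2"
      by (intro conv_mollifier_close[OF r m] less_imp_le) (use y0(2) in \<open>auto simp: dist_norm\<close>)
    then show ?thesis using \<open>0 < e\<close> by linarith
  qed
  then show "\<exists>N. \<forall>n\<ge>N. norm (conv m (\<lambda>t. of_real (\<rho> n t)) x - m x) < e" by blast
qed

text \<open>The indicator of \<open>{c<..d}\<close> is left continuous, so its one-sided
  mollifications are test functions that converge to it everywhere. This reduces the claim to
  integrals over intervals.\<close>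

lemma AE_zero_if_test_functions:
  fixes H :: "real \<Rightarrow> complex"
  assumes H: "\<And>a b. 0 < a \<Longrightarrow> a \<le> b \<Longrightarrow> set_integrable lborel {a..b} H"
    and z: "\<And>\<psi>. \<psi> \<in> test_functions {0<..} \<Longrightarrow> (LINT x:{0<..}|lborel. H x * \<psi> x) = 0"
  shows "AE x in lborel. 0 < x \<longrightarrow> H x = 0"
proof -
  obtain \<rho> where r: "mollifier \<rho>" by (rule mollifier_exists)
  have iv: "(LINT x:{c<..d}|lborel. H x) = 0" if cd: "0 < c" "c \<le> d" for c d
  proof -
    define m :: "real \<Rightarrow> complex" where "m x = complex_of_real (indicator {c<..d} x)" for x
    define \<psi> where "\<psi> n = conv m (\<lambda>t. of_real (\<rho> n t))" for n
    have [measurable]: "m \<in> borel_measurable borel" unfolding m_def[abs_def] by measurable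
    have mi: "integrable lborel m" unfolding m_def[abs_def]
      using cd by (intro integrable_of_real integrable_real_indicator) auto
    have pt: "\<psi> n \<in> test_functions {0<..}" for n
      unfolding \<psi>_def by (rule conv_test_functions[OF mi, of d]) (use cd mollifierD(1)[OF r] in \<open>auto simp: m_def\<close>)
    have bd: "norm (\<psi> n x - 0) \<le> 1" for n x
      unfolding \<psi>_def by (rule conv_mollifier_close[OF r]) (auto simp: m_def indicator_def)
    have supp: "\<psi> n x = 0" if "x < c \<or> d + 1 < x" for n x
    proof -
      have "norm (\<psi> n x - 0) \<le> 0" unfolding \<psi>_def
      proof (rule conv_mollifier_close[OF r])
        fix t assume t: "0 < t" "t \<le> inverse (real (Suc n))"
        have "inverse (real (Suc n)) \<le> 1" using inverse_le_1_iff by force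
        then show "norm (m (x - t) - 0) \<le> 0" using t that by (auto simp: m_def indicator_def)
      qed simp
      then show ?thesis by simp
    qed
    have lim: "(\<lambda>n. \<psi> n x) \<longlonglongrightarrow> m x" for x
      unfolding \<psi>_def
    proof (rule conv_mollifier_tendsto[OF r])
      have "eventually (\<lambda>y. m x = m y) (at_left x)"
      proof (cases "x \<le> c")
        case True
        then show ?thesis by (auto simp: eventually_at_filter m_def indicator_def)
      next
        case F: False
        show ?thesis
        proof (cases "x \<le> d")
          case True
          show ?thesis using eventually_at_left_real[of c x] F True
            by (auto elim!: eventually_mono simp: m_def indicator_def)
        next
          case False
          show ?thesis using eventually_at_left_real[of d x] False
            by (auto elim!: eventually_mono simp: m_def indicator_def)
        qed
      qed
      then show "(m \<longlongrightarrow> m x) (at_left x)" by (rule Lim_transform_eventually[OF tendsto_const])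
    qed simp
    \<comment> \<open>\<open>H\<close> is only locally integrable; \<open>[c, d + 1]\<close>
      contains the supports of all \<open>\<psi> n\<close>, so that cutting off there changes no
      integral and supplies an integrable majorant.\<close>
    define K where "K x = indicator {c..d + 1} x *\<^sub>R H x" for x
    have Ki: "integrable lborel K" using H[of c "d + 1"] cd unfolding K_def set_integrable_def by simp
    have [measurable]: "K \<in> borel_measurable borel" using Ki by auto
    have [measurable]: "\<psi> n \<in> borel_measurable borel" for n using pt by (rule test_functions_measurable)
    have eq: "(LINT x|lborel. K x * \<psi> n x) = 0" for n
    proof -
      have "(LINT x|lborel. K x * \<psi> n x) = (LINT x:{0<..}|lborel. H x * \<psi> n x)"
        unfolding set_lebesgue_integral_def
        proof (rule Bochner_Integration.integral_cong[OF refl])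
          fix x show "K x * \<psi> n x = indicator {0<..} x *\<^sub>R (H x * \<psi> n x)"
            using supp[of x n] cd by (cases "x < c \<or> d + 1 < x") (auto simp: K_def indicator_def)
        qed
      then show ?thesis using z[OF pt] by simp
    qed
    have "(\<lambda>n. LINT x|lborel. K x * \<psi> n x) \<longlonglongrightarrow> (LINT x|lborel. K x * m x)"
    proof (rule integral_dominated_convergence[where w = "\<lambda>x. norm (K x)"])
      show "AE x in lborel. norm (K x * \<psi> n x) \<le> norm (K x)" for n
        using bd[of n] by (auto simp: norm_mult intro!: mult_left_le)
      show "AE x in lborel. (\<lambda>n. K x * \<psi> n x) \<longlonglongrightarrow> K x * m x"
        by (intro AE_I2 tendsto_intros lim)
    qed (use Ki in auto)
    then have "(LINT x|lborel. K x * m x) = 0" unfolding eq by (simp add: LIMSEQ_const_iff)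
    moreover have "(LINT x|lborel. K x * m x) = (LINT x:{c<..d}|lborel. H x)"
      unfolding set_lebesgue_integral_def
      by (rule Bochner_Integration.integral_cong) (auto simp: K_def m_def indicator_def)
    ultimately show ?thesis by simp
  qed
  \<comment> \<open>\<open>AE_zero_if_intervals\<close> needs an integrable function, hence the
    exhaustion of the half line by \<open>(1 / (n + 1), n + 1]\<close>.\<close>
  have "AE x in lborel. indicator {inverse (real (Suc n))<..real (Suc n)} x *\<^sub>R H x = 0" for n
  proof (rule AE_zero_if_intervals)
    let ?a = "inverse (real (Suc n))" and ?b = "real (Suc n)"
    have ab: "0 < ?a" "?a \<le> ?b" using inverse_le_1_iff[of "real (Suc n)"] by (auto intro: order_trans[of _ 1])
    have "set_integrable lborel {?a<..?b} H"
      by (rule set_integrable_subset[OF H[OF ab]]) auto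
    then show "integrable lborel (\<lambda>x. indicator {?a<..?b} x *\<^sub>R H x)" by (simp add: set_integrable_def)
    fix c d :: real assume "c \<le> d"
    have "(LINT x:{c<..d}|lborel. indicator {?a<..?b} x *\<^sub>R H x) = (LINT x:{max ?a c<..min ?b d}|lborel. H x)"
      unfolding set_lebesgue_integral_def
      by (rule Bochner_Integration.integral_cong) (auto simp: indicator_def)
    also have "\<dots> = 0"
    proof (cases "max ?a c \<le> min ?b d")
      case True then show ?thesis using ab by (intro iv) (auto intro: less_le_trans[OF ab(1)])
    next
      case False
      then have "{max ?a c<..min ?b d} = {}" by auto
      then show ?thesis by (simp only: set_lebesgue_integral_def) simp
    qed
    finally show "(LINT x:{c<..d}|lborel. indicator {?a<..?b} x *\<^sub>R H x) = 0" .
  qed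
  then have "AE x in lborel. \<forall>n. indicator {inverse (real (Suc n))<..real (Suc n)} x *\<^sub>R H x = 0"
    unfolding AE_all_countable by blast
  then show ?thesis
  proof eventually_elim
    fix x assume h: "\<forall>n. indicator {inverse (real (Suc n))<..real (Suc n)} x *\<^sub>R H x = 0"
    show "0 < x \<longrightarrow> H x = 0"
    proof
      assume x: "0 < x"
      obtain n where n: "inverse (real (Suc n)) < x" using reals_Archimedean[OF x] by blast
      obtain k :: nat where k: "x \<le> k" using real_arch_simple by blast
      have "inverse (real (Suc (n + k))) \<le> inverse (real (Suc n))" by simp
      then have "inverse (real (Suc (n + k))) < x" using n by (rule le_less_trans)
      then have "x \<in> {inverse (real (Suc (n + k)))<..real (Suc (n + k))}" using k by auto
      then show "H x = 0" using h[rule_format, of "n + k"] by simp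
    qed
  qed
qed

subsection \<open>Fourier inversion\<close>

lemma std_normal_ft:
  "(LINT y|lborel. of_real (std_normal_density y) * exp (\<i> * of_real (t * y))) = of_real (exp (- (t\<^sup>2) / 2))"
proof -
  have "char std_normal_distribution t = (LINT y|lborel. std_normal_density y *\<^sub>R exp (\<i> * of_real (t * y)))"
    unfolding char_def by (rule integral_density) auto
  then show ?thesis unfolding char_std_normal_distribution by (simp add: scaleR_conv_of_real)
qed

text \<open>A Gaussian factor \<open>N (\<sigma> * x)\<close> makes Fubini applicable and turns the
  inverse transform into a Gaussian average of \<open>v\<close> around \<open>y\<close>. As \<sigma>
  tends to 0, integrability of \<open>ft v\<close> controls one side, boundedness and continuity of
  \<open>v\<close> the other.\<close>

lemma fourier_inversion:
  fixes v :: "real \<Rightarrow> complex"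
  assumes v: "integrable lborel v" and c: "continuous_on UNIV v" and B: "\<And>t. norm (v t) \<le> B"
    and fv: "integrable lborel (ft v)"
  shows "(LINT x|lborel. exp (\<i> * of_real (x * y)) * ft v x) = 2 * pi * v y"
proof -
  define N where "N = std_normal_density"
  have [measurable]: "N \<in> borel_measurable borel" unfolding N_def by simp
  have [measurable]: "v \<in> borel_measurable borel" "ft v \<in> borel_measurable borel" using v fv by auto
  have N0: "N y \<ge> 0" "N y \<le> 1 / sqrt (2 * pi)" for y
    by (auto simp: N_def std_normal_density_def intro!: divide_right_mono)
  have Ni: "integrable lborel N" "(LINT y|lborel. N y) = 1"
    unfolding N_def using prob_space_normal_density[of 1 0] by (auto simp: integrable_std_normal_moment[of 0, simplified])
  define s where "s n = inverse (real (Suc n))" for n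
  have s: "s n > 0" for n by (simp add: s_def)
  have s0: "s \<longlonglongrightarrow> 0" unfolding s_def by (rule LIMSEQ_inverse_real_of_nat)
  \<comment> \<open>The characteristic function of the normal distribution, rescaled: the Gaussian
    reproduces itself with width \<sigma>.\<close>
  have gauss: "(LINT x|lborel. of_real (N (\<sigma> * x)) * exp (\<i> * of_real (x * u))) = of_real (sqrt (2 * pi) / \<sigma> * N (u / \<sigma>))"
    if "\<sigma> > 0" for \<sigma> u
  proof -
    have "of_real (exp (- ((u / \<sigma>)\<^sup>2) / 2)) = (LINT y|lborel. of_real (N y) * exp (\<i> * complex_of_real (u / \<sigma> * y)))"
      unfolding N_def by (rule std_normal_ft[symmetric])
    also have "\<dots> = \<sigma> *\<^sub>R (LINT x|lborel. of_real (N (\<sigma> * x)) * exp (\<i> * of_real (u / \<sigma> * (\<sigma> * x))))"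
      using lborel_integral_real_affine[of \<sigma> "\<lambda>y. of_real (N y) * exp (\<i> * complex_of_real (u / \<sigma> * y))" 0] that by simp
    also have "\<dots> = \<sigma> *\<^sub>R (LINT x|lborel. of_real (N (\<sigma> * x)) * exp (\<i> * of_real (x * u)))"
      using that by (simp add: mult.commute)
    finally have "(LINT x|lborel. of_real (N (\<sigma> * x)) * exp (\<i> * of_real (x * u))) = of_real (exp (- ((u / \<sigma>)\<^sup>2) / 2) / \<sigma>)"
      using that by (simp add: scaleR_conv_of_real field_simps)
    also have "exp (- ((u / \<sigma>)\<^sup>2) / 2) / \<sigma> = sqrt (2 * pi) / \<sigma> * N (u / \<sigma>)"
      by (simp add: N_def std_normal_density_def)
    finally show ?thesis .
  qed
  have id: "(LINT x|lborel. of_real (N (\<sigma> * x)) * (exp (\<i> * of_real (x * y)) * ft v x)) =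
      sqrt (2 * pi) * (LINT t|lborel. of_real (N t) * v (y - \<sigma> * t))" if \<sigma>: "\<sigma> > 0" for \<sigma>
  proof -
    have Nsi: "integrable lborel (\<lambda>x. N (\<sigma> * x))"
      using lborel_integrable_real_affine[OF Ni(1), of \<sigma> 0] \<sigma> by simp
    have e: "exp (\<i> * of_real (x * y)) * exp (- (\<i> * of_real (x * t))) = exp (\<i> * complex_of_real (x * (y - t)))" for x t
      by (simp add: exp_add[symmetric] algebra_simps)
    define k where "k x t = of_real (N (\<sigma> * x)) * (exp (\<i> * complex_of_real (x * (y - t))) * v t)" for x t
    have "(LINT x|lborel. of_real (N (\<sigma> * x)) * (exp (\<i> * of_real (x * y)) * ft v x)) = (LINT x|lborel. LINT t|lborel. k x t)"
      unfolding ft_def k_def e[symmetric] by (simp add: mult.assoc)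
    also have "\<dots> = (LINT t|lborel. LINT x|lborel. k x t)"
    proof (rule LINT_swap(1)[symmetric])
      have "(\<integral>\<^sup>+x. \<integral>\<^sup>+t. ennreal (norm (k x t)) \<partial>lborel \<partial>lborel) = (\<integral>\<^sup>+x. ennreal (N (\<sigma> * x)) * (\<integral>\<^sup>+t. ennreal (norm (v t)) \<partial>lborel) \<partial>lborel)"
        by (simp add: k_def norm_mult N0 ennreal_mult nn_integral_cmult del: of_real_mult)
      also have "\<dots> = (\<integral>\<^sup>+x. ennreal (N (\<sigma> * x)) \<partial>lborel) * (\<integral>\<^sup>+t. ennreal (norm (v t)) \<partial>lborel)"
        by (simp add: nn_integral_multc)
      also have "\<dots> < \<infinity>"
        using nn_integral_norm_finite[OF v] nn_integral_norm_finite[OF integrable_of_real[OF Nsi]] N0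
        by (simp add: ennreal_mult_less_top)
      finally show "(\<integral>\<^sup>+x. \<integral>\<^sup>+t. ennreal (norm (k x t)) \<partial>lborel \<partial>lborel) < \<infinity>" .
    qed (simp add: k_def)
    also have "\<dots> = (LINT t|lborel. of_real (sqrt (2 * pi) / \<sigma> * N ((y - t) / \<sigma>)) * v t)"
    proof (rule Bochner_Integration.integral_cong[OF refl])
      fix t
      have "(LINT x|lborel. k x t) = (LINT x|lborel. (of_real (N (\<sigma> * x)) * exp (\<i> * of_real (x * (y - t)))) * v t)"
        by (simp add: k_def mult.assoc)
      also have "\<dots> = (LINT x|lborel. of_real (N (\<sigma> * x)) * exp (\<i> * of_real (x * (y - t)))) * v t"
        by (rule integral_mult_left_zero)
      finally show "(LINT x|lborel. k x t) = of_real (sqrt (2 * pi) / \<sigma> * N ((y - t) / \<sigma>)) * v t"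
        unfolding gauss[OF \<sigma>] .
    qed
    also have "\<dots> = \<sigma> *\<^sub>R (LINT t|lborel. of_real (sqrt (2 * pi) / \<sigma> * N t) * v (y - \<sigma> * t))"
      using lborel_integral_real_affine[of "-\<sigma>" "\<lambda>t. of_real (sqrt (2 * pi) / \<sigma> * N ((y - t) / \<sigma>)) * v t" y] \<sigma> by simp
    also have "\<dots> = (LINT t|lborel. \<sigma> *\<^sub>R (of_real (sqrt (2 * pi) / \<sigma> * N t) * v (y - \<sigma> * t)))" by simp
    also have "\<dots> = (LINT t|lborel. of_real (sqrt (2 * pi)) * (of_real (N t) * v (y - \<sigma> * t)))"
      using \<sigma> by (intro Bochner_Integration.integral_cong) (auto simp: scaleR_conv_of_real)
    finally show ?thesis by simp
  qed
  have N_lim: "(\<lambda>n. N (s n * x)) \<longlonglongrightarrow> N 0" for x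
  proof -
    have "(\<lambda>n. N (s n * x)) \<longlonglongrightarrow> N (0 * x)"
      unfolding N_def std_normal_density_def by (intro tendsto_intros s0) auto
    then show ?thesis by simp
  qed
  have "(\<lambda>n. LINT x|lborel. of_real (N (s n * x)) * (exp (\<i> * of_real (x * y)) * ft v x)) \<longlonglongrightarrow>
      (LINT x|lborel. of_real (N 0) * (exp (\<i> * of_real (x * y)) * ft v x))"
  proof (rule integral_dominated_convergence[where w = "\<lambda>x. 1 / sqrt (2 * pi) * norm (ft v x)"])
    show "AE x in lborel. norm (of_real (N (s n * x)) * (exp (\<i> * of_real (x * y)) * ft v x)) \<le> 1 / sqrt (2 * pi) * norm (ft v x)" for n
      using mult_right_mono[OF N0(2) norm_ge_zero] N0(1) by (auto simp: norm_mult simp del: of_real_mult)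
    show "AE x in lborel. (\<lambda>n. of_real (N (s n * x)) * (exp (\<i> * of_real (x * y)) * ft v x)) \<longlonglongrightarrow> of_real (N 0) * (exp (\<i> * of_real (x * y)) * ft v x)"
      by (intro AE_I2 tendsto_intros N_lim)
  qed (use fv in auto)
  moreover have "(\<lambda>n. sqrt (2 * pi) * (LINT t|lborel. of_real (N t) * v (y - s n * t))) \<longlonglongrightarrow> sqrt (2 * pi) * (LINT t|lborel. of_real (N t) * v y)"
  proof (intro tendsto_intros, rule integral_dominated_convergence[where w = "\<lambda>x. B * N x"])
    show "AE t in lborel. norm (of_real (N t) * v (y - s n * t)) \<le> B * N t" for n
      using N0 mult_right_mono[OF B N0(1)] by (auto simp: norm_mult mult.commute intro!: AE_I2)
    have "(\<lambda>n. v (y - s n * t)) \<longlonglongrightarrow> v y" for t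
    proof -
      have "isCont v y" using c by (simp add: continuous_on_eq_continuous_at)
      moreover have "(\<lambda>n. y - s n * t) \<longlonglongrightarrow> y - 0 * t" by (intro tendsto_intros s0)
      then have "(\<lambda>n. y - s n * t) \<longlonglongrightarrow> y" by simp
      ultimately show ?thesis by (rule isCont_tendsto_compose)
    qed
    then show "AE t in lborel. (\<lambda>n. of_real (N t) * v (y - s n * t)) \<longlonglongrightarrow> of_real (N t) * v y"
      by (intro AE_I2 tendsto_intros)
  qed (use Ni in auto)
  ultimately have "(LINT x|lborel. of_real (N 0) * (exp (\<i> * of_real (x * y)) * ft v x)) = sqrt (2 * pi) * (LINT t|lborel. of_real (N t) * v y)"
    unfolding id[OF s] by (rule LIMSEQ_unique)
  also have "(LINT t|lborel. of_real (N t) * v y) = v y"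
    using Ni by (simp add: integral_mult_left_zero)
  finally have "of_real (1 / sqrt (2 * pi)) * (LINT x|lborel. exp (\<i> * of_real (x * y)) * ft v x) = sqrt (2 * pi) * v y"
    by (simp add: N_def std_normal_density_def)
  then have "(of_real (sqrt (2 * pi)) * of_real (1 / sqrt (2 * pi))) * (LINT x|lborel. exp (\<i> * of_real (x * y)) * ft v x) = (of_real (sqrt (2 * pi)) * of_real (sqrt (2 * pi))) * v y"
    unfolding mult.assoc by simp
  then show ?thesis by (simp flip: of_real_mult)
qed

subsection \<open>Gamma integrals\<close>

text \<open>A Gamma density without normalisation, set to 0 for \<open>t \<le> 0\<close>. Its
  transform is a negative power of \<open>c + i x\<close> (\<open>ft_gk\<close>), which makes it the
  building block of all kernels and Laguerre functions below.\<close>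

definition gk :: "real \<Rightarrow> real \<Rightarrow> real \<Rightarrow> real" where
  "gk b c t = (if t > 0 then t powr (b - 1) * exp (- (c * t)) else 0)"

lemma gk_nonneg [simp]: "gk b c t \<ge> 0" by (simp add: gk_def)

lemma gk_measurable [measurable]: "gk b c \<in> borel_measurable borel" unfolding gk_def[abs_def] by measurable

lemma gk_nonpos [simp]: "t \<le> 0 \<Longrightarrow> gk b c t = 0" by (simp add: gk_def)

lemma gk_times: "t * gk b c t = gk (b + 1) c t"
  by (auto simp: gk_def powr_mult_base)

lemma gk_nn_integral:
  assumes "b > 0" "c > 0" shows "(\<integral>\<^sup>+t. ennreal (gk b c t) \<partial>lborel) = ennreal (Gamma b * c powr (- b))"
proof -
  have "ennreal (Gamma b) = (\<integral>\<^sup>+t. ennreal (indicator {0..} t * t powr (b - 1) / exp t) \<partial>lborel)"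
    by (rule Gamma_conv_nn_integral_real[OF assms(1)])
  also have "\<dots> = (\<integral>\<^sup>+t. ennreal (gk b 1 t) \<partial>lborel)"
    by (intro nn_integral_cong) (auto simp: gk_def indicator_def exp_minus field_simps)
  also have "\<dots> = c * (\<integral>\<^sup>+t. ennreal (gk b 1 (c * t)) \<partial>lborel)"
    using assms by (subst nn_integral_real_affine[where c = c and t = 0]) auto
  also have "(\<lambda>t. gk b 1 (c * t)) = (\<lambda>t. c powr (b - 1) * gk b c t)"
    using assms by (auto simp: gk_def fun_eq_iff powr_mult zero_less_mult_iff)
  also have "(\<integral>\<^sup>+t. ennreal (c powr (b - 1) * gk b c t) \<partial>lborel) = c powr (b - 1) * (\<integral>\<^sup>+t. ennreal (gk b c t) \<partial>lborel)"
    by (simp add: ennreal_mult nn_integral_cmult)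
  finally have e: "ennreal (Gamma b) = ennreal (c powr b) * (\<integral>\<^sup>+t. ennreal (gk b c t) \<partial>lborel)"
    using assms by (simp add: mult.assoc[symmetric] ennreal_mult[symmetric] powr_mult_base)
  have "ennreal (c powr (- b)) * ennreal (c powr b) = 1"
    using assms by (simp add: ennreal_mult[symmetric] powr_add[symmetric])
  then have "(\<integral>\<^sup>+t. ennreal (gk b c t) \<partial>lborel) = ennreal (c powr (- b)) * ennreal (Gamma b)"
    unfolding e by (simp add: mult.assoc[symmetric])
  then show ?thesis using assms Gamma_real_pos[of b] by (simp add: ennreal_mult[symmetric] mult.commute)
qed

lemma gk_integrable: assumes "b > 0" "c > 0" shows "integrable lborel (gk b c)"
  by (rule integrableI_bounded) (use assms gk_nn_integral[OF assms] in \<open>auto simp: abs_of_nonneg\<close>)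

lemma gk_integral: assumes "b > 0" "c > 0" shows "(LINT t|lborel. gk b c t) = Gamma b * c powr (- b)"
  using gk_nn_integral[OF assms] assms Gamma_real_pos[of b]
  by (subst integral_eq_nn_integral) auto

lemma Complex_not_nonpos: "c > 0 \<Longrightarrow> Complex c x \<notin> \<real>\<^sub>\<le>\<^sub>0"
  by (auto simp: complex_nonpos_Reals_iff)

lemma powr_exp_tendsto_0: assumes "c > 0" shows "((\<lambda>t. t powr b * exp (- (c * t))) \<longlongrightarrow> (0::real)) at_top"
proof -
  obtain n :: nat where n: "b \<le> n" using real_arch_simple by blast
  have "((\<lambda>t. t ^ n / exp t) \<longlongrightarrow> (0::real)) at_top" by (rule tendsto_power_div_exp_0)
  moreover have "filterlim (\<lambda>t. c * t) at_top at_top"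
    using assms by (intro filterlim_tendsto_pos_mult_at_top[OF tendsto_const]) (auto simp: filterlim_ident)
  ultimately have "((\<lambda>t. (c * t) ^ n / exp (c * t)) \<longlongrightarrow> 0) at_top" by (rule filterlim_compose)
  then have "((\<lambda>t. inverse c ^ n * ((c * t) ^ n / exp (c * t))) \<longlongrightarrow> inverse c ^ n * 0) at_top" by (intro tendsto_intros)
  then have l: "((\<lambda>t. t ^ n * exp (- (c * t))) \<longlongrightarrow> 0) at_top"
    using assms by (simp add: power_mult_distrib exp_minus divide_inverse mult.assoc[symmetric] power_inverse)
  show ?thesis
  proof (rule tendsto_sandwich[OF _ _ tendsto_const l])
    show "\<forall>\<^sub>F t in at_top. t powr b * exp (- (c * t)) \<le> t ^ n * exp (- (c * t))"
      using eventually_ge_at_top[of 1]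
    proof eventually_elim
      fix t :: real assume t: "1 \<le> t"
      then have "t powr b \<le> t powr n" using n by (intro powr_mono) auto
      then show "t powr b * exp (- (c * t)) \<le> t ^ n * exp (- (c * t))" using t by (simp add: powr_realpow)
    qed
  qed auto
qed

text \<open>The derivative of \<open>t^b exp (- w t)\<close>, with \<open>w = c + i x\<close>,
  integrates to 0 over the half line: the boundary value at 0 vanishes because \<open>b > 0\<close>,
  the one at infinity because \<open>c > 0\<close>.\<close>

lemma ft_gk_recurrence:
  assumes b: "b > 0" and c: "c > 0"
  shows "Complex c x * ft (\<lambda>t. of_real (gk (b + 1) c t)) x = of_real b * ft (\<lambda>t. of_real (gk b c t)) x"
proof -
  define w where "w = Complex c x"
  define F where "F t = of_real (t powr b) * exp (- (w * of_real t))" for t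
  define f where "f t = of_real (b * t powr (b - 1)) * exp (- (w * of_real t)) - w * (of_real (t powr b) * exp (- (w * of_real t)))" for t
  have ew: "exp (- (w * of_real t)) = of_real (exp (- (c * t))) * exp (- (\<i> * of_real (x * t)))" for t
  proof -
    have "- (w * of_real t) = of_real (- (c * t)) + - (\<i> * of_real (x * t))" by (simp add: w_def complex_eq_iff)
    then show ?thesis by (simp only: exp_add exp_of_real)
  qed
  have ib: "integrable lborel (\<lambda>t. exp (- (\<i> * of_real (x * t))) * of_real (gk b' c t))" if "b' > 0" for b'
    by (rule integrable_exp_mult) (intro integrable_of_real gk_integrable that c)
  have fi: "indicator {0<..} t *\<^sub>R f t = of_real b * (exp (- (\<i> * of_real (x * t))) * of_real (gk b c t)) - w * (exp (- (\<i> * of_real (x * t))) * of_real (gk (b + 1) c t))" for t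
    by (auto simp: f_def gk_def ew indicator_def algebra_simps)
  have nF: "norm (F t) = t powr b * exp (- (c * t))" for t
    by (simp add: F_def ew norm_mult del: of_real_mult)
  have e: "einterval 0 \<infinity> = {0<..}" by (auto simp: einterval_def)
  have "(LBINT t=0..\<infinity>. f t) = 0 - 0"
  proof (rule interval_integral_FTC_integrable)
    show "(F has_vector_derivative f t) (at t)" if "0 < ereal t" for t
    proof -
      have "((\<lambda>t. t powr b) has_real_derivative b * t powr (b - 1)) (at t)"
        using that by (auto intro!: derivative_eq_intros)
      then have 1: "((\<lambda>t. complex_of_real (t powr b)) has_vector_derivative of_real (b * t powr (b - 1))) (at t)"
        unfolding has_real_derivative_iff_has_vector_derivative
        by (rule bounded_linear.has_vector_derivative[OF bounded_linear_of_real])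
      have "((\<lambda>z. exp (- (w * z))) has_field_derivative - w * exp (- (w * of_real t))) (at (of_real t))"
        by (auto intro!: derivative_eq_intros)
      from has_vector_derivative_mult[OF 1 has_vector_derivative_real_field[OF this]]
      show ?thesis unfolding F_def[abs_def] f_def by (simp add: algebra_simps)
    qed
    show "isCont f t" if "0 < ereal t" for t
      unfolding f_def using that by (intro continuous_intros) auto
    show "set_integrable lborel (einterval 0 \<infinity>) f"
      unfolding e set_integrable_def fi using b by (intro Bochner_Integration.integrable_diff integrable_mult_right ib) auto
    have "(F \<longlongrightarrow> 0) (at_right 0)"
    proof (rule tendsto_norm_zero_cancel)
      have "((\<lambda>t. t powr b * exp (- (c * t))) \<longlongrightarrow> 0 powr b * exp (- (c * 0))) (at_right 0)"
        using b by (intro tendsto_intros tendsto_powr') (auto simp: eventually_at_filter)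
      then show "((\<lambda>t. norm (F t)) \<longlongrightarrow> 0) (at_right 0)" using b by (simp add: nF)
    qed
    then show "((F \<circ> real_of_ereal) \<longlongrightarrow> 0) (at_right 0)"
      unfolding zero_ereal_def ereal_tendsto_simps .
    have "(F \<longlongrightarrow> 0) at_top"
      by (rule tendsto_norm_zero_cancel) (simp add: nF powr_exp_tendsto_0[OF c])
    then show "((F \<circ> real_of_ereal) \<longlongrightarrow> 0) (at_left \<infinity>)"
      unfolding ereal_tendsto_simps .
  qed auto
  then have "(LINT t|lborel. indicator {0<..} t *\<^sub>R f t) = 0"
    by (simp add: interval_lebesgue_integral_def e set_lebesgue_integral_def)
  then show ?thesis
    unfolding fi using ib[OF b] ib[of "b + 1"] b
    by (simp add: ft_def w_def del: of_real_mult)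
qed

text \<open>The transform times \<open>Complex c x powr b\<close> has derivative 0 in
  \<open>x\<close>: differentiating under the integral raises \<open>b\<close> by one and the
  recurrence lowers it again. Its constant value is read off at \<open>x = 0\<close>, from the real
  Gamma integral.\<close>

lemma ft_gk:
  assumes b: "b > 0" and c: "c > 0"
  shows "ft (\<lambda>t. of_real (gk b c t)) x = of_real (Gamma b) * Complex c x powr (- of_real b)"
proof -
  define I where "I = ft (\<lambda>t. of_real (gk b c t))"
  define D where "D x = I x * Complex c x powr of_real b" for x
  have I': "(I has_vector_derivative - \<i> * ft (\<lambda>t. of_real (gk (b + 1) c t)) x) (at x)" for x
  proof -
    have "((\<lambda>x. LINT t|lborel. exp (- (\<i> * of_real (x * t))) * of_real (gk b c t)) has_vector_derivative
       (LINT t|lborel. - \<i> * (exp (- (\<i> * of_real (x * t))) * of_real (gk (b + 1) c t)))) (at x)"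
    proof (rule has_vector_derivative_LINT[where B = "gk (b + 1) c"])
      show "integrable lborel (\<lambda>t. exp (- (\<i> * of_real (x * t))) * of_real (gk b c t))" for x
        by (rule integrable_exp_mult) (intro integrable_of_real gk_integrable b c)
      show "integrable lborel (gk (b + 1) c)" using b c by (intro gk_integrable) auto
      show "norm (- \<i> * (exp (- (\<i> * of_real (x * t))) * of_real (gk (b + 1) c t))) \<le> gk (b + 1) c t" for x t
        by (simp add: norm_mult del: of_real_mult)
      fix x t
      have "((\<lambda>z. exp (- (\<i> * (z * of_real t))) * of_real (gk b c t)) has_field_derivative
          - \<i> * (exp (- (\<i> * of_real (x * t))) * of_real (gk (b + 1) c t))) (at (of_real x))"
        by (auto intro!: derivative_eq_intros simp: gk_times[symmetric])
      from has_vector_derivative_real_field[OF this]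
      show "((\<lambda>x. exp (- (\<i> * of_real (x * t))) * of_real (gk b c t)) has_vector_derivative
          - \<i> * (exp (- (\<i> * of_real (x * t))) * of_real (gk (b + 1) c t))) (at x)" by simp
    qed simp
    then show ?thesis unfolding I_def ft_def[abs_def] by simp
  qed
  have D': "(D has_vector_derivative 0) (at x)" for x
  proof -
    define w where "w = Complex c x"
    have w: "w \<notin> \<real>\<^sub>\<le>\<^sub>0" "w \<noteq> 0" using Complex_not_nonpos[OF c] c by (auto simp: w_def complex_eq_iff)
    have cx: "Complex c y = of_real c + \<i> * of_real y" for y by (simp add: complex_eq_iff)
    have "((\<lambda>z. (of_real c + \<i> * z) powr of_real b) has_field_derivative (\<i> * (of_real b * w powr (of_real b - 1)))) (at (of_real x))"
      using w unfolding w_def cx by (auto intro!: derivative_eq_intros)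
    from has_vector_derivative_mult[OF I' has_vector_derivative_real_field[OF this]]
    have "(D has_vector_derivative I x * (\<i> * (of_real b * w powr (of_real b - 1))) + - \<i> * ft (\<lambda>t. of_real (gk (b + 1) c t)) x * w powr of_real b) (at x)"
      unfolding D_def[abs_def] cx w_def by simp
    moreover have "ft (\<lambda>t. of_real (gk (b + 1) c t)) x = of_real b * I x / w"
      using ft_gk_recurrence[OF b c, of x] w by (simp add: I_def w_def field_simps)
    moreover have "w powr (of_real b - 1) = w powr of_real b / w" using w by (simp add: powr_diff)
    moreover have "I x * (\<i> * (of_real b * (w powr of_real b / w))) + - \<i> * (of_real b * I x / w) * w powr of_real b = 0"
      using w by (simp add: field_simps)
    ultimately show ?thesis by simp
  qed
  have "D x = D 0"
  proof (rule has_derivative_zero_unique[of UNIV D, THEN trans])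
  qed (use D' in \<open>auto simp: has_vector_derivative_def\<close>)
  also have "D 0 = of_real (Gamma b)"
  proof -
    have "I 0 = of_real (LINT t|lborel. gk b c t)" by (simp add: I_def ft_def)
    moreover have "Complex c 0 powr of_real b = of_real (c powr b)"
      using c by (simp add: complex_of_real_def[symmetric] powr_of_real)
    ultimately show ?thesis using gk_integral[OF b c] c by (simp add: D_def of_real_mult[symmetric] powr_add[symmetric] mult.assoc del: of_real_mult)
  qed
  finally have "I x * Complex c x powr of_real b = of_real (Gamma b)" by (simp add: D_def)
  moreover have "Complex c x powr of_real b \<noteq> 0" 
    using Complex_not_nonpos[OF c, of x] by auto
  ultimately show ?thesis by (simp add: I_def powr_minus field_simps)
qed

subsection \<open>Weighted Fourier transforms on the half line\<close>

text \<open>The constants \<open>\<i> powr r\<close> and \<open>1 / (2 * pi)\<close> contributed by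
  \<open>kappa_minus\<close> and \<open>fourier\<close> are left out here and return in
  \<open>spectral_restricts\<close>. Requiring \<open>G\<close> to vanish for
  \<open>t \<le> 0\<close> lets all later integrals run over the whole line.\<close>

definition spectral :: "real \<Rightarrow> real \<Rightarrow> (real \<Rightarrow> complex) \<Rightarrow> (real \<Rightarrow> complex) \<Rightarrow> bool" where
  "spectral l r f G \<longleftrightarrow> G \<in> borel_measurable borel \<and> (\<forall>t\<le>0. G t = 0) \<and>
     (\<forall>\<psi>\<in>test_functions {0<..}.
        (LINT x|lborel. Complex l x powr of_real r * f x * ft \<psi> x) = (LINT t|lborel. G t * \<psi> t))"

text \<open>The square of the weighted norm, valued in \<open>ennreal\<close> so that finiteness is
  a plain inequality without integrability side conditions.\<close>

definition wnorm :: "real \<Rightarrow> (real \<Rightarrow> complex) \<Rightarrow> ennreal" where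
  "wnorm s G = (\<integral>\<^sup>+t. ennreal (t powr (2 * s) * (norm (G t))\<^sup>2) \<partial>lborel)"

definition sq_int :: "(real \<Rightarrow> complex) \<Rightarrow> bool" where
  "sq_int f \<longleftrightarrow> f \<in> borel_measurable borel \<and> integrable lborel (\<lambda>x. (norm (f x))\<^sup>2)"

lemma spectralD:
  assumes "spectral l r f G"
  shows "G \<in> borel_measurable borel" "t \<le> 0 \<Longrightarrow> G t = 0"
    "\<psi> \<in> test_functions {0<..} \<Longrightarrow> (LINT x|lborel. Complex l x powr of_real r * f x * ft \<psi> x) = (LINT t|lborel. G t * \<psi> t)"
  using assms unfolding spectral_def by blast+

lemma norm_powr_of_real: "w \<noteq> 0 \<Longrightarrow> norm (w powr complex_of_real r) = norm w powr r"
  by (simp add: powr_def norm_exp_eq_Re)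

lemma Complex_nonzero: "c > 0 \<Longrightarrow> Complex c x \<noteq> 0"
  by (simp add: complex_eq_iff)

lemma norm_Complex_ge: "c > 0 \<Longrightarrow> c \<le> norm (Complex c x)" "\<bar>x\<bar> \<le> norm (Complex c x)"
  using complex_Re_le_cmod[of "Complex c x"] abs_Im_le_cmod[of "Complex c x"] by simp_all

lemma measurable_Complex [measurable]: "Complex c \<in> borel_measurable borel"
proof -
  have "Complex c = (\<lambda>x. of_real c + \<i> * of_real x)" by (auto simp: fun_eq_iff complex_eq_iff)
  then show ?thesis by simp
qed

lemma measurable_Complex_powr:
  assumes "c > 0" shows "(\<lambda>x. Complex c x powr a) \<in> borel_measurable borel"
proof (rule borel_measurable_continuous_onI)
  have "Complex c = (\<lambda>x. of_real c + \<i> * of_real x)" by (auto simp: fun_eq_iff complex_eq_iff)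
  then have "continuous_on UNIV (\<lambda>x. Complex c x)" by (simp add: continuous_intros)
  then show "continuous_on UNIV (\<lambda>x. Complex c x powr a)" using assms
    by (intro continuous_on_powr_complex continuous_on_const) (auto simp: complex_eq_iff)
qed

lemma integrable_inverse_norm_Complex:
  assumes "c > 0" shows "integrable lborel (\<lambda>x. inverse ((norm (Complex c x))\<^sup>2))"
proof -
  have "integrable lborel (\<lambda>x::real. inverse (1 + x\<^sup>2))"
    using integrable_inverse_1_plus_square by (simp add: set_integrable_def einterval_def)
  from lborel_integrable_real_affine[OF this, of "inverse c" 0]
  have "integrable lborel (\<lambda>x. inverse (c\<^sup>2) * inverse (1 + (inverse c * x)\<^sup>2))" using assms by simp
  then show ?thesis
    by (rule Bochner_Integration.integrable_cong[THEN iffD1, rotated 2])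
      (use assms in \<open>auto simp: cmod_power2 power_mult_distrib field_simps\<close>)
qed

lemma sq_int_mult_integrable:
  assumes "sq_int f" "sq_int g" shows "integrable lborel (\<lambda>x. f x * g x)"
proof (rule Bochner_Integration.integrable_bound)
  show "integrable lborel (\<lambda>x. (norm (f x))\<^sup>2 + (norm (g x))\<^sup>2)" using assms by (simp add: sq_int_def)
  have [measurable]: "f \<in> borel_measurable borel" "g \<in> borel_measurable borel" using assms by (auto simp: sq_int_def)
  show "(\<lambda>x. f x * g x) \<in> borel_measurable lborel" by measurable
  have "norm (f x) * norm (g x) \<le> (norm (f x))\<^sup>2 + (norm (g x))\<^sup>2" for x
    using sum_squares_bound[of "norm (f x)" "norm (g x)"] mult_nonneg_nonneg[OF norm_ge_zero[of "f x"] norm_ge_zero[of "g x"]] by linarith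
  then show "AE x in lborel. norm (f x * g x) \<le> norm ((norm (f x))\<^sup>2 + (norm (g x))\<^sup>2)"
    by (auto simp: norm_mult)
qed

lemma sq_int_bound:
  assumes "c > 0" "f \<in> borel_measurable borel" "\<And>x. norm (f x) \<le> C / norm (Complex c x)"
  shows "sq_int f"
  unfolding sq_int_def
proof
  show "integrable lborel (\<lambda>x. (norm (f x))\<^sup>2)"
  proof (rule Bochner_Integration.integrable_bound)
    show "integrable lborel (\<lambda>x. C\<^sup>2 * inverse ((norm (Complex c x))\<^sup>2))"
      using integrable_inverse_norm_Complex[OF assms(1)] by simp
    show "(\<lambda>x. (norm (f x))\<^sup>2) \<in> borel_measurable lborel" using assms(2) by simp
    show "AE x in lborel. norm ((norm (f x))\<^sup>2) \<le> norm (C\<^sup>2 * inverse ((norm (Complex c x))\<^sup>2))"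
      using power_mono[OF assms(3) norm_ge_zero, of _ 2] by (auto simp: power_divide divide_inverse power_mult_distrib power_inverse)
  qed
qed fact

lemma sq_int_weighted_ft:
  assumes "\<psi> \<in> test_functions {0<..}" "l > 0"
  shows "sq_int (\<lambda>x. Complex l x powr of_real r * ft \<psi> x)"
proof -
  have [measurable]: "ft \<psi> \<in> borel_measurable borel" by (rule measurable_ft[OF test_functions_integrable[OF assms(1)]])
  note [measurable] = measurable_Complex_powr[OF assms(2)]
  \<comment> \<open>One order of decay beyond \<open>r\<close> leaves
    \<open>1 / norm (Complex l x)\<close>, which is square integrable.\<close>
  obtain C where C: "\<And>x. norm (ft \<psi> x) \<le> C * norm (Complex l x) powr (- (r + 1))" using ft_decay[OF assms, of "r + 1"] by blast
  show ?thesis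
  proof (rule sq_int_bound[OF assms(2)])
    fix x
    have w: "norm (Complex l x) > 0" using Complex_nonzero[OF assms(2)] by simp
    have "norm (Complex l x powr of_real r * ft \<psi> x) \<le> norm (Complex l x) powr r * (C * norm (Complex l x) powr (- (r + 1)))"
      using C Complex_nonzero[OF assms(2)] by (auto simp: norm_mult norm_powr_of_real intro!: mult_left_mono)
    also have "\<dots> = C / norm (Complex l x)" using w by (simp add: powr_diff powr_minus field_simps powr_add)
    finally show "norm (Complex l x powr of_real r * ft \<psi> x) \<le> C / norm (Complex l x)" .
  qed measurable
qed

lemma spectral_integrable:
  assumes "\<psi> \<in> test_functions {0<..}" "l > 0" "sq_int f"
  shows "integrable lborel (\<lambda>x. Complex l x powr of_real r * f x * ft \<psi> x)"
  using sq_int_mult_integrable[OF sq_int_weighted_ft[OF assms(1,2), of r] assms(3)] by (simp add: mult_ac)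

text \<open>The weights \<open>t powr s\<close> and \<open>t powr (- s)\<close> are dual to each
  other: the product of the two functions is dominated by the sum of the two weighted
  squares.\<close>

lemma wnorm_pair_integrable:
  assumes [measurable]: "G \<in> borel_measurable borel" "p \<in> borel_measurable borel"
    and z: "\<And>t. t \<le> 0 \<Longrightarrow> G t = 0" and fin: "wnorm s G < \<infinity>" "wnorm (- s) p < \<infinity>"
  shows "integrable lborel (\<lambda>t. G t * p t)"
proof (rule Bochner_Integration.integrable_bound)
  have i: "integrable lborel (\<lambda>t. t powr (2 * s) * (norm (G t))\<^sup>2)" if "wnorm s G < \<infinity>" "G \<in> borel_measurable borel" for s G
    by (rule integrableI_bounded) (use that in \<open>auto simp: wnorm_def abs_mult\<close>)
  show "integrable lborel (\<lambda>t. t powr (2 * s) * (norm (G t))\<^sup>2 + t powr (2 * (- s)) * (norm (p t))\<^sup>2)"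
    by (intro Bochner_Integration.integrable_add i fin) measurable
  show "AE t in lborel. norm (G t * p t) \<le> norm (t powr (2 * s) * (norm (G t))\<^sup>2 + t powr (2 * (- s)) * (norm (p t))\<^sup>2)"
  proof (rule AE_I2)
    fix t
    show "norm (G t * p t) \<le> norm (t powr (2 * s) * (norm (G t))\<^sup>2 + t powr (2 * (- s)) * (norm (p t))\<^sup>2)"
    proof (cases "t \<le> 0")
      case False
      let ?x = "t powr s * norm (G t)" and ?y = "t powr (- s) * norm (p t)"
      have "norm (G t * p t) = ?x * ?y" using False by (simp add: norm_mult powr_minus)
      also have "\<dots> \<le> ?x\<^sup>2 + ?y\<^sup>2"
      proof -
        have "0 \<le> ?x * ?y" by simp
        then show ?thesis using sum_squares_bound[of ?x ?y] by linarith
      qed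
      also have "\<dots> = t powr (2 * s) * (norm (G t))\<^sup>2 + t powr (2 * (- s)) * (norm (p t))\<^sup>2"
        using False by (simp add: power_mult_distrib powr_power mult.commute)
      finally show ?thesis by simp
    qed (simp add: z)
  qed
qed measurable

lemma gk_square: "t powr (2 * s) * (gk b c t)\<^sup>2 = gk (2 * b + 2 * s - 1) (2 * c) t"
proof (cases "t > 0")
  case True
  have "(exp (- (c * t)))\<^sup>2 = exp (- (2 * c * t))" by (simp add: exp_double[symmetric] flip: exp_of_nat_mult)
  then show ?thesis using True
    by (simp add: gk_def power_mult_distrib powr_power powr_add[symmetric] algebra_simps)
qed (simp add: gk_def)

lemma wnorm_mono:
  assumes "\<And>t. norm (G t) \<le> norm (H t)" shows "wnorm s G \<le> wnorm s H"
  unfolding wnorm_def by (intro nn_integral_mono ennreal_leI mult_left_mono power_mono assms) auto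

text \<open>The condition on \<open>b\<close> is integrability at 0, where the weighted square of
  the kernel behaves like \<open>t powr (2 * b + 2 * s - 2)\<close>.\<close>

lemma wnorm_gk_finite:
  assumes p: "\<And>t. norm (p t) \<le> C * gk b c t" and c: "c > 0" and b: "2 * b + 2 * s > 1"
  shows "wnorm s p < \<infinity>"
proof -
  have "wnorm s p \<le> (\<integral>\<^sup>+t. ennreal (C\<^sup>2 * gk (2 * b + 2 * s - 1) (2 * c) t) \<partial>lborel)"
    unfolding wnorm_def
  proof (intro nn_integral_mono ennreal_leI)
    fix t
    have "t powr (2 * s) * (norm (p t))\<^sup>2 \<le> t powr (2 * s) * (C * gk b c t)\<^sup>2"
      by (intro mult_left_mono power_mono p) auto
    also have "\<dots> = C\<^sup>2 * gk (2 * b + 2 * s - 1) (2 * c) t"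
      unfolding gk_square[symmetric] by (simp add: power_mult_distrib)
    finally show "t powr (2 * s) * (norm (p t))\<^sup>2 \<le> C\<^sup>2 * gk (2 * b + 2 * s - 1) (2 * c) t" .
  qed
  also have "\<dots> = ennreal (C\<^sup>2) * ennreal (Gamma (2 * b + 2 * s - 1) * (2 * c) powr (- (2 * b + 2 * s - 1)))"
    using b c by (subst gk_nn_integral[symmetric]) (auto simp: ennreal_mult nn_integral_cmult)
  also have "\<dots> < \<infinity>" by (simp add: ennreal_mult_less_top)
  finally show ?thesis .
qed

section \<open>Testing with functions that are not compactly supported\<close>

text \<open>Cutting \<open>g\<close> off at \<open>k\<close> and mollifying it to the right produces
  genuine test functions. The limits in \<open>k\<close> and then in the mollifier are taken on both
  sides of the identity; on the side of the density a single majorant \<open>U\<close> serves both,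
  and it is integrable against \<open>G\<close> by duality because \<open>a \<ge> s\<close>.\<close>

lemma extended_testing:
  assumes l: "l > 0" and spec: "spectral l r f G" and f: "sq_int f" and W: "wnorm s G < \<infinity>"
    and gc: "continuous_on UNIV g" and gb: "\<And>t. norm (g t) \<le> C * gk (a + 1) c t"
    and c: "c > 0" and a: "a \<ge> 0" "a \<ge> s"
    and int: "integrable lborel (\<lambda>x. Complex l x powr of_real r * f x * ft g x)"
  shows "(LINT x|lborel. Complex l x powr of_real r * f x * ft g x) = (LINT t|lborel. G t * g t)"
proof -
  obtain \<rho> where r: "mollifier \<rho>" by (rule mollifier_exists)
  define R where "R n t = complex_of_real (\<rho> n t)" for n t
  have Rt: "R n \<in> test_functions {0<..}" for n unfolding R_def[abs_def] by (rule mollifierD(1)[OF r])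
  have Ri: "integrable lborel (R n)" for n by (rule test_functions_integrable[OF Rt])
  define F where "F x = Complex l x powr of_real r * f x" for x
  have [measurable]: "g \<in> borel_measurable borel" using gc by (rule borel_measurable_continuous_onI)
  have [measurable]: "f \<in> borel_measurable borel" using f by (simp add: sq_int_def)
  note [measurable] = measurable_Complex_powr[OF l]
  have [measurable]: "F \<in> borel_measurable borel" unfolding F_def[abs_def] by measurable
  note [measurable] = spectralD(1)[OF spec]
  have [measurable]: "R n \<in> borel_measurable borel" for n using Rt by (rule test_functions_measurable)
  have C: "C \<ge> 0"
  proof -
    have "0 \<le> C * gk (a + 1) c 1" using gb[of 1] norm_ge_zero order_trans by blast
    then show ?thesis by (simp add: gk_def zero_le_mult_iff)
  qed
  have g0: "g t = 0" if "t \<le> 0" for t using gb[of t] that by simp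
  have gi: "integrable lborel g"
    by (rule Bochner_Integration.integrable_bound[of _ "\<lambda>t. C * gk (a + 1) c t"])
      (use gk_integrable[of "a + 1" c] a c gb in \<open>auto intro!: AE_I2 order_trans[OF gb] abs_ge_self\<close>)
  \<comment> \<open>A shift of the argument by at most 1 costs at most the factor
    \<open>exp c\<close>, so \<open>U\<close> dominates every mollified cut-off of
    \<open>g\<close>.\<close>
  define U where "U t = C * exp c * gk (a + 1) c t" for t
  have gU: "norm (g (t - u)) \<le> U t" if "0 < u" "u \<le> 1" for t u
  proof (cases "t - u \<le> 0")
    case True then show ?thesis using C by (simp add: g0 U_def)
  next
    case False
    then have "gk (a + 1) c (t - u) = (t - u) powr a * exp (- (c * (t - u)))" by (simp add: gk_def)
    also have "\<dots> \<le> t powr a * exp (c + - (c * t))"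
      using False that a c by (intro mult_mono powr_mono2) (auto simp: algebra_simps mult_left_le)
    also have "\<dots> = exp c * gk (a + 1) c t" using False that by (simp add: gk_def exp_diff exp_minus field_simps)
    finally have "C * gk (a + 1) c (t - u) \<le> U t" using C by (simp add: U_def mult_left_mono mult.assoc)
    then show ?thesis using gb order_trans by blast
  qed
  have Ui: "integrable lborel (\<lambda>t. G t * of_real (U t))"
  proof (rule wnorm_pair_integrable[of _ _ s])
    show "wnorm (- s) (\<lambda>t. of_real (U t)) < \<infinity>"
      by (rule wnorm_gk_finite[of _ "C * exp c" "a + 1" c]) (use C c a in \<open>auto simp: U_def norm_mult abs_mult simp del: of_real_mult\<close>)
  qed (use W spectralD(2)[OF spec] in \<open>auto simp: U_def\<close>)
  \<comment> \<open>A sharp cut suffices: the mollifier supplies the smoothness, and the bounded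
    support makes the convolution a test function.\<close>
  define gR where "gR k t = (if t \<le> real k then g t else 0)" for k t
  have [measurable]: "gR k \<in> borel_measurable borel" for k unfolding gR_def[abs_def] by measurable
  have gRg: "norm (gR k t) \<le> norm (g t)" for k t by (simp add: gR_def)
  have gRi: "integrable lborel (gR k)" for k
    by (rule Bochner_Integration.integrable_bound[OF gi]) (use gRg in auto)
  have inv1: "inverse (real (Suc n)) \<le> 1" for n using inverse_le_1_iff by force
  have cb: "norm (conv (gR k) (R n) t) \<le> U t" "norm (conv g (R n) t) \<le> U t" for k n t
  proof -
    have "norm (conv m (R n) t - 0) \<le> U t"
      if [measurable]: "m \<in> borel_measurable borel" and m: "\<And>u. norm (m u) \<le> norm (g u)" for m
      unfolding R_def[abs_def]
    proof (rule conv_mollifier_close[OF r])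
      fix u assume u: "0 < u" "u \<le> inverse (real (Suc n))"
      then have "u \<le> 1" using inv1[of n] by linarith
      then show "norm (m (t - u) - 0) \<le> U t" using order_trans[OF m gU] u by simp
    qed fact
    from this[of "gR k"] this[of g]
    show "norm (conv (gR k) (R n) t) \<le> U t" "norm (conv g (R n) t) \<le> U t" by (simp_all add: gRg)
  qed
  have test: "conv (gR k) (R n) \<in> test_functions {0<..}" for k n
    by (rule conv_test_functions[OF gRi, of k]) (use g0 Rt in \<open>auto simp: gR_def\<close>)
  have mc [measurable]: "conv (gR k) (R n) \<in> borel_measurable borel" "conv g (R n) \<in> borel_measurable borel" for k n
    using ft_conv(2)[OF gRi Ri] ft_conv(2)[OF gi Ri] by auto
  have [measurable]: "ft (gR k) \<in> borel_measurable borel" "ft g \<in> borel_measurable borel" "ft (R n) \<in> borel_measurable borel" for k n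
    by (intro measurable_ft gRi gi Ri)+
  have dom: "norm (G t * z) \<le> norm (G t * of_real (U t))" if "norm z \<le> U t" for t z
    using that by (auto simp: norm_mult intro!: mult_left_mono)
  \<comment> \<open>The limit in \<open>k\<close> at fixed \<open>n\<close>. On the Fourier side the
    decay of \<open>ft (R n)\<close> makes the majorant integrable; on the other side the
    convolution at a given \<open>t\<close> is eventually constant in \<open>k\<close>.\<close>
  have step1: "(LINT x|lborel. F x * (ft g x * ft (R n) x)) = (LINT t|lborel. G t * conv g (R n) t)" for n
  proof -
    have eq: "(LINT x|lborel. F x * (ft (gR k) x * ft (R n) x)) = (LINT t|lborel. G t * conv (gR k) (R n) t)" for k
      using spectralD(3)[OF spec test[of k n]] ft_conv(1)[OF gRi Ri] by (simp add: F_def)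
    have lim_g: "(\<lambda>k. gR k t) \<longlonglongrightarrow> g t" for t
    proof -
      obtain N :: nat where "t \<le> N" using real_arch_simple by blast
      then have "eventually (\<lambda>k. g t = gR k t) sequentially"
        unfolding eventually_sequentially by (intro exI[of _ N]) (auto simp: gR_def)
      then show ?thesis by (rule Lim_transform_eventually[OF tendsto_const])
    qed
    have lim_c: "(\<lambda>k. conv (gR k) (R n) t) \<longlonglongrightarrow> conv g (R n) t" for t
    proof -
        obtain N :: nat where N: "t \<le> N" using real_arch_simple by blast
        have "conv g (R n) t = conv (gR k) (R n) t" if "k \<ge> N" for k
          unfolding conv_commute
        proof (rule Bochner_Integration.integral_cong[OF refl])
          fix u show "g (t - u) * R n u = gR k (t - u) * R n u"
          proof (cases "u \<le> 0")
            case True then show ?thesis using mollifierD(3)[OF r, of u n] by (simp add: R_def)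
          next
            case False
            then have "t - u \<le> real k" using N that by linarith
            then show ?thesis by (simp add: gR_def)
          qed
        qed
        then have "eventually (\<lambda>k. conv g (R n) t = conv (gR k) (R n) t) sequentially"
          unfolding eventually_sequentially by blast
        then show ?thesis by (rule Lim_transform_eventually[OF tendsto_const])
    qed
    have lim_ft: "(\<lambda>k. ft (gR k) x) \<longlonglongrightarrow> ft g x" for x
      unfolding ft_def
    proof (rule integral_dominated_convergence[where w = "\<lambda>t. norm (g t)"])
      show "AE t in lborel. (\<lambda>k. exp (- (\<i> * complex_of_real (x * t))) * gR k t) \<longlonglongrightarrow> exp (- (\<i> * complex_of_real (x * t))) * g t"
        by (intro AE_I2 tendsto_intros lim_g)
    qed (use gi gRg in \<open>auto simp: norm_mult simp del: of_real_mult\<close>)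
    have "(\<lambda>k. LINT x|lborel. F x * (ft (gR k) x * ft (R n) x)) \<longlonglongrightarrow> (LINT x|lborel. F x * (ft g x * ft (R n) x))"
    proof (rule integral_dominated_convergence[where w = "\<lambda>x. norm (F x * ft (R n) x) * (LINT t|lborel. norm (g t))"])
      show "integrable lborel (\<lambda>x. norm (F x * ft (R n) x) * (LINT t|lborel. norm (g t)))"
        using spectral_integrable[OF Rt l f] by (intro integrable_mult_left integrable_norm) (simp add: F_def)
      show "AE x in lborel. norm (F x * (ft (gR k) x * ft (R n) x)) \<le> norm (F x * ft (R n) x) * (LINT t|lborel. norm (g t))" for k
      proof (rule AE_I2)
        fix x
        have "norm (ft (gR k) x) \<le> (LINT t|lborel. norm (g t))"
          by (rule order_trans[OF norm_ft_le], rule integral_mono) (use gi gRi gRg in auto)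
        from mult_left_mono[OF this, of "norm (F x * ft (R n) x)"]
        show "norm (F x * (ft (gR k) x * ft (R n) x)) \<le> norm (F x * ft (R n) x) * (LINT t|lborel. norm (g t))"
          by (simp add: norm_mult mult_ac)
      qed
      show "AE x in lborel. (\<lambda>k. F x * (ft (gR k) x * ft (R n) x)) \<longlonglongrightarrow> F x * (ft g x * ft (R n) x)"
        by (intro AE_I2 tendsto_intros lim_ft)
    qed measurable
    moreover have "(\<lambda>k. LINT t|lborel. G t * conv (gR k) (R n) t) \<longlonglongrightarrow> (LINT t|lborel. G t * conv g (R n) t)"
    proof (rule integral_dominated_convergence[where w = "\<lambda>t. norm (G t * of_real (U t))"])
      show "AE t in lborel. (\<lambda>k. G t * conv (gR k) (R n) t) \<longlonglongrightarrow> G t * conv g (R n) t"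
        by (intro AE_I2 tendsto_intros lim_c)
      show "AE t in lborel. norm (G t * conv (gR k) (R n) t) \<le> norm (G t * of_real (U t))" for k
        by (intro AE_I2 dom cb)
    qed (use Ui in \<open>auto intro: integrable_norm\<close>)
    ultimately show ?thesis unfolding eq using LIMSEQ_unique by blast
  qed
  have bR: "norm (ft (R n) x) \<le> 1" for n x
  proof -
    have "(LINT t|lborel. norm (R n t)) = (LINT t|lborel. \<rho> n t)"
      by (intro Bochner_Integration.integral_cong) (use mollifierD(2)[OF r] in \<open>auto simp: R_def\<close>)
    then show ?thesis using norm_ft_le[of "R n" x] mollifierD(4)[OF r, of n] by simp
  qed
  have lR: "(\<lambda>n. ft (R n) x) \<longlonglongrightarrow> 1" for x
  proof -
    \<comment> \<open>The transform of the mollifier is written as a convolution evaluated at 0: an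
      average of exponentials near their value 1.\<close>
    define e where "e t = exp (- (\<i> * complex_of_real (x * (- t))))" for t
    have ce: "continuous_on UNIV e" unfolding e_def by (intro continuous_intros)
    have "(\<lambda>n. conv e (\<lambda>t. of_real (\<rho> n t)) 0) \<longlonglongrightarrow> e 0"
    proof (rule conv_mollifier_tendsto[OF r borel_measurable_continuous_onI[OF ce]])
      show "(e \<longlongrightarrow> e 0) (at_left 0)"
        using ce by (meson UNIV_I continuous_on_def filterlim_at_split open_UNIV at_within_open filterlim_mono at_le subset_UNIV order_refl)
    qed
    moreover have "conv e (\<lambda>t. of_real (\<rho> n t)) 0 = ft (R n) x" for n
      unfolding conv_commute ft_def by (simp add: e_def R_def)
    ultimately show ?thesis by (simp add: e_def)
  qed
  have lim_cg: "(\<lambda>n. conv g (R n) t) \<longlonglongrightarrow> g t" for t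
  proof -
      have "isCont g t" using gc by (simp add: continuous_on_eq_continuous_at)
      then have "(g \<longlongrightarrow> g t) (at_left t)" unfolding isCont_def filterlim_at_split by blast
      then show ?thesis
        unfolding R_def[abs_def] by (intro conv_mollifier_tendsto[OF r]) simp_all
  qed
  \<comment> \<open>Now the mollifier shrinks. The factors \<open>ft (R n)\<close> are merely
    bounded by 1, uniformly in \<open>n\<close>, so the integrability hypothesis \<open>int\<close>
    has to provide the majorant.\<close>
  have "(\<lambda>n. LINT x|lborel. F x * (ft g x * ft (R n) x)) \<longlonglongrightarrow> (LINT x|lborel. F x * (ft g x * 1))"
  proof (rule integral_dominated_convergence[where w = "\<lambda>x. norm (F x * ft g x)"])
    show "integrable lborel (\<lambda>x. norm (F x * ft g x))" using int by (simp add: F_def)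
    show "AE x in lborel. norm (F x * (ft g x * ft (R n) x)) \<le> norm (F x * ft g x)" for n
    proof (rule AE_I2)
      fix x show "norm (F x * (ft g x * ft (R n) x)) \<le> norm (F x * ft g x)"
        using mult_left_mono[OF bR[of n x], of "norm (F x * ft g x)"] by (simp add: norm_mult mult_ac)
    qed
    show "AE x in lborel. (\<lambda>n. F x * (ft g x * ft (R n) x)) \<longlonglongrightarrow> F x * (ft g x * 1)"
      by (intro AE_I2 tendsto_intros lR)
  qed measurable
  moreover have "(\<lambda>n. LINT t|lborel. G t * conv g (R n) t) \<longlonglongrightarrow> (LINT t|lborel. G t * g t)"
  proof (rule integral_dominated_convergence[where w = "\<lambda>t. norm (G t * of_real (U t))"])
    show "AE t in lborel. (\<lambda>n. G t * conv g (R n) t) \<longlonglongrightarrow> G t * g t"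
      by (intro AE_I2 tendsto_intros lim_cg)
    show "AE t in lborel. norm (G t * conv g (R n) t) \<le> norm (G t * of_real (U t))" for n
      by (intro AE_I2 dom cb)
  qed (use Ui in \<open>auto intro: integrable_norm\<close>)
  ultimately have "(LINT x|lborel. F x * (ft g x * 1)) = (LINT t|lborel. G t * g t)"
    unfolding step1 by (rule LIMSEQ_unique)
  then show ?thesis by (simp add: F_def)
qed

subsection \<open>Schur test and change of weights\<close>

text \<open>Split \<open>k * g\<close> into \<open>sqrt (k * w)\<close> and
  \<open>sqrt (k / w) * g\<close>. Cauchy-Schwarz and the row bound leave the factor
  \<open>A * w t\<close>; after exchanging the integrals the column bound cancels the division by
  \<open>w u\<close>.\<close>

lemma schur_test:
  fixes k :: "real \<Rightarrow> real \<Rightarrow> real" and w g :: "real \<Rightarrow> real"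
  assumes [measurable]: "(\<lambda>(t, u). k t u) \<in> borel_measurable (borel \<Otimes>\<^sub>M borel)" "w \<in> borel_measurable borel" "g \<in> borel_measurable borel"
    and pos: "\<And>t u. k t u \<ge> 0" "\<And>t. w t > 0" "\<And>t. g t \<ge> 0" "A \<ge> 0" "B \<ge> 0"
    and 1: "\<And>t. (\<integral>\<^sup>+u. ennreal (k t u * w u) \<partial>lborel) \<le> ennreal (A * w t)"
    and 2: "\<And>u. (\<integral>\<^sup>+t. ennreal (k t u * w t) \<partial>lborel) \<le> ennreal (B * w u)"
  shows "(\<integral>\<^sup>+t. (\<integral>\<^sup>+u. ennreal (k t u * g u) \<partial>lborel)\<^sup>2 \<partial>lborel) \<le> ennreal (A * B) * (\<integral>\<^sup>+u. ennreal ((g u)\<^sup>2) \<partial>lborel)"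
proof -
  have kt [measurable]: "(\<lambda>u. k t u) \<in> borel_measurable borel" for t by simp
  have "(\<integral>\<^sup>+u. ennreal (k t u * g u) \<partial>lborel)\<^sup>2 \<le> ennreal (A * w t) * (\<integral>\<^sup>+u. ennreal (k t u * (g u)\<^sup>2 / w u) \<partial>lborel)" for t
  proof -
    have e: "ennreal (k t u * g u) = ennreal (sqrt (k t u * w u)) * ennreal (sqrt (k t u / w u) * g u)" for u
    proof -
      have "sqrt (k t u * w u) * sqrt (k t u / w u) = sqrt (k t u * k t u)"
        using pos(2)[of u] by (simp add: real_sqrt_mult[symmetric] mult.assoc)
      then show ?thesis using pos(1)[of t u] pos(2)[of u] pos(3)[of u]
        by (simp add: ennreal_mult[symmetric] mult.assoc[symmetric] less_imp_le)
    qed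
    have "(\<integral>\<^sup>+u. ennreal (k t u * g u) \<partial>lborel)\<^sup>2 \<le>
        (\<integral>\<^sup>+u. (ennreal (sqrt (k t u * w u)))\<^sup>2 \<partial>lborel) * (\<integral>\<^sup>+u. (ennreal (sqrt (k t u / w u) * g u))\<^sup>2 \<partial>lborel)"
      unfolding e by (rule Cauchy_Schwarz_nn_integral) measurable
    also have "(\<integral>\<^sup>+u. (ennreal (sqrt (k t u * w u)))\<^sup>2 \<partial>lborel) = (\<integral>\<^sup>+u. ennreal (k t u * w u) \<partial>lborel)"
      using pos by (intro nn_integral_cong) (simp add: ennreal_power less_imp_le)
    also have "(\<integral>\<^sup>+u. (ennreal (sqrt (k t u / w u) * g u))\<^sup>2 \<partial>lborel) = (\<integral>\<^sup>+u. ennreal (k t u * (g u)\<^sup>2 / w u) \<partial>lborel)"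
      using pos by (intro nn_integral_cong) (simp add: ennreal_power less_imp_le power_mult_distrib)
    finally show ?thesis by (rule order_trans) (intro mult_right_mono 1 zero_le)
  qed
  then have "(\<integral>\<^sup>+t. (\<integral>\<^sup>+u. ennreal (k t u * g u) \<partial>lborel)\<^sup>2 \<partial>lborel) \<le>
      (\<integral>\<^sup>+t. ennreal (A * w t) * (\<integral>\<^sup>+u. ennreal (k t u * (g u)\<^sup>2 / w u) \<partial>lborel) \<partial>lborel)"
    by (rule nn_integral_mono)
  also have "\<dots> = (\<integral>\<^sup>+t. (\<integral>\<^sup>+u. ennreal (A * w t) * ennreal (k t u * (g u)\<^sup>2 / w u) \<partial>lborel) \<partial>lborel)"
    by (simp add: nn_integral_cmult)
  also have "\<dots> = (\<integral>\<^sup>+u. (\<integral>\<^sup>+t. ennreal (A * w t) * ennreal (k t u * (g u)\<^sup>2 / w u) \<partial>lborel) \<partial>lborel)"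
    by (rule lborel_pair.Fubini'[symmetric]) measurable
  also have "\<dots> = (\<integral>\<^sup>+u. ennreal (A * (g u)\<^sup>2 / w u) * (\<integral>\<^sup>+t. ennreal (k t u * w t) \<partial>lborel) \<partial>lborel)"
  proof (rule nn_integral_cong)
    fix u
    have "(\<integral>\<^sup>+t. ennreal (A * w t) * ennreal (k t u * (g u)\<^sup>2 / w u) \<partial>lborel) = (\<integral>\<^sup>+t. ennreal (A * (g u)\<^sup>2 / w u) * ennreal (k t u * w t) \<partial>lborel)"
      using pos by (intro nn_integral_cong) (simp add: ennreal_mult[symmetric] less_imp_le mult_ac)
    also have "\<dots> = ennreal (A * (g u)\<^sup>2 / w u) * (\<integral>\<^sup>+t. ennreal (k t u * w t) \<partial>lborel)"
      by (rule nn_integral_cmult) measurable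
    finally show "(\<integral>\<^sup>+t. ennreal (A * w t) * ennreal (k t u * (g u)\<^sup>2 / w u) \<partial>lborel) = ennreal (A * (g u)\<^sup>2 / w u) * (\<integral>\<^sup>+t. ennreal (k t u * w t) \<partial>lborel)" .
  qed
  also have "\<dots> \<le> (\<integral>\<^sup>+u. ennreal (A * (g u)\<^sup>2 / w u) * ennreal (B * w u) \<partial>lborel)"
    by (intro nn_integral_mono mult_left_mono 2 zero_le)
  also have "\<dots> = (\<integral>\<^sup>+u. ennreal (A * B) * ennreal ((g u)\<^sup>2) \<partial>lborel)"
  proof (rule nn_integral_cong)
    fix u
    have "A * (g u)\<^sup>2 / w u * (B * w u) = A * B * (g u)\<^sup>2" using pos(2)[of u] by (simp add: field_simps)
    then show "ennreal (A * (g u)\<^sup>2 / w u) * ennreal (B * w u) = ennreal (A * B) * ennreal ((g u)\<^sup>2)"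
      using pos by (simp add: ennreal_mult[symmetric] less_imp_le)
  qed
  also have "\<dots> = ennreal (A * B) * (\<integral>\<^sup>+u. ennreal ((g u)\<^sup>2) \<partial>lborel)" by (simp add: nn_integral_cmult)
  finally show ?thesis .
qed

text \<open>The exponent is rounded up to an integer \<open>n \<ge> 1\<close>, and
  \<open>(1 + c * v / n) ^ n \<le> exp (c * v)\<close> gives the bound \<open>(n / c) ^ n\<close>.
  The additional 1 covers \<open>v \<le> 1\<close>, where the rounded power may be smaller.\<close>

lemma powr_exp_bounded:
  fixes c d :: real assumes "c > 0" "d \<ge> 0"
  obtains C where "C > 0" "\<And>v. v > 0 \<Longrightarrow> v powr d * exp (- (c * v)) \<le> C"
proof -
  obtain n0 :: nat where "d \<le> n0" using real_arch_simple by blast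
  define n where "n = Suc n0"
  have n: "d \<le> n" "n > 0" using \<open>d \<le> n0\<close> by (auto simp: n_def)
  show ?thesis
  proof (rule that[of "1 + (n / c) ^ n"])
    fix v :: real assume v: "v > 0"
    have "v powr d \<le> 1 + v ^ n"
    proof (cases "v \<le> 1")
      case True
      then have "v powr d \<le> 1 powr d" using v assms by (intro powr_mono2) auto
      then show ?thesis using v by (simp add: add_increasing2)
    next
      case False
      then have "v powr d \<le> v powr n" using n by (intro powr_mono) auto
      then show ?thesis using False by (simp add: powr_realpow)
    qed
    then have "v powr d * exp (- (c * v)) \<le> (1 + v ^ n) * exp (- (c * v))" by (intro mult_right_mono) auto
    also have "\<dots> = exp (- (c * v)) + v ^ n * exp (- (c * v))" by (simp add: algebra_simps)
    also have "\<dots> \<le> 1 + (n / c) ^ n"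
    proof (rule add_mono)
      show "exp (- (c * v)) \<le> 1" using assms v by simp
    show "v ^ n * exp (- (c * v)) \<le> (n / c) ^ n"
    proof -
      have "(c * v / n) ^ n \<le> (1 + c * v / n) ^ n" using assms v n by (intro power_mono) auto
      also have "\<dots> \<le> exp (c * v)"
        by (rule exp_ge_one_plus_x_over_n_power_n) (use assms v n in \<open>auto intro: order_trans[of _ 0]\<close>)
      finally have "v ^ n * (c / n) ^ n \<le> exp (c * v)" by (simp add: power_mult_distrib power_divide mult_ac)
      then have "v ^ n \<le> exp (c * v) * (n / c) ^ n" using assms n by (simp add: power_divide field_simps)
      then show ?thesis by (simp add: exp_minus field_simps)
    qed
    qed
    finally show "v powr d * exp (- (c * v)) \<le> 1 + (n / c) ^ n" .
  qed (use assms in \<open>auto intro: add_pos_nonneg\<close>)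
qed

lemma nn_integral_powr_tail:
  assumes "p > 1" shows "(\<integral>\<^sup>+v. ennreal (v powr (- p)) * indicator {1..} v \<partial>lborel) < \<infinity>"
proof -
  have "(\<integral>\<^sup>+v. ennreal (v powr (- p)) * indicator {1..} v \<partial>lborel) = ennreal (0 - (- (1 powr (1 - p) / (p - 1))))"
  proof (rule nn_integral_FTC_atLeast[where F = "\<lambda>v. - (v powr (1 - p) / (p - 1))"])
    show "((\<lambda>v. - (v powr (1 - p) / (p - 1))) has_real_derivative v powr (- p)) (at v)" if "1 \<le> v" for v
    proof -
      have "((\<lambda>v. v powr (1 - p)) has_real_derivative (1 - p) * v powr (1 - p - 1)) (at v)"
        using that by (intro has_real_derivative_powr) auto
      then have "((\<lambda>v. - (v powr (1 - p) / (p - 1))) has_real_derivative - ((1 - p) * v powr (1 - p - 1) / (p - 1))) (at v)"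
        by (intro DERIV_minus DERIV_cdivide)
      moreover have "- ((1 - p) * v powr (1 - p - 1) / (p - 1)) = v powr (- p)" using assms by (simp add: field_simps)
      ultimately show ?thesis by simp
    qed
    have "((\<lambda>v. v powr (1 - p)) \<longlongrightarrow> 0) at_top"
      by (rule tendsto_neg_powr) (use assms in \<open>auto simp: filterlim_ident\<close>)
    then have "((\<lambda>v. - (v powr (1 - p) / (p - 1))) \<longlongrightarrow> - (0 / (p - 1))) at_top" using assms by (intro tendsto_intros) auto
    then show "((\<lambda>v. - (v powr (1 - p) / (p - 1))) \<longlongrightarrow> 0) at_top" by simp
  qed auto
  then show ?thesis by simp
qed

text \<open>The first alternative is Young's inequality; the second one covers the scale invariant
  situation of Hardy's inequality, where the kernel is only homogeneous of degree \<open>-1\<close>.\<close>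

definition schur_admissible :: "real \<Rightarrow> real \<Rightarrow> real \<Rightarrow> bool" where
  "schur_admissible b r s \<longleftrightarrow> (0 < s \<and> s \<le> r \<and> 0 < b - r + s) \<or> (- 1 / 2 < s \<and> s \<le> 0 \<and> s < r \<and> r - s \<le> b)"

text \<open>By homogeneity of degree -1, both Schur integrals with the weight
  \<open>t powr (- 1 / 2)\<close> reduce to constants. The first is a Gamma integral for
  \<open>v < 1\<close> and behaves like \<open>v powr (- (s + 3 / 2))\<close> at infinity, the
  second is a Beta integral with parameters \<open>s + 1 / 2\<close> and \<open>r - s\<close>; both
  converge because \<open>- 1 / 2 < s < r\<close>.\<close>

lemma hardy_kernel_integrals:
  fixes r s :: real assumes s: "- 1 / 2 < s" "s < r"
  defines "k \<equiv> \<lambda>t u. if 0 < t \<and> t < u then t powr s * u powr (- r) * (u - t) powr (r - s - 1) else 0"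
  obtains A where "A \<ge> 0" "\<And>t. t > 0 \<Longrightarrow> (\<integral>\<^sup>+u. ennreal (k t u * u powr (- 1 / 2)) \<partial>lborel) \<le> ennreal (A * t powr (- 1 / 2))"
    "\<And>u. u > 0 \<Longrightarrow> (\<integral>\<^sup>+t. ennreal (k t u * t powr (- 1 / 2)) \<partial>lborel) \<le> ennreal (A * u powr (- 1 / 2))"
proof -
  define b where "b = r - s"
  have b: "b > 0" using s by (simp add: b_def)
  \<comment> \<open>\<open>f1\<close> arises from the substitution \<open>u = t + t * v\<close>,
    \<open>f2\<close> below from \<open>t = u * v\<close>, after all powers of \<open>t\<close> and
    of \<open>u\<close> respectively have been collected.\<close>
  define f1 where "f1 v = (if 0 < v then (1 + v) powr (- r - 1 / 2) * v powr (b - 1) else 0)" for v :: real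
  define f2 where "f2 v = (if 0 < v \<and> v < 1 then v powr (s - 1 / 2) * (1 - v) powr (b - 1) else 0)" for v :: real
  have [measurable]: "f1 \<in> borel_measurable borel" "f2 \<in> borel_measurable borel" unfolding f1_def[abs_def] f2_def[abs_def] by measurable
  have "(\<integral>\<^sup>+v. ennreal (f1 v) \<partial>lborel) \<le> (\<integral>\<^sup>+v. ennreal (exp 1 * gk b 1 v) + ennreal (v powr (- (s + 3 / 2))) * indicator {1..} v \<partial>lborel)"
  proof (rule nn_integral_mono)
    fix v :: real
    show "ennreal (f1 v) \<le> ennreal (exp 1 * gk b 1 v) + ennreal (v powr (- (s + 3 / 2))) * indicator {1..} v"
    proof (cases "0 < v")
      case v: True
      show ?thesis
      proof (cases "v < 1")
        case True
        have "(1 + v) powr (- r - 1 / 2) \<le> (1 + v) powr 0" using v s by (intro powr_mono) auto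
        then have "(1 + v) powr (- r - 1 / 2) \<le> 1" using v by simp
        then have "(1 + v) powr (- r - 1 / 2) * v powr (b - 1) \<le> 1 * v powr (b - 1)" by (intro mult_right_mono) auto
        also have "\<dots> \<le> exp (1 - v) * v powr (b - 1)" using True by (intro mult_right_mono) auto
        also have "\<dots> = exp 1 * gk b 1 v" using v by (simp add: gk_def exp_diff exp_minus field_simps)
        finally have "f1 v \<le> exp 1 * gk b 1 v" using v by (simp add: f1_def)
        then show ?thesis using True by (simp add: ennreal_leI)
      next
        case False
        have "(1 + v) powr (- r - 1 / 2) \<le> v powr (- r - 1 / 2)" using v s by (intro powr_mono2') auto
        then have "(1 + v) powr (- r - 1 / 2) * v powr (b - 1) \<le> v powr (- r - 1 / 2) * v powr (b - 1)" by (intro mult_right_mono) auto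
        also have "\<dots> = v powr (- (s + 3 / 2))" using v by (simp add: powr_add[symmetric] b_def algebra_simps)
        finally have "f1 v \<le> v powr (- (s + 3 / 2))" using v by (simp add: f1_def)
        then have "ennreal (f1 v) \<le> ennreal (v powr (- (s + 3 / 2))) * indicator {1..} v" using False by (simp add: ennreal_leI)
        then show ?thesis by (rule order_trans) simp
      qed
    qed (simp add: f1_def)
  qed
  also have "\<dots> < \<infinity>"
  proof -
    have "(\<integral>\<^sup>+v. ennreal (exp 1 * gk b 1 v) \<partial>lborel) = ennreal (exp 1) * ennreal (Gamma b * 1 powr (- b))"
      using gk_nn_integral[of b 1] b by (simp add: ennreal_mult nn_integral_cmult)
    then show ?thesis using nn_integral_powr_tail[of "s + 3 / 2"] s
      by (subst nn_integral_add) (auto simp: ennreal_mult_less_top)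
  qed
  finally have fin1: "(\<integral>\<^sup>+v. ennreal (f1 v) \<partial>lborel) < \<infinity>" .
  have fin2: "(\<integral>\<^sup>+v. ennreal (f2 v) \<partial>lborel) < \<infinity>"
  proof -
    have i: "integrable lborel (\<lambda>t. indicator {0..1} t *\<^sub>R (t powr ((s + 1 / 2) - 1) * (1 - t) powr (b - 1)))"
      using integrable_Beta[of "s + 1 / 2" b] s b by (simp add: set_integrable_def)
    have "(\<integral>\<^sup>+v. ennreal (f2 v) \<partial>lborel) \<le> (\<integral>\<^sup>+v. ennreal (norm (indicator {0..1} v *\<^sub>R (v powr ((s + 1 / 2) - 1) * (1 - v) powr (b - 1)))) \<partial>lborel)"
      by (intro nn_integral_mono ennreal_leI) (auto simp: f2_def indicator_def)
    also have "\<dots> < \<infinity>" using i by (simp add: integrable_iff_bounded)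
    finally show ?thesis .
  qed
  define A where "A = enn2real (\<integral>\<^sup>+v. ennreal (f1 v) \<partial>lborel) + enn2real (\<integral>\<^sup>+v. ennreal (f2 v) \<partial>lborel)"
  have A1: "(\<integral>\<^sup>+v. ennreal (f1 v) \<partial>lborel) \<le> ennreal A"
    using fin1 by (subst ennreal_enn2real[symmetric]) (auto simp: A_def intro!: ennreal_leI)
  have A2: "(\<integral>\<^sup>+v. ennreal (f2 v) \<partial>lborel) \<le> ennreal A"
    using fin2 by (subst ennreal_enn2real[symmetric]) (auto simp: A_def intro!: ennreal_leI)
  have A0: "A \<ge> 0" by (simp add: A_def)
  show ?thesis
  proof (rule that[of A])
    show "A \<ge> 0" by (rule A0)
  next
    fix t :: real assume t: "t > 0"
    have "(\<integral>\<^sup>+u. ennreal (k t u * u powr (- 1 / 2)) \<partial>lborel) = t * (\<integral>\<^sup>+v. ennreal (k t (t + t * v) * (t + t * v) powr (- 1 / 2)) \<partial>lborel)"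
      using t by (subst nn_integral_real_affine[where c = t and t = t]) (auto simp: k_def)
    also have "(\<lambda>v. k t (t + t * v) * (t + t * v) powr (- 1 / 2)) = (\<lambda>v. t powr (- 3 / 2) * f1 v)"
    proof
      fix v
      show "k t (t + t * v) * (t + t * v) powr (- 1 / 2) = t powr (- 3 / 2) * f1 v"
      proof (cases "0 < v")
        case True
        have e: "t + t * v = t * (1 + v)" by (simp add: algebra_simps)
        have "k t (t + t * v) * (t + t * v) powr (- 1 / 2) = t powr s * (t * (1 + v)) powr (- r) * (t * v) powr (r - s - 1) * (t * (1 + v)) powr (- 1 / 2)"
          using t True unfolding k_def e by (auto simp: algebra_simps)
        also have "\<dots> = (t powr s * t powr (- r) * t powr (r - s - 1) * t powr (- 1 / 2)) * (((1 + v) powr (- r) * (1 + v) powr (- 1 / 2)) * v powr (r - s - 1))"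
          using t True by (simp add: powr_mult mult_ac)
        also have "t powr s * t powr (- r) * t powr (r - s - 1) * t powr (- 1 / 2) = t powr (- 3 / 2)"
        proof -
          have "s + - r + (r - s - 1) + - 1 / 2 = - 3 / 2" by simp
          then show ?thesis by (simp only: powr_add[symmetric])
        qed
        also have "(1 + v) powr (- r) * (1 + v) powr (- 1 / 2) = (1 + v) powr (- r - 1 / 2)"
          using True by (simp add: powr_add[symmetric])
        finally show ?thesis using True by (simp add: f1_def b_def)
      next
        case False
        then show ?thesis using t by (auto simp: k_def f1_def mult_less_0_iff zero_less_mult_iff)
      qed
    qed
    also have "t * (\<integral>\<^sup>+v. ennreal (t powr (- 3 / 2) * f1 v) \<partial>lborel) = ennreal (t * t powr (- 3 / 2)) * (\<integral>\<^sup>+v. ennreal (f1 v) \<partial>lborel)"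
      using t by (simp add: ennreal_mult' nn_integral_cmult mult.assoc)
    also have "\<dots> \<le> ennreal (t * t powr (- 3 / 2)) * ennreal A" by (intro mult_left_mono A1) simp
    also have "t * t powr (- 3 / 2) = t powr (- 1 / 2)" using t by (subst powr_mult_base) auto
    finally show "(\<integral>\<^sup>+u. ennreal (k t u * u powr (- 1 / 2)) \<partial>lborel) \<le> ennreal (A * t powr (- 1 / 2))"
      by (simp add: ennreal_mult[symmetric] A0 mult.commute)
  next
    fix u :: real assume u: "u > 0"
    have "(\<integral>\<^sup>+t. ennreal (k t u * t powr (- 1 / 2)) \<partial>lborel) = u * (\<integral>\<^sup>+v. ennreal (k (u * v) u * (u * v) powr (- 1 / 2)) \<partial>lborel)"
      using u by (subst nn_integral_real_affine[where c = u and t = 0]) (auto simp: k_def)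
    also have "(\<lambda>v. k (u * v) u * (u * v) powr (- 1 / 2)) = (\<lambda>v. u powr (- 3 / 2) * f2 v)"
    proof
      fix v
      show "k (u * v) u * (u * v) powr (- 1 / 2) = u powr (- 3 / 2) * f2 v"
      proof (cases "0 < v \<and> v < 1")
        case True
        have e: "u - u * v = u * (1 - v)" by (simp add: algebra_simps)
        have "k (u * v) u * (u * v) powr (- 1 / 2) = (u * v) powr s * u powr (- r) * (u * (1 - v)) powr (r - s - 1) * (u * v) powr (- 1 / 2)"
          using u True unfolding k_def e by auto
        also have "\<dots> = (u powr s * u powr (- r) * u powr (r - s - 1) * u powr (- 1 / 2)) * ((v powr s * v powr (- 1 / 2)) * (1 - v) powr (r - s - 1))"
          using u True by (simp add: powr_mult mult_ac)
        also have "u powr s * u powr (- r) * u powr (r - s - 1) * u powr (- 1 / 2) = u powr (- 3 / 2)"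
        proof -
          have "s + - r + (r - s - 1) + - 1 / 2 = - 3 / 2" by simp
          then show ?thesis by (simp only: powr_add[symmetric])
        qed
        also have "v powr s * v powr (- 1 / 2) = v powr (s - 1 / 2)"
          using True by (simp add: powr_add[symmetric])
        finally show ?thesis using True by (simp add: f2_def b_def)
      next
        case False
        then show ?thesis using u by (auto simp: k_def f2_def zero_less_mult_iff)
      qed
    qed
    also have "u * (\<integral>\<^sup>+v. ennreal (u powr (- 3 / 2) * f2 v) \<partial>lborel) = ennreal (u * u powr (- 3 / 2)) * (\<integral>\<^sup>+v. ennreal (f2 v) \<partial>lborel)"
      using u by (simp add: ennreal_mult' nn_integral_cmult mult.assoc)
    also have "\<dots> \<le> ennreal (u * u powr (- 3 / 2)) * ennreal A" by (intro mult_left_mono A2) simp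
    also have "u * u powr (- 3 / 2) = u powr (- 1 / 2)" using u by (subst powr_mult_base) auto
    finally show "(\<integral>\<^sup>+t. ennreal (k t u * t powr (- 1 / 2)) \<partial>lborel) \<le> ennreal (A * u powr (- 1 / 2))"
      by (simp add: ennreal_mult[symmetric] A0 mult.commute)
  qed
qed

text \<open>Conjugation with the two weights turns the claim into unweighted boundedness of the
  kernel \<open>k\<close>, to which Schur's test applies; the auxiliary weight \<open>w\<close>
  depends on the sign of \<open>s\<close>.\<close>

lemma schur_gk:
  assumes c: "c > 0" and b: "b > 0" and adm: "schur_admissible b r s"
  obtains A where "A \<ge> 0" "\<And>G. G \<in> borel_measurable borel \<Longrightarrow> (\<And>t. t \<le> 0 \<Longrightarrow> G t = 0) \<Longrightarrow>
     (\<integral>\<^sup>+t. ennreal (if 0 < t then t powr (2 * s) else 0) * (\<integral>\<^sup>+u. ennreal (gk b c (u - t) * norm (G u)) \<partial>lborel)\<^sup>2 \<partial>lborel)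
       \<le> ennreal A * wnorm r (G :: real \<Rightarrow> complex)"
proof -
  define k where "k t u = (if 0 < t then t powr s * u powr (- r) * gk b c (u - t) else 0)" for t u
  have km [measurable]: "(\<lambda>(t, u). k t u) \<in> borel_measurable (borel \<Otimes>\<^sub>M borel)" unfolding k_def by measurable
  have k0: "k t u \<ge> 0" for t u by (simp add: k_def)
  have k00: "k t u = 0" if "t \<le> 0 \<or> u \<le> t" for t u using that by (auto simp: k_def)
  have "\<exists>w A. A \<ge> 0 \<and> w \<in> borel_measurable borel \<and> (\<forall>t. w t > 0) \<and>
      (\<forall>t. (\<integral>\<^sup>+u. ennreal (k t u * w u) \<partial>lborel) \<le> ennreal (A * w t)) \<and>
      (\<forall>u. (\<integral>\<^sup>+t. ennreal (k t u * w t) \<partial>lborel) \<le> ennreal (A * w u))"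
  proof (cases "s > 0")
    case True
    then have s: "s \<le> r" "0 < b - r + s" using adm by (auto simp: schur_admissible_def)
    \<comment> \<open>For \<open>0 < s \<le> r\<close> and \<open>0 < t < u\<close>, the weights are
      at most \<open>(u - t) powr (- (r - s))\<close>, which merely lowers the order of the Gamma
      kernel from \<open>b\<close> to \<open>d\<close>. An integrable convolution kernel remains,
      and the weight 1 suffices.\<close>
    define d where "d = b - r + s"
    have d: "d > 0" using s by (simp add: d_def)
    have kb: "k t u \<le> gk d c (u - t)" for t u
    proof (cases "0 < t \<and> t < u")
      case T: True
      have "t powr s * u powr (- r) = (t powr s * u powr (- s)) * u powr (- (r - s))"
        using T by (simp add: powr_add[symmetric])
      also have "\<dots> \<le> 1 * (u - t) powr (- (r - s))"
      proof (intro mult_mono)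
        have "t powr s \<le> u powr s" using T True by (intro powr_mono2) auto
        then have "t powr s * u powr (- s) \<le> u powr s * u powr (- s)" by (intro mult_right_mono) auto
        also have "\<dots> = 1" using T by (simp add: powr_add[symmetric])
        finally show "t powr s * u powr (- s) \<le> 1" .
        show "u powr (- (r - s)) \<le> (u - t) powr (- (r - s))" using T s by (intro powr_mono2') auto
      qed auto
      finally have "k t u \<le> (u - t) powr (- (r - s)) * gk b c (u - t)"
        using T by (simp add: k_def mult_right_mono)
      also have "\<dots> = gk d c (u - t)" using T by (simp add: gk_def powr_add[symmetric] d_def algebra_simps)
      finally show ?thesis .
    qed (use k00[of t u] in auto)
    let ?A = "Gamma d * c powr (- d)"
    have "(\<integral>\<^sup>+u. ennreal (k t u * 1) \<partial>lborel) \<le> ennreal (?A * 1)" for t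
      using nn_integral_shift(1)[of "\<lambda>u. ennreal (gk d c u)" t] gk_nn_integral[OF d c]
        nn_integral_mono[of lborel "\<lambda>u. ennreal (k t u * 1)" "\<lambda>u. ennreal (gk d c (u - t))"] kb
      by (simp add: ennreal_leI)
    moreover have "(\<integral>\<^sup>+t. ennreal (k t u * 1) \<partial>lborel) \<le> ennreal (?A * 1)" for u
      using nn_integral_shift(3)[of "\<lambda>u. ennreal (gk d c u)" u] gk_nn_integral[OF d c]
        nn_integral_mono[of lborel "\<lambda>t. ennreal (k t u * 1)" "\<lambda>t. ennreal (gk d c (u - t))"] kb
      by (simp add: ennreal_leI)
    ultimately show ?thesis using d Gamma_real_pos[OF d]
      by (intro exI[of _ "\<lambda>_. 1"] exI[of _ ?A]) auto
  next
    case False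
    then have s: "- 1 / 2 < s" "s \<le> 0" "s < r" "r - s \<le> b" using adm by (auto simp: schur_admissible_def)
    \<comment> \<open>For \<open>s \<le> 0\<close>, whatever \<open>gk b c (u - t)\<close> contains
      beyond \<open>(u - t) powr (r - s - 1)\<close> is a bounded factor, since
      \<open>r - s \<le> b\<close>; what is left is Hardy's kernel.\<close>
    define h where "h t u = (if 0 < t \<and> t < u then t powr s * u powr (- r) * (u - t) powr (r - s - 1) else 0)" for t u :: real
    obtain A where A: "A \<ge> 0" "\<And>t. t > 0 \<Longrightarrow> (\<integral>\<^sup>+u. ennreal (h t u * u powr (- 1 / 2)) \<partial>lborel) \<le> ennreal (A * t powr (- 1 / 2))"
      "\<And>u. u > 0 \<Longrightarrow> (\<integral>\<^sup>+t. ennreal (h t u * t powr (- 1 / 2)) \<partial>lborel) \<le> ennreal (A * u powr (- 1 / 2))"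
      using hardy_kernel_integrals[OF s(1,3)] unfolding h_def by blast
    have [measurable]: "(\<lambda>(t, u). h t u) \<in> borel_measurable (borel \<Otimes>\<^sub>M borel)" unfolding h_def by measurable
    obtain C where C: "C > 0" "\<And>v. v > 0 \<Longrightarrow> v powr (b - (r - s)) * exp (- (c * v)) \<le> C"
      using powr_exp_bounded[OF c, of "b - (r - s)"] s by auto
    have kb: "k t u \<le> C * h t u" for t u
    proof (cases "0 < t \<and> t < u")
      case T: True
      have "gk b c (u - t) = (u - t) powr (r - s - 1) * ((u - t) powr (b - (r - s)) * exp (- (c * (u - t))))"
        using T by (simp add: gk_def powr_add[symmetric] mult.assoc[symmetric])
      also have "\<dots> \<le> (u - t) powr (r - s - 1) * C" using T C by (intro mult_left_mono) auto
      finally have "t powr s * u powr (- r) * gk b c (u - t) \<le> t powr s * u powr (- r) * ((u - t) powr (r - s - 1) * C)"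
        by (intro mult_left_mono) auto
      then show ?thesis using T by (simp add: k_def h_def mult_ac)
    qed (use k00[of t u] in \<open>auto simp: h_def\<close>)
    \<comment> \<open>The value 1 for \<open>t \<le> 0\<close> meets the positivity demanded by
      \<open>schur_test\<close>; the kernel vanishes there.\<close>
    define w where "w t = (if 0 < t then t powr (- 1 / 2) else 1)" for t :: real
    have 1: "(\<integral>\<^sup>+u. ennreal (k t u * w u) \<partial>lborel) \<le> ennreal (C * A * w t)" for t
    proof (cases "0 < t")
      case True
      have "(\<integral>\<^sup>+u. ennreal (k t u * w u) \<partial>lborel) \<le> (\<integral>\<^sup>+u. ennreal C * ennreal (h t u * u powr (- 1 / 2)) \<partial>lborel)"
      proof (rule nn_integral_mono)
        fix u
        have "k t u * w u \<le> C * h t u * w u" using kb by (intro mult_right_mono) (auto simp: w_def)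
        also have "\<dots> = C * (h t u * u powr (- 1 / 2))" using True by (auto simp: h_def w_def)
        finally show "ennreal (k t u * w u) \<le> ennreal C * ennreal (h t u * u powr (- 1 / 2))"
          using C by (simp add: ennreal_mult'[symmetric] ennreal_leI)
      qed
      also have "\<dots> = ennreal C * (\<integral>\<^sup>+u. ennreal (h t u * u powr (- 1 / 2)) \<partial>lborel)" by (rule nn_integral_cmult) measurable
      also have "\<dots> \<le> ennreal C * ennreal (A * t powr (- 1 / 2))" by (intro mult_left_mono A True zero_le)
      finally show ?thesis using True C A(1) by (simp add: w_def ennreal_mult'[symmetric] mult_ac)
    qed (simp add: k00)
    have 2: "(\<integral>\<^sup>+t. ennreal (k t u * w t) \<partial>lborel) \<le> ennreal (C * A * w u)" for u
    proof (cases "0 < u")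
      case True
      have "(\<integral>\<^sup>+t. ennreal (k t u * w t) \<partial>lborel) \<le> (\<integral>\<^sup>+t. ennreal C * ennreal (h t u * t powr (- 1 / 2)) \<partial>lborel)"
      proof (rule nn_integral_mono)
        fix t
        have "k t u * w t \<le> C * h t u * w t" using kb by (intro mult_right_mono) (auto simp: w_def)
        also have "\<dots> = C * (h t u * t powr (- 1 / 2))" by (auto simp: h_def w_def)
        finally show "ennreal (k t u * w t) \<le> ennreal C * ennreal (h t u * t powr (- 1 / 2))"
          using C by (simp add: ennreal_mult'[symmetric] ennreal_leI)
      qed
      also have "\<dots> = ennreal C * (\<integral>\<^sup>+t. ennreal (h t u * t powr (- 1 / 2)) \<partial>lborel)" by (rule nn_integral_cmult) measurable
      also have "\<dots> \<le> ennreal C * ennreal (A * u powr (- 1 / 2))" by (intro mult_left_mono A True zero_le)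
      finally show ?thesis using True C A(1) by (simp add: w_def ennreal_mult'[symmetric] mult_ac)
    next
      case F: False
      then have "k t u = 0" for t by (cases "t \<le> 0") (auto simp: k00)
      then show ?thesis by simp
    qed
    have "w \<in> borel_measurable borel" unfolding w_def[abs_def] by measurable
    then show ?thesis using 1 2 C A(1)
      by (intro exI[of _ w] exI[of _ "C * A"]) (auto simp: w_def)
  qed
  then obtain w A where w: "A \<ge> 0" "w \<in> borel_measurable borel" "\<And>t. w t > 0"
      "\<And>t. (\<integral>\<^sup>+u. ennreal (k t u * w u) \<partial>lborel) \<le> ennreal (A * w t)"
      "\<And>u. (\<integral>\<^sup>+t. ennreal (k t u * w t) \<partial>lborel) \<le> ennreal (A * w u)" by blast
  show ?thesis
  proof (rule that[of "A * A"])
    fix G :: "real \<Rightarrow> complex" assume [measurable]: "G \<in> borel_measurable borel" and z: "\<And>t. t \<le> 0 \<Longrightarrow> G t = 0"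
    define g where "g u = (if 0 < u then u powr r * norm (G u) else 0)" for u
    have [measurable]: "g \<in> borel_measurable borel" unfolding g_def[abs_def] by measurable
    have "ennreal (if 0 < t then t powr (2 * s) else 0) * (\<integral>\<^sup>+u. ennreal (gk b c (u - t) * norm (G u)) \<partial>lborel)\<^sup>2 = (\<integral>\<^sup>+u. ennreal (k t u * g u) \<partial>lborel)\<^sup>2" for t
    proof (cases "0 < t")
      case True
      have "ennreal (t powr (2 * s)) * (\<integral>\<^sup>+u. ennreal (gk b c (u - t) * norm (G u)) \<partial>lborel)\<^sup>2 = (ennreal (t powr s) * (\<integral>\<^sup>+u. ennreal (gk b c (u - t) * norm (G u)) \<partial>lborel))\<^sup>2"
      proof -
        have "ennreal (t powr (2 * s)) = ennreal (t powr s) * ennreal (t powr s)"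
          by (simp add: ennreal_mult[symmetric] powr_add[symmetric])
        then show ?thesis by (simp add: power2_eq_square mult_ac)
      qed
      also have "ennreal (t powr s) * (\<integral>\<^sup>+u. ennreal (gk b c (u - t) * norm (G u)) \<partial>lborel) = (\<integral>\<^sup>+u. ennreal (k t u * g u) \<partial>lborel)"
      proof (subst nn_integral_cmult[symmetric])
        show "(\<integral>\<^sup>+u. ennreal (t powr s) * ennreal (gk b c (u - t) * norm (G u)) \<partial>lborel) = (\<integral>\<^sup>+u. ennreal (k t u * g u) \<partial>lborel)"
        proof (rule nn_integral_cong)
          fix u
          show "ennreal (t powr s) * ennreal (gk b c (u - t) * norm (G u)) = ennreal (k t u * g u)"
          proof (cases "0 < u")
            case u: True
            have "k t u * g u = t powr s * (gk b c (u - t) * norm (G u)) * (u powr (- r) * u powr r)"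
              using u True by (simp add: k_def g_def)
            also have "u powr (- r) * u powr r = 1" using u by (simp add: powr_add[symmetric])
            finally show ?thesis by (simp add: ennreal_mult'[symmetric])
          qed (simp add: z g_def)
        qed
      qed simp
      finally show ?thesis using True by simp
    qed (simp add: k00)
    then have "(\<integral>\<^sup>+t. ennreal (if 0 < t then t powr (2 * s) else 0) * (\<integral>\<^sup>+u. ennreal (gk b c (u - t) * norm (G u)) \<partial>lborel)\<^sup>2 \<partial>lborel) =
       (\<integral>\<^sup>+t. (\<integral>\<^sup>+u. ennreal (k t u * g u) \<partial>lborel)\<^sup>2 \<partial>lborel)" by simp
    also have "\<dots> \<le> ennreal (A * A) * (\<integral>\<^sup>+u. ennreal ((g u)\<^sup>2) \<partial>lborel)"
      by (rule schur_test[OF km w(2) _ k0 w(3) _ w(1) w(1) w(4,5)]) (simp_all add: g_def)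
    also have "(\<integral>\<^sup>+u. ennreal ((g u)\<^sup>2) \<partial>lborel) = wnorm r G"
      unfolding wnorm_def by (intro nn_integral_cong) (auto simp: g_def z power_mult_distrib powr_power mult.commute)
    finally show "(\<integral>\<^sup>+t. ennreal (if 0 < t then t powr (2 * s) else 0) * (\<integral>\<^sup>+u. ennreal (gk b c (u - t) * norm (G u)) \<partial>lborel)\<^sup>2 \<partial>lborel)
       \<le> ennreal (A * A) * wnorm r G" .
  qed (use w in auto)
qed

lemma norm_LINT_le_nn:
  fixes f :: "real \<Rightarrow> complex"
  shows "ennreal (norm (LINT t|lborel. f t)) \<le> (\<integral>\<^sup>+t. ennreal (norm (f t)) \<partial>lborel)"
  by (cases "integrable lborel f") (simp_all add: integral_norm_bound_ennreal not_integrable_integral_eq)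

text \<open>The exponential of the kernel is split into two halves. One keeps the integral over
  \<open>t\<close> finite; the other gives decay in \<open>u\<close> at rate \<open>c / 2\<close>,
  because \<open>t\<close> is bounded on the support of \<psi>. As the integral vanishes for
  \<open>u < a0\<close>, any power \<open>u powr a\<close> may be put in front, at the price of
  \<open>a0 powr (- a)\<close>.\<close>

lemma kernel_conv_bound:
  fixes k :: "real \<Rightarrow> real"
  assumes [measurable]: "k \<in> borel_measurable borel" and kb: "\<And>t. \<bar>k t\<bar> \<le> C * gk b c t" and bc: "b > 0" "c > 0"
    and \<psi>: "\<psi> \<in> test_functions {0<..}" and a: "a \<ge> 0"
  obtains C' where "\<And>u. (\<integral>\<^sup>+t. ennreal (norm (of_real (k (u - t)) * \<psi> t)) \<partial>lborel) \<le> ennreal (C' * gk (a + 1) (c / 2) u)"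
proof -
  obtain a0 b0 where ab: "0 < a0" "a0 < b0" "\<And>x. x < a0 \<or> b0 < x \<Longrightarrow> \<psi> x = 0" using test_functions_cases[OF \<psi>] by blast
  obtain B where B: "0 < B" "\<And>x. norm (\<psi> x) \<le> B" using test_functions_bounded[OF \<psi>] by blast
  have C: "C \<ge> 0"
  proof -
    have "0 \<le> C * gk b c 1" using kb[of 1] abs_ge_zero order_trans by blast
    then show ?thesis by (simp add: gk_def zero_le_mult_iff)
  qed
  have k0: "k t = 0" if "t \<le> 0" for t using kb[of t] that by simp
  have c2: "c / 2 > 0" using bc by simp
  define K where "K = Gamma b * (c / 2) powr (- b)"
  have K: "K \<ge> 0" using Gamma_real_pos[OF bc(1)] by (simp add: K_def)
  define C1 where "C1 = B * C * exp (c * b0 / 2)"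
  have C1: "C1 \<ge> 0" using B C by (simp add: C1_def)
  have pw: "norm (of_real (k (u - t)) * \<psi> t) \<le> C1 * exp (- (c * u / 2)) * gk b (c / 2) (u - t)" for u t
  proof (cases "\<psi> t = 0 \<or> u \<le> t")
    case True then show ?thesis using C1 k0[of "u - t"] by auto
  next
    case False
    then have t: "t \<le> b0" "t < u" using ab(3)[of t] by force+
    have "norm (of_real (k (u - t)) * \<psi> t) \<le> (C * gk b c (u - t)) * B"
      using kb B C by (auto simp: norm_mult intro!: mult_mono)
    also have "gk b c (u - t) = gk b (c / 2) (u - t) * exp (- (c / 2 * (u - t)))"
      using t by (simp add: gk_def mult.assoc exp_add[symmetric])
    also have "C * (gk b (c / 2) (u - t) * exp (- (c / 2 * (u - t)))) * B \<le> C * (gk b (c / 2) (u - t) * exp (- (c / 2 * (u - b0)))) * B"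
      using t bc B C by (intro mult_right_mono mult_left_mono) auto
    also have "exp (- (c / 2 * (u - b0))) = exp (c * b0 / 2) * exp (- (c * u / 2))"
      by (simp add: exp_add[symmetric] field_simps)
    finally show ?thesis by (simp add: C1_def mult_ac)
  qed
  show ?thesis
  proof (rule that[of "C1 * K * a0 powr (- a)"])
    fix u
    show "(\<integral>\<^sup>+t. ennreal (norm (of_real (k (u - t)) * \<psi> t)) \<partial>lborel) \<le> ennreal (C1 * K * a0 powr (- a) * gk (a + 1) (c / 2) u)"
    proof (cases "u < a0")
      case True
      have "of_real (k (u - t)) * \<psi> t = 0" for t using k0[of "u - t"] ab(3)[of t] True by (cases "t < u") auto
      then show ?thesis by (simp only:) simp
    next
      case False
      have "(\<integral>\<^sup>+t. ennreal (norm (of_real (k (u - t)) * \<psi> t)) \<partial>lborel) \<le> (\<integral>\<^sup>+t. ennreal (C1 * exp (- (c * u / 2))) * ennreal (gk b (c / 2) (u - t)) \<partial>lborel)"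
        using pw C1 by (intro nn_integral_mono) (simp add: ennreal_mult[symmetric] ennreal_leI)
      also have "\<dots> = ennreal (C1 * exp (- (c * u / 2))) * (\<integral>\<^sup>+t. ennreal (gk b (c / 2) (u - t)) \<partial>lborel)"
        by (rule nn_integral_cmult) measurable
      also have "(\<integral>\<^sup>+t. ennreal (gk b (c / 2) (u - t)) \<partial>lborel) = ennreal K"
        using nn_integral_shift(3)[of "\<lambda>t. ennreal (gk b (c / 2) t)" u] gk_nn_integral[OF bc(1) c2] by (simp add: K_def)
      also have "ennreal (C1 * exp (- (c * u / 2))) * ennreal K = ennreal (C1 * K * exp (- (c * u / 2)))"
        using C1 K by (simp add: ennreal_mult[symmetric] mult_ac)
      also have "\<dots> \<le> ennreal (C1 * K * (a0 powr (- a) * gk (a + 1) (c / 2) u))"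
      proof (intro ennreal_leI mult_left_mono)
        have "a0 powr a \<le> u powr a" using False ab a by (intro powr_mono2) auto
        then have "1 \<le> a0 powr (- a) * u powr a" using ab by (simp add: powr_minus field_simps)
        then have "1 * exp (- (c * u / 2)) \<le> (a0 powr (- a) * u powr a) * exp (- (c * u / 2))" by (intro mult_right_mono) auto
        then show "exp (- (c * u / 2)) \<le> a0 powr (- a) * gk (a + 1) (c / 2) u"
          using False ab by (simp add: gk_def mult.assoc)
      qed (use C1 K in auto)
      finally show ?thesis by (simp add: mult.assoc)
    qed
  qed
qed

text \<open>By \<open>mult\<close>, testing the new weighted function with \<psi> amounts to testing
  the old one with the convolution of \<open>k\<close> and \<psi>; Fubini then moves the kernel onto
  \<open>G\<close>. The convolution has unbounded support, so the extended testing identity is used,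
  and the norm bound is \<open>schur_gk\<close>.\<close>

lemma spectral_transfer:
  fixes k :: "real \<Rightarrow> real"
  assumes l: "l1 > 0" "l2 > 0" and km [measurable]: "k \<in> borel_measurable borel"
    and kb: "\<And>t. \<bar>k t\<bar> \<le> C * gk b c t" and bc: "b > 0" "c > 0"
    and mult: "\<And>x. Complex l2 x powr of_real \<sigma> = Complex l1 x powr of_real \<rho> * ft (\<lambda>t. of_real (k t)) x"
    and adm: "schur_admissible b r s"
  obtains A where "A > 0" "\<And>f G. spectral l1 \<rho> f G \<Longrightarrow> sq_int f \<Longrightarrow> wnorm r G < \<infinity> \<Longrightarrow>
     \<exists>H. spectral l2 \<sigma> f H \<and> wnorm s H \<le> ennreal A * wnorm r G"
proof -
  have C: "C \<ge> 0"
  proof -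
    have "0 \<le> C * gk b c 1" using kb[of 1] abs_ge_zero order_trans by blast
    then show ?thesis by (simp add: gk_def zero_le_mult_iff)
  qed
  have ki: "integrable lborel (\<lambda>t. complex_of_real (k t))"
    by (rule Bochner_Integration.integrable_bound[of _ "\<lambda>t. C * gk b c t"])
      (use gk_integrable[OF bc] kb in \<open>auto intro!: AE_I2 order_trans[OF kb] abs_ge_self\<close>)
  obtain A where A: "A \<ge> 0" "\<And>G. G \<in> borel_measurable borel \<Longrightarrow> (\<And>t. t \<le> 0 \<Longrightarrow> G t = 0) \<Longrightarrow>
     (\<integral>\<^sup>+t. ennreal (if 0 < t then t powr (2 * s) else 0) * (\<integral>\<^sup>+u. ennreal (gk b c (u - t) * norm (G u)) \<partial>lborel)\<^sup>2 \<partial>lborel)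
       \<le> ennreal A * wnorm r (G :: real \<Rightarrow> complex)"
    using schur_gk[OF bc(2,1) adm] by blast
  show ?thesis
  proof (rule that[of "C\<^sup>2 * A + 1"])
    show "0 < C\<^sup>2 * A + 1" using A by (simp add: add_nonneg_pos)
    fix f G assume spec: "spectral l1 \<rho> f G" and f: "sq_int f" and W: "wnorm r G < \<infinity>"
    note [measurable] = spectralD(1)[OF spec]
    \<comment> \<open>The adjoint of convolution with \<open>k\<close>: it integrates over
      \<open>u > t\<close>, since \<open>k\<close> vanishes on the negative axis.\<close>
    define H where "H t = (if 0 < t then LINT u|lborel. of_real (k (u - t)) * G u else 0)" for t
    have Hm [measurable]: "H \<in> borel_measurable borel"
    proof -
      have "(\<lambda>t. LINT u|lborel. of_real (k (u - t)) * G u) \<in> borel_measurable borel"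
        by (rule lborel.borel_measurable_lebesgue_integral) measurable
      then show ?thesis unfolding H_def[abs_def] by measurable
    qed
    have HG: "ennreal (norm (H t)) \<le> ennreal C * (\<integral>\<^sup>+u. ennreal (gk b c (u - t) * norm (G u)) \<partial>lborel)" for t
    proof -
      have "ennreal (norm (H t)) \<le> (\<integral>\<^sup>+u. ennreal (norm (of_real (k (u - t)) * G u)) \<partial>lborel)"
        by (auto simp: H_def intro: norm_LINT_le_nn)
      also have "\<dots> \<le> (\<integral>\<^sup>+u. ennreal C * ennreal (gk b c (u - t) * norm (G u)) \<partial>lborel)"
      proof (rule nn_integral_mono)
        fix u show "ennreal (norm (of_real (k (u - t)) * G u)) \<le> ennreal C * ennreal (gk b c (u - t) * norm (G u))"
          using mult_right_mono[OF kb[of "u - t"] norm_ge_zero[of "G u"]] C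
          by (simp add: norm_mult ennreal_mult[symmetric] ennreal_leI mult.assoc)
      qed
      also have "\<dots> = ennreal C * (\<integral>\<^sup>+u. ennreal (gk b c (u - t) * norm (G u)) \<partial>lborel)" by (rule nn_integral_cmult) measurable
      finally show ?thesis .
    qed
    have "wnorm s H \<le> (\<integral>\<^sup>+t. ennreal (C\<^sup>2) * (ennreal (if 0 < t then t powr (2 * s) else 0) * (\<integral>\<^sup>+u. ennreal (gk b c (u - t) * norm (G u)) \<partial>lborel)\<^sup>2) \<partial>lborel)"
      unfolding wnorm_def
    proof (rule nn_integral_mono)
      fix t
      show "ennreal (t powr (2 * s) * (norm (H t))\<^sup>2) \<le> ennreal (C\<^sup>2) * (ennreal (if 0 < t then t powr (2 * s) else 0) * (\<integral>\<^sup>+u. ennreal (gk b c (u - t) * norm (G u)) \<partial>lborel)\<^sup>2)"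
      proof (cases "0 < t")
        case True
        have "ennreal (t powr (2 * s) * (norm (H t))\<^sup>2) = ennreal (t powr (2 * s)) * (ennreal (norm (H t)))\<^sup>2"
          by (simp add: ennreal_mult ennreal_power)
        also have "\<dots> \<le> ennreal (t powr (2 * s)) * (ennreal C * (\<integral>\<^sup>+u. ennreal (gk b c (u - t) * norm (G u)) \<partial>lborel))\<^sup>2"
          by (intro mult_left_mono power_mono HG) auto
        finally show ?thesis using True C by (simp add: power_mult_distrib ennreal_power mult_ac)
      qed (simp add: H_def)
    qed
    also have "\<dots> = ennreal (C\<^sup>2) * (\<integral>\<^sup>+t. ennreal (if 0 < t then t powr (2 * s) else 0) * (\<integral>\<^sup>+u. ennreal (gk b c (u - t) * norm (G u)) \<partial>lborel)\<^sup>2 \<partial>lborel)"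
      by (rule nn_integral_cmult) measurable
    also have "\<dots> \<le> ennreal (C\<^sup>2) * (ennreal A * wnorm r G)"
      by (intro mult_left_mono A(2) spectralD[OF spec]) auto
    also have "\<dots> \<le> ennreal (C\<^sup>2 * A + 1) * wnorm r G"
      using A(1) by (simp add: mult.assoc[symmetric] ennreal_mult[symmetric] mult_right_mono ennreal_leI)
    finally have W': "wnorm s H \<le> ennreal (C\<^sup>2 * A + 1) * wnorm r G" .
    have "spectral l2 \<sigma> f H"
      unfolding spectral_def
    proof (intro conjI ballI)
      show "\<forall>t\<le>0. H t = 0" by (simp add: H_def)
      fix \<psi> assume \<psi>: "\<psi> \<in> test_functions {0<..}"
      have \<psi>0: "\<psi> t = 0" if "t \<le> 0" for t using test_functions_cases[OF \<psi>] that by (metis le_less_trans)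
      have [measurable]: "\<psi> \<in> borel_measurable borel" using \<psi> by (rule test_functions_measurable)
      obtain B where B: "0 < B" "\<And>x. norm (\<psi> x) \<le> B" using test_functions_bounded[OF \<psi>] by blast
      \<comment> \<open>\<open>extended_testing\<close> asks for an order of vanishing at 0 that is
        nonnegative and at least \<open>r\<close>; the convolution vanishes near 0, so every order
        is available.\<close>
      define a where "a = max 0 r"
      have a: "a \<ge> 0" "a \<ge> r" by (auto simp: a_def)
      obtain C' where C': "\<And>u. (\<integral>\<^sup>+t. ennreal (norm (of_real (k (u - t)) * \<psi> t)) \<partial>lborel) \<le> ennreal (C' * gk (a + 1) (c / 2) u)"
        using kernel_conv_bound[OF km kb bc \<psi> a(1)] by blast
      have C'2: "(\<integral>\<^sup>+t. ennreal (norm (of_real (k (u - t)) * \<psi> t)) \<partial>lborel) \<le> ennreal (\<bar>C'\<bar> * gk (a + 1) (c / 2) u)" for u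
        by (rule order_trans[OF C'] ennreal_leI mult_right_mono)+ auto
      define g where "g = conv (\<lambda>t. of_real (k t)) \<psi>"
      have gb: "norm (g u) \<le> \<bar>C'\<bar> * gk (a + 1) (c / 2) u" for u
      proof -
        have "ennreal (norm (g u)) \<le> (\<integral>\<^sup>+t. ennreal (norm (of_real (k (u - t)) * \<psi> t)) \<partial>lborel)"
          unfolding g_def conv_commute by (rule norm_LINT_le_nn)
        also note C'2
        finally show ?thesis by (subst (asm) ennreal_le_iff) auto
      qed
      have gc: "continuous_on UNIV g"
        unfolding g_def by (rule continuous_conv[OF ki test_functions_continuous[OF \<psi>] B(2)])
      have mg: "Complex l1 x powr of_real \<rho> * f x * ft g x = Complex l2 x powr of_real \<sigma> * f x * ft \<psi> x" for x
        unfolding g_def ft_conv(1)[OF ki test_functions_integrable[OF \<psi>]] mult by (simp add: mult_ac)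
      have "(LINT x|lborel. Complex l1 x powr of_real \<rho> * f x * ft g x) = (LINT t|lborel. G t * g t)"
        by (rule extended_testing[OF l(1) spec f W gc gb _ a])
          (use bc spectral_integrable[OF \<psi> l(2) f] in \<open>auto simp: mg\<close>)
      also have "\<dots> = (LINT u|lborel. LINT t|lborel. G u * (of_real (k (u - t)) * \<psi> t))"
        unfolding g_def conv_commute by simp
      also have "\<dots> = (LINT t|lborel. LINT u|lborel. G u * (of_real (k (u - t)) * \<psi> t))"
      proof (rule LINT_swap(1)[symmetric])
        have Gi: "integrable lborel (\<lambda>t. G t * of_real (\<bar>C'\<bar> * gk (a + 1) (c / 2) t))"
        proof (rule wnorm_pair_integrable[of _ _ r])
          show "wnorm (- r) (\<lambda>t. of_real (\<bar>C'\<bar> * gk (a + 1) (c / 2) t)) < \<infinity>"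
            by (rule wnorm_gk_finite[of _ "\<bar>C'\<bar>" "a + 1" "c / 2"]) (use bc a in \<open>auto simp: norm_mult abs_mult simp del: of_real_mult\<close>)
        qed (use W spectralD[OF spec] in auto)
        have "(\<integral>\<^sup>+u. \<integral>\<^sup>+t. ennreal (norm (G u * (of_real (k (u - t)) * \<psi> t))) \<partial>lborel \<partial>lborel) =
            (\<integral>\<^sup>+u. ennreal (norm (G u)) * (\<integral>\<^sup>+t. ennreal (norm (of_real (k (u - t)) * \<psi> t)) \<partial>lborel) \<partial>lborel)"
          by (intro nn_integral_cong, subst nn_integral_cmult[symmetric]) (auto simp: norm_mult ennreal_mult)
        also have "\<dots> \<le> (\<integral>\<^sup>+u. ennreal (norm (G u)) * ennreal (\<bar>C'\<bar> * gk (a + 1) (c / 2) u) \<partial>lborel)"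
          by (intro nn_integral_mono mult_left_mono C'2) auto
        also have "\<dots> = (\<integral>\<^sup>+u. ennreal (norm (G u * of_real (\<bar>C'\<bar> * gk (a + 1) (c / 2) u))) \<partial>lborel)"
          by (intro nn_integral_cong) (simp add: norm_mult abs_mult ennreal_mult)
        also have "\<dots> < \<infinity>" by (rule nn_integral_norm_finite[OF Gi])
        finally show "(\<integral>\<^sup>+u. \<integral>\<^sup>+t. ennreal (norm (G u * (of_real (k (u - t)) * \<psi> t))) \<partial>lborel \<partial>lborel) < \<infinity>" .
      qed measurable
      also have "\<dots> = (LINT t|lborel. H t * \<psi> t)"
      proof (rule Bochner_Integration.integral_cong[OF refl])
        fix t
        have "(LINT u|lborel. G u * (of_real (k (u - t)) * \<psi> t)) = (LINT u|lborel. (of_real (k (u - t)) * G u) * \<psi> t)"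
          by (simp add: mult_ac)
        also have "\<dots> = (LINT u|lborel. of_real (k (u - t)) * G u) * \<psi> t" by (rule integral_mult_left_zero)
        also have "\<dots> = H t * \<psi> t" using \<psi>0[of t] by (auto simp: H_def)
        finally show "(LINT u|lborel. G u * (of_real (k (u - t)) * \<psi> t)) = H t * \<psi> t" .
      qed
      finally show "(LINT x|lborel. Complex l2 x powr of_real \<sigma> * f x * ft \<psi> x) = (LINT t|lborel. H t * \<psi> t)"
        unfolding mg .
    qed (rule Hm)
    with W' show "\<exists>H. spectral l2 \<sigma> f H \<and> wnorm s H \<le> ennreal (C\<^sup>2 * A + 1) * wnorm r G" by blast
  qed
qed

subsection \<open>Multipliers relating two scaling parameters\<close>

lemma powr_mult_Re_pos:
  assumes "Re a > 0" "Re b > 0" shows "(a * b) powr z = a powr z * b powr (z :: complex)"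
proof -
  have nz: "a \<noteq> 0" "b \<noteq> 0" using assms by auto
  have "\<bar>Im (Ln a)\<bar> < pi / 2" "\<bar>Im (Ln b)\<bar> < pi / 2" using Re_Ln_pos_lt_imp assms nz by auto
  then have "Ln (a * b) = Ln a + Ln b" using nz by (auto simp: Ln_times)
  then show ?thesis using nz by (simp add: powr_def exp_add distrib_left)
qed

text \<open>The linear factor is just what the induction can absorb, as
  \<open>n + 1 \<le> b + n + 1\<close>. In \<open>multiplier_kernel\<close> it disappears in a
  geometric factor.\<close>

lemma fact_le_pochhammer:
  fixes b :: real assumes "b > 0" shows "fact n \<le> (1 + n / b) * pochhammer b n"
proof (induction n)
  case (Suc n)
  have p: "pochhammer b n \<ge> 0" using assms by (intro less_imp_le pochhammer_pos)
  have "fact (Suc n) = (n + 1) * (fact n :: real)" by simp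
  also have "\<dots> \<le> (n + 1) * ((1 + n / b) * pochhammer b n)" using Suc by (intro mult_left_mono) auto
  also have "\<dots> = ((n + 1) * (b + n) / b) * pochhammer b n" using assms by (simp add: field_simps)
  also have "\<dots> \<le> ((b + n + 1) * (b + n) / b) * pochhammer b n"
    using assms p by (intro mult_right_mono divide_right_mono) auto
  also have "\<dots> = (1 + Suc n / b) * pochhammer b (Suc n)" using assms by (simp add: pochhammer_Suc field_simps)
  finally show ?case .
qed simp

text \<open>The binomial series converges absolutely inside the unit disc: its value at 3/4 gives
  the growth rate 4/3 for pointwise kernel bounds, its value at 1/2 the summability for
  \<open>norm z \<le> 1 / 2\<close>.\<close>

lemma gbinomial_growth:
  fixes q :: real obtains M where "M > 0" "\<And>n. \<bar>q gchoose n\<bar> \<le> M * (4 / 3) ^ n" "summable (\<lambda>n. \<bar>q gchoose n\<bar> * (1 / 2) ^ n)"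
proof -
  have cr: "conv_radius (\<lambda>n. q gchoose n) \<ge> 1" by (simp add: conv_radius_gchoose)
  have s: "summable (\<lambda>n. norm ((q gchoose n) * x ^ n))" if "\<bar>x\<bar> < 1" for x :: real
    by (rule abs_summable_in_conv_radius, rule less_le_trans[OF _ cr]) (use that in simp)
  have s1: "summable (\<lambda>n. \<bar>q gchoose n\<bar> * (3 / 4) ^ n)" using s[of "3/4"] by (simp add: abs_mult)
  have s2: "summable (\<lambda>n. \<bar>q gchoose n\<bar> * (1 / 2) ^ n)" using s[of "1/2"] by (simp add: abs_mult)
  define M where "M = (\<Sum>n. \<bar>q gchoose n\<bar> * (3 / 4) ^ n) + 1"
  have "\<bar>q gchoose n\<bar> \<le> M * (4 / 3) ^ n" for n
  proof -
    have "(\<Sum>i\<in>{n}. \<bar>q gchoose i\<bar> * (3 / 4) ^ i) \<le> (\<Sum>i. \<bar>q gchoose i\<bar> * (3 / 4) ^ i)" by (rule sum_le_suminf[OF s1]) auto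
    then have "\<bar>q gchoose n\<bar> * (3 / 4) ^ n \<le> M" by (simp add: M_def)
    then have "(\<bar>q gchoose n\<bar> * (3 / 4) ^ n) * (4 / 3) ^ n \<le> M * (4 / 3) ^ n" by (intro mult_right_mono) auto
    then show ?thesis by (simp add: mult.assoc power_mult_distrib[symmetric])
  qed
  moreover have "M > 0" using suminf_nonneg[OF s1] by (auto simp: M_def intro: add_nonneg_pos)
  ultimately show ?thesis using s2 that by blast
qed

lemma of_real_gbinomial: "complex_of_real (q gchoose n) = of_real q gchoose n"
  by (simp add: gbinomial_prod_rev)

text \<open>The quotient \<open>(L / 2 + i x) / (L + i x)\<close> equals \<open>1 - z\<close> with
  \<open>z = (L / 2) / (L + i x)\<close> and \<open>norm z \<le> 1 / 2\<close>. In the binomial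
  series of its power each term is a multiple of \<open>(L + i x)^(- b - n)\<close>, the transform
  of a Gamma density, so \<open>k\<close> is a series of such densities. Its terms add up to at most
  \<open>exp (5 / 6 * L * t)\<close>, which leaves the decay rate \<open>L / 6\<close>.\<close>

lemma multiplier_kernel:
  fixes q :: real assumes b: "b > 0" and L: "L > 0"
  obtains k :: "real \<Rightarrow> real" and C where "k \<in> borel_measurable borel" "\<And>t. \<bar>k t\<bar> \<le> C * gk b (L / 6) t"
    "\<And>x. ft (\<lambda>t. of_real (k t)) x = Complex L x powr (- of_real b) * (Complex (L / 2) x / Complex L x) powr of_real q"
proof -
  obtain M where M: "M > 0" "\<And>n. \<bar>q gchoose n\<bar> \<le> M * (4 / 3) ^ n" "summable (\<lambda>n. \<bar>q gchoose n\<bar> * (1 / 2) ^ n)"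
    using gbinomial_growth[of q] by blast
  define d where "d n = (q gchoose n) * (- (L / 2)) ^ n / Gamma (b + n)" for n
  define T where "T n t = d n * gk (b + n) L t" for n t
  have [measurable]: "T n \<in> borel_measurable borel" for n unfolding T_def[abs_def] by measurable
  have Gp: "Gamma (b + n) > 0" for n :: nat using b by (intro Gamma_real_pos) auto
  have Gpoch: "Gamma (b + n) = Gamma b * pochhammer b n" for n
  proof -
    have "b \<notin> \<int>\<^sub>\<le>\<^sub>0" using b nonpos_Ints_nonpos[of b] by auto
    then show ?thesis using pochhammer_Gamma[of b n] Gamma_real_pos[OF b] by (simp add: field_simps)
  qed
  define E where "E = M * (1 + 4 / b) / Gamma b"
  have E: "E > 0" using M b Gamma_real_pos[OF b] by (auto simp: E_def intro!: divide_pos_pos mult_pos_pos add_pos_pos)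
  have bound: "\<bar>T n t\<bar> \<le> gk b L t * E * ((5 / 6 * L * t) ^ n / fact n)" for n t
  proof (cases "t > 0")
    case True
    \<comment> \<open>The slope 1/4 in Bernoulli's inequality yields the ratio 5/4, small enough to
      keep \<open>4/3 * 1/2 * 5/4 = 5/6\<close> below 1.\<close>
    have "1 + n / b \<le> (1 + 4 / b) * (1 + n / 4)" using b by (simp add: field_simps)
    also have "1 + n / 4 \<le> (1 + 1 / 4 :: real) ^ n" using Bernoulli_inequality[of "1 / 4" n] by simp
    finally have "1 + n / b \<le> (1 + 4 / b) * (5 / 4) ^ n" using b by (simp add: mult_left_mono)
    then have "(1 + n / b) * pochhammer b n \<le> (1 + 4 / b) * (5 / 4) ^ n * pochhammer b n"
      by (rule mult_right_mono[OF _ less_imp_le[OF pochhammer_pos[OF b]]])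
    with fact_le_pochhammer[OF b, of n] have "fact n \<le> (1 + 4 / b) * (5 / 4) ^ n * pochhammer b n" by (rule order_trans)
    then have Gi: "1 / Gamma (b + n) \<le> (1 + 4 / b) / Gamma b * (5 / 4) ^ n / fact n"
      unfolding Gpoch using b Gamma_real_pos[OF b] pochhammer_pos[OF b, of n] by (simp add: field_simps)
    have gkn: "gk (b + n) L t = gk b L t * t ^ n"
      using True by (simp add: gk_def powr_realpow[symmetric] powr_add[symmetric] algebra_simps)
    have "\<bar>T n t\<bar> = \<bar>q gchoose n\<bar> * (L / 2) ^ n * (1 / Gamma (b + n)) * (gk b L t * t ^ n)"
      using L Gp[of n] True by (simp add: T_def d_def gkn abs_mult power_abs)
    also have "\<dots> \<le> (M * (4 / 3) ^ n) * (L / 2) ^ n * ((1 + 4 / b) / Gamma b * (5 / 4) ^ n / fact n) * (gk b L t * t ^ n)"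
      using M Gi L True b Gp[of n] Gamma_real_pos[OF b] by (intro mult_mono) auto
    also have "\<dots> = gk b L t * E * (((4 / 3) ^ n * (L / 2) ^ n * (5 / 4) ^ n * t ^ n) / fact n)"
      by (simp add: E_def)
    also have "(4 / 3) ^ n * (L / 2) ^ n * (5 / 4) ^ n * t ^ n = (5 / 6 * L * t) ^ n"
    proof -
      have "(4 / 3) * (L / 2) * (5 / 4) * t = 5 / 6 * L * t" by simp
      then show ?thesis by (simp only: power_mult_distrib[symmetric])
    qed
    finally show ?thesis .
  qed (simp add: T_def)
  have se: "(\<lambda>n. gk b L t * E * ((5 / 6 * L * t) ^ n / fact n)) sums (gk b L t * E * exp (5 / 6 * L * t))" for t
  proof (rule sums_mult)
    have "(\<lambda>n. x ^ n / fact n) sums exp x" for x :: real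
      using exp_converges[of x] by (simp add: divide_inverse mult.commute)
    then show "(\<lambda>n. (5 / 6 * L * t) ^ n / fact n) sums exp (5 / 6 * L * t)" .
  qed
  have sT: "summable (\<lambda>n. \<bar>T n t\<bar>)" for t
  proof (rule summable_comparison_test'[OF sums_summable[OF se[of t]], of 0])
    fix n show "norm \<bar>T n t\<bar> \<le> gk b L t * E * ((5 / 6 * L * t) ^ n / fact n)"
      using bound[of n t] unfolding real_norm_def abs_abs .
  qed
  define k where "k t = (\<Sum>n. T n t)" for t
  have km [measurable]: "k \<in> borel_measurable borel" unfolding k_def[abs_def] by measurable
  have kb: "\<bar>k t\<bar> \<le> E * gk b (L / 6) t" for t
  proof -
    have "\<bar>k t\<bar> \<le> (\<Sum>n. \<bar>T n t\<bar>)" unfolding k_def by (rule summable_rabs[OF sT])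
    also have "\<dots> \<le> (\<Sum>n. gk b L t * E * ((5 / 6 * L * t) ^ n / fact n))"
      by (rule suminf_le[OF bound sT sums_summable[OF se]])
    also have "\<dots> = gk b L t * E * exp (5 / 6 * L * t)" using se by (rule sums_unique[symmetric])
    also have "\<dots> = E * gk b (L / 6) t" by (simp add: gk_def exp_add[symmetric])
    finally show ?thesis .
  qed
  have ftk: "ft (\<lambda>t. of_real (k t)) x = Complex L x powr (- of_real b) * (Complex (L / 2) x / Complex L x) powr of_real q" for x
  proof -
    define w where "w = Complex L x"
    have w0: "w \<noteq> 0" "L \<le> norm w" using Complex_nonzero[OF L] norm_Complex_ge(1)[OF L] by (auto simp: w_def)
    define z where "z = of_real (L / 2) / w"
    have "norm z \<le> 1 / 2" using w0 L by (simp add: z_def norm_divide field_simps)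
    then have z: "norm (- z) < 1" by simp
    have zw: "1 + - z = Complex (L / 2) x / Complex L x"
      using w0(1) by (simp add: z_def w_def field_simps) (simp add: complex_eq_iff)
    define h where "h n t = exp (- (\<i> * of_real (x * t))) * complex_of_real (T n t)" for n t
    have gi: "integrable lborel (gk (b + n) L)" for n :: nat using b L by (intro gk_integrable) auto
    have hi: "integrable lborel (h n)" for n
      unfolding h_def[abs_def] by (intro integrable_exp_mult integrable_of_real) (simp add: T_def[abs_def] gi)
    have nh: "norm (h n t) = \<bar>T n t\<bar>" for n t by (simp add: h_def norm_mult del: of_real_mult)
    have nhi: "(LINT t|lborel. norm (h n t)) = \<bar>q gchoose n\<bar> * (1 / 2) ^ n * L powr (- b)" for n
    proof -
      have "(LINT t|lborel. norm (h n t)) = (LINT t|lborel. \<bar>d n\<bar> * gk (b + n) L t)"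
        by (simp add: nh T_def abs_mult)
      also have "\<dots> = \<bar>d n\<bar> * (Gamma (b + n) * L powr (- (b + n)))"
        using gk_integral[of "b + n" L] b L by simp
      also have "\<dots> = \<bar>q gchoose n\<bar> * ((L / 2) ^ n * L powr (- (b + n)))"
        using Gp[of n] L by (simp add: d_def abs_mult power_abs)
      also have "L powr (- (b + n)) = L powr (- b) / L ^ n"
        using L by (simp add: powr_diff powr_realpow)
      finally show ?thesis using L by (simp add: power_divide)
    qed
    \<comment> \<open>Termwise integration: the integrals of \<open>norm (h n t)\<close> are
      multiples of the summable numbers
      \<open>\<bar>q gchoose n\<bar> * (1 / 2) ^ n\<close>.\<close>
    have "(\<lambda>n. LINT t|lborel. h n t) sums (LINT t|lborel. (\<Sum>n. h n t))"
    proof (rule sums_integral)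
      show "AE t in lborel. summable (\<lambda>n. norm (h n t))" by (simp add: nh sT)
      show "summable (\<lambda>n. LINT t|lborel. norm (h n t))" unfolding nhi by (intro summable_mult2 M)
    qed (rule hi)
    moreover have "(\<Sum>n. h n t) = exp (- (\<i> * of_real (x * t))) * of_real (k t)" for t
      unfolding h_def k_def using summable_rabs_cancel[OF sT[of t]]
      by (simp add: suminf_mult summable_of_real suminf_of_real del: of_real_mult)
    moreover have "(LINT t|lborel. h n t) = w powr (- of_real b) * ((of_real q gchoose n) * (- z) ^ n)" for n
    proof -
      have "(LINT t|lborel. h n t) = of_real (d n) * ft (\<lambda>t. of_real (gk (b + n) L t)) x"
        unfolding ft_cmult[symmetric] by (simp add: ft_def h_def T_def)
      also have "\<dots> = of_real (d n * Gamma (b + n)) * w powr (- of_real (b + n))"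
        using ft_gk[of "b + n" L] b L by (simp add: w_def)
      also have "d n * Gamma (b + n) = (q gchoose n) * (- (L / 2)) ^ n" using Gp[of n] by (simp add: d_def)
      also have "w powr (- of_real (b + n)) = w powr (- of_real b) / w ^ n"
        using w0 by (simp add: powr_diff powr_nat)
      also have "complex_of_real ((q gchoose n) * (- (L / 2)) ^ n) * (w powr (- of_real b) / w ^ n) =
          w powr (- of_real b) * ((of_real q gchoose n) * (- z) ^ n)"
        by (simp add: z_def of_real_gbinomial power_divide power_minus[of "_ / _"] power_minus[of "of_real L / 2"] )
      finally show ?thesis .
    qed
    ultimately have "(\<lambda>n. w powr (- of_real b) * ((of_real q gchoose n) * (- z) ^ n)) sums ft (\<lambda>t. of_real (k t)) x"
      by (simp add: ft_def)
    moreover have "(\<lambda>n. w powr (- of_real b) * ((of_real q gchoose n) * (- z) ^ n)) sums (w powr (- of_real b) * (1 + - z) powr of_real q)"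
      by (intro sums_mult gen_binomial_complex z)
    ultimately show ?thesis unfolding zw w_def[symmetric] by (rule sums_unique2)
  qed
  show ?thesis by (rule that[OF km kb ftk])
qed

subsection \<open>Laguerre functions\<close>

text \<open>On the line \<open>cnj (Complex d x)\<close> is \<open>d - i x\<close>, so this is a
  rational function with its only pole at \<open>i d\<close>. For \<open>d = l / 2\<close> the MTC
  functions are real parts of multiples of these (\<open>mtc_eq\<close>).\<close>

definition hardy_fun :: "real \<Rightarrow> nat \<Rightarrow> real \<Rightarrow> complex" where
  "hardy_fun d k x = cnj (Complex d x) ^ k / Complex d x ^ (k + 1)"

lemma norm_hardy_fun: "d > 0 \<Longrightarrow> norm (hardy_fun d k x) = 1 / norm (Complex d x)"
  using Complex_nonzero[of d x] by (simp add: hardy_fun_def norm_divide norm_mult norm_power)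

lemma measurable_hardy_fun [measurable]: "hardy_fun d k \<in> borel_measurable borel"
proof -
  have c: "cnj (Complex d x) = Complex d (- x)" for x by (simp add: complex_eq_iff)
  have [measurable]: "(\<lambda>x. Complex d (- x)) \<in> borel_measurable borel"
    by (rule measurable_compose[OF _ measurable_Complex]) simp
  have "(\<lambda>x. (\<Prod>i<k. Complex d (- x)) / (\<Prod>i<k + 1. Complex d x)) \<in> borel_measurable borel" by measurable
  then show ?thesis by (simp add: hardy_fun_def[abs_def] c)
qed

lemma sq_int_hardy_fun: "d > 0 \<Longrightarrow> sq_int (hardy_fun d k)"
  by (rule sq_int_bound[where c = d and C = 1]) (auto simp: norm_hardy_fun)

text \<open>The Gamma factor in the denominator cancels the one in \<open>ft_gk\<close>, so that the
  transform of \<open>lag_dual\<close> becomes a binomial sum.\<close>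

definition lag_coeff :: "real \<Rightarrow> real \<Rightarrow> nat \<Rightarrow> nat \<Rightarrow> real" where
  "lag_coeff d a k i = real (k choose i) * (- (2 * d)) ^ i / Gamma (real i + 1 + a)"

text \<open>Up to normalisation, \<open>lag d a k\<close> is \<open>exp (- d * t) * L\<^sub>k\<^sup>(\<^sup>a\<^sup>) (2 * d * t)\<close> with the generalised
  Laguerre polynomial of parameter \<open>a\<close>, and \<open>lag_dual d a k\<close> is its product with the weight \<open>t powr a\<close>.\<close>

definition lag :: "real \<Rightarrow> real \<Rightarrow> nat \<Rightarrow> real \<Rightarrow> real" where
  "lag d a k t = (\<Sum>i\<le>k. lag_coeff d a k i * gk (real i + 1) d t)"

definition lag_dual :: "real \<Rightarrow> real \<Rightarrow> nat \<Rightarrow> real \<Rightarrow> real" where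
  "lag_dual d a k t = (\<Sum>i\<le>k. lag_coeff d a k i * gk (real i + 1 + a) d t)"

lemma measurable_lag [measurable]: "lag d a k \<in> borel_measurable borel" "lag_dual d a k \<in> borel_measurable borel"
  unfolding lag_def[abs_def] lag_dual_def[abs_def] by measurable

lemma lag_nonpos [simp]: "t \<le> 0 \<Longrightarrow> lag d a k t = 0" "t \<le> 0 \<Longrightarrow> lag_dual d a k t = 0"
  by (simp_all add: lag_def lag_dual_def)

lemma lag_dual_eq: "lag_dual d a k t = t powr a * lag d a k t"
proof (cases "t > 0")
  case True
  then have "gk (real i + 1 + a) d t = t powr a * gk (real i + 1) d t" for i
    by (simp add: gk_def powr_add[symmetric] mult.assoc[symmetric] add_ac)
  then show ?thesis by (simp add: lag_def lag_dual_def sum_distrib_left mult_ac)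
qed simp

lemma integrable_lag:
  assumes "d > 0" "a \<ge> 0" shows "integrable lborel (lag_dual d a k)" "integrable lborel (lag d a k)"
  unfolding lag_dual_def[abs_def] lag_def[abs_def] using assms
  by (intro Bochner_Integration.integrable_sum integrable_mult_right gk_integrable; simp)+

lemma ft_sum:
  assumes "finite I" "\<And>i. i \<in> I \<Longrightarrow> integrable lborel (g i)"
  shows "ft (\<lambda>t. \<Sum>i\<in>I. g i t) x = (\<Sum>i\<in>I. ft (g i) x)"
proof -
  have "ft (\<lambda>t. \<Sum>i\<in>I. g i t) x = (LINT t|lborel. (\<Sum>i\<in>I. exp (- (\<i> * of_real (x * t))) * g i t))"
    unfolding ft_def by (simp add: sum_distrib_left)
  also have "\<dots> = (\<Sum>i\<in>I. ft (g i) x)"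
    unfolding ft_def by (rule Bochner_Integration.integral_sum) (use assms integrable_exp_mult in blast)
  finally show ?thesis .
qed

text \<open>With \<open>w = Complex d x\<close> the sum is the binomial expansion of
  \<open>(1 - 2 * d / w) ^ k\<close>, and \<open>w + cnj w = 2 * d\<close> turns this into
  \<open>(- cnj w / w) ^ k\<close>.\<close>

lemma ft_lag_dual:
  assumes d: "d > 0" and a: "a \<ge> 0"
  shows "ft (\<lambda>t. of_real (lag_dual d a k t)) x = (- 1) ^ k * hardy_fun d k x * Complex d x powr (- of_real a)"
proof -
  define w where "w = Complex d x"
  have w: "w \<noteq> 0" using Complex_nonzero[OF d] by (simp add: w_def)
  have "ft (\<lambda>t. of_real (lag_dual d a k t)) x = (\<Sum>i\<le>k. ft (\<lambda>t. of_real (lag_coeff d a k i) * of_real (gk (real i + 1 + a) d t)) x)"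
    unfolding lag_dual_def of_real_sum of_real_mult
    by (rule ft_sum) (use d a in \<open>auto intro!: integrable_mult_right gk_integrable integrable_of_real\<close>)
  also have "\<dots> = (\<Sum>i\<le>k. w powr (- of_real a) / w * (of_nat (k choose i) * (- (of_real (2 * d) / w)) ^ i))"
  proof (rule sum.cong[OF refl])
    fix i
    have G: "Gamma (real i + 1 + a) > 0" using a by (intro Gamma_real_pos) auto
    have "ft (\<lambda>t. of_real (lag_coeff d a k i) * of_real (gk (real i + 1 + a) d t)) x
        = of_real (lag_coeff d a k i * Gamma (real i + 1 + a)) * w powr (- of_real (real i + 1 + a))"
      using d a by (simp add: ft_cmult ft_gk w_def)
    also have "lag_coeff d a k i * Gamma (real i + 1 + a) = real (k choose i) * (- (2 * d)) ^ i" using G by (simp add: lag_coeff_def)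
    also have "w powr (- of_real (real i + 1 + a)) = w powr (- of_real a) / w ^ (i + 1)"
    proof -
      have "- complex_of_real (real i + 1 + a) = - of_real a - of_nat (i + 1)" by simp
      then show ?thesis using w by (simp only: powr_diff powr_nat' if_False simp_thms)
    qed
    also have "complex_of_real (real (k choose i) * (- (2 * d)) ^ i) * (w powr (- of_real a) / w ^ (i + 1)) =
        w powr (- of_real a) / w * (of_nat (k choose i) * (- (of_real (2 * d) / w)) ^ i)"
    proof -
      have "complex_of_real ((- (2 * d)) ^ i) / w ^ i = (- (of_real (2 * d) / w)) ^ i"
        unfolding of_real_power by (simp only: power_divide[symmetric]) simp
      from this[symmetric] show ?thesis by (simp only: of_real_mult of_real_of_nat_eq) (simp add: mult_ac)
    qed
    finally show "ft (\<lambda>t. of_real (lag_coeff d a k i) * of_real (gk (real i + 1 + a) d t)) x =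
        w powr (- of_real a) / w * (of_nat (k choose i) * (- (of_real (2 * d) / w)) ^ i)" .
  qed
  also have "\<dots> = w powr (- of_real a) / w * (- (of_real (2 * d) / w) + 1) ^ k"
    unfolding binomial_ring power_one mult_1_right by (rule sum_distrib_left[symmetric])
  also have "- (of_real (2 * d) / w) + 1 = (- 1) * (cnj w / w)"
    using w by (simp add: field_simps) (simp add: w_def complex_eq_iff)
  finally show ?thesis using w by (simp add: hardy_fun_def w_def[symmetric] power_mult_distrib[of "-1"] power_divide power_minus[of "cnj w / w"] field_simps)
qed

text \<open>Up to sign, these are \<open>k\<close>-th finite differences of a polynomial of degree
  \<open>m\<close> in \<open>y\<close>: zero for \<open>m < k\<close>, constant for
  \<open>m = k\<close>.\<close>

lemma alternating_pochhammer_sum: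
  fixes y :: real
  shows "m < k \<Longrightarrow> (\<Sum>i\<le>k. (- 1) ^ i * real (k choose i) * pochhammer (y + real i) m) = 0"
    and "(\<Sum>i\<le>k. (- 1) ^ i * real (k choose i) * pochhammer (y + real i) k) = (- 1) ^ k * fact k"
proof -
  define S where "S k m y = (\<Sum>i\<le>k. (- 1) ^ i * real (k choose i) * pochhammer (y + real i) m)" for k m and y :: real
  have rec0: "S (Suc k) m y = S k m y - S k m (y + 1)" for k m y
  proof -
    have "S (Suc k) m y = pochhammer y m + (\<Sum>i\<le>k. (- 1) ^ Suc i * real (Suc k choose Suc i) * pochhammer (y + real (Suc i)) m)"
      unfolding S_def by (subst sum.atMost_Suc_shift) simp
    also have "\<dots> = (pochhammer y m + (\<Sum>i\<le>k. (- 1) ^ Suc i * real (k choose Suc i) * pochhammer (y + real (Suc i)) m))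
        - (\<Sum>i\<le>k. (- 1) ^ i * real (k choose i) * pochhammer (y + 1 + real i) m)"
      by (simp add: algebra_simps sum.distrib sum_subtractf sum_negf)
    also have "pochhammer y m + (\<Sum>i\<le>k. (- 1) ^ Suc i * real (k choose Suc i) * pochhammer (y + real (Suc i)) m) =
        (\<Sum>i\<le>Suc k. (- 1) ^ i * real (k choose i) * pochhammer (y + real i) m)"
      by (subst sum.atMost_Suc_shift) simp
    also have "\<dots> = S k m y" by (simp add: S_def)
    finally show ?thesis by (simp add: S_def)
  qed
  \<comment> \<open>Differencing a Pochhammer symbol lowers its degree by one, which gives a
    recursion in both indices at once.\<close>
  have poch: "pochhammer z (Suc m) - pochhammer (z + 1) (Suc m) = - (real (Suc m)) * pochhammer (z + 1) m" for z :: real and m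
    unfolding pochhammer_rec[of z] pochhammer_Suc[of "z + 1"] by (simp add: algebra_simps)
  have rec: "S (Suc k) (Suc m) y = - (real (Suc m)) * S k m (y + 1)" for k m y
  proof -
    have "S (Suc k) (Suc m) y = (\<Sum>i\<le>k. (- 1) ^ i * real (k choose i) * (pochhammer (y + real i) (Suc m) - pochhammer (y + real i + 1) (Suc m)))"
      by (subst rec0, unfold S_def sum_subtractf[symmetric], intro sum.cong refl) (simp add: algebra_simps)
    also have "\<dots> = - (real (Suc m)) * S k m (y + 1)"
      unfolding poch S_def sum_distrib_left by (intro sum.cong refl) (simp add: algebra_simps)
    finally show ?thesis .
  qed
  have z: "S (Suc k) 0 y = 0" for k y unfolding rec0 by (simp add: S_def)
  have "S k m y = 0" if "m < k" for k m y
    using that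
  proof (induction k arbitrary: m y)
    case (Suc k) then show ?case by (cases m) (simp_all add: z rec)
  qed simp
  then show "m < k \<Longrightarrow> (\<Sum>i\<le>k. (- 1) ^ i * real (k choose i) * pochhammer (y + real i) m) = 0" by (simp add: S_def)
  have "S k k y = (- 1) ^ k * fact k" for k y
    by (induction k arbitrary: y) (simp add: S_def, simp add: rec algebra_simps)
  then show "(\<Sum>i\<le>k. (- 1) ^ i * real (k choose i) * pochhammer (y + real i) k) = (- 1) ^ k * fact k" by (simp add: S_def)
qed

lemma Gamma_plus_nat: "z > 0 \<Longrightarrow> Gamma (z + real m) = pochhammer z m * Gamma (z :: real)"
proof -
  assume z: "z > 0"
  then have "z \<notin> \<int>\<^sub>\<le>\<^sub>0" using nonpos_Ints_nonpos[of z] by auto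
  then show ?thesis using pochhammer_Gamma[of z m] Gamma_real_pos[OF z] by (simp add: field_simps)
qed

lemma gk_mult: "gk b c t * gk b' c' t = gk (b + b' - 1) (c + c') t"
  by (auto simp: gk_def powr_add[symmetric] exp_add[symmetric] algebra_simps simp flip: mult.assoc)

text \<open>The integral of each term produces \<open>Gamma (1 + a + i + m)\<close>. Divided by the
  Gamma value in \<open>lag_coeff\<close> it is a Pochhammer symbol of degree \<open>m\<close> in
  \<open>i\<close>, so the moment is a finite difference and vanishes for
  \<open>m < k\<close>.\<close>

lemma lag_moment:
  assumes d: "d > 0" and a: "a \<ge> 0"
  shows "integrable lborel (\<lambda>t. gk (real m + 1) d t * lag_dual d a k t)"
    "(LINT t|lborel. gk (real m + 1) d t * lag_dual d a k t) =
      (2 * d) powr (- (real m + 1 + a)) * (\<Sum>i\<le>k. (- 1) ^ i * real (k choose i) * pochhammer (1 + a + real i) m)"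
proof -
  have e: "gk (real m + 1) d t * lag_dual d a k t = (\<Sum>i\<le>k. lag_coeff d a k i * gk (1 + a + real i + real m) (2 * d) t)" for t
    unfolding lag_dual_def sum_distrib_left
    by (intro sum.cong refl) (simp add: gk_mult[of "real m + 1" d t "real _ + 1 + a" d, symmetric] add_ac mult.left_commute gk_mult)
  have i: "integrable lborel (\<lambda>t. lag_coeff d a k i * gk (1 + a + real i + real m) (2 * d) t)" for i
    using d a by (intro integrable_mult_right gk_integrable) auto
  show "integrable lborel (\<lambda>t. gk (real m + 1) d t * lag_dual d a k t)"
    unfolding e by (intro Bochner_Integration.integrable_sum i)
  have "(LINT t|lborel. gk (real m + 1) d t * lag_dual d a k t) = (\<Sum>i\<le>k. lag_coeff d a k i * (Gamma (1 + a + real i + real m) * (2 * d) powr (- (1 + a + real i + real m))))"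
    unfolding e using i d a by (subst Bochner_Integration.integral_sum) (auto simp: gk_integral)
  also have "\<dots> = (\<Sum>i\<le>k. (2 * d) powr (- (real m + 1 + a)) * ((- 1) ^ i * real (k choose i) * pochhammer (1 + a + real i) m))"
  proof (rule sum.cong[OF refl])
    fix i
    have p: "1 + a + real i > 0" using a by auto
    have "(2 * d) powr (- (1 + a + real i + real m)) = (2 * d) powr (- (real m + 1 + a)) / (2 * d) ^ i"
    proof -
      have "- (1 + a + real i + real m) = - (real m + 1 + a) - real i" by simp
      then show ?thesis using d by (simp only: powr_diff powr_realpow)
    qed
    then show "lag_coeff d a k i * (Gamma (1 + a + real i + real m) * (2 * d) powr (- (1 + a + real i + real m))) =
        (2 * d) powr (- (real m + 1 + a)) * ((- 1) ^ i * real (k choose i) * pochhammer (1 + a + real i) m)"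
      using Gamma_plus_nat[OF p, of m] Gamma_real_pos[OF p] d
      by (simp add: lag_coeff_def power_minus[of "2 * d"] add_ac)
  qed
  finally show "(LINT t|lborel. gk (real m + 1) d t * lag_dual d a k t) =
      (2 * d) powr (- (real m + 1 + a)) * (\<Sum>i\<le>k. (- 1) ^ i * real (k choose i) * pochhammer (1 + a + real i) m)"
    by (simp add: sum_distrib_left)
qed

text \<open>The squared norm of \<open>lag d a k\<close> for the weight \<open>t powr a\<close>
  (\<open>wnorm_lag\<close>).\<close>

definition lag_norm :: "real \<Rightarrow> real \<Rightarrow> nat \<Rightarrow> real" where
  "lag_norm d a k = (2 * d) powr (- (1 + a)) * fact k / Gamma (real k + 1 + a)"

lemma lag_norm_pos: "d > 0 \<Longrightarrow> a \<ge> 0 \<Longrightarrow> lag_norm d a k > 0"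
  unfolding lag_norm_def by (intro divide_pos_pos mult_pos_pos Gamma_real_pos) auto

text \<open>\<open>lag d a j\<close> involves only moments up to order \<open>j\<close>, which
  \<open>lag_dual d a k\<close> annihilates if \<open>j < k\<close>. The weight can be moved from
  one factor to the other, so \<open>k < j\<close> follows by symmetry.\<close>

lemma lag_orthogonal:
  assumes d: "d > 0" and a: "a \<ge> 0"
  shows "integrable lborel (\<lambda>t. lag d a j t * lag_dual d a k t)"
    "(LINT t|lborel. lag d a j t * lag_dual d a k t) = (if j = k then lag_norm d a k else 0)"
proof -
  have e: "lag d a j t * lag_dual d a k t = (\<Sum>i\<le>j. lag_coeff d a j i * (gk (real i + 1) d t * lag_dual d a k t))" for j k t
    by (simp add: lag_def sum_distrib_right mult.assoc)
  show int: "integrable lborel (\<lambda>t. lag d a j t * lag_dual d a k t)" for j k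
    unfolding e by (intro Bochner_Integration.integrable_sum integrable_mult_right lag_moment d a)
  have I: "(LINT t|lborel. lag d a j t * lag_dual d a k t) = (\<Sum>i\<le>j. lag_coeff d a j i * (LINT t|lborel. gk (real i + 1) d t * lag_dual d a k t))" for j k
    unfolding e using lag_moment(1)[OF d a] by (subst Bochner_Integration.integral_sum) auto
  have lt: "(LINT t|lborel. lag d a j t * lag_dual d a k t) = 0" if "j < k" for j k
    unfolding I using that by (intro sum.neutral ballI) (simp add: lag_moment(2)[OF d a] alternating_pochhammer_sum(1))
  consider "j < k" | "j = k" | "k < j" by linarith
  then show "(LINT t|lborel. lag d a j t * lag_dual d a k t) = (if j = k then lag_norm d a k else 0)"
  proof cases
    case 1 then show ?thesis using lt by simp
  next
    case 3
    have "(LINT t|lborel. lag d a j t * lag_dual d a k t) = (LINT t|lborel. lag d a k t * lag_dual d a j t)"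
      by (simp add: lag_dual_eq mult_ac)
    then show ?thesis using lt[OF 3] 3 by simp
  next
    case 2
    \<comment> \<open>On the diagonal only the leading coefficient meets a nonzero moment.\<close>
    have "(LINT t|lborel. lag d a k t * lag_dual d a k t) = (\<Sum>i\<in>{k}. lag_coeff d a k i * (LINT t|lborel. gk (real i + 1) d t * lag_dual d a k t))"
      unfolding I by (intro sum.mono_neutral_right) (auto simp: lag_moment(2)[OF d a] alternating_pochhammer_sum(1))
    also have "\<dots> = lag_coeff d a k k * ((2 * d) powr (- (real k + 1 + a)) * ((- 1) ^ k * fact k))"
      by (simp add: lag_moment(2)[OF d a] alternating_pochhammer_sum(2))
    also have "(2 * d) powr (- (real k + 1 + a)) = (2 * d) powr (- (1 + a)) / (2 * d) ^ k"
    proof -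
      have "- (real k + 1 + a) = - (1 + a) - real k" by simp
      then show ?thesis using d by (simp only: powr_diff powr_realpow)
    qed
    finally show ?thesis using 2 d by (simp add: lag_coeff_def lag_norm_def power_minus[of "2 * d"])
  qed
qed

lemma wnorm_lag:
  assumes d: "d > 0" and a: "a \<ge> 0"
  shows "wnorm (a / 2) (\<lambda>t. of_real (lag d a k t)) = ennreal (lag_norm d a k)"
proof -
  have "wnorm (a / 2) (\<lambda>t. of_real (lag d a k t)) = (\<integral>\<^sup>+t. ennreal (lag d a k t * lag_dual d a k t) \<partial>lborel)"
    unfolding wnorm_def by (intro nn_integral_cong) (simp add: lag_dual_eq power2_eq_square abs_mult[symmetric] mult.left_commute)
  also have "\<dots> = ennreal (LINT t|lborel. lag d a k t * lag_dual d a k t)"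
    by (rule nn_integral_eq_integral[OF lag_orthogonal(1)[OF d a]]) (simp add: lag_dual_eq mult.left_commute[of _ "_ powr _"])
  finally show ?thesis by (simp add: lag_orthogonal(2)[OF d a])
qed

text \<open>By Euler's limit formula for Gamma, the ratio divided by \<open>(k + 1) powr a\<close>
  tends to 1. It and its inverse are therefore bounded.\<close>

lemma Gamma_ratio_bounds:
  fixes a :: real assumes a: "a > 0"
  obtains C where "C > 0" "\<And>k. Gamma (real k + 1 + a) / fact k \<le> C * (real k + 1) powr a"
    "\<And>k. fact k / Gamma (real k + 1 + a) \<le> C * (real k + 1) powr (- a)"
proof -
  define x where "x k = Gamma (real k + 1 + a) / (fact k * (real k + 1) powr a)" for k :: nat
  have Gp: "Gamma (real k + 1 + a) > 0" for k using a by (intro Gamma_real_pos) auto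
  have "(\<lambda>k. Gamma_series a k) \<longlonglongrightarrow> Gamma a" by (rule Gamma_series_LIMSEQ)
  then have "(\<lambda>k. Gamma a / Gamma_series a k) \<longlonglongrightarrow> Gamma a / Gamma a"
    using Gamma_real_pos[OF a] by (intro tendsto_intros) auto
  moreover have "(\<lambda>k. (real k / (real k + 1)) powr a) \<longlonglongrightarrow> 1 powr a"
  proof (intro tendsto_intros)
    have "(\<lambda>k. 1 - inverse (real (Suc k))) \<longlonglongrightarrow> 1 - 0" by (intro tendsto_intros LIMSEQ_inverse_real_of_nat)
    moreover have "1 - inverse (real (Suc k)) = real k / (real k + 1)" for k by (simp add: field_simps)
    ultimately show "(\<lambda>k. real k / (real k + 1)) \<longlonglongrightarrow> 1" by simp
  qed simp
  ultimately have "(\<lambda>k. Gamma a / Gamma_series a k * (real k / (real k + 1)) powr a) \<longlonglongrightarrow> Gamma a / Gamma a * 1 powr a"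
    by (rule tendsto_mult)
  moreover have "eventually (\<lambda>k. Gamma a / Gamma_series a k * (real k / (real k + 1)) powr a = x k) sequentially"
    using eventually_gt_at_top[of 0]
  proof eventually_elim
    fix k :: nat assume k: "k > 0"
    have "Gamma (real k + 1 + a) = pochhammer a (k + 1) * Gamma a"
      using Gamma_plus_nat[OF a, of "k + 1"] by (simp add: add_ac)
    moreover have "exp (a * ln (real k)) = real k powr a" using k by (simp add: powr_def)
    ultimately show "Gamma a / Gamma_series a k * (real k / (real k + 1)) powr a = x k"
      using k by (simp add: Gamma_series_def x_def powr_divide field_simps)
  qed
  ultimately have x1: "x \<longlonglongrightarrow> 1" using Gamma_real_pos[OF a] by (simp add: tendsto_cong)
  have xp: "x k > 0" for k using Gp[of k] by (simp add: x_def)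
  obtain C1 where C1: "C1 > 0" "\<And>k. norm (x k) \<le> C1"
    using convergent_imp_Bseq[OF convergentI[OF x1]] by (auto elim: BseqE)
  have "(\<lambda>k. inverse (x k)) \<longlonglongrightarrow> inverse 1" using x1 by (intro tendsto_intros) auto
  then have "Bseq (\<lambda>k. inverse (x k))" by (rule convergent_imp_Bseq[OF convergentI])
  then obtain C2 where C2: "C2 > 0" "\<And>k. norm (inverse (x k)) \<le> C2" by (auto elim: BseqE)
  show ?thesis
  proof (rule that[of "C1 + C2"])
    fix k
    have "Gamma (real k + 1 + a) / fact k = x k * (real k + 1) powr a" by (simp add: x_def)
    also have "\<dots> \<le> (C1 + C2) * (real k + 1) powr a" using C1(2)[of k] C2(1) by (intro mult_right_mono) auto
    finally show "Gamma (real k + 1 + a) / fact k \<le> (C1 + C2) * (real k + 1) powr a" .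
    have "fact k / Gamma (real k + 1 + a) = inverse (x k) * (real k + 1) powr (- a)"
      using Gp[of k] by (simp add: x_def powr_minus field_simps)
    also have "\<dots> \<le> (C1 + C2) * (real k + 1) powr (- a)" using C2(2)[of k] C1(1) xp[of k] by (intro mult_right_mono) auto
    finally show "fact k / Gamma (real k + 1 + a) \<le> (C1 + C2) * (real k + 1) powr (- a)" .
  qed (use C1 C2 in auto)
qed

section \<open>Spectral densities of the Hardy functions\<close>

lemma integrable_weighted_ft:
  assumes \<psi>: "\<psi> \<in> test_functions {0<..}" and d: "d > 0" and m: "F \<in> borel_measurable borel"
    and F: "\<And>x. norm (F x) \<le> norm (Complex d x) powr r * norm (ft \<psi> x)"
  shows "integrable lborel (F :: real \<Rightarrow> complex)"
proof -
  obtain C where C: "0 < C" "\<And>x. norm (ft \<psi> x) \<le> C * norm (Complex d x) powr (- (r + 2))"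
    using ft_decay[OF \<psi> d] by blast
  show ?thesis
  proof (rule Bochner_Integration.integrable_bound)
    show "integrable lborel (\<lambda>x. C * inverse ((norm (Complex d x))\<^sup>2))"
      using integrable_inverse_norm_Complex[OF d] by simp
    show "AE x in lborel. norm (F x) \<le> norm (C * inverse ((norm (Complex d x))\<^sup>2))"
    proof (rule AE_I2)
      fix x
      have w: "norm (Complex d x) > 0" using Complex_nonzero[OF d] by simp
      have "norm (F x) \<le> norm (Complex d x) powr r * (C * norm (Complex d x) powr (- (r + 2)))"
        by (rule order_trans[OF F]) (intro mult_left_mono C; simp)
      also have "\<dots> = C * (norm (Complex d x) powr r * norm (Complex d x) powr (- (r + 2)))" by simp
      also have "norm (Complex d x) powr r * norm (Complex d x) powr (- (r + 2)) = norm (Complex d x) powr (- 2)"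
        by (simp only: powr_add[symmetric]) simp
      also have "\<dots> = inverse ((norm (Complex d x))\<^sup>2)" using w powr_realpow[of "norm (Complex d x)" 2] by (simp add: powr_minus)
      finally show "norm (F x) \<le> norm (C * inverse ((norm (Complex d x))\<^sup>2))" using C by simp
    qed
  qed (use m in simp)
qed

lemma ft_injective:
  assumes "integrable lborel u" "continuous_on UNIV u" "\<And>t. norm (u t) \<le> B"
    and "integrable lborel v" "continuous_on UNIV v" "\<And>t. norm (v t) \<le> B'"
    and "integrable lborel (ft u)" "\<And>x. ft u x = ft v x"
  shows "u t = (v t :: complex)"
proof -
  have "ft u = ft v" using assms(8) by (simp add: fun_eq_iff)
  then have "2 * pi * u t = 2 * pi * v t"
    using fourier_inversion[OF assms(1,2,3), of t] fourier_inversion[OF assms(4,5,6), of t] assms(7) by simp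
  then show ?thesis by simp
qed

text \<open>The kernel of fractional integration of order \<open>b\<close>, damped by
  \<open>exp (- d t)\<close> and normalised to have the transform
  \<open>Complex d x powr (- b)\<close>.\<close>

definition gamma_kernel :: "real \<Rightarrow> real \<Rightarrow> real \<Rightarrow> complex" where
  "gamma_kernel b d t = of_real (gk b d t / Gamma b)"

lemma gamma_kernel:
  assumes "b > 0" "d > 0"
  shows "integrable lborel (gamma_kernel b d)" "ft (gamma_kernel b d) x = Complex d x powr (- of_real b)"
    "t \<le> 0 \<Longrightarrow> gamma_kernel b d t = 0"
proof -
  show "integrable lborel (gamma_kernel b d)"
    unfolding gamma_kernel_def[abs_def] by (intro integrable_of_real integrable_divide gk_integrable assms)
  have "ft (gamma_kernel b d) x = ft (\<lambda>t. of_real (1 / Gamma b) * of_real (gk b d t)) x"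
    unfolding gamma_kernel_def[abs_def] by (simp add: field_simps)
  also have "\<dots> = Complex d x powr (- of_real b)"
    unfolding ft_cmult ft_gk[OF assms] using Gamma_real_pos[OF assms(1)] by simp
  finally show "ft (gamma_kernel b d) x = Complex d x powr (- of_real b)" .
qed (simp add: gamma_kernel_def)

text \<open>The function \<open>g\<close> below is the fractional derivative of order \<open>r\<close> of the test function \<open>\<psi>\<close>
  (more precisely \<open>(d + D)\<^sup>r \<psi>\<close>), multiplied by a bounded multiplier with a causal kernel \<open>m\<close>.\<close>

lemma causal_multiplier:
  assumes \<psi>: "\<psi> \<in> test_functions {0<..}" and d: "d > 0" and r: "r < real N"
    and m: "integrable lborel m" "\<And>t. t \<le> 0 \<Longrightarrow> m t = 0"
    and M: "\<And>x. norm (ft m x) \<le> norm (Complex d x) powr (r - real N)"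
  obtains g where "integrable lborel g" "continuous_on UNIV g" "\<And>t. t \<le> 0 \<Longrightarrow> g t = 0" "\<exists>B. \<forall>t. norm (g t) \<le> B"
    "\<And>x. ft g x = ft m x * Complex d x ^ N * ft \<psi> x" "integrable lborel (ft g)"
proof -
  \<comment> \<open>The integer order \<open>N\<close> of differentiation comes first, since it
    preserves test functions; the decay of \<open>ft m\<close> then takes the surplus
    \<open>N - r\<close> back.\<close>
  obtain \<zeta> where z: "\<zeta> \<in> test_functions {0<..}" "\<And>x. ft \<zeta> x = Complex d x ^ N * ft \<psi> x"
    using ft_multiplier[OF \<psi>] by blast
  obtain B where B: "\<And>x. norm (\<zeta> x) \<le> B" using test_functions_bounded[OF z(1)] by blast
  have zi: "integrable lborel \<zeta>" using z(1) by (rule test_functions_integrable)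
  have z0: "\<zeta> t = 0" if "t \<le> 0" for t
    using test_functions_cases[OF z(1)] that by (metis le_less_trans)
  define g where "g = conv m \<zeta>"
  have ftg: "ft g x = ft m x * Complex d x ^ N * ft \<psi> x" for x
    unfolding g_def ft_conv(1)[OF m(1) zi] z(2) by simp
  have gi: "integrable lborel g" unfolding g_def by (rule ft_conv(2)[OF m(1) zi])
  show ?thesis
  proof (rule that)
    show "integrable lborel g" by (rule gi)
    show "continuous_on UNIV g" unfolding g_def by (rule continuous_conv[OF m(1) test_functions_continuous[OF z(1)] B])
    show "g t = 0" if t: "t \<le> 0" for t
    proof -
      have "m u * \<zeta> (t - u) = 0" for u using m(2)[of u] z0[of "t - u"] t by (cases "u \<le> 0") auto
      then show ?thesis unfolding g_def conv_def by (simp only:) simp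
    qed
    show "\<exists>B. \<forall>t. norm (g t) \<le> B" unfolding g_def using norm_conv_le[where \<psi> = \<zeta>, OF m(1) B] by blast
    show "ft g x = ft m x * Complex d x ^ N * ft \<psi> x" for x by (rule ftg)
    show "integrable lborel (ft g)"
    proof (rule integrable_weighted_ft[OF \<psi> d measurable_ft[OF gi]])
      fix x
      have w: "norm (Complex d x) > 0" using Complex_nonzero[OF d] by simp
      have "norm (ft g x) \<le> norm (Complex d x) powr (r - real N) * norm (Complex d x) powr real N * norm (ft \<psi> x)"
        unfolding ftg using M[of x] w by (simp add: norm_mult norm_power powr_realpow mult_right_mono)
      also have "norm (Complex d x) powr (r - real N) * norm (Complex d x) powr real N = norm (Complex d x) powr r"
        by (simp add: powr_add[symmetric])
      finally show "norm (ft g x) \<le> norm (Complex d x) powr r * norm (ft \<psi> x)" .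
    qed
  qed
qed

lemma Complex_powr_nat: "d > 0 \<Longrightarrow> Complex d x powr (of_real a - of_real b) * Complex d x ^ n = Complex d x powr of_real (a - b + real n)"
  using Complex_nonzero[of d x] by (simp add: powr_add powr_diff powr_nat')

text \<open>The Hardy functions have no spectrum on the positive half line: the weighted function
  times \<open>ft \<psi>\<close> is, up to sign, the transform of a continuous causal function, and
  its integral is \<open>2 * pi\<close> times the value of that function at 0.\<close>

lemma spectral_hardy_fun:
  assumes d: "d > 0" and a: "a \<ge> 0"
  shows "spectral d a (hardy_fun d k) (\<lambda>_. 0)"
  unfolding spectral_def
proof (intro conjI ballI)
  fix \<psi> assume \<psi>: "\<psi> \<in> test_functions {0<..}"
  obtain N :: nat where N: "a + 1 < real N" using reals_Archimedean2 by blast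
  \<comment> \<open>With this exponent, \<open>ft m\<close> times \<open>Complex d x ^ N\<close> is
    \<open>Complex d x powr a * hardy_fun d k x\<close> up to sign.\<close>
  define a' where "a' = real N - a"
  have a': "a' > 0" "a' \<ge> 0" using N by (auto simp: a'_def)
  define m where "m t = complex_of_real (lag_dual d a' k t)" for t
  have ftm: "ft m x = (- 1) ^ k * hardy_fun d k x * Complex d x powr (- of_real a')" for x
    unfolding m_def by (rule ft_lag_dual[OF d a'(2)])
  have nm: "norm (ft m x) \<le> norm (Complex d x) powr (a - 1 - real N)" for x
  proof -
    have w: "norm (Complex d x) > 0" using Complex_nonzero[OF d] by simp
    have "norm (ft m x) = norm (Complex d x) powr (- 1) * norm (Complex d x) powr (- a')"
    proof -
      have "norm (Complex d x powr (- of_real a')) = norm (Complex d x) powr (- a')"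
        using norm_powr_of_real[OF Complex_nonzero[OF d], of x "- a'"] by simp
      then show ?thesis using w unfolding ftm norm_mult norm_power norm_hardy_fun[OF d]
        by (simp add: powr_minus divide_inverse)
    qed
    also have "\<dots> = norm (Complex d x) powr (a - 1 - real N)"
      by (simp only: powr_add[symmetric]) (simp add: a'_def algebra_simps)
    finally show ?thesis by simp
  qed
  have mi: "integrable lborel m" unfolding m_def[abs_def] by (intro integrable_of_real integrable_lag d a')
  obtain g where g: "integrable lborel g" "continuous_on UNIV g" "\<And>t. t \<le> 0 \<Longrightarrow> g t = 0" "\<exists>B. \<forall>t. norm (g t) \<le> B"
    "\<And>x. ft g x = ft m x * Complex d x ^ N * ft \<psi> x" "integrable lborel (ft g)"
    by (rule causal_multiplier[OF \<psi> d _ mi _ nm]) (use N in \<open>auto simp: m_def\<close>)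
  obtain B where B: "\<And>t. norm (g t) \<le> B" using g(4) by blast
  have "Complex d x powr of_real a * hardy_fun d k x * ft \<psi> x = (- 1) ^ k * (exp (\<i> * of_real (x * 0)) * ft g x)" for x
  proof -
    have "Complex d x powr (of_real 0 - of_real a') * Complex d x ^ N = Complex d x powr of_real a"
      unfolding Complex_powr_nat[OF d] by (simp add: a'_def)
    then have "Complex d x powr (- of_real a') * Complex d x ^ N = Complex d x powr of_real a" by simp
    then have "ft g x = (- 1) ^ k * (Complex d x powr of_real a * hardy_fun d k x * ft \<psi> x)"
      unfolding g(5) ftm by (simp add: mult_ac)
    then show ?thesis by (simp add: power_mult_distrib[symmetric] mult.assoc[symmetric])
  qed
  then have "(LINT x|lborel. Complex d x powr of_real a * hardy_fun d k x * ft \<psi> x) = (- 1) ^ k * (LINT x|lborel. exp (\<i> * of_real (x * 0)) * ft g x)"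
    by (simp del: mult_zero_right)
  \<comment> \<open>Inversion at the point 0, where the causal function \<open>g\<close>
    vanishes.\<close>
  also have "\<dots> = 0" unfolding fourier_inversion[OF g(1,2) B g(6)] by (simp add: g(3))
  finally show "(LINT x|lborel. Complex d x powr of_real a * hardy_fun d k x * ft \<psi> x) = (LINT t|lborel. 0 * \<psi> t)" by simp
qed auto

text \<open>A Rodrigues formula in integrated form: fractional integration of order
  \<open>a + k\<close> reduces the Laguerre function to a single power times an exponential. After
  expanding \<open>(u + t) ^ i\<close>, the coefficient of \<open>u ^ j\<close> with
  \<open>j < k\<close> is a finite difference of order \<open>k - j\<close> of a polynomial of
  degree \<open>k - j - 1\<close>, hence 0.\<close>

lemma lag_gk_conv:
  assumes d: "d > 0" and a: "a > 0" and u: "u > 0"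
  shows "(LINT t|lborel. gk (a + real k) d t * lag d a k (u + t)) =
     Gamma (a + real k) * ((- 1) ^ k * (2 * d) powr (- a) / Gamma (real k + 1 + a)) * gk (real k + 1) d u"
    and "integrable lborel (\<lambda>t. gk (a + real k) d t * lag d a k (u + t))"
proof -
  define \<eta> where "\<eta> = a + real k"
  have eta: "\<eta> > 0" using a by (simp add: \<eta>_def)
  define E where "E i j = lag_coeff d a k i * real (i choose j) * u ^ j * exp (- (d * u))" for i j
  have e: "gk \<eta> d t * lag d a k (u + t) = (\<Sum>i\<le>k. \<Sum>j\<le>i. E i j * gk (\<eta> + real (i - j)) (2 * d) t)" for t
  proof (cases "t > 0")
    case True
    have "gk \<eta> d t * gk (real i + 1) d (u + t) = (\<Sum>j\<le>i. real (i choose j) * u ^ j * exp (- (d * u)) * gk (\<eta> + real (i - j)) (2 * d) t)" for i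
    proof -
      have A: "gk (real i + 1) d (u + t) = (\<Sum>j\<le>i. real (i choose j) * u ^ j * t ^ (i - j)) * (exp (- (d * u)) * exp (- (d * t)))"
      proof -
        have "gk (real i + 1) d (u + t) = (u + t) ^ i * (exp (- (d * u)) * exp (- (d * t)))"
          using True u by (simp add: gk_def powr_realpow exp_add[symmetric] algebra_simps)
        then show ?thesis by (simp only: binomial_ring)
      qed
      have B: "gk \<eta> d t * (t ^ (i - j) * exp (- (d * t))) = gk (\<eta> + real (i - j)) (2 * d) t" for j
        using True by (simp add: gk_def powr_realpow[symmetric] powr_add[symmetric] exp_add[symmetric] algebra_simps)
      have "gk \<eta> d t * gk (real i + 1) d (u + t) = (\<Sum>j\<le>i. real (i choose j) * u ^ j * exp (- (d * u)) * (gk \<eta> d t * (t ^ (i - j) * exp (- (d * t)))))"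
        unfolding A by (simp add: sum_distrib_left sum_distrib_right mult_ac)
      then show ?thesis unfolding B .
    qed
    then show ?thesis unfolding lag_def sum_distrib_left E_def
      by (simp only: mult.left_commute[of "gk \<eta> d t"] sum_distrib_left mult.assoc)
  qed simp
  have gi: "integrable lborel (gk (\<eta> + real n) (2 * d))" for n using eta d by (intro gk_integrable) auto
  show "integrable lborel (\<lambda>t. gk (a + real k) d t * lag d a k (u + t))"
    unfolding \<eta>_def[symmetric] e by (intro Bochner_Integration.integrable_sum integrable_mult_right gi)
  define c where "c i j = E i j * (Gamma (\<eta> + real (i - j)) * (2 * d) powr (- (\<eta> + real (i - j))))" for i j
  have "(LINT t|lborel. gk \<eta> d t * lag d a k (u + t)) = (\<Sum>i\<le>k. \<Sum>j\<le>i. c i j)"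
    unfolding e c_def using gi eta d
    by (simp add: Bochner_Integration.integral_sum gk_integral del: of_nat_diff)
  also have "\<dots> = (\<Sum>i\<le>k. \<Sum>j\<le>k. c i j)"
    by (intro sum.cong refl sum.mono_neutral_left) (auto simp: c_def E_def binomial_eq_0)
  also have "\<dots> = (\<Sum>j\<le>k. \<Sum>i\<le>k. c i j)" by (rule sum.swap)
  also have "\<dots> = (\<Sum>j\<le>k. if j = k then c k k else 0)"
  proof (rule sum.cong[OF refl])
    fix j assume "j \<in> {..k}"
    then have j: "j \<le> k" by simp
    have "(\<Sum>i\<le>k. c i j) = (\<Sum>i=j..k. c i j)"
      by (intro sum.mono_neutral_right) (auto simp: c_def E_def binomial_eq_0)
    also have "\<dots> = (\<Sum>i\<le>k - j. c (j + i) j)" using j by (subst sum.atLeastAtMost_shift_0) (auto simp: atLeast0AtMost)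
    also have "\<dots> = (if j = k then c k k else 0)"
    proof (cases "j = k")
      case False
      define n where "n = k - j - 1"
      have kn: "k = j + Suc n" using False j by (simp add: n_def)
      define Q where "Q = real (k choose j) * (- (2 * d)) ^ j * u ^ j * exp (- (d * u)) * (2 * d) powr (- \<eta>)"
      have "c (j + i) j = Q * ((- 1) ^ i * real (Suc n choose i) * pochhammer (a + real j + 1 + real i) n)" if i: "i \<le> k - j" for i
      proof -
        have p: "a + real j + 1 + real i > 0" using a by auto
        have ch: "(k choose (j + i)) * ((j + i) choose j) = (k choose j) * (Suc n choose i)"
          using choose_mult[of j "j + i" k] i j by (simp add: kn)
        have G: "Gamma (\<eta> + real i) = pochhammer (a + real j + 1 + real i) n * Gamma (a + real j + 1 + real i)"
          using Gamma_plus_nat[OF p, of n] by (simp add: \<eta>_def kn add_ac)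
        have pw: "(2 * d) powr (- (\<eta> + real i)) = (2 * d) powr (- \<eta>) / (2 * d) ^ i"
        proof -
          have "- (\<eta> + real i) = - \<eta> - real i" by simp
          then show ?thesis using d by (simp only: powr_diff powr_realpow)
        qed
        have sg: "(- (2 * d)) ^ (j + i) / (2 * d) ^ i = (- (2 * d)) ^ j * (- 1) ^ i"
          using d by (simp add: power_add power_minus[of "2 * d" i])
        have "c (j + i) j = real ((k choose (j + i)) * ((j + i) choose j)) * ((- (2 * d)) ^ (j + i) / (2 * d) ^ i) * (u ^ j * exp (- (d * u)))
            * (Gamma (\<eta> + real i) / Gamma (a + real j + 1 + real i)) * (2 * d) powr (- \<eta>)"
        proof -
          have e1: "real (j + i) + 1 + a = a + real j + 1 + real i" by simp
          show ?thesis unfolding c_def E_def lag_coeff_def add_diff_cancel_left' pw e1 by (simp add: mult_ac)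
        qed
        also have "Gamma (\<eta> + real i) / Gamma (a + real j + 1 + real i) = pochhammer (a + real j + 1 + real i) n"
          using G Gamma_real_pos[OF p] by simp
        finally show ?thesis unfolding ch sg Q_def by simp
      qed
      then have "(\<Sum>i\<le>k - j. c (j + i) j) = (\<Sum>i\<le>Suc n. Q * ((- 1) ^ i * real (Suc n choose i) * pochhammer (a + real j + 1 + real i) n))"
        by (intro sum.cong) (auto simp: kn)
      also have "\<dots> = 0"
        unfolding sum_distrib_left[symmetric] using alternating_pochhammer_sum(1)[of n "Suc n" "a + real j + 1"] by simp
      finally show ?thesis using False by simp
    qed simp
    finally show "(\<Sum>i\<le>k. c i j) = (if j = k then c k k else 0)" .
  qed
  also have "\<dots> = c k k" by simp
  also have "c k k = Gamma \<eta> * ((- 1) ^ k * (2 * d) powr (- a) / Gamma (real k + 1 + a)) * gk (real k + 1) d u"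
  proof -
    have "(2 * d) powr (- \<eta>) = (2 * d) powr (- a) / (2 * d) ^ k"
    proof -
      have "- \<eta> = - a - real k" by (simp add: \<eta>_def)
      then show ?thesis using d by (simp only: powr_diff powr_realpow)
    qed
    then show ?thesis using d u by (simp add: c_def E_def lag_coeff_def gk_def powr_realpow power_minus[of "2 * d"])
  qed
  finally show "(LINT t|lborel. gk (a + real k) d t * lag d a k (u + t)) =
     Gamma (a + real k) * ((- 1) ^ k * (2 * d) powr (- a) / Gamma (real k + 1 + a)) * gk (real k + 1) d u"
    by (simp add: \<eta>_def)
qed

text \<open>Both sides are reduced to the same pairing of \<open>K1\<close> with the fractional
  derivative \<open>g\<close> of \<psi>. On the left \<open>g\<close> absorbs all powers of
  \<open>d + i x\<close>; on the right \<psi> is the fractional integral of \<open>g\<close>, and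
  the integration is shifted onto the Laguerre function, where \<open>lag_gk_conv\<close> evaluates
  it.\<close>

lemma spectral_cnj_hardy_fun:
  assumes d: "d > 0" and a: "a > 0"
  shows "spectral d a (\<lambda>x. cnj (hardy_fun d k x))
    (\<lambda>t. of_real (2 * pi * (- 1) ^ k * (2 * d) powr a * Gamma (real k + 1 + a) / fact k * lag d a k t))"
  unfolding spectral_def
proof (intro conjI ballI)
  fix \<psi> assume \<psi>: "\<psi> \<in> test_functions {0<..}"
  \<comment> \<open>The weight contributes the power \<open>a\<close> of \<open>d + i x\<close>, the
    numerator of the conjugated Hardy function the power \<open>k\<close>.\<close>
  define \<eta> where "\<eta> = a + real k"
  have eta: "\<eta> > 0" using a by (simp add: \<eta>_def)
  obtain N :: nat where N: "\<eta> < real N" using reals_Archimedean2 by blast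
  define b where "b = real N - \<eta>"
  have b: "b > 0" using N by (simp add: b_def)
  have pint: "integrable lborel \<psi>" by (rule test_functions_integrable[OF \<psi>])
  have [measurable]: "\<psi> \<in> borel_measurable borel" using \<psi> by (rule test_functions_measurable)
  have nm: "norm (ft (gamma_kernel b d) x) \<le> norm (Complex d x) powr (\<eta> - real N)" for x
    unfolding gamma_kernel(2)[OF b d] using norm_powr_of_real[OF Complex_nonzero[OF d], of x "- b"] by (simp add: b_def)
  obtain g where g: "integrable lborel g" "continuous_on UNIV g" "\<And>t. t \<le> 0 \<Longrightarrow> g t = 0" "\<exists>B. \<forall>t. norm (g t) \<le> B"
    "\<And>x. ft g x = ft (gamma_kernel b d) x * Complex d x ^ N * ft \<psi> x" "integrable lborel (ft g)"
    by (rule causal_multiplier[OF \<psi> d N gamma_kernel(1)[OF b d] gamma_kernel(3)[OF b d] nm]) auto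
  obtain B where B: "\<And>t. norm (g t) \<le> B" using g(4) by blast
  have [measurable]: "g \<in> borel_measurable borel" "ft g \<in> borel_measurable borel" using g(1,6) by auto
  have ftg: "ft g x = Complex d x powr of_real \<eta> * ft \<psi> x" for x
  proof -
    have "Complex d x powr (of_real 0 - of_real b) * Complex d x ^ N = Complex d x powr of_real \<eta>"
      unfolding Complex_powr_nat[OF d] by (simp add: b_def)
    then show ?thesis unfolding g(5) gamma_kernel(2)[OF b d] by simp
  qed
  define K1 where "K1 t = complex_of_real (gk (real k + 1) d t)" for t
  have [measurable]: "K1 \<in> borel_measurable borel" unfolding K1_def[abs_def] by measurable
  have K1i: "integrable lborel K1" unfolding K1_def[abs_def] using d by (intro integrable_of_real gk_integrable) auto
  \<comment> \<open>The remaining factor \<open>1 / (d - i x) ^ (k + 1)\<close> is a Gamma transform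
    taken at \<open>- x\<close>; Fubini and inversion turn the product into an integral over
    \<open>t\<close>.\<close>
  have left: "(LINT x|lborel. Complex d x powr of_real a * cnj (hardy_fun d k x) * ft \<psi> x) = 2 * pi / fact k * (LINT t|lborel. K1 t * g t)"
  proof -
    have e: "Complex d x powr of_real a * cnj (hardy_fun d k x) * ft \<psi> x = of_real (1 / fact k) * (ft g x * ft K1 (- x))" for x
    proof -
      have w: "Complex d x \<noteq> 0" "Complex d (- x) \<noteq> 0" by (auto simp: Complex_nonzero[OF d])
      have c: "cnj (Complex d x) = Complex d (- x)" by (simp add: complex_eq_iff)
      have "ft K1 (- x) = fact k * Complex d (- x) powr (- of_real (real k + 1))"
        unfolding K1_def using d Gamma_fact[of k, where 'a = real] by (subst ft_gk) (auto simp: add.commute)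
      also have "- complex_of_real (real k + 1) = - of_nat (k + 1)" by simp
      also have "Complex d (- x) powr (- of_nat (k + 1)) = 1 / Complex d (- x) ^ (k + 1)"
        using w powr_nat'[of "Complex d (- x)" "k + 1"] by (simp only: powr_minus divide_inverse mult_1_left) simp
      finally have K: "ft K1 (- x) = fact k / Complex d (- x) ^ (k + 1)" by simp
      have "Complex d x powr of_real \<eta> = Complex d x powr of_real a * Complex d x ^ k"
        using w by (simp add: \<eta>_def powr_add powr_nat')
      moreover have "cnj (hardy_fun d k x) = Complex d x ^ k / Complex d (- x) ^ (k + 1)"
        by (simp add: hardy_fun_def c[symmetric])
      ultimately show ?thesis unfolding ftg K by simp
    qed
    have "(LINT x|lborel. Complex d x powr of_real a * cnj (hardy_fun d k x) * ft \<psi> x) = of_real (1 / fact k) * (LINT x|lborel. ft g x * ft K1 (- x))"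
      unfolding e by simp
    also have "(LINT x|lborel. ft g x * ft K1 (- x)) = (LINT x|lborel. LINT t|lborel. ft g x * (exp (\<i> * of_real (x * t)) * K1 t))"
      unfolding ft_def[of K1] by simp
    also have "\<dots> = (LINT t|lborel. LINT x|lborel. ft g x * (exp (\<i> * of_real (x * t)) * K1 t))"
    proof (rule LINT_swap(1)[symmetric])
      have "(\<integral>\<^sup>+x. \<integral>\<^sup>+t. ennreal (norm (ft g x * (exp (\<i> * of_real (x * t)) * K1 t))) \<partial>lborel \<partial>lborel) =
          (\<integral>\<^sup>+x. ennreal (norm (ft g x)) * (\<integral>\<^sup>+t. ennreal (norm (K1 t)) \<partial>lborel) \<partial>lborel)"
        by (simp add: norm_mult ennreal_mult nn_integral_cmult del: of_real_mult)
      also have "\<dots> = (\<integral>\<^sup>+x. ennreal (norm (ft g x)) \<partial>lborel) * (\<integral>\<^sup>+t. ennreal (norm (K1 t)) \<partial>lborel)"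
        by (rule nn_integral_multc) measurable
      also have "\<dots> < \<infinity>" using nn_integral_norm_finite[OF g(6)] nn_integral_norm_finite[OF K1i] by (simp add: ennreal_mult_less_top)
      finally show "(\<integral>\<^sup>+x. \<integral>\<^sup>+t. ennreal (norm (ft g x * (exp (\<i> * of_real (x * t)) * K1 t))) \<partial>lborel \<partial>lborel) < \<infinity>" .
    qed measurable
    also have "\<dots> = (LINT t|lborel. 2 * pi * (K1 t * g t))"
    proof (rule Bochner_Integration.integral_cong[OF refl])
      fix t
      have "(LINT x|lborel. ft g x * (exp (\<i> * of_real (x * t)) * K1 t)) = (LINT x|lborel. K1 t * (exp (\<i> * of_real (x * t)) * ft g x))"
        by (simp add: mult_ac)
      also have "\<dots> = K1 t * (2 * pi * g t)"
        unfolding fourier_inversion[OF g(1,2) B g(6), symmetric] by (rule integral_mult_right_zero)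
      finally show "(LINT x|lborel. ft g x * (exp (\<i> * of_real (x * t)) * K1 t)) = 2 * pi * (K1 t * g t)" by simp
    qed
    finally show ?thesis by simp
  qed
  define m where "m = gamma_kernel \<eta> d"
  have mi: "integrable lborel m" unfolding m_def by (rule gamma_kernel(1)[OF eta d])
  have [measurable]: "m \<in> borel_measurable borel" using mi by auto
  obtain B' where B': "\<And>t. norm (\<psi> t) \<le> B'" using test_functions_bounded[OF \<psi>] by blast
  \<comment> \<open>Fractional integration of order \<eta> inverts the passage from \<psi> to
    \<open>g\<close>; the identity is checked on transforms.\<close>
  have psi: "\<psi> t = conv m g t" for t
  proof (rule ft_injective[symmetric])
    show "integrable lborel (conv m g)" by (rule ft_conv(2)[OF mi g(1)])
    show "continuous_on UNIV (conv m g)" by (rule continuous_conv[OF mi g(2) B])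
    show "norm (conv m g t) \<le> B * (LINT t|lborel. norm (m t))" for t by (rule norm_conv_le[OF mi B])
    show fc: "ft (conv m g) x = ft \<psi> x" for x
    proof -
      have "Complex d x powr (- of_real \<eta>) * Complex d x powr of_real \<eta> = 1"
        using Complex_nonzero[OF d] by (simp add: powr_minus)
      moreover have "ft m x = Complex d x powr (- of_real \<eta>)" unfolding m_def by (rule gamma_kernel(2)[OF eta d])
      ultimately show ?thesis unfolding ft_conv(1)[OF mi g(1)] ftg by (simp add: mult.assoc[symmetric])
    qed
    have "integrable lborel (ft \<psi>)"
      by (rule integrable_weighted_ft[OF \<psi> d measurable_ft[OF pint], of 0]) (use Complex_nonzero[OF d] in auto)
    then show "integrable lborel (ft (conv m g))" by (simp add: fc cong: Bochner_Integration.integrable_cong)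
    show "norm (\<psi> t) \<le> B'" for t by (rule B')
  qed (use pint test_functions_continuous[OF \<psi>] in auto)
  define Lc where "Lc t = complex_of_real (lag d a k t)" for t
  have [measurable]: "Lc \<in> borel_measurable borel" unfolding Lc_def[abs_def] by measurable
  have Lci: "integrable lborel Lc" unfolding Lc_def[abs_def] using a by (intro integrable_of_real integrable_lag d) auto
  define q where "q = (- 1) ^ k * (2 * d) powr (- a) / Gamma (real k + 1 + a)"
  \<comment> \<open>Fubini moves the kernel \<open>m\<close> from \<open>g\<close> onto the Laguerre
    function.\<close>
  have right: "(LINT t|lborel. Lc t * \<psi> t) = of_real q * (LINT t|lborel. K1 t * g t)"
  proof -
    have "(LINT t|lborel. Lc t * \<psi> t) = (LINT t|lborel. LINT u|lborel. Lc t * (m (t - u) * g u))"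
      unfolding psi conv_commute by simp
    also have "\<dots> = (LINT u|lborel. LINT t|lborel. Lc t * (m (t - u) * g u))"
    proof (rule LINT_swap(1)[symmetric])
      have "(\<integral>\<^sup>+t. \<integral>\<^sup>+u. ennreal (norm (Lc t * (m (t - u) * g u))) \<partial>lborel \<partial>lborel) \<le>
          (\<integral>\<^sup>+t. ennreal (norm (Lc t) * B) * (\<integral>\<^sup>+u. ennreal (norm (m u)) \<partial>lborel) \<partial>lborel)"
      proof (rule nn_integral_mono)
        fix t
        have "(\<integral>\<^sup>+u. ennreal (norm (Lc t * (m (t - u) * g u))) \<partial>lborel) \<le> (\<integral>\<^sup>+u. ennreal (norm (Lc t) * B) * ennreal (norm (m (t - u))) \<partial>lborel)"
        proof (rule nn_integral_mono)
          fix u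
          have "norm (Lc t * (m (t - u) * g u)) \<le> norm (Lc t) * B * norm (m (t - u))"
            using mult_left_mono[OF B[of u], of "norm (Lc t) * norm (m (t - u))"] by (simp add: norm_mult mult_ac)
          moreover have "0 \<le> norm (Lc t) * B" using order_trans[OF norm_ge_zero B[of 0]] by (intro mult_nonneg_nonneg) auto
          ultimately show "ennreal (norm (Lc t * (m (t - u) * g u))) \<le> ennreal (norm (Lc t) * B) * ennreal (norm (m (t - u)))"
            by (simp add: ennreal_mult[symmetric] ennreal_leI)
        qed
        also have "\<dots> = ennreal (norm (Lc t) * B) * (\<integral>\<^sup>+u. ennreal (norm (m (t - u))) \<partial>lborel)"
          by (rule nn_integral_cmult) measurable
        also have "(\<integral>\<^sup>+u. ennreal (norm (m (t - u))) \<partial>lborel) = (\<integral>\<^sup>+u. ennreal (norm (m u)) \<partial>lborel)"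
          by (rule nn_integral_shift(3)[of "\<lambda>u. ennreal (norm (m u))"]) measurable
        finally show "(\<integral>\<^sup>+u. ennreal (norm (Lc t * (m (t - u) * g u))) \<partial>lborel) \<le> ennreal (norm (Lc t) * B) * (\<integral>\<^sup>+u. ennreal (norm (m u)) \<partial>lborel)" .
      qed
      also have "\<dots> = (\<integral>\<^sup>+t. ennreal (norm (Lc t) * B) \<partial>lborel) * (\<integral>\<^sup>+u. ennreal (norm (m u)) \<partial>lborel)"
        by (rule nn_integral_multc) measurable
      also have "\<dots> < \<infinity>"
      proof -
        have "(\<integral>\<^sup>+t. ennreal (norm (Lc t) * B) \<partial>lborel) < \<infinity>"
          using nn_integral_norm_finite[OF integrable_mult_right[OF Lci, of "of_real B"]] order_trans[OF norm_ge_zero B[of 0]]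
          by (simp add: norm_mult mult.commute)
        then show ?thesis using nn_integral_norm_finite[OF mi] by (simp add: ennreal_mult_less_top)
      qed
      finally show "(\<integral>\<^sup>+t. \<integral>\<^sup>+u. ennreal (norm (Lc t * (m (t - u) * g u))) \<partial>lborel \<partial>lborel) < \<infinity>" .
    qed measurable
    also have "\<dots> = (LINT u|lborel. of_real q * (K1 u * g u))"
    proof (rule Bochner_Integration.integral_cong[OF refl])
      fix u
      show "(LINT t|lborel. Lc t * (m (t - u) * g u)) = of_real q * (K1 u * g u)"
      proof (cases "u \<le> 0")
        case True then show ?thesis by (simp add: g(3))
      next
        case False
        then have u: "u > 0" by simp
        have "(LINT t|lborel. Lc t * (m (t - u) * g u)) = (LINT t|lborel. Lc t * m (t - u)) * g u"
          by (simp add: mult.assoc[symmetric])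
        also have "(LINT t|lborel. Lc t * m (t - u)) = (LINT t|lborel. Lc (u + t) * m t)"
          using LINT_shift(1)[of "\<lambda>t. Lc (u + t) * m t" u] by simp
        also have "\<dots> = (LINT t|lborel. of_real (gk \<eta> d t * lag d a k (u + t) / Gamma \<eta>))"
          by (simp add: Lc_def m_def gamma_kernel_def mult.commute)
        also have "\<dots> = of_real ((LINT t|lborel. gk \<eta> d t * lag d a k (u + t)) / Gamma \<eta>)"
          unfolding integral_complex_of_real by simp
        also have "\<dots> = of_real q * K1 u"
          using lag_gk_conv(1)[OF d a u, of k] Gamma_real_pos[OF eta] by (simp add: \<eta>_def[symmetric] K1_def q_def)
        finally show ?thesis by simp
      qed
    qed
    finally show ?thesis by simp
  qed
  have G: "Gamma (real k + 1 + a) > 0" using a by (intro Gamma_real_pos) auto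
  \<comment> \<open>The normalisation for which \<open>p * q\<close> is the constant
    \<open>2 * pi / fact k\<close> found in \<open>left\<close>.\<close>
  define p where "p = 2 * pi * (- 1) ^ k * (2 * d) powr a * Gamma (real k + 1 + a) / fact k"
  have "p * q = 2 * pi / fact k * ((- 1) ^ k * (- 1) ^ k * ((2 * d) powr a * (2 * d) powr (- a)))"
    using G by (simp add: p_def q_def)
  also have "\<dots> = 2 * pi / fact k" using d by (simp add: powr_add[symmetric] power_mult_distrib[symmetric])
  finally have pq: "p * q = 2 * pi / fact k" .
  have "(LINT t|lborel. of_real (p * lag d a k t) * \<psi> t) = of_real p * (LINT t|lborel. Lc t * \<psi> t)"
    by (simp add: Lc_def mult.assoc)
  also have "\<dots> = of_real (p * q) * (LINT t|lborel. K1 t * g t)" unfolding right by simp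
  finally show "(LINT x|lborel. Complex d x powr of_real a * cnj (hardy_fun d k x) * ft \<psi> x) =
     (LINT t|lborel. of_real (2 * pi * (- 1) ^ k * (2 * d) powr a * Gamma (real k + 1 + a) / fact k * lag d a k t) * \<psi> t)"
    unfolding left pq p_def[symmetric] by simp
qed auto

subsection \<open>The MTC functions\<close>

text \<open>The unit factor that rotates a Hardy function so that its real part is an MTC function;
  the factor \<open>\<i>\<close> for odd indices selects the imaginary part instead, up to
  sign.\<close>

definition mtc_sign :: "nat \<Rightarrow> complex" where
  "mtc_sign j = (- 1) ^ (j div 2) * (if even j then 1 else \<i>)"

lemma norm_mtc_sign [simp]: "norm (mtc_sign j) = 1"
  by (simp add: mtc_sign_def norm_mult norm_power)

text \<open>With \<open>w = Complex (l / 2) x\<close> one has \<open>2 x + i l = 2 i cnj w\<close>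
  and \<open>2 x - i l = - 2 i w\<close>. The quotient of the constants gives the sign
  \<open>(- 1) ^ k\<close>, and the leftover factor \<open>i / 2\<close> exchanges real and
  imaginary parts.\<close>

lemma mtc_eq:
  assumes l: "l > 0"
  shows "mtc l j x = sqrt (l / pi) * Re (mtc_sign j * hardy_fun (l / 2) (j div 2) x)"
proof -
  define k where "k = j div 2"
  define w where "w = Complex (l / 2) x"
  have w: "w \<noteq> 0" using Complex_nonzero[of "l / 2"] l by (simp add: w_def)
  have 1: "complex_of_real (2 * x) + \<i> * complex_of_real l = 2 * \<i> * cnj w" by (simp add: w_def complex_eq_iff)
  have 2: "complex_of_real (2 * x) - \<i> * complex_of_real l = - (2 * \<i>) * w" by (simp add: w_def complex_eq_iff)
  have "(complex_of_real (2 * x) + \<i> * complex_of_real l) ^ k / (complex_of_real (2 * x) - \<i> * complex_of_real l) ^ (k + 1)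
     = ((2 * \<i>) / (- (2 * \<i>))) ^ k * (1 / (- (2 * \<i>))) * (cnj w ^ k / w ^ (k + 1))"
  proof -
    have "(A * c) ^ k / (B * w) ^ (k + 1) = (A / B) ^ k * (1 / B) * (c ^ k / w ^ (k + 1))" for A B c :: complex
      by (simp add: power_mult_distrib power_divide)
    then show ?thesis unfolding 1 2 .
  qed
  also have "(2 * \<i>) / (- (2 * \<i>)) = - 1" by simp
  also have "1 / (- (2 * \<i>)) = \<i> / 2" by (simp add: field_simps)
  finally have z: "(complex_of_real (2 * x) + \<i> * complex_of_real l) ^ k / (complex_of_real (2 * x) - \<i> * complex_of_real l) ^ (k + 1)
     = (- 1) ^ k * (\<i> / 2) * hardy_fun (l / 2) k x" by (simp add: hardy_fun_def w_def)
  have r: "(- 1) ^ k = complex_of_real ((- 1) ^ k)" by simp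
  show ?thesis
    unfolding mtc_def Let_def k_def[symmetric] z mtc_sign_def r by (auto simp: Im_divide_numeral)
qed

lemma of_real_mtc:
  assumes "l > 0"
  shows "complex_of_real (mtc l j x) = of_real (sqrt (l / pi) / 2) *
    (mtc_sign j * hardy_fun (l / 2) (j div 2) x + cnj (mtc_sign j) * cnj (hardy_fun (l / 2) (j div 2) x))"
  unfolding mtc_eq[OF assms] by (simp add: complex_eq_iff)

lemma abs_mtc_le:
  assumes "l > 0" shows "\<bar>mtc l j x\<bar> \<le> sqrt (l / pi) / norm (Complex (l / 2) x)"
proof -
  have "\<bar>Re (mtc_sign j * hardy_fun (l / 2) (j div 2) x)\<bar> \<le> 1 / norm (Complex (l / 2) x)"
    using abs_Re_le_cmod[of "mtc_sign j * hardy_fun (l / 2) (j div 2) x"] assms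
    by (simp add: norm_mult norm_hardy_fun)
  from mult_left_mono[OF this, of "sqrt (l / pi)"] show ?thesis
    unfolding mtc_eq[OF assms] abs_mult using assms by simp
qed

lemma measurable_mtc: assumes "l > 0" shows "mtc l j \<in> borel_measurable borel"
  unfolding mtc_eq[OF assms, abs_def] by measurable

lemma continuous_mtc: assumes l: "l > 0" shows "continuous_on UNIV (mtc l j)"
proof -
  have "complex_of_real (2 * x) - \<i> * complex_of_real l \<noteq> 0" for x using l by (simp add: complex_eq_iff)
  then show ?thesis unfolding mtc_def[abs_def] Let_def
    by (cases "even j") (auto intro!: continuous_intros)
qed

section \<open>The Cayley transform, orthonormality and completeness\<close>

definition cayley :: "real \<Rightarrow> real \<Rightarrow> complex" where "cayley d x = cnj (Complex d x) / Complex d x"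

lemma norm_cayley: "d > 0 \<Longrightarrow> norm (cayley d x) = 1"
  using Complex_nonzero[of d x] by (simp add: cayley_def norm_divide)

text \<open>\<open>1 / norm (Complex d x)^2\<close> is a multiple of the angular velocity of
  \<open>cayley d x\<close> on the circle. The integrand is therefore the derivative of a multiple
  of the \<open>n\<close>-th power, which has the same limit at both ends of the line.\<close>

lemma cayley_integral:
  assumes d: "d > 0" and n: "n > 0"
  shows "(LINT x|lborel. cayley d x ^ n / of_real ((norm (Complex d x))\<^sup>2)) = 0"
proof -
  define Z where "Z = cayley d"
  define F where "F x = (\<i> / of_real (2 * d * real n)) * Z x ^ n" for x
  define f where "f x = Z x ^ n / of_real ((norm (Complex d x))\<^sup>2)" for x
  have cx: "Complex d x = of_real d + \<i> * of_real x" for x by (simp add: complex_eq_iff)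
  have w0: "Complex d x \<noteq> 0" for x using Complex_nonzero[OF d] .
  have Zc: "Z x = (of_real d - \<i> * of_real x) / (of_real d + \<i> * of_real x)" for x
    unfolding Z_def cayley_def cx by simp
  have nn: "of_real ((norm (Complex d x))\<^sup>2) = (of_real d + \<i> * of_real x) * (of_real d - \<i> * of_real x)" for x
    unfolding complex_norm_square cx by simp
  have fc: "continuous_on UNIV f"
  proof -
    have "(of_real d + \<i> * of_real x) * (of_real d - \<i> * of_real x) \<noteq> 0" for x
      using d by (auto simp: complex_eq_iff)
    moreover have "of_real d + \<i> * of_real x \<noteq> 0" for x using d by (auto simp: complex_eq_iff)
    ultimately show ?thesis unfolding f_def Zc nn by (intro continuous_intros) auto
  qed
  have fi: "integrable lborel f"
  proof (rule Bochner_Integration.integrable_bound)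
    show "integrable lborel (\<lambda>x. inverse ((norm (Complex d x))\<^sup>2))" by (rule integrable_inverse_norm_Complex[OF d])
    show "f \<in> borel_measurable lborel" using borel_measurable_continuous_onI[OF fc] by simp
    have "norm (f x) = inverse ((norm (Complex d x))\<^sup>2)" for x
      by (simp add: f_def norm_divide norm_mult norm_power norm_cayley[OF d] Z_def divide_inverse norm_inverse del: of_real_power)
    then show "AE x in lborel. norm (f x) \<le> norm (inverse ((norm (Complex d x))\<^sup>2))" by simp
  qed
  have e: "einterval (-\<infinity>) \<infinity> = UNIV" by (auto simp: einterval_def)
  have lim: "(F \<longlongrightarrow> (\<i> / of_real (2 * d * real n)) * (- 1) ^ n) G" if G: "filterlim (\<lambda>x. norm (Complex d x)) at_top G" for G
  proof -
    have "((\<lambda>x. of_real (2 * d) / Complex d x) \<longlongrightarrow> 0) G"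
    proof (rule tendsto_divide_0[OF tendsto_const])
      show "filterlim (Complex d) at_infinity G" using G by (rule filterlim_norm_at_top_imp_at_infinity)
    qed
    then have "((\<lambda>x. of_real (2 * d) / Complex d x - 1) \<longlongrightarrow> 0 - 1) G" by (intro tendsto_intros)
    moreover have "of_real (2 * d) / Complex d x - 1 = Z x" for x
      using w0[of x] by (simp add: Z_def cayley_def field_simps) (simp add: complex_eq_iff)
    ultimately have "(Z \<longlongrightarrow> - 1) G" by simp
    then show ?thesis unfolding F_def[abs_def] by (intro tendsto_intros)
  qed
  have top: "filterlim (\<lambda>x. norm (Complex d x)) at_top at_top"
  proof (rule filterlim_at_top_mono[OF filterlim_ident])
    show "eventually (\<lambda>x. x \<le> norm (Complex d x)) at_top"
      by (rule always_eventually) (use order_trans[OF abs_ge_self norm_Complex_ge(2)] in blast)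
  qed
  have bot: "filterlim (\<lambda>x. norm (Complex d x)) at_top at_bot"
  proof (rule filterlim_at_top_mono[OF filterlim_uminus_at_top_at_bot])
    show "eventually (\<lambda>x. - x \<le> norm (Complex d x)) at_bot"
      by (rule always_eventually) (use order_trans[OF abs_ge_minus_self norm_Complex_ge(2)] in blast)
  qed
  have "(LBINT x=-\<infinity>..\<infinity>. f x) = (\<i> / of_real (2 * d * real n)) * (- 1) ^ n - (\<i> / of_real (2 * d * real n)) * (- 1) ^ n"
  proof (rule interval_integral_FTC_integrable[where F = F])
    fix x :: real
    obtain m where m: "n = Suc m" using n by (cases n) auto
    have nz: "of_real d + \<i> * of_real x \<noteq> 0" "of_real d - \<i> * of_real x \<noteq> 0" using d by (auto simp: complex_eq_iff)
    define z1 where "z1 = of_real d + \<i> * of_real x"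
    define z2 where "z2 = of_real d - \<i> * of_real x"
    have z: "z1 \<noteq> 0" "z2 \<noteq> 0" "z1 + z2 = 2 * of_real d" using nz by (auto simp: z1_def z2_def)
    have dq: "((\<lambda>z. (of_real d - \<i> * z) / (of_real d + \<i> * z)) has_field_derivative (- \<i> * (z1 + z2)) / (z1 * z1)) (at (of_real x))"
      using nz unfolding z1_def z2_def by (auto intro!: derivative_eq_intros simp: field_simps)
    have "((\<lambda>z. (\<i> / of_real (2 * d * real n)) * ((of_real d - \<i> * z) / (of_real d + \<i> * z)) ^ n) has_field_derivative f x) (at (of_real x))"
    proof (rule DERIV_cong[OF DERIV_cmult[OF DERIV_power[OF dq]]])
      have "(\<i> / of_real (2 * d * real n)) * (of_nat n * (((- \<i> * (2 * of_real d)) / (z1 * z1)) * (z2 / z1) ^ m)) = (z2 / z1) ^ m / (z1 * z1)"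
        using d n by (simp add: field_simps)
      also have "\<dots> = (z2 / z1) ^ n / (z1 * z2)" using z by (simp add: m field_simps)
      also have "\<dots> = f x" unfolding f_def nn Zc z1_def z2_def ..
      finally show "(\<i> / of_real (2 * d * real n)) * (of_nat n * (((- \<i> * (z1 + z2)) / (z1 * z1)) * ((of_real d - \<i> * of_real x) / (of_real d + \<i> * of_real x)) ^ (n - Suc 0))) = f x"
        unfolding z(3) by (simp add: m z1_def z2_def)
    qed
    from has_vector_derivative_real_field[OF this] show "(F has_vector_derivative f x) (at x)"
      unfolding F_def[abs_def] Zc by simp
    show "isCont f x" using fc by (simp add: continuous_on_eq_continuous_at)
  next
    show "set_integrable lborel (einterval (-\<infinity>) \<infinity>) f" unfolding e set_integrable_def using fi by simp
    show "((F \<circ> real_of_ereal) \<longlongrightarrow> (\<i> / of_real (2 * d * real n)) * (- 1) ^ n) (at_right (-\<infinity>))"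
      unfolding ereal_tendsto_simps by (rule lim[OF bot])
    show "((F \<circ> real_of_ereal) \<longlongrightarrow> (\<i> / of_real (2 * d * real n)) * (- 1) ^ n) (at_left \<infinity>)"
      unfolding ereal_tendsto_simps by (rule lim[OF top])
  qed simp
  then show ?thesis by (simp add: interval_lebesgue_integral_def e set_lebesgue_integral_def f_def Z_def)
qed

lemma inverse_norm_integral:
  assumes d: "d > 0" shows "(LINT x|lborel. 1 / (norm (Complex d x))\<^sup>2) = pi / d"
proof -
  have "(LINT x|lborel. inverse (1 + x\<^sup>2)) = pi"
    using LBINT_inverse_1_plus_square by (simp add: interval_lebesgue_integral_def einterval_def set_lebesgue_integral_def)
  moreover have "(LINT x|lborel. inverse (1 + x\<^sup>2)) = \<bar>inverse d\<bar> *\<^sub>R (LINT x|lborel. inverse (1 + (0 + inverse d * x)\<^sup>2))"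
    using d by (intro lborel_integral_real_affine) auto
  moreover have "inverse (1 + (0 + inverse d * x)\<^sup>2) = d\<^sup>2 * (1 / (norm (Complex d x))\<^sup>2)" for x
    using d by (simp add: cmod_power2 power_mult_distrib field_simps)
  ultimately have "pi = \<bar>inverse d\<bar> *\<^sub>R (d\<^sup>2 * (LINT x|lborel. 1 / (norm (Complex d x))\<^sup>2))"
    by (simp only: integral_mult_right_zero)
  then have "pi = inverse d * (d\<^sup>2 * (LINT x|lborel. 1 / (norm (Complex d x))\<^sup>2))" using d by simp
  then show ?thesis using d by (simp add: field_simps power2_eq_square)
qed

text \<open>Integrals of products become Fourier coefficients on the circle: the frequency
  \<open>j + k + 1\<close> is never 0, and \<open>j - k\<close> is 0 exactly on the diagonal.
  \<open>hardy_fun_orthogonal\<close> reads off the consequences.\<close>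

lemma hardy_fun_cayley:
  assumes d: "d > 0"
  shows "hardy_fun d j x * hardy_fun d k x = cayley d x ^ (j + k + 1) / of_real ((norm (Complex d x))\<^sup>2)"
    "j \<ge> k \<Longrightarrow> hardy_fun d j x * cnj (hardy_fun d k x) = cayley d x ^ (j - k) / of_real ((norm (Complex d x))\<^sup>2)"
proof -
  define w where "w = Complex d x"
  have w: "w \<noteq> 0" "cnj w \<noteq> 0" using Complex_nonzero[OF d] by (simp_all add: w_def)
  have nn: "of_real ((norm w)\<^sup>2) = w * cnj w" by (rule complex_norm_square)
  show "hardy_fun d j x * hardy_fun d k x = cayley d x ^ (j + k + 1) / of_real ((norm (Complex d x))\<^sup>2)"
    unfolding hardy_fun_def cayley_def w_def[symmetric] nn using w by (simp add: power_divide power_add field_simps)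
  assume "j \<ge> k"
  then obtain m where m: "j = k + m" using le_Suc_ex by blast
  show "hardy_fun d j x * cnj (hardy_fun d k x) = cayley d x ^ (j - k) / of_real ((norm (Complex d x))\<^sup>2)"
    unfolding hardy_fun_def cayley_def w_def[symmetric] nn m using w by (simp add: power_divide power_add field_simps)
qed

lemma hardy_fun_orthogonal:
  assumes d: "d > 0"
  shows "(LINT x|lborel. hardy_fun d j x * hardy_fun d k x) = 0"
    "(LINT x|lborel. hardy_fun d j x * cnj (hardy_fun d k x)) = (if j = k then of_real (pi / d) else 0)"
proof -
  show "(LINT x|lborel. hardy_fun d j x * hardy_fun d k x) = 0"
    unfolding hardy_fun_cayley(1)[OF d] by (rule cayley_integral[OF d]) simp
  have ge: "(LINT x|lborel. hardy_fun d j x * cnj (hardy_fun d k x)) = (if j = k then of_real (pi / d) else 0)" if "j \<ge> k" for j k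
  proof (cases "j = k")
    case True
    have "(LINT x|lborel. hardy_fun d j x * cnj (hardy_fun d k x)) = (LINT x|lborel. of_real (1 / (norm (Complex d x))\<^sup>2))"
      unfolding hardy_fun_cayley(2)[OF d that] using True by simp
    then show ?thesis using True unfolding integral_complex_of_real inverse_norm_integral[OF d] by simp
  next
    case False
    then show ?thesis unfolding hardy_fun_cayley(2)[OF d that] using that cayley_integral[OF d, of "j - k"] by simp
  qed
  show "(LINT x|lborel. hardy_fun d j x * cnj (hardy_fun d k x)) = (if j = k then of_real (pi / d) else 0)"
  proof (cases "j \<ge> k")
    case True then show ?thesis by (rule ge)
  next
    case False
    have "(LINT x|lborel. hardy_fun d j x * cnj (hardy_fun d k x)) = (LINT x|lborel. cnj (hardy_fun d k x * cnj (hardy_fun d j x)))"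
      by (simp add: mult.commute)
    also have "\<dots> = cnj (LINT x|lborel. hardy_fun d k x * cnj (hardy_fun d j x))"
      by (rule Bochner_Integration.integral_cnj)
    also have "(LINT x|lborel. hardy_fun d k x * cnj (hardy_fun d j x)) = 0" using ge[of j k] False by auto
    finally show ?thesis using False by auto
  qed
qed

lemma sq_int_mtc: assumes "l > 0" shows "sq_int (\<lambda>x. of_real (mtc l j x))"
proof (rule sq_int_bound[where c = "l / 2" and C = "sqrt (l / pi)"])
  show "(\<lambda>x. complex_of_real (mtc l j x)) \<in> borel_measurable borel"
    using measurable_mtc[OF assms] by measurable
qed (use assms abs_mtc_le[OF assms] in auto)

lemma sq_int_cnj: "sq_int f \<Longrightarrow> sq_int (\<lambda>x. cnj (f x))"
  unfolding sq_int_def by (auto intro!: measurable_compose[OF _ borel_measurable_continuous_onI[of cnj]] continuous_intros)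

text \<open>The identity \<open>Re a * Re b = Re (a * b + a * cnj b) / 2\<close> leaves only
  pairings with a conjugate, which vanish for different Hardy indices. For the two MTC functions of
  equal Hardy index the product of the signs is imaginary, so its real part is 0.\<close>

lemma mtc_orthonormal:
  assumes l: "l > 0"
  shows "(LINT x|lborel. mtc l i x * mtc l j x) = (if i = j then 1 else 0)"
proof -
  define d where "d = l / 2"
  have d: "d > 0" using l by (simp add: d_def)
  define H where "H i = hardy_fun d (i div 2)" for i
  define e where "e = mtc_sign"
  have sq: "sq_int (H i)" "sq_int (\<lambda>x. cnj (H i x))" for i
    unfolding H_def using sq_int_hardy_fun[OF d] sq_int_cnj by auto
  have ii: "integrable lborel (\<lambda>x. H i x * H j x)" "integrable lborel (\<lambda>x. H i x * cnj (H j x))" for i j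
    by (intro sq_int_mult_integrable sq)+
  have p: "mtc l i x * mtc l j x = (l / (2 * pi)) * Re (e i * e j * (H i x * H j x) + e i * cnj (e j) * (H i x * cnj (H j x)))" for x
  proof -
    have r: "Re a * Re b = Re (a * b + a * cnj b) / 2" for a b by simp
    have "mtc l i x * mtc l j x = (sqrt (l / pi) * sqrt (l / pi)) * (Re (e i * H i x) * Re (e j * H j x))"
      unfolding mtc_eq[OF l] e_def H_def d_def by (simp only: mult_ac)
    also have "sqrt (l / pi) * sqrt (l / pi) = l / pi" using l by simp
    also have "Re (e i * H i x) * Re (e j * H j x) = Re (e i * e j * (H i x * H j x) + e i * cnj (e j) * (H i x * cnj (H j x))) / 2"
      unfolding r by (simp add: mult_ac)
    finally show ?thesis by simp
  qed
  have "(LINT x|lborel. mtc l i x * mtc l j x) = (l / (2 * pi)) * Re (LINT x|lborel. e i * e j * (H i x * H j x) + e i * cnj (e j) * (H i x * cnj (H j x)))"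
    unfolding p integral_mult_right_zero using ii by (subst integral_Re) auto
  also have "(LINT x|lborel. e i * e j * (H i x * H j x) + e i * cnj (e j) * (H i x * cnj (H j x))) =
      e i * e j * (LINT x|lborel. H i x * H j x) + e i * cnj (e j) * (LINT x|lborel. H i x * cnj (H j x))"
    using ii by simp
  also have "\<dots> = e i * cnj (e j) * (if i div 2 = j div 2 then of_real (pi / d) else 0)"
    unfolding H_def hardy_fun_orthogonal[OF d] by simp
  also have "(l / (2 * pi)) * Re \<dots> = (if i = j then 1 else 0)"
  proof (cases "i div 2 = j div 2")
    case True
    have m1: "(- 1) ^ (j div 2) * (- 1) ^ (j div 2) = (1 :: complex)" by (simp add: power_mult_distrib[symmetric])
    have c: "cnj ((- 1) ^ (j div 2)) = (- 1) ^ (j div 2)" by simp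
    have "e i * cnj (e j) = ((- 1) ^ (j div 2) * (- 1) ^ (j div 2)) * ((if even i then 1 else \<i>) * cnj (if even j then 1 else \<i>))"
      unfolding e_def mtc_sign_def True complex_cnj_mult c by simp
    then have ec: "e i * cnj (e j) = (if even i then 1 else \<i>) * cnj (if even j then 1 else \<i>)" unfolding m1 by simp
    have "i = j \<longleftrightarrow> even i = even j" using True by (metis even_two_times_div_two odd_two_times_div_two_succ)
    then show ?thesis using True l unfolding ec by (auto simp: d_def)
  next
    case False
    then show ?thesis by auto
  qed
  finally show ?thesis .
qed

text \<open>The MTC functions with indices \<open>2 * k\<close> and \<open>2 * k + 1\<close> are
  multiples of the real and imaginary parts of one Hardy function, so the real function
  \<open>f\<close> is orthogonal to it and to its conjugate. These are \<open>1 / w\<close> times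
  the Cayley powers \<open>k\<close> and \<open>- (k + 1)\<close>, which together exhaust the
  integers.\<close>

lemma cayley_powi_integral_zero:
  fixes f :: "real \<Rightarrow> real"
  assumes l: "l > 0" and f: "sq_int (\<lambda>x. of_real (f x))" and z: "\<And>j. (LINT x|lborel. f x * mtc l j x) = 0"
  shows "(LINT x|lborel. of_real (f x) / Complex (l / 2) x * cayley (l / 2) x powi n) = 0"
proof -
  define d where "d = l / 2"
  have d: "d > 0" using l by (simp add: d_def)
  have w: "Complex d x \<noteq> 0" "cnj (Complex d x) \<noteq> 0" for x using Complex_nonzero[OF d] by auto
  have int: "integrable lborel (\<lambda>x. of_real (f x) * hardy_fun d k x)" for k
    by (rule sq_int_mult_integrable[OF f sq_int_hardy_fun[OF d]])
  have h: "(LINT x|lborel. of_real (f x) * hardy_fun d k x) = 0" for k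
  proof -
    have R: "(LINT x|lborel. f x * Re (mtc_sign j * hardy_fun d k x)) = 0" if "j div 2 = k" for j
    proof -
      have "(LINT x|lborel. f x * mtc l j x) = (LINT x|lborel. sqrt (l / pi) * (f x * Re (mtc_sign j * hardy_fun d k x)))"
        unfolding mtc_eq[OF l] d_def[symmetric] that by (simp only: mult_ac)
      then show ?thesis using z[of j] l by simp
    qed
    have e: "Re (mtc_sign (2 * k) * u) = (- 1) ^ k * Re u" "Re (mtc_sign (2 * k + 1) * u) = - ((- 1) ^ k * Im u)" for u
    proof -
      have r: "(- 1) ^ k = complex_of_real ((- 1) ^ k)" by simp
      show "Re (mtc_sign (2 * k) * u) = (- 1) ^ k * Re u" "Re (mtc_sign (2 * k + 1) * u) = - ((- 1) ^ k * Im u)"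
        unfolding mtc_sign_def by (simp_all add: r del: of_real_power of_real_minus of_real_1)
    qed
    have "(LINT x|lborel. (- 1) ^ k * (f x * Re (hardy_fun d k x))) = 0" "(LINT x|lborel. (- 1) ^ k * (- (f x * Im (hardy_fun d k x)))) = 0"
      using R[of "2 * k"] R[of "2 * k + 1"] unfolding e by (simp_all add: mult.left_commute)
    then have "(LINT x|lborel. f x * Re (hardy_fun d k x)) = 0" "(LINT x|lborel. f x * Im (hardy_fun d k x)) = 0" by simp_all
    then show ?thesis using int[of k] by (simp add: complex_eq_iff integral_Re[symmetric] integral_Im[symmetric])
  qed
  have c: "(LINT x|lborel. of_real (f x) * cnj (hardy_fun d k x)) = 0" for k
  proof -
    have "(LINT x|lborel. of_real (f x) * cnj (hardy_fun d k x)) = (LINT x|lborel. cnj (of_real (f x) * hardy_fun d k x))" by simp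
    also have "\<dots> = 0" unfolding Bochner_Integration.integral_cnj h by simp
    finally show ?thesis .
  qed
  show ?thesis
  proof (cases "n \<ge> 0")
    case True
    then obtain k where k: "n = int k" using nonneg_int_cases by blast
    have "of_real (f x) / Complex d x * cayley d x powi n = of_real (f x) * hardy_fun d k x" for x
      by (simp add: k hardy_fun_def cayley_def power_divide)
    then show ?thesis using h by (simp add: d_def)
  next
    case False
    then obtain k where k: "n = - int (Suc k)" by (metis int_of_nat_induct int_cases3 not_le_imp_less less_imp_le neg_int_cases of_nat_0_le_iff gr0_conv_Suc)
    have "of_real (f x) / Complex d x * cayley d x powi n = of_real (f x) * cnj (hardy_fun d k x)" for x
      using w[of x] unfolding k power_int_minus power_int_of_nat by (simp add: hardy_fun_def cayley_def power_divide field_simps)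
    then show ?thesis using c by (simp add: d_def)
  qed
qed

text \<open>The Cayley transform maps the line to the unit circle, where trigonometric polynomials are dense;
  an open interval corresponds to the part of the circle on one side of a straight line.\<close>

lemma mtc_complete:
  fixes f :: "real \<Rightarrow> real"
  assumes l: "l > 0" and f: "sq_int (\<lambda>x. of_real (f x))" and z: "\<And>j. (LINT x|lborel. f x * mtc l j x) = 0"
  shows "AE x in lborel. f x = 0"
proof -
  define d where "d = l / 2"
  have d: "d > 0" using l by (simp add: d_def)
  have w: "Complex d x \<noteq> 0" for x using Complex_nonzero[OF d] .
  define Z where "Z = cayley d"
  have nZ: "norm (Z x) = 1" for x by (simp add: Z_def norm_cayley[OF d])
  have Z0: "Z x \<noteq> 0" for x using nZ[of x] by auto
  have cx: "Complex d x = of_real d + \<i> * of_real x" for x by (simp add: complex_eq_iff)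
  have Zcont: "continuous_on UNIV Z"
  proof -
    have "of_real d + \<i> * of_real x \<noteq> 0" for x using d by (auto simp: complex_eq_iff)
    then show ?thesis unfolding Z_def cayley_def cx by (auto intro!: continuous_intros)
  qed
  have Zm [measurable]: "Z \<in> borel_measurable borel" using Zcont by (rule borel_measurable_continuous_onI)
  define u where "u x = of_real (f x) / Complex d x" for x
  have ui: "integrable lborel u"
  proof -
    have "sq_int (\<lambda>x. 1 / Complex d x)"
      by (rule sq_int_bound[OF d, where C = 1]) (auto simp: norm_divide)
    from sq_int_mult_integrable[OF f this] show ?thesis by (simp add: u_def[abs_def])
  qed
  have [measurable]: "u \<in> borel_measurable borel" using ui by auto
  have uZ: "(LINT x|lborel. u x * Z x powi n) = 0" for n
    using cayley_powi_integral_zero[OF l f z, of n] by (simp add: u_def Z_def d_def)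
  \<comment> \<open>Bounded functions all of whose moments against integer powers of
    \<open>Z\<close> vanish; allowing every integer makes the class stable under multiplication by
    \<open>Z\<close> and its inverse.\<close>
  define NN where "NN = {\<Phi> :: real \<Rightarrow> complex. \<Phi> \<in> borel_measurable borel \<and> (\<exists>B. \<forall>x. norm (\<Phi> x) \<le> B) \<and> (\<forall>n. (LINT x|lborel. u x * (\<Phi> x * Z x powi n)) = 0)}"
  have NNi: "integrable lborel (\<lambda>x. u x * (\<Phi> x * Z x powi n))" if mem: "\<Phi> \<in> NN" for \<Phi> n
  proof -
    obtain B where B: "\<And>x. norm (\<Phi> x) \<le> B" and [measurable]: "\<Phi> \<in> borel_measurable borel" using mem by (auto simp: NN_def)
    have [measurable]: "(\<lambda>x. Z x powi n) \<in> borel_measurable borel" unfolding power_int_def by measurable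
    show ?thesis
      by (rule integrable_mult_bounded[OF ui]) (use B in \<open>auto simp: norm_mult norm_power_int nZ\<close>)
  qed
  \<comment> \<open>Multiplication by \<open>F (Z x)\<close> preserves \<open>NN\<close>. Phrased
    this way, closure under products is immediate, as the algebra in the Stone-Weierstrass theorem
    requires.\<close>
  define P where "P F \<longleftrightarrow> continuous_on UNIV F \<and> (\<forall>\<Phi>\<in>NN. (\<lambda>x. of_real (F (Z x)) * \<Phi> x) \<in> NN)" for F :: "complex \<Rightarrow> real"
  have P_add: "P (\<lambda>z. F z + G z)" if "P F \<and> P G" for F G
  proof -
    have "(\<lambda>x. of_real (F (Z x) + G (Z x)) * \<Phi> x) \<in> NN" if \<Phi>: "\<Phi> \<in> NN" for \<Phi>
    proof -
      have 1: "(\<lambda>x. of_real (F (Z x)) * \<Phi> x) \<in> NN" "(\<lambda>x. of_real (G (Z x)) * \<Phi> x) \<in> NN"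
        using \<open>P F \<and> P G\<close> \<Phi> by (auto simp: P_def)
      obtain B C where B: "\<And>x. norm (of_real (F (Z x)) * \<Phi> x) \<le> B" and C: "\<And>x. norm (of_real (G (Z x)) * \<Phi> x) \<le> C"
        using 1 by (auto simp: NN_def)
      have e: "of_real (F (Z x) + G (Z x)) * \<Phi> x = of_real (F (Z x)) * \<Phi> x + of_real (G (Z x)) * \<Phi> x" for x
        by (simp add: distrib_right)
      have "norm (of_real (F (Z x) + G (Z x)) * \<Phi> x) \<le> B + C" for x
        unfolding e by (rule order_trans[OF norm_triangle_ineq add_mono[OF B C]])
      moreover have "(\<lambda>x. of_real (F (Z x) + G (Z x)) * \<Phi> x) \<in> borel_measurable borel"
        unfolding e using 1 by (auto simp: NN_def)
      moreover have "(LINT x|lborel. u x * (of_real (F (Z x) + G (Z x)) * \<Phi> x * Z x powi n)) = 0" for n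
      proof -
        have "(LINT x|lborel. u x * (of_real (F (Z x) + G (Z x)) * \<Phi> x * Z x powi n)) =
            (LINT x|lborel. u x * ((of_real (F (Z x)) * \<Phi> x) * Z x powi n) + u x * ((of_real (G (Z x)) * \<Phi> x) * Z x powi n))"
          unfolding e by (simp only: distrib_left distrib_right)
        also have "\<dots> = 0" using 1 by (subst Bochner_Integration.integral_add[OF NNi NNi]) (auto simp: NN_def)
        finally show ?thesis .
      qed
      ultimately show ?thesis unfolding NN_def by blast
    qed
    then show ?thesis using that by (auto simp: P_def intro!: continuous_intros)
  qed
  have P_mult: "P (\<lambda>z. F z * G z)" if "P F \<and> P G" for F G
    using that by (auto simp: P_def mult.assoc intro!: continuous_intros)
  have P_lin: "P (\<lambda>z. Re (c * z))" for c
  proof -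
    have "(\<lambda>x. of_real (Re (c * Z x)) * \<Phi> x) \<in> NN" if \<Phi>: "\<Phi> \<in> NN" for \<Phi>
    proof -
      obtain B where B: "\<And>x. norm (\<Phi> x) \<le> B" and [measurable]: "\<Phi> \<in> borel_measurable borel"
        and I: "\<And>n. (LINT x|lborel. u x * (\<Phi> x * Z x powi n)) = 0" using \<Phi> by (auto simp: NN_def)
      \<comment> \<open>On the circle the conjugate is the inverse, so multiplying by the real part
        of \<open>c * Z x\<close> only shifts the power \<open>n\<close> by one in either
        direction.\<close>
      have r: "of_real (Re (c * Z x)) = (c * Z x + cnj c * Z x powi (- 1)) / 2" for x
      proof -
        have "Z x * cnj (Z x) = 1" using nZ[of x] by (simp add: complex_norm_square[symmetric])
        then have "Z x powi (- 1) = cnj (Z x)" using Z0[of x] by (simp add: power_int_minus field_simps)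
        then show ?thesis by (simp add: complex_eq_iff)
      qed
      have "norm (of_real (Re (c * Z x)) * \<Phi> x) \<le> norm c * B" for x
      proof -
        have "\<bar>Re (c * Z x)\<bar> \<le> norm c" using abs_Re_le_cmod[of "c * Z x"] by (simp only: norm_mult nZ mult_1_right)
        then show ?thesis unfolding norm_mult norm_of_real using B[of x] by (intro mult_mono) auto
      qed
      moreover have "(LINT x|lborel. u x * (of_real (Re (c * Z x)) * \<Phi> x * Z x powi n)) = 0" for n
      proof -
        have "u x * (of_real (Re (c * Z x)) * \<Phi> x * Z x powi n) =
            c / 2 * (u x * (\<Phi> x * Z x powi (n + 1))) + cnj c / 2 * (u x * (\<Phi> x * Z x powi (n - 1)))" for x
          unfolding r using Z0[of x] by (simp add: power_int_add power_int_diff power_int_minus field_simps)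
        then have "(LINT x|lborel. u x * (of_real (Re (c * Z x)) * \<Phi> x * Z x powi n)) =
            (LINT x|lborel. c / 2 * (u x * (\<Phi> x * Z x powi (n + 1))) + cnj c / 2 * (u x * (\<Phi> x * Z x powi (n - 1))))" by simp
        also have "\<dots> = 0" using NNi[OF \<Phi>] by (simp add: I)
        finally show ?thesis .
      qed
      moreover have "(\<lambda>x. of_real (Re (c * Z x)) * \<Phi> x) \<in> borel_measurable borel" by measurable
      ultimately show ?thesis unfolding NN_def by blast
    qed
    then show ?thesis by (auto simp: P_def intro!: continuous_intros)
  qed
  have P_const: "P (\<lambda>z. c)" for c
  proof -
    have "(\<lambda>x. of_real c * \<Phi> x) \<in> NN" if \<Phi>: "\<Phi> \<in> NN" for \<Phi>
    proof -
      obtain B where B: "\<And>x. norm (\<Phi> x) \<le> B" and [measurable]: "\<Phi> \<in> borel_measurable borel"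
        and I: "\<And>n. (LINT x|lborel. u x * (\<Phi> x * Z x powi n)) = 0" using \<Phi> by (auto simp: NN_def)
      have "norm (of_real c * \<Phi> x) \<le> \<bar>c\<bar> * B" for x using B[of x] by (simp add: norm_mult mult_left_mono)
      moreover have "(LINT x|lborel. u x * (of_real c * \<Phi> x * Z x powi n)) = 0" for n
      proof -
        have "(LINT x|lborel. u x * (of_real c * \<Phi> x * Z x powi n)) = (LINT x|lborel. of_real c * (u x * (\<Phi> x * Z x powi n)))"
          by (simp only: mult_ac)
        then show ?thesis using I by simp
      qed
      moreover have "(\<lambda>x. of_real c * \<Phi> x) \<in> borel_measurable borel" by measurable
      ultimately show ?thesis unfolding NN_def by blast
    qed
    then show ?thesis by (auto simp: P_def)
  qed
  have PD: "(\<lambda>x. of_real (F (Z x)) * \<Phi> x) \<in> NN" if "P F" "\<Phi> \<in> NN" for F \<Phi>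
    using that by (simp add: P_def)
  have one: "(\<lambda>_. 1) \<in> NN" using uZ by (auto simp: NN_def)
  have Pz: "(LINT x|lborel. u x * of_real (F (Z x))) = 0" if "P F" for F
  proof -
    have "(\<lambda>x. of_real (F (Z x)) * 1) \<in> NN" by (rule PD[OF that one])
    then have "(LINT x|lborel. u x * ((of_real (F (Z x)) * 1) * Z x powi 0)) = 0" unfolding NN_def by blast
    then show ?thesis by simp
  qed
  have dense: "(LINT x|lborel. u x * of_real (F (Z x))) = 0" if F: "continuous_on UNIV F" for F :: "complex \<Rightarrow> real"
  proof -
    have [measurable]: "F \<in> borel_measurable borel" using F by (rule borel_measurable_continuous_onI)
    have le: "norm (LINT x|lborel. u x * of_real (F (Z x))) \<le> e * (LINT x|lborel. norm (u x))" if e: "e > 0" for e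
    proof -
      have "\<exists>g. P g \<and> (\<forall>x\<in>sphere 0 1. \<bar>F x - g x\<bar> < e)"
      proof (rule Stone_Weierstrass_HOL)
        show "compact (sphere (0 :: complex) 1)" by simp
        show "P (\<lambda>x. c)" for c by (rule P_const)
        show "continuous_on (sphere 0 1) f" if "P f" for f using that continuous_on_subset by (auto simp: P_def)
        show "P (\<lambda>x. f x + g x)" if "P f \<and> P g" for f g by (rule P_add[OF that])
        show "P (\<lambda>x. f x * g x)" if "P f \<and> P g" for f g by (rule P_mult[OF that])
        show "\<exists>f. P f \<and> f x \<noteq> f y" if "x \<in> sphere 0 1 \<and> y \<in> sphere 0 1 \<and> x \<noteq> y" for x y
        proof (cases "Re x = Re y")
          case True
          then have "Re (- \<i> * x) \<noteq> Re (- \<i> * y)" using that by (auto simp: complex_eq_iff)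
          then show ?thesis using P_lin[of "- \<i>"] by blast
        next
          case False
          then show ?thesis using P_lin[of 1] by auto
        qed
        show "continuous_on (sphere 0 1) F" using F continuous_on_subset by blast
      qed (rule e)
      then obtain g where g: "P g" "\<And>x. \<bar>F (Z x) - g (Z x)\<bar> < e" using nZ by fastforce
      have [measurable]: "g \<in> borel_measurable borel" using g(1) borel_measurable_continuous_onI by (auto simp: P_def)
      have nb: "norm (u x * of_real (F (Z x) - g (Z x))) \<le> e * norm (u x)" for x
        using mult_left_mono[OF less_imp_le[OF g(2)[of x]], of "norm (u x)"] unfolding norm_mult norm_of_real by (simp add: mult.commute)
      have i1: "integrable lborel (\<lambda>x. u x * of_real (F (Z x) - g (Z x)))"
        by (rule Bochner_Integration.integrable_bound[of _ "\<lambda>x. e * norm (u x)"]) (use ui e in \<open>auto intro!: AE_I2 order_trans[OF nb] simp del: of_real_diff\<close>)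
      have i2: "integrable lborel (\<lambda>x. u x * of_real (g (Z x)))"
      proof -
        have "(\<lambda>x. of_real (g (Z x)) * 1) \<in> NN" by (rule PD[OF g(1) one])
        from NNi[OF this, of 0] show ?thesis by simp
      qed
      have "(LINT x|lborel. u x * of_real (F (Z x))) = (LINT x|lborel. u x * of_real (F (Z x) - g (Z x)) + u x * of_real (g (Z x)))"
        by (simp add: algebra_simps)
      also have "\<dots> = (LINT x|lborel. u x * of_real (F (Z x) - g (Z x)))"
        unfolding Bochner_Integration.integral_add[OF i1 i2] Pz[OF g(1)] by simp
      finally have "norm (LINT x|lborel. u x * of_real (F (Z x))) \<le> (LINT x|lborel. norm (u x * of_real (F (Z x) - g (Z x))))"
        by (simp only: integral_norm_bound)
      also have "\<dots> \<le> (LINT x|lborel. e * norm (u x))"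
        by (rule integral_mono[OF integrable_norm[OF i1] _ nb]) (use ui in simp)
      finally show ?thesis by simp
    qed
    have "norm (LINT x|lborel. u x * of_real (F (Z x))) \<le> 0"
    proof (rule field_le_epsilon)
      fix e :: real assume e: "e > 0"
      define M where "M = (LINT x|lborel. norm (u x)) + 1"
      have M: "M > 0" "(LINT x|lborel. norm (u x)) \<le> M" by (auto simp: M_def intro!: add_nonneg_pos)
      have "norm (LINT x|lborel. u x * of_real (F (Z x))) \<le> e / M * (LINT x|lborel. norm (u x))" using e M by (intro le) simp
      also have "\<dots> \<le> e / M * M" using e M by (intro mult_left_mono) auto
      finally show "norm (LINT x|lborel. u x * of_real (F (Z x))) \<le> 0 + e" using M by simp
    qed
    then show ?thesis by simp
  qed
  have "AE x in lborel. u x = 0"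
  proof (rule AE_zero_if_intervals[OF ui])
    fix a b :: real assume "a \<le> b"
    \<comment> \<open>\<open>1\<close>, \<open>x\<close> and \<open>x^2\<close>, each divided by
      \<open>d^2 + x^2\<close>, are affine in the real and imaginary parts of \<open>Z x\<close>.
      Combining them gives an affine function that has the sign of \<open>(x - a) * (b - x)\<close>
      at \<open>Z x\<close>.\<close>
    define q where "q z = - ((1 - Re z) / 2) + (a + b) * (- Im z / (2 * d)) - a * b * ((1 + Re z) / (2 * d\<^sup>2))" for z
    have q: "q (Z x) = (x - a) * (b - x) / (d\<^sup>2 + x\<^sup>2)" for x
    proof -
      have dx: "d\<^sup>2 + x\<^sup>2 > 0" using d by (simp add: add_pos_nonneg)
      have "Z x = (of_real d - \<i> * of_real x) * (of_real d - \<i> * of_real x) / ((of_real d + \<i> * of_real x) * (of_real d - \<i> * of_real x))"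
        using d unfolding Z_def cayley_def cx by (simp add: complex_eq_iff)
      also have "(of_real d + \<i> * of_real x) * (of_real d - \<i> * of_real x) = complex_of_real (d\<^sup>2 + x\<^sup>2)"
        by (simp add: complex_eq_iff power2_eq_square)
      finally have "Re (Z x) = (d\<^sup>2 - x\<^sup>2) / (d\<^sup>2 + x\<^sup>2)" "Im (Z x) = - 2 * d * x / (d\<^sup>2 + x\<^sup>2)"
        by (simp_all add: Re_divide_of_real Im_divide_of_real power2_eq_square del: of_real_add)
      moreover have "(1 - (d\<^sup>2 - x\<^sup>2) / (d\<^sup>2 + x\<^sup>2)) / 2 = x\<^sup>2 / (d\<^sup>2 + x\<^sup>2)"
      proof -
        have "(1 - (A - B) / (A + B)) / 2 = B / (A + B)" if "A + B > 0" for A B :: real using that by (simp add: field_simps)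
        then show ?thesis using dx .
      qed
      moreover have "- (- 2 * d * x / (d\<^sup>2 + x\<^sup>2)) / (2 * d) = x / (d\<^sup>2 + x\<^sup>2)" using d by simp
      moreover have "(1 + (d\<^sup>2 - x\<^sup>2) / (d\<^sup>2 + x\<^sup>2)) / (2 * d\<^sup>2) = 1 / (d\<^sup>2 + x\<^sup>2)"
      proof -
        have "(1 + (A - B) / (A + B)) / (2 * A) = 1 / (A + B)" if "A + B > 0" "A > 0" for A B :: real
        proof -
          have "1 + (A - B) / (A + B) = 2 * A / (A + B)" using that by (simp add: field_simps)
          then show ?thesis using that by simp
        qed
        from this[OF dx] show ?thesis using d by simp
      qed
      ultimately have "q (Z x) = - (x\<^sup>2 / (d\<^sup>2 + x\<^sup>2)) + (a + b) * (x / (d\<^sup>2 + x\<^sup>2)) - a * b * (1 / (d\<^sup>2 + x\<^sup>2))"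
        by (simp only: q_def)
      also have "\<dots> = (- x\<^sup>2 + (a + b) * x - a * b) / (d\<^sup>2 + x\<^sup>2)" by (simp add: diff_divide_distrib add_divide_distrib)
      also have "- x\<^sup>2 + (a + b) * x - a * b = (x - a) * (b - x)" by (simp add: algebra_simps power2_eq_square)
      finally show ?thesis .
    qed
    \<comment> \<open>Truncation of \<open>n * q\<close> to \<open>[0, 1]\<close>: continuous
      functions on the circle that converge to the indicator of the open interval on the
      line.\<close>
    define F where "F n z = min 1 (max 0 (real n * q z))" for n z
    have Fc: "continuous_on UNIV (F n)" for n
      unfolding F_def q_def by (intro continuous_intros) (use d in auto)
    have [measurable]: "F n \<in> borel_measurable borel" for n using Fc by (rule borel_measurable_continuous_onI)
    have lim: "(\<lambda>n. F n (Z x)) \<longlonglongrightarrow> (if a < x \<and> x < b then 1 else 0)" for x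
    proof (cases "a < x \<and> x < b")
      case True
      have "d\<^sup>2 + x\<^sup>2 > 0" using d by (simp add: add_pos_nonneg)
      then have qp: "q (Z x) > 0" using True by (simp add: q)
      obtain N :: nat where N: "1 / q (Z x) \<le> N" using real_arch_simple by blast
      have "F n (Z x) = 1" if "n \<ge> N" for n
      proof -
        have "1 / q (Z x) \<le> real n" using N that by linarith
        then have "1 \<le> real n * q (Z x)" using qp by (simp add: field_simps)
        then show ?thesis by (simp add: F_def)
      qed
      then have "eventually (\<lambda>n. 1 = F n (Z x)) sequentially" unfolding eventually_sequentially by metis
      then have "(\<lambda>n. F n (Z x)) \<longlonglongrightarrow> 1" by (rule Lim_transform_eventually[OF tendsto_const])
      then show ?thesis using True by simp
    next
      case False
      have "(x - a) * (b - x) \<le> 0" using False \<open>a \<le> b\<close> by (auto simp: mult_le_0_iff)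
      then have "q (Z x) \<le> 0" unfolding q using d by (intro divide_nonpos_nonneg) auto
      then have "real n * q (Z x) \<le> 0" for n by (simp add: mult_nonneg_nonpos)
      then have "F n (Z x) = 0" for n by (simp add: F_def max_absorb1)
      then show ?thesis unfolding if_not_P[OF False] by simp
    qed
    have "(\<lambda>n. LINT x|lborel. u x * of_real (F n (Z x))) \<longlonglongrightarrow> (LINT x|lborel. u x * of_real (if a < x \<and> x < b then 1 else 0))"
    proof (rule integral_dominated_convergence[where w = "\<lambda>x. norm (u x)"])
      show "AE x in lborel. (\<lambda>n. u x * of_real (F n (Z x))) \<longlonglongrightarrow> u x * of_real (if a < x \<and> x < b then 1 else 0)"
        by (intro AE_I2 tendsto_intros lim)
      show "AE x in lborel. norm (u x * of_real (F n (Z x))) \<le> norm (u x)" for n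
        by (auto simp: norm_mult F_def intro!: AE_I2 mult_left_le)
    qed (use ui in auto)
    then have "(LINT x|lborel. u x * of_real (if a < x \<and> x < b then 1 else 0)) = 0"
      unfolding dense[OF Fc] by (simp add: LIMSEQ_const_iff)
    moreover have "(LINT x|lborel. u x * of_real (if a < x \<and> x < b then 1 else 0)) = (LINT x:{a<..b}|lborel. u x)"
      unfolding set_lebesgue_integral_def
      by (rule integral_cong_AE) (use AE_lborel_singleton[of b] in \<open>auto simp: indicator_def elim!: eventually_mono\<close>)
    ultimately show "(LINT x:{a<..b}|lborel. u x) = 0" by simp
  qed
  then show ?thesis by eventually_elim (use w in \<open>simp add: u_def\<close>)
qed

subsection \<open>Decay of the MTC coefficients\<close>

lemma continuous_gk: assumes "b > 1" shows "continuous_on UNIV (gk b c)"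
proof -
  have "gk b c = (\<lambda>t. max t 0 powr (b - 1) * exp (- (c * t)))"
    by (auto simp: gk_def fun_eq_iff max_def)
  moreover have "continuous_on UNIV (\<lambda>t. max t 0 powr (b - 1) * exp (- (c * t)))"
    using assms by (intro continuous_intros continuous_on_powr') auto
  ultimately show ?thesis by simp
qed

lemma continuous_lag_dual: assumes "a > 0" shows "continuous_on UNIV (lag_dual d a k)"
  unfolding lag_dual_def[abs_def] using assms
  by (intro continuous_on_sum continuous_on_mult continuous_on_const continuous_gk) auto

text \<open>Half of the exponential decay absorbs the polynomial factor, which puts
  \<open>lag_dual\<close> into the form required by \<open>extended_testing\<close>.\<close>

lemma lag_dual_bound:
  assumes d: "d > 0" and a: "a > 0"
  obtains C where "\<And>t. \<bar>lag_dual d a k t\<bar> \<le> C * gk (a + 1) (d / 2) t"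
proof -
  have d2: "d / 2 > 0" using d by simp
  have "\<exists>C. \<forall>t. gk (real i + 1 + a) d t \<le> C * gk (a + 1) (d / 2) t" for i
  proof -
    obtain C where C: "C > 0" "\<And>v. v > 0 \<Longrightarrow> v powr (real i) * exp (- (d / 2 * v)) \<le> C"
      using powr_exp_bounded[OF d2, of "real i"] by auto
    have "gk (real i + 1 + a) d t \<le> C * gk (a + 1) (d / 2) t" for t
    proof (cases "t > 0")
      case True
      have "exp (- (d * t)) = exp (- (d / 2 * t)) * exp (- (d / 2 * t))" by (simp add: exp_add[symmetric])
      moreover have "t powr (real i + a) = t powr real i * t powr a" by (simp add: powr_add)
      ultimately have "gk (real i + 1 + a) d t = (t powr real i * exp (- (d / 2 * t))) * gk (a + 1) (d / 2) t"
        using True by (simp add: gk_def)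
      also have "\<dots> \<le> C * gk (a + 1) (d / 2) t" by (intro mult_right_mono C True) simp
      finally show ?thesis .
    qed simp
    then show ?thesis by blast
  qed
  then obtain C where C: "\<And>i t. gk (real i + 1 + a) d t \<le> C i * gk (a + 1) (d / 2) t" by metis
  show ?thesis
  proof (rule that[of "\<Sum>i\<le>k. \<bar>lag_coeff d a k i\<bar> * C i"])
    fix t
    have "\<bar>lag_dual d a k t\<bar> \<le> (\<Sum>i\<le>k. \<bar>lag_coeff d a k i * gk (real i + 1 + a) d t\<bar>)"
      unfolding lag_dual_def by (rule sum_abs)
    also have "\<dots> \<le> (\<Sum>i\<le>k. \<bar>lag_coeff d a k i\<bar> * (C i * gk (a + 1) (d / 2) t))"
      by (rule sum_mono) (use C in \<open>auto simp: abs_mult intro!: mult_left_mono\<close>)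
    finally show "\<bar>lag_dual d a k t\<bar> \<le> (\<Sum>i\<le>k. \<bar>lag_coeff d a k i\<bar> * C i) * gk (a + 1) (d / 2) t"
      by (simp add: sum_distrib_right mult.assoc)
  qed
qed

text \<open>The transform of \<open>lag_dual\<close> carries the factor
  \<open>Complex d x powr (- a)\<close>, which cancels the weight. Testing with it turns the Hardy
  coefficients of \<open>f\<close> into the Laguerre coefficients of \<open>G\<close>.\<close>

lemma hardy_coeff_eq:
  assumes d: "d > 0" and a: "a > 0" and spec: "spectral d a f G" and f: "sq_int f" and W: "wnorm (a / 2) G < \<infinity>"
  shows "(- 1) ^ k * (LINT x|lborel. f x * hardy_fun d k x) = (LINT t|lborel. G t * of_real (lag_dual d a k t))"
    and "integrable lborel (\<lambda>t. G t * of_real (lag_dual d a k t))"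
proof -
  obtain C where C: "\<And>t. \<bar>lag_dual d a k t\<bar> \<le> C * gk (a + 1) (d / 2) t" using lag_dual_bound[OF d a] by blast
  have e: "Complex d x powr of_real a * f x * ft (\<lambda>t. of_real (lag_dual d a k t)) x = (- 1) ^ k * (f x * hardy_fun d k x)" for x
  proof -
    have "Complex d x powr of_real a * Complex d x powr (- of_real a) = 1" using Complex_nonzero[OF d] by (simp add: powr_minus)
    then have "Complex d x powr of_real a * f x * ft (\<lambda>t. of_real (lag_dual d a k t)) x = 1 * ((- 1) ^ k * (f x * hardy_fun d k x))"
      unfolding ft_lag_dual[OF d less_imp_le[OF a]] by (simp only: mult_ac)
    then show ?thesis by simp
  qed
  have "(LINT x|lborel. Complex d x powr of_real a * f x * ft (\<lambda>t. of_real (lag_dual d a k t)) x) = (LINT t|lborel. G t * of_real (lag_dual d a k t))"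
  proof (rule extended_testing[OF d spec f W])
    show "continuous_on UNIV (\<lambda>t. complex_of_real (lag_dual d a k t))" using continuous_lag_dual[OF a] by (intro continuous_intros)
    show "norm (complex_of_real (lag_dual d a k t)) \<le> C * gk (a + 1) (d / 2) t" for t using C by simp
    show "integrable lborel (\<lambda>x. Complex d x powr of_real a * f x * ft (\<lambda>t. of_real (lag_dual d a k t)) x)"
      unfolding e using sq_int_mult_integrable[OF f sq_int_hardy_fun[OF d]] by simp
  qed (use d a in auto)
  then show "(- 1) ^ k * (LINT x|lborel. f x * hardy_fun d k x) = (LINT t|lborel. G t * of_real (lag_dual d a k t))"
    unfolding e by simp
  show "integrable lborel (\<lambda>t. G t * of_real (lag_dual d a k t))"
  proof (rule wnorm_pair_integrable[OF spectralD(1)[OF spec] _ spectralD(2)[OF spec] W])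
    show "wnorm (- (a / 2)) (\<lambda>t. of_real (lag_dual d a k t)) < \<infinity>"
      by (rule wnorm_gk_finite[of _ C "a + 1" "d / 2"]) (use C d a in auto)
  qed measurable
qed

text \<open>Bessel's inequality in the space with weight \<open>t powr a\<close>: expand the
  nonnegative integral of \<open>t powr a\<close> times the squared distance between
  \<open>G\<close> and its projection.\<close>

lemma laguerre_bessel:
  assumes d: "d > 0" and a: "a > 0" and spec: "spectral d a f G" and f: "sq_int f" and W: "wnorm (a / 2) G < \<infinity>"
  shows "(\<Sum>k<K. (norm (LINT x|lborel. f x * hardy_fun d k x))\<^sup>2 / lag_norm d a k) \<le> enn2real (wnorm (a / 2) G)"
proof -
  define y where "y k = (LINT t|lborel. G t * of_real (lag_dual d a k t))" for k
  define N where "N = lag_norm d a"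
  have N: "N k > 0" for k unfolding N_def using lag_norm_pos[OF d] a by simp
  have ny: "norm (LINT x|lborel. f x * hardy_fun d k x) = norm (y k)" for k
    unfolding y_def hardy_coeff_eq(1)[OF assms, symmetric] by (simp add: norm_mult norm_power)
  have int: "integrable lborel (\<lambda>t. G t * of_real (lag_dual d a k t))" for k by (rule hardy_coeff_eq(2)[OF assms])
  have [measurable]: "G \<in> borel_measurable borel" by (rule spectralD(1)[OF spec])
  \<comment> \<open>The pairing \<open>y k\<close> contains no conjugation; with the conjugated
    coefficients, \<open>cnj (S t)\<close> is the orthogonal projection of \<open>G\<close>.\<close>
  define b where "b k = cnj (y k) / of_real (N k)" for k
  define T where "T = (\<Sum>k<K. (norm (y k))\<^sup>2 / N k)"
  define S where "S t = (\<Sum>k<K. b k * of_real (lag d a k t))" for t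
  define Sd where "Sd t = (\<Sum>k<K. b k * of_real (lag_dual d a k t))" for t
  have Sd: "Sd t = of_real (t powr a) * S t" for t
    by (simp add: Sd_def S_def lag_dual_eq sum_distrib_left mult_ac)
  have i1: "integrable lborel (\<lambda>t. t powr a * (norm (G t))\<^sup>2)"
    by (rule integrableI_bounded) (use W in \<open>auto simp: wnorm_def abs_mult\<close>)
  have I1: "(LINT t|lborel. t powr a * (norm (G t))\<^sup>2) = enn2real (wnorm (a / 2) G)"
    by (subst integral_eq_nn_integral) (auto simp: wnorm_def)
  have i2: "integrable lborel (\<lambda>t. G t * Sd t)"
    unfolding Sd_def sum_distrib_left mult.left_commute[of "G _"] by (intro Bochner_Integration.integrable_sum integrable_mult_right int)
  have I2: "(LINT t|lborel. G t * Sd t) = of_real T"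
  proof -
    have "(LINT t|lborel. G t * Sd t) = (LINT t|lborel. (\<Sum>k<K. b k * (G t * of_real (lag_dual d a k t))))"
      unfolding Sd_def sum_distrib_left by (simp only: mult.left_commute)
    also have "\<dots> = (\<Sum>k<K. b k * y k)"
      unfolding y_def using int by (subst Bochner_Integration.integral_sum) auto
    also have "\<dots> = (\<Sum>k<K. of_real ((norm (y k))\<^sup>2 / N k))"
      by (intro sum.cong refl) (simp add: b_def complex_norm_square mult.commute del: of_real_power)
    finally show ?thesis by (simp add: T_def)
  qed
  have ll: "integrable lborel (\<lambda>t. complex_of_real (lag d a j t * lag_dual d a k t))" for j k
    using lag_orthogonal(1)[OF d less_imp_le[OF a]] by (rule integrable_of_real)
  have e3: "S t * cnj (Sd t) = (\<Sum>j<K. \<Sum>k<K. (b j * cnj (b k)) * of_real (lag d a j t * lag_dual d a k t))" for t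
    by (simp add: S_def Sd_def sum_product mult_ac)
  have i3: "integrable lborel (\<lambda>t. S t * cnj (Sd t))"
    unfolding e3 by (intro Bochner_Integration.integrable_sum integrable_mult_right ll)
  have I3: "(LINT t|lborel. S t * cnj (Sd t)) = of_real T"
  proof -
    have "(LINT t|lborel. S t * cnj (Sd t)) = (\<Sum>j<K. \<Sum>k<K. (b j * cnj (b k)) * of_real (LINT t|lborel. lag d a j t * lag_dual d a k t))"
      unfolding e3
      by (subst Bochner_Integration.integral_sum, intro Bochner_Integration.integrable_sum integrable_mult_right ll,
          intro sum.cong refl, subst Bochner_Integration.integral_sum, intro integrable_mult_right ll,
          intro sum.cong refl) (simp only: integral_mult_right_zero integral_complex_of_real)
    also have "\<dots> = (\<Sum>j<K. \<Sum>k<K. if j = k then (b j * cnj (b k)) * of_real (N k) else 0)"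
      by (intro sum.cong refl) (simp add: lag_orthogonal(2)[OF d less_imp_le[OF a]] N_def)
    also have "\<dots> = (\<Sum>j<K. (b j * cnj (b j)) * of_real (N j))" by (simp add: sum.delta')
    also have "\<dots> = (\<Sum>j<K. of_real ((norm (y j))\<^sup>2 / N j))"
    proof (intro sum.cong refl)
      fix j
      have "b j * cnj (b j) * of_real (N j) = (y j * cnj (y j)) / of_real (N j)"
        using N[of j] by (simp add: b_def field_simps)
      then show "b j * cnj (b j) * of_real (N j) = of_real ((norm (y j))\<^sup>2 / N j)"
        by (simp add: complex_norm_square[symmetric] del: of_real_power)
    qed
    finally show ?thesis by (simp add: T_def)
  qed
  have pw: "0 \<le> t powr a * (norm (G t))\<^sup>2 - 2 * Re (G t * Sd t) + Re (S t * cnj (Sd t))" for t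
  proof -
    have "0 \<le> t powr a * (norm (G t - cnj (S t)))\<^sup>2" by simp
    also have "(norm (G t - cnj (S t)))\<^sup>2 = (norm (G t))\<^sup>2 - 2 * Re (G t * S t) + (norm (S t))\<^sup>2"
      unfolding cmod_power2 by (simp add: power2_eq_square algebra_simps)
    also have "t powr a * \<dots> = t powr a * (norm (G t))\<^sup>2 - 2 * Re (G t * Sd t) + Re (S t * cnj (Sd t))"
    proof -
      have "Re (G t * Sd t) = t powr a * Re (G t * S t)" unfolding Sd by (simp add: algebra_simps)
      moreover have "Re (S t * cnj (Sd t)) = t powr a * (norm (S t))\<^sup>2"
        unfolding Sd cmod_power2 by (simp add: algebra_simps power2_eq_square)
      ultimately show ?thesis by (simp add: algebra_simps)
    qed
    finally show ?thesis .
  qed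
  have "0 \<le> (LINT t|lborel. t powr a * (norm (G t))\<^sup>2 - 2 * Re (G t * Sd t) + Re (S t * cnj (Sd t)))"
    by (rule Bochner_Integration.integral_nonneg) (rule pw)
  also have "\<dots> = (LINT t|lborel. t powr a * (norm (G t))\<^sup>2) - 2 * Re (LINT t|lborel. G t * Sd t) + Re (LINT t|lborel. S t * cnj (Sd t))"
    using i1 i2 i3 by (simp only: Bochner_Integration.integral_add Bochner_Integration.integral_diff Bochner_Integration.integrable_diff
        integrable_mult_right integrable_Re integral_Re integral_mult_right_zero)
  also have "\<dots> = enn2real (wnorm (a / 2) G) - T" unfolding I1 I2 I3 by simp
  finally show ?thesis unfolding ny N_def[symmetric] T_def[symmetric] by simp
qed

lemma mtc_coeff_le_hardy:
  fixes f :: "real \<Rightarrow> real"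
  assumes l: "l > 0" and f: "sq_int (\<lambda>x. of_real (f x))"
  shows "\<bar>LINT x|lborel. f x * mtc l j x\<bar> \<le> sqrt (l / pi) * norm (LINT x|lborel. of_real (f x) * hardy_fun (l / 2) (j div 2) x)"
proof -
  have i: "integrable lborel (\<lambda>x. of_real (f x) * hardy_fun (l / 2) (j div 2) x)"
    using l by (intro sq_int_mult_integrable f sq_int_hardy_fun) auto
  have "(LINT x|lborel. f x * mtc l j x) = (LINT x|lborel. sqrt (l / pi) * Re (mtc_sign j * (of_real (f x) * hardy_fun (l / 2) (j div 2) x)))"
    unfolding mtc_eq[OF l] by (intro Bochner_Integration.integral_cong refl) (simp add: algebra_simps)
  also have "\<dots> = sqrt (l / pi) * Re (mtc_sign j * (LINT x|lborel. of_real (f x) * hardy_fun (l / 2) (j div 2) x))"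
    using i by (simp only: integral_mult_right_zero integral_Re integrable_mult_right)
  finally show ?thesis
    using l abs_Re_le_cmod[of "mtc_sign j * (LINT x|lborel. of_real (f x) * hardy_fun (l / 2) (j div 2) x)"]
    by (simp add: abs_mult norm_mult mult_left_mono)
qed

text \<open>\<open>lag_norm\<close> decays like \<open>(k + 1) powr (- 2 * r)\<close>, so Bessel's
  inequality bounds the Hardy coefficients in weighted square sum. Cauchy-Schwarz against
  \<open>(k + 1) powr (\<mu> - r)\<close> then bounds the weighted sum itself; square summability of
  that sequence is the condition \<open>\<mu> < r - 1 / 2\<close>, the origin of the loss of
  1/2.\<close>

lemma mtc_coeff_summable:
  assumes l: "l > 0" and r: "r > 0" and mu: "0 \<le> \<mu>" "\<mu> < r - 1 / 2"
  obtains C where "C > 0" "\<And>f G. spectral (l / 2) (2 * r) (\<lambda>x. of_real (f x)) G \<Longrightarrow> sq_int (\<lambda>x. of_real (f x)) \<Longrightarrow> wnorm r G < \<infinity> \<Longrightarrow>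
     summable (\<lambda>j. (real j + 1) powr \<mu> * \<bar>LINT x|lborel. f x * mtc l j x\<bar>) \<and>
     (\<Sum>j. (real j + 1) powr \<mu> * \<bar>LINT x|lborel. f x * mtc l j x\<bar>) \<le> C * sqrt (enn2real (wnorm r G))"
proof -
  define d where "d = l / 2"
  have d: "d > 0" using l by (simp add: d_def)
  define a where "a = 2 * r"
  have a: "a > 0" using r by (simp add: a_def)
  obtain C0 where C0: "C0 > 0" "\<And>k. fact k / Gamma (real k + 1 + a) \<le> C0 * (real k + 1) powr (- a)"
    by (rule Gamma_ratio_bounds[OF a]) (rule that)
  define C1 where "C1 = (2 * d) powr (- (1 + a)) * C0"
  have C1: "C1 > 0" using C0 d by (simp add: C1_def)
  have Nle: "lag_norm d a k \<le> C1 * (real k + 1) powr (- a)" for k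
    using mult_left_mono[OF C0(2)[of k], of "(2 * d) powr (- (1 + a))"] by (simp add: lag_norm_def C1_def mult.assoc)
  define q where "q = 2 * (\<mu> - r)"
  have q: "q < - 1" using mu by (simp add: q_def)
  have "summable (\<lambda>n. real n powr q)" using q by (simp add: summable_real_powr_iff)
  then have "summable (\<lambda>n. real (Suc n) powr q)" by (subst summable_Suc_iff)
  then have sq: "summable (\<lambda>k. (real k + 1) powr q)" by (simp add: add.commute)
  define Q where "Q = (\<Sum>k. (real k + 1) powr q) + 1"
  have Q: "Q > 0" "(\<Sum>k<K. (real k + 1) powr q) \<le> Q" for K
    using suminf_nonneg[OF sq] sum_le_suminf[OF sq, of "{..<K}"] by (auto simp: Q_def intro: add_nonneg_pos)
  define C where "C = 2 * sqrt (l / pi) * 2 powr \<mu> * sqrt C1 * sqrt Q"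
  show ?thesis
  proof (rule that[of C])
    show "C > 0" using C1 Q(1) l by (simp add: C_def)
    fix f G assume spec: "spectral (l / 2) (2 * r) (\<lambda>x. complex_of_real (f x)) G" and f: "sq_int (\<lambda>x. complex_of_real (f x))" and W: "wnorm r G < \<infinity>"
    define w where "w = enn2real (wnorm r G)"
    define y where "y k = norm (LINT x|lborel. of_real (f x) * hardy_fun d k x)" for k
    define t where "t j = (real j + 1) powr \<mu> * \<bar>LINT x|lborel. f x * mtc l j x\<bar>" for j
    have t0: "t j \<ge> 0" for j by (simp add: t_def)
    have bes: "(\<Sum>k<K. (y k)\<^sup>2 * (real k + 1) powr a) \<le> C1 * w" for K
    proof -
      have "(\<Sum>k<K. (y k)\<^sup>2 * (real k + 1) powr a) \<le> (\<Sum>k<K. C1 * ((y k)\<^sup>2 / lag_norm d a k))"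
      proof (rule sum_mono)
        fix k
        have N: "lag_norm d a k > 0" using lag_norm_pos[OF d] a by simp
        have "lag_norm d a k * (real k + 1) powr a \<le> (C1 * (real k + 1) powr (- a)) * (real k + 1) powr a"
          by (intro mult_right_mono Nle) simp
        also have "\<dots> = C1" by (simp add: powr_minus)
        finally have "(y k)\<^sup>2 * (lag_norm d a k * (real k + 1) powr a) \<le> (y k)\<^sup>2 * C1" by (intro mult_left_mono) auto
        then show "(y k)\<^sup>2 * (real k + 1) powr a \<le> C1 * ((y k)\<^sup>2 / lag_norm d a k)" using N by (simp add: field_simps)
      qed
      also have "\<dots> = C1 * (\<Sum>k<K. (y k)\<^sup>2 / lag_norm d a k)" by (simp add: sum_distrib_left)
      also have "\<dots> \<le> C1 * w"
        using laguerre_bessel[OF d a, of "\<lambda>x. of_real (f x)" G K] spec f W C1 by (intro mult_left_mono) (auto simp: d_def a_def y_def w_def)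
      finally show ?thesis .
    qed
    have tk: "t j \<le> sqrt (l / pi) * 2 powr \<mu> * ((real (j div 2) + 1) powr \<mu> * y (j div 2))" for j
    proof -
      have "j \<le> 2 * (j div 2) + 1" by linarith
      then have "real j \<le> real (2 * (j div 2) + 1)" by (simp only: of_nat_le_iff)
      then have "real j + 1 \<le> 2 * (real (j div 2) + 1)" by simp
      then have "(real j + 1) powr \<mu> \<le> (2 * (real (j div 2) + 1)) powr \<mu>" using mu by (intro powr_mono2) auto
      also have "\<dots> = 2 powr \<mu> * (real (j div 2) + 1) powr \<mu>" by (rule powr_mult)
      finally have "t j \<le> (2 powr \<mu> * (real (j div 2) + 1) powr \<mu>) * (sqrt (l / pi) * y (j div 2))"
        unfolding t_def y_def d_def by (intro mult_mono mtc_coeff_le_hardy l f) auto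
      then show ?thesis by (simp add: mult_ac)
    qed
    have cs: "(\<Sum>k<K. (real k + 1) powr \<mu> * y k) \<le> sqrt Q * sqrt (C1 * w)" for K
    proof -
      have e: "(real k + 1) powr \<mu> * y k = (real k + 1) powr (\<mu> - r) * (y k * (real k + 1) powr r)" for k
        by (simp add: powr_diff)
      have "(\<Sum>k<K. (real k + 1) powr \<mu> * y k)\<^sup>2 \<le> (\<Sum>k<K. ((real k + 1) powr (\<mu> - r))\<^sup>2) * (\<Sum>k<K. (y k * (real k + 1) powr r)\<^sup>2)"
        unfolding e by (rule Cauchy_Schwarz_ineq_sum)
      also have "\<dots> = (\<Sum>k<K. (real k + 1) powr q) * (\<Sum>k<K. (y k)\<^sup>2 * (real k + 1) powr a)"
      proof -
        have "((real k + 1) powr (\<mu> - r))\<^sup>2 = (real k + 1) powr q" for k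
          unfolding power2_eq_square powr_add[symmetric] by (simp add: q_def)
        moreover have "((real k + 1) powr r)\<^sup>2 = (real k + 1) powr a" for k
          unfolding power2_eq_square powr_add[symmetric] by (simp add: a_def)
        ultimately show ?thesis by (simp only: power_mult_distrib)
      qed
      also have "\<dots> \<le> Q * (C1 * w)" using Q bes by (intro mult_mono) (auto intro: sum_nonneg)
      finally have "(\<Sum>k<K. (real k + 1) powr \<mu> * y k) \<le> sqrt (Q * (C1 * w))" by (rule real_le_rsqrt)
      then show ?thesis by (simp add: real_sqrt_mult)
    qed
    \<comment> \<open>The indices \<open>2 * k\<close> and \<open>2 * k + 1\<close> share one Hardy
      coefficient, hence the grouping in pairs.\<close>
    have part: "(\<Sum>j<J. t j) \<le> C * sqrt w" for J
    proof -
      have "(\<Sum>j<J. t j) \<le> (\<Sum>j<2 * J. t j)" by (rule sum_mono2) (use t0 in auto)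
      also have "\<dots> = (\<Sum>k<J. t (2 * k) + t (2 * k + 1))" by (induction J) auto
      also have "\<dots> \<le> (\<Sum>k<J. 2 * (sqrt (l / pi) * 2 powr \<mu> * ((real k + 1) powr \<mu> * y k)))"
      proof (rule sum_mono)
        fix k
        have "t (2 * k) \<le> sqrt (l / pi) * 2 powr \<mu> * ((real k + 1) powr \<mu> * y k)" using tk[of "2 * k"] by simp
        moreover have "t (2 * k + 1) \<le> sqrt (l / pi) * 2 powr \<mu> * ((real k + 1) powr \<mu> * y k)" using tk[of "2 * k + 1"] by simp
        ultimately show "t (2 * k) + t (2 * k + 1) \<le> 2 * (sqrt (l / pi) * 2 powr \<mu> * ((real k + 1) powr \<mu> * y k))" by linarith
      qed
      also have "\<dots> = 2 * sqrt (l / pi) * 2 powr \<mu> * (\<Sum>k<J. (real k + 1) powr \<mu> * y k)"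
        by (simp add: sum_distrib_left mult.assoc)
      also have "\<dots> \<le> 2 * sqrt (l / pi) * 2 powr \<mu> * (sqrt Q * sqrt (C1 * w))"
        using l by (intro mult_left_mono cs) auto
      finally show ?thesis by (simp add: C_def real_sqrt_mult mult_ac)
    qed
    have "summable t" by (rule summableI_nonneg_bounded[OF t0 part])
    moreover have "suminf t \<le> C * sqrt w" by (rule suminf_le_const[OF \<open>summable t\<close> part])
    ultimately show "summable (\<lambda>j. (real j + 1) powr \<mu> * \<bar>LINT x|lborel. f x * mtc l j x\<bar>) \<and>
     (\<Sum>j. (real j + 1) powr \<mu> * \<bar>LINT x|lborel. f x * mtc l j x\<bar>) \<le> C * sqrt (enn2real (wnorm r G))"
      unfolding t_def w_def by blast
  qed
qed

subsection \<open>The MTC expansion and the continuous representative\<close>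

definition mtc_series :: "real \<Rightarrow> (nat \<Rightarrow> real) \<Rightarrow> real \<Rightarrow> real" where
  "mtc_series l a x = (\<Sum>j. a j * mtc l j x)"

text \<open>All MTC functions have the common majorant
  \<open>sqrt (l / pi) / norm (Complex (l / 2) x)\<close>. Absolutely summable coefficients thus
  suffice for convergence and give a square integrable bound for the sum.\<close>

lemma mtc_series_summable:
  assumes l: "l > 0" and a: "summable (\<lambda>j. \<bar>a j\<bar>)"
  shows "summable (\<lambda>j. \<bar>a j * mtc l j x\<bar>)" "\<bar>mtc_series l a x\<bar> \<le> (\<Sum>j. \<bar>a j\<bar>) * (sqrt (l / pi) / norm (Complex (l / 2) x))"
proof -
  have b: "\<bar>a j * mtc l j x\<bar> \<le> \<bar>a j\<bar> * (sqrt (l / pi) / norm (Complex (l / 2) x))" for j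
    using abs_mtc_le[OF l, of j x] by (simp only: abs_mult mult_left_mono abs_ge_zero)
  have s: "summable (\<lambda>j. \<bar>a j\<bar> * (sqrt (l / pi) / norm (Complex (l / 2) x)))" by (rule summable_mult2[OF a])
  show sm: "summable (\<lambda>j. \<bar>a j * mtc l j x\<bar>)"
    by (rule summable_comparison_test'[OF s, of 0]) (use b in simp)
  have "\<bar>mtc_series l a x\<bar> \<le> (\<Sum>j. \<bar>a j * mtc l j x\<bar>)" unfolding mtc_series_def by (rule summable_rabs[OF sm])
  also have "\<dots> \<le> (\<Sum>j. \<bar>a j\<bar> * (sqrt (l / pi) / norm (Complex (l / 2) x)))" by (rule suminf_le[OF b sm s])
  also have "\<dots> = (\<Sum>j. \<bar>a j\<bar>) * (sqrt (l / pi) / norm (Complex (l / 2) x))" by (rule suminf_mult2[OF a, symmetric])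
  finally show "\<bar>mtc_series l a x\<bar> \<le> (\<Sum>j. \<bar>a j\<bar>) * (sqrt (l / pi) / norm (Complex (l / 2) x))" .
qed

lemma measurable_mtc_series: "l > 0 \<Longrightarrow> mtc_series l a \<in> borel_measurable borel"
  unfolding mtc_series_def[abs_def] using measurable_mtc[of l] by measurable

lemma continuous_mtc_series:
  assumes l: "l > 0" and a: "summable (\<lambda>j. \<bar>a j\<bar>)" shows "continuous_on UNIV (mtc_series l a)"
proof (rule uniform_limit_theorem)
  define M where "M = sqrt (l / pi) / (l / 2)"
  have M: "\<bar>mtc l j x\<bar> \<le> M" for j x
  proof -
    have "sqrt (l / pi) / norm (Complex (l / 2) x) \<le> M"
      unfolding M_def using norm_Complex_ge(1)[of "l / 2" x] l by (intro divide_left_mono) (auto simp: Complex_nonzero)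
    then show ?thesis using abs_mtc_le[OF l, of j x] by (rule order_trans[rotated])
  qed
  show "uniform_limit UNIV (\<lambda>n x. \<Sum>j<n. a j * mtc l j x) (mtc_series l a) sequentially"
    unfolding mtc_series_def[abs_def]
  proof (rule Weierstrass_m_test)
    show "norm (a j * mtc l j x) \<le> \<bar>a j\<bar> * M" for j x using M[of j x] by (simp add: abs_mult mult_left_mono)
    show "summable (\<lambda>j. \<bar>a j\<bar> * M)" by (rule summable_mult2[OF a])
  qed
  show "\<forall>\<^sub>F n in sequentially. continuous_on UNIV (\<lambda>x. \<Sum>j<n. a j * mtc l j x)"
    by (rule always_eventually) (intro allI continuous_on_sum continuous_on_mult continuous_on_const continuous_mtc[OF l])
qed simp

lemma sq_int_mtc_series:
  assumes l: "l > 0" and a: "summable (\<lambda>j. \<bar>a j\<bar>)" shows "sq_int (\<lambda>x. of_real (mtc_series l a x))"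
proof (rule sq_int_bound[where c = "l / 2" and C = "(\<Sum>j. \<bar>a j\<bar>) * sqrt (l / pi)"])
  show "(\<lambda>x. complex_of_real (mtc_series l a x)) \<in> borel_measurable borel" using measurable_mtc_series[OF l] by measurable
  show "norm (complex_of_real (mtc_series l a x)) \<le> (\<Sum>j. \<bar>a j\<bar>) * sqrt (l / pi) / norm (Complex (l / 2) x)" for x
    using mtc_series_summable(2)[OF l a, of x] by simp
qed (use l in simp)

lemma sq_int_of_real_mult: "sq_int (\<lambda>x. of_real (f x)) \<Longrightarrow> sq_int (\<lambda>x. of_real (g x)) \<Longrightarrow> integrable lborel (\<lambda>x. f x * g x :: real)"
  using sq_int_mult_integrable[of "\<lambda>x. of_real (f x)" "\<lambda>x. of_real (g x)"] integrable_Re[of lborel "\<lambda>x. complex_of_real (f x) * of_real (g x)"] by simp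

lemma sq_int_of_real_iff: "sq_int (\<lambda>x. of_real (f x)) \<longleftrightarrow> f \<in> borel_measurable borel \<and> integrable lborel (\<lambda>x. (f x)\<^sup>2)"
proof
  assume h: "sq_int (\<lambda>x. of_real (f x))"
  then have "(\<lambda>x. complex_of_real (f x)) \<in> borel_measurable borel" by (simp add: sq_int_def)
  then have "(\<lambda>x. Re (complex_of_real (f x))) \<in> borel_measurable borel"
    by (rule measurable_compose) (intro borel_measurable_continuous_onI continuous_intros)
  then show "f \<in> borel_measurable borel \<and> integrable lborel (\<lambda>x. (f x)\<^sup>2)" using h by (simp add: sq_int_def)
next
  assume h: "f \<in> borel_measurable borel \<and> integrable lborel (\<lambda>x. (f x)\<^sup>2)"
  then have [measurable]: "f \<in> borel_measurable borel" by simp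
  have "(\<lambda>x. complex_of_real (f x)) \<in> borel_measurable borel" by measurable
  then show "sq_int (\<lambda>x. of_real (f x))" using h by (simp add: sq_int_def)
qed

lemma sq_int_add:
  assumes "sq_int f" "sq_int g" shows "sq_int (\<lambda>x. f x + g x)"
  unfolding sq_int_def
proof
  have [measurable]: "f \<in> borel_measurable borel" "g \<in> borel_measurable borel" using assms by (auto simp: sq_int_def)
  show "(\<lambda>x. f x + g x) \<in> borel_measurable borel" by measurable
  show "integrable lborel (\<lambda>x. (norm (f x + g x))\<^sup>2)"
  proof (rule Bochner_Integration.integrable_bound)
    show "integrable lborel (\<lambda>x. 2 * (norm (f x))\<^sup>2 + 2 * (norm (g x))\<^sup>2)" using assms by (simp add: sq_int_def)
    have "(norm (f x + g x))\<^sup>2 \<le> 2 * (norm (f x))\<^sup>2 + 2 * (norm (g x))\<^sup>2" for x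
    proof -
      have "(norm (f x + g x))\<^sup>2 \<le> (norm (f x) + norm (g x))\<^sup>2" by (intro power_mono norm_triangle_ineq) simp
      also have "\<dots> \<le> 2 * (norm (f x))\<^sup>2 + 2 * (norm (g x))\<^sup>2"
        using sum_squares_bound[of "norm (f x)" "norm (g x)"] by (simp add: power2_sum)
      finally show ?thesis .
    qed
    then show "AE x in lborel. norm ((norm (f x + g x))\<^sup>2) \<le> norm (2 * (norm (f x))\<^sup>2 + 2 * (norm (g x))\<^sup>2)" by simp
  qed measurable
qed

lemma sq_int_cmult: "sq_int f \<Longrightarrow> sq_int (\<lambda>x. c * f x)"
  unfolding sq_int_def by (auto simp: norm_mult power_mult_distrib)

lemma mtc_series_inner:
  assumes l: "l > 0" and a: "summable (\<lambda>j. \<bar>a j\<bar>)"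
  shows "(LINT x|lborel. mtc_series l a x * mtc l m x) = a m"
proof -
  define c where "c x = (sqrt (l / pi) / norm (Complex (l / 2) x))\<^sup>2" for x
  have ci: "integrable lborel c"
    unfolding c_def power_divide divide_inverse[of "(sqrt (l / pi))\<^sup>2"] using integrable_inverse_norm_Complex[of "l / 2"] l by simp
  define h where "h j x = a j * (mtc l j x * mtc l m x)" for j x
  have mi: "integrable lborel (\<lambda>x. mtc l j x * mtc l m x)" for j by (intro sq_int_of_real_mult sq_int_mtc l)
  have hb: "norm (h j x) \<le> \<bar>a j\<bar> * c x" for j x
    unfolding h_def c_def real_norm_def abs_mult power2_eq_square
    by (intro mult_left_mono mult_mono abs_mtc_le l) (use l in auto)
  have "(\<lambda>j. LINT x|lborel. h j x) sums (LINT x|lborel. (\<Sum>j. h j x))"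
  proof (rule sums_integral)
    show "integrable lborel (h j)" for j unfolding h_def[abs_def] using mi by simp
    show "AE x in lborel. summable (\<lambda>j. norm (h j x))"
      by (intro AE_I2 summable_comparison_test'[OF summable_mult2[OF a], of 0]) (use hb in simp)
    show "summable (\<lambda>j. LINT x|lborel. norm (h j x))"
    proof (rule summable_comparison_test'[OF summable_mult2[OF a], of 0])
      fix j
      have "(LINT x|lborel. norm (h j x)) \<le> (LINT x|lborel. \<bar>a j\<bar> * c x)"
        by (rule integral_mono) (use mi ci hb in \<open>auto simp: h_def\<close>)
      then show "norm (LINT x|lborel. norm (h j x)) \<le> \<bar>a j\<bar> * (LINT x|lborel. c x)" by simp
    qed
  qed
  moreover have "(\<Sum>j. h j x) = mtc_series l a x * mtc l m x" for x
    unfolding h_def mtc_series_def mult.assoc[symmetric]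
    by (rule suminf_mult2[symmetric]) (rule summable_rabs_cancel[OF mtc_series_summable(1)[OF l a]])
  moreover have "(LINT x|lborel. h j x) = (if j = m then a j else 0)" for j
    unfolding h_def integral_mult_right_zero mtc_orthonormal[OF l] by simp
  ultimately have "(\<lambda>j. if j = m then a j else 0) sums (LINT x|lborel. mtc_series l a x * mtc l m x)" by simp
  moreover have "(\<lambda>j. if j = m then a j else 0) sums a m" by (rule sums_single)
  ultimately show ?thesis by (rule sums_unique2)
qed

text \<open>Termwise integration shows that the series has the same coefficients as
  \<open>f\<close>; completeness, applied to the difference, identifies the two.\<close>

lemma mtc_expansion:
  fixes f :: "real \<Rightarrow> real"
  assumes l: "l > 0" and f: "sq_int (\<lambda>x. of_real (f x))"
    and a: "summable (\<lambda>j. \<bar>LINT x|lborel. f x * mtc l j x\<bar>)"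
  shows "AE x in lborel. f x = mtc_series l (\<lambda>j. LINT x|lborel. f x * mtc l j x) x"
proof -
  define g where "g = mtc_series l (\<lambda>j. LINT x|lborel. f x * mtc l j x)"
  have gs: "sq_int (\<lambda>x. of_real (g x))" unfolding g_def by (rule sq_int_mtc_series[OF l a])
  have d: "sq_int (\<lambda>x. of_real (f x - g x))" using sq_int_add[OF f sq_int_cmult[OF gs, of "-1"]] by simp
  have "(LINT x|lborel. (f x - g x) * mtc l j x) = 0" for j
  proof -
    have "integrable lborel (\<lambda>x. f x * mtc l j x)" "integrable lborel (\<lambda>x. g x * mtc l j x)"
      by (intro sq_int_of_real_mult f gs sq_int_mtc l)+
    then show ?thesis using mtc_series_inner[OF l a, of j] by (simp add: left_diff_distrib g_def)
  qed
  then have "AE x in lborel. f x - g x = 0" by (rule mtc_complete[OF l d])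
  then show ?thesis by (simp add: g_def)
qed

lemma continuous_AE_eq:
  fixes g h :: "real \<Rightarrow> real"
  assumes "continuous_on UNIV g" "continuous_on UNIV h" "AE x in lborel. g x = h x"
  shows "g = h"
proof (rule ccontr)
  assume "g \<noteq> h"
  define S where "S = {x. g x \<noteq> h x}"
  have "open S" unfolding S_def using assms(1,2) by (intro open_Collect_neq)
  moreover have "S \<noteq> {}" using \<open>g \<noteq> h\<close> by (auto simp: S_def)
  moreover have "S \<in> null_sets lborel"
  proof -
    have "S \<in> sets lborel" using \<open>open S\<close> by simp
    then show ?thesis using assms(3) by (subst (asm) AE_iff_null_sets[symmetric, of S, THEN iffD1] | auto simp: S_def AE_iff_null_sets)+
  qed
  then have "negligible S" using null_sets_completionI negligible_iff_null_sets by blast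
  ultimately show False using open_not_negligible by blast
qed

text \<open>Continuous functions that agree almost everywhere are equal, so the choice in
  \<open>cont_rep\<close> has a single candidate.\<close>

lemma cont_rep_eq:
  assumes "continuous_on UNIV g" "AE x in lborel. f x = g x" shows "cont_rep f = g"
proof -
  have "continuous_on UNIV (cont_rep f) \<and> (AE x in lborel. cont_rep f x = f x)"
    unfolding cont_rep_def by (rule someI[of _ g]) (use assms in \<open>auto elim: eventually_mono\<close>)
  then have c: "continuous_on UNIV (cont_rep f)" and ae: "AE x in lborel. cont_rep f x = f x" by auto
  from ae assms(2) have "AE x in lborel. cont_rep f x = g x" by eventually_elim simp
  then show ?thesis by (rule continuous_AE_eq[OF c assms(1)])
qed

subsection \<open>Discrete orthogonality and aliasing\<close>

definition node_arg :: "nat \<Rightarrow> nat \<Rightarrow> real" where "node_arg p m = real (2 * m + 1) / real (4 * p) * pi"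

text \<open>With \<open>k = j div 2\<close>, this is \<open>sin ((2 k + 1) t)\<close> for even and
  \<open>cos ((2 k + 1) t)\<close> for odd \<open>j\<close>: the oscillating factor of an MTC
  function at \<open>x = l / 2 * cot t\<close>.\<close>

definition trig :: "nat \<Rightarrow> real \<Rightarrow> real" where
  "trig j t = Re ((if even j then - \<i> else 1) * cis (real (2 * (j div 2) + 1) * t))"

lemma abs_trig_le: "\<bar>trig j t\<bar> \<le> 1"
  unfolding trig_def by (rule order_trans[OF abs_Re_le_cmod]) (simp add: norm_mult)

lemma node_arg_range: assumes "m < 2 * p" shows "0 < node_arg p m" "node_arg p m < pi"
proof -
  have p: "p > 0" using assms by auto
  show "0 < node_arg p m" using p by (simp add: node_arg_def)
  have "real (2 * m + 1) < real (4 * p)" using assms by linarith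
  then have "real (2 * m + 1) / real (4 * p) < 1" using p by (subst divide_less_eq_1_pos) auto
  then show "node_arg p m < pi" unfolding node_arg_def using pi_gt_zero by (metis mult.left_neutral mult_less_cancel_right_pos)
qed

text \<open>At \<open>x = l / 2 * cot t\<close> one has
  \<open>Complex (l / 2) x = l / (2 sin t) * i * cis (- t)\<close>. The Cayley transform is then
  \<open>- cis (2 t)\<close>, and its sign to the power \<open>k\<close> cancels the one in
  \<open>mtc_sign\<close>.\<close>

lemma mtc_node_eq:
  assumes l: "l > 0" and m: "m < 2 * p"
  shows "mtc l j (mtc_node l p m) = sqrt (l / pi) * (2 * sin (node_arg p m) / l) * trig j (node_arg p m)"
    and "l\<^sup>2 + 4 * (mtc_node l p m)\<^sup>2 = (l / sin (node_arg p m))\<^sup>2"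
proof -
  define t where "t = node_arg p m"
  define k where "k = j div 2"
  have s: "sin t > 0" unfolding t_def using node_arg_range[OF m] by (rule sin_gt_zero)
  have x: "mtc_node l p m = l / 2 * (cos t / sin t)" by (simp add: mtc_node_def cot_def t_def node_arg_def)
  show "l\<^sup>2 + 4 * (mtc_node l p m)\<^sup>2 = (l / sin (node_arg p m))\<^sup>2"
  proof -
    have "l\<^sup>2 + 4 * (mtc_node l p m)\<^sup>2 = l\<^sup>2 * ((sin t)\<^sup>2 + (cos t)\<^sup>2) / (sin t)\<^sup>2"
      unfolding x distrib_left add_divide_distrib using s by (simp add: power_mult_distrib power_divide)
    also have "(sin t)\<^sup>2 + (cos t)\<^sup>2 = 1" by simp
    finally show ?thesis by (simp add: power_divide t_def)
  qed
  define w where "w = Complex (l / 2) (mtc_node l p m)"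
  have w: "w = of_real (l / (2 * sin t)) * \<i> * cis (- t)"
    unfolding w_def x using s by (simp add: complex_eq_iff)
  have cw: "cnj w = of_real (l / (2 * sin t)) * (- \<i>) * cis t"
    unfolding w by (simp add: cis_cnj)
  have nz: "complex_of_real (l / (2 * sin t)) \<noteq> 0" using l s by simp
  have "hardy_fun (l / 2) k (mtc_node l p m) = (cnj w / w) ^ k * (1 / w)"
    by (simp add: hardy_fun_def w_def power_divide)
  also have "cnj w / w = - (cis t * cis t)"
    unfolding cw unfolding w using nz by (simp add: field_simps cis_mult)
  also have "1 / w = of_real (2 * sin t / l) * (- \<i>) * cis t"
    unfolding w using nz l s by (simp add: field_simps cis_mult)
  also have "(- (cis t * cis t)) ^ k * (of_real (2 * sin t / l) * (- \<i>) * cis t) = (- 1) ^ k * of_real (2 * sin t / l) * ((- \<i>) * cis (real (2 * k + 1) * t))"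
  proof -
    have "(- (cis t * cis t)) ^ k = (- 1) ^ k * cis (2 * real k * t)"
    proof -
      have "(cis t * cis t) ^ k = cis (2 * real k * t)"
        unfolding cis_mult Complex.DeMoivre by (rule arg_cong[where f = cis]) (simp add: algebra_simps)
      then show ?thesis by (subst power_minus) simp
    qed
    moreover have "cis (2 * real k * t) * cis t = cis (real (2 * k + 1) * t)" by (simp add: cis_mult algebra_simps)
    ultimately show ?thesis by (simp add: mult_ac)
  qed
  finally have h: "hardy_fun (l / 2) k (mtc_node l p m) = (- 1) ^ k * of_real (2 * sin t / l) * ((- \<i>) * cis (real (2 * k + 1) * t))" .
  have m1: "(- 1) ^ k * (- 1) ^ k = (1 :: complex)" by (simp add: power_mult_distrib[symmetric])
  have "mtc_sign j * hardy_fun (l / 2) k (mtc_node l p m) = ((- 1) ^ k * (- 1) ^ k) * (of_real (2 * sin t / l) * ((if even j then 1 else \<i>) * ((- \<i>) * cis (real (2 * k + 1) * t))))"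
    unfolding h mtc_sign_def k_def[symmetric] by (simp only: mult_ac)
  also have "(if even j then 1 else \<i>) * ((- \<i>) * cis (real (2 * k + 1) * t)) = (if even j then - \<i> else 1) * cis (real (2 * k + 1) * t)"
    by (simp add: mult.assoc[symmetric])
  finally have "Re (mtc_sign j * hardy_fun (l / 2) k (mtc_node l p m)) = (2 * sin t / l) * trig j t"
    unfolding m1 trig_def k_def[symmetric] mult_1_left by simp
  then show "mtc l j (mtc_node l p m) = sqrt (l / pi) * (2 * sin (node_arg p m) / l) * trig j (node_arg p m)"
    unfolding mtc_eq[OF l] k_def t_def by simp
qed

text \<open>The Gram matrix of the MTC functions for the quadrature rule in
  \<open>mtc_coeff\<close>: the weight \<open>(l / sin t)^2\<close> cancels the sines contributed by
  both functions, so only trigonometric factors remain.\<close>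

definition mtc_gram :: "nat \<Rightarrow> nat \<Rightarrow> nat \<Rightarrow> real" where
  "mtc_gram p i j = 1 / real p * (\<Sum>m<2 * p. trig i (node_arg p m) * trig j (node_arg p m))"

lemma abs_mtc_gram_le: assumes "p \<ge> 1" shows "\<bar>mtc_gram p i j\<bar> \<le> 2"
proof -
  have "\<bar>\<Sum>m<2 * p. trig i (node_arg p m) * trig j (node_arg p m)\<bar> \<le> (\<Sum>m<2 * p. 1)"
    by (rule order_trans[OF sum_abs sum_mono]) (auto simp: abs_mult abs_trig_le intro!: mult_le_one)
  then show ?thesis using assms by (simp add: mtc_gram_def abs_mult divide_le_eq)
qed

text \<open>A geometric sum with ratio \<open>cis (q * pi / p)\<close>: the ratio differs from 1
  because \<open>2 * p\<close> does not divide \<open>q\<close>, while its power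
  \<open>2 * p\<close> equals 1.\<close>

lemma node_sum_zero:
  assumes p: "p \<ge> 1" and q: "q \<noteq> 0" "\<bar>q\<bar> < 2 * int p"
  shows "(\<Sum>m<2 * p. cis (2 * of_int q * node_arg p m)) = 0"
proof -
  define z where "z = cis (of_int q * pi / real p)"
  have "cis (2 * of_int q * node_arg p m) = cis (of_int q * pi / (2 * real p)) * z ^ m" for m
    unfolding z_def Complex.DeMoivre cis_mult node_arg_def using p by (intro arg_cong[where f = cis]) (simp add: field_simps)
  then have "(\<Sum>m<2 * p. cis (2 * of_int q * node_arg p m)) = cis (of_int q * pi / (2 * real p)) * (\<Sum>m<2 * p. z ^ m)"
    by (simp add: sum_distrib_left)
  moreover have "z \<noteq> 1"
  proof
    assume "z = 1"
    then have "cos (of_int q * pi / real p) = 1" by (simp add: z_def complex_eq_iff)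
    then obtain n :: int where "of_int q * pi / real p = of_int n * 2 * pi" using cos_one_2pi_int by blast
    then have "of_int q = (of_int (n * 2 * int p) :: real)" using p by (simp add: field_simps)
    then have "q = n * (2 * int p)" by linarith
    then have "2 * int p dvd q" by simp
    then have "2 * int p \<le> \<bar>q\<bar>" using dvd_imp_le_int[OF q(1), of "2 * int p"] by simp
    then show False using q(2) by linarith
  qed
  moreover have "z ^ (2 * p) = 1"
  proof -
    have "z ^ (2 * p) = cis (2 * pi * of_int q)" unfolding z_def Complex.DeMoivre using p by (intro arg_cong[where f = cis]) (simp add: field_simps)
    also have "\<dots> = 1" by (rule cis_multiple_2pi) simp
    finally show ?thesis .
  qed
  ultimately show ?thesis by (simp add: sum_gp_strict)
qed

text \<open>The product of two trigonometric factors has the frequencies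
  \<open>k i + k j + 1\<close> and \<open>k i - k j\<close>. Indices below \<open>2 * p\<close> keep
  both within the range of \<open>node_sum_zero\<close>, so only a zero difference
  contributes.\<close>

lemma mtc_gram_orthonormal:
  assumes p: "p \<ge> 1" and ij: "i < 2 * p" "j < 2 * p"
  shows "mtc_gram p i j = (if i = j then 1 else 0)"
proof -
  define \<sigma> where "\<sigma> j = (if even j then - \<i> else 1 :: complex)" for j :: nat
  define k where "k j = int (j div 2)" for j :: nat
  have tr: "trig i t * trig j t = Re (\<sigma> i * \<sigma> j * cis (2 * of_int (k i + k j + 1) * t) + \<sigma> i * cnj (\<sigma> j) * cis (2 * of_int (k i - k j) * t)) / 2" for t
  proof -
    have r: "Re a * Re b = Re (a * b + a * cnj b) / 2" for a b by simp
    have c1: "cis (real (2 * (i div 2) + 1) * t) * cis (real (2 * (j div 2) + 1) * t) = cis (2 * of_int (k i + k j + 1) * t)"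
      by (simp add: cis_mult k_def algebra_simps)
    have c2: "cis (real (2 * (i div 2) + 1) * t) * cnj (cis (real (2 * (j div 2) + 1) * t)) = cis (2 * of_int (k i - k j) * t)"
      by (simp add: cis_cnj cis_mult k_def algebra_simps)
    have "trig i t * trig j t = Re (\<sigma> i * \<sigma> j * (cis (real (2 * (i div 2) + 1) * t) * cis (real (2 * (j div 2) + 1) * t))
       + \<sigma> i * cnj (\<sigma> j) * (cis (real (2 * (i div 2) + 1) * t) * cnj (cis (real (2 * (j div 2) + 1) * t)))) / 2"
      unfolding trig_def \<sigma>_def[symmetric] r complex_cnj_mult by (simp only: mult_ac)
    then show ?thesis unfolding c1 c2 .
  qed
  have kk: "0 \<le> k i" "k i < int p" "0 \<le> k j" "k j < int p" using ij by (auto simp: k_def)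
  have "(\<Sum>m<2 * p. trig i (node_arg p m) * trig j (node_arg p m)) =
      Re (\<sigma> i * \<sigma> j * (\<Sum>m<2 * p. cis (2 * of_int (k i + k j + 1) * node_arg p m)) + \<sigma> i * cnj (\<sigma> j) * (\<Sum>m<2 * p. cis (2 * of_int (k i - k j) * node_arg p m))) / 2"
    unfolding tr by (simp only: sum_divide_distrib[symmetric] Re_sum[symmetric] sum.distrib sum_distrib_left)
  also have "(\<Sum>m<2 * p. cis (2 * of_int (k i + k j + 1) * node_arg p m)) = 0"
    by (rule node_sum_zero[OF p]) (use kk in auto)
  also have "(\<Sum>m<2 * p. cis (2 * of_int (k i - k j) * node_arg p m)) = (if k i = k j then of_nat (2 * p) else 0)"
  proof (cases "k i = k j")
    case True then show ?thesis by simp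
  next
    case False
    then show ?thesis using node_sum_zero[OF p, of "k i - k j"] kk by auto
  qed
  finally have S: "mtc_gram p i j = 1 / real p * (Re (\<sigma> i * cnj (\<sigma> j) * (if k i = k j then of_nat (2 * p) else 0)) / 2)"
    by (simp only: mtc_gram_def mult_zero_right add_0_left)
  show ?thesis
  proof (cases "k i = k j")
    case True
    then have "i div 2 = j div 2" by (simp add: k_def)
    then have "i = j \<longleftrightarrow> even i = even j" by (metis even_two_times_div_two odd_two_times_div_two_succ)
    then show ?thesis unfolding S using True p by (auto simp: \<sigma>_def)
  next
    case False
    then have "i \<noteq> j" by auto
    then show ?thesis unfolding S using False by simp
  qed
qed

lemma mtc_coeff_series:
  assumes l: "l > 0" and p: "p \<ge> 1" and a: "summable (\<lambda>j. \<bar>a j\<bar>)"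
  shows "mtc_coeff l p (mtc_series l a) k = (\<Sum>j. a j * mtc_gram p k j)" "summable (\<lambda>j. \<bar>a j * mtc_gram p k j\<bar>)"
proof -
  have set: "{0..2 * p - 1} = {..<2 * p}" using p by auto
  \<comment> \<open>The quadrature weight cancels both sines and the two factors
    \<open>sqrt (l / pi)\<close>.\<close>
  have tm: "pi / (4 * l * real p) * ((l\<^sup>2 + 4 * (mtc_node l p m)\<^sup>2) * mtc l k (mtc_node l p m) * mtc l j (mtc_node l p m)) =
      1 / real p * (trig k (node_arg p m) * trig j (node_arg p m))" if m: "m < 2 * p" for m j
  proof -
    have s: "sin (node_arg p m) > 0" using node_arg_range[OF m] by (rule sin_gt_zero)
    have sq: "sqrt (l / pi) * sqrt (l / pi) = l / pi" using l by simp
    have "(l\<^sup>2 + 4 * (mtc_node l p m)\<^sup>2) * mtc l k (mtc_node l p m) * mtc l j (mtc_node l p m) =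
        (l / sin (node_arg p m))\<^sup>2 * (sqrt (l / pi) * sqrt (l / pi)) * (2 * sin (node_arg p m) / l)\<^sup>2 * (trig k (node_arg p m) * trig j (node_arg p m))"
      unfolding mtc_node_eq(2)[OF l m] unfolding mtc_node_eq(1)[OF l m] power2_eq_square by (simp only: mult_ac)
    also have "\<dots> = (4 * l / pi) * (trig k (node_arg p m) * trig j (node_arg p m))"
      unfolding sq using l s by (simp add: power_divide power_mult_distrib)
    finally show ?thesis using l by simp
  qed
  have gr: "mtc_gram p k j = (\<Sum>m<2 * p. pi / (4 * l * real p) * ((l\<^sup>2 + 4 * (mtc_node l p m)\<^sup>2) * mtc l k (mtc_node l p m) * mtc l j (mtc_node l p m)))" for j
    unfolding mtc_gram_def sum_distrib_left using tm by (intro sum.cong refl) auto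
  define c where "c m = pi / (4 * l * real p) * ((l\<^sup>2 + 4 * (mtc_node l p m)\<^sup>2) * mtc l k (mtc_node l p m))" for m
  have sm: "summable (\<lambda>j. a j * mtc l j x)" for x using mtc_series_summable(1)[OF l a] by (rule summable_rabs_cancel)
  have "mtc_coeff l p (mtc_series l a) k = (\<Sum>m<2 * p. c m * (\<Sum>j. a j * mtc l j (mtc_node l p m)))"
    unfolding mtc_coeff_def set c_def mtc_series_def sum_distrib_left by (simp only: mult.assoc)
  also have "\<dots> = (\<Sum>m<2 * p. \<Sum>j. c m * (a j * mtc l j (mtc_node l p m)))" by (simp add: suminf_mult[OF sm])
  also have "\<dots> = (\<Sum>j. \<Sum>m<2 * p. c m * (a j * mtc l j (mtc_node l p m)))"
    by (rule suminf_sum[symmetric]) (intro summable_mult sm)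
  also have "\<dots> = (\<Sum>j. a j * mtc_gram p k j)"
    unfolding gr sum_distrib_left c_def by (simp only: mult_ac)
  finally show "mtc_coeff l p (mtc_series l a) k = (\<Sum>j. a j * mtc_gram p k j)" .
  show "summable (\<lambda>j. \<bar>a j * mtc_gram p k j\<bar>)"
  proof (rule summable_comparison_test'[OF summable_mult2[OF a, of 2], of 0])
    show "norm \<bar>a j * mtc_gram p k j\<bar> \<le> \<bar>a j\<bar> * 2" for j using abs_mtc_gram_le[OF p, of k j] by (simp add: abs_mult mult_left_mono)
  qed
qed

text \<open>The discrete coefficient of a series is the series of Gram entries. The first
  \<open>2 * p\<close> of them reproduce \<open>a k\<close> by discrete orthonormality; all others
  are at most 2 in absolute value, being \<open>1 / p\<close> times a sum of \<open>2 * p\<close>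
  bounded terms.\<close>

lemma mtc_aliasing:
  assumes l: "l > 0" and p: "p \<ge> 1" and a: "summable (\<lambda>j. \<bar>a j\<bar>)" and k: "k < 2 * p"
  shows "\<bar>mtc_coeff l p (mtc_series l a) k - a k\<bar> \<le> 2 * (\<Sum>j. \<bar>a (j + 2 * p)\<bar>)"
proof -
  note s = mtc_coeff_series[OF l p a, of k]
  have ss: "summable (\<lambda>j. a j * mtc_gram p k j)" using s(2) by (rule summable_rabs_cancel)
  have "(\<Sum>j. a j * mtc_gram p k j) = (\<Sum>j. a (j + 2 * p) * mtc_gram p k (j + 2 * p)) + (\<Sum>j<2 * p. a j * mtc_gram p k j)"
    by (rule suminf_split_initial_segment[OF ss])
  also have "(\<Sum>j<2 * p. a j * mtc_gram p k j) = (\<Sum>j<2 * p. if k = j then a j else 0)"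
    by (intro sum.cong refl) (simp add: mtc_gram_orthonormal[OF p k])
  also have "\<dots> = a k" using k by simp
  finally have "mtc_coeff l p (mtc_series l a) k - a k = (\<Sum>j. a (j + 2 * p) * mtc_gram p k (j + 2 * p))" unfolding s(1) by simp
  also have "\<bar>\<dots>\<bar> \<le> (\<Sum>j. \<bar>a (j + 2 * p) * mtc_gram p k (j + 2 * p)\<bar>)"
    by (rule summable_rabs[OF summable_ignore_initial_segment[OF s(2)]])
  also have "\<dots> \<le> (\<Sum>j. 2 * \<bar>a (j + 2 * p)\<bar>)"
  proof (rule suminf_le)
    show "\<bar>a (j + 2 * p) * mtc_gram p k (j + 2 * p)\<bar> \<le> 2 * \<bar>a (j + 2 * p)\<bar>" for j
      using mult_left_mono[OF abs_mtc_gram_le[OF p, of k "j + 2 * p"], of "\<bar>a (j + 2 * p)\<bar>"] by (simp add: abs_mult mult.commute)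
    show "summable (\<lambda>j. \<bar>a (j + 2 * p) * mtc_gram p k (j + 2 * p)\<bar>)" by (rule summable_ignore_initial_segment[OF s(2)])
    show "summable (\<lambda>j. 2 * \<bar>a (j + 2 * p)\<bar>)" by (intro summable_mult summable_ignore_initial_segment[OF a])
  qed
  also have "\<dots> = 2 * (\<Sum>j. \<bar>a (j + 2 * p)\<bar>)" by (intro suminf_mult summable_ignore_initial_segment[OF a])
  finally show ?thesis .
qed

subsection \<open>Sobolev norms in terms of the spectral density\<close>

text \<open>\<open>i l - x = i (l + i x)\<close>, and the principal branch is multiplicative here:
  the argument of \<open>l + i x\<close> stays strictly between \<open>- pi / 2\<close> and
  \<open>pi / 2\<close>, so adding the argument of \<open>i\<close> does not reach the cut.\<close>

lemma kappa_minus_eq: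
  assumes l: "l > 0"
  shows "kappa_minus l r x = of_real (1 / sqrt (2 * pi)) * (\<i> powr of_real r * Complex l x powr of_real r)"
proof -
  have w: "Re (Complex l x) > 0" "Complex l x \<noteq> 0" using l by (auto simp: complex_eq_iff)
  have "\<bar>Im (Ln (Complex l x))\<bar> < pi / 2" by (rule Re_Ln_pos_lt_imp) (use w in simp)
  then have "\<not> pi < pi / 2 + Im (Ln (Complex l x))" "\<not> pi / 2 + Im (Ln (Complex l x)) \<le> - pi"
    unfolding abs_less_iff by linarith+
  then have "Ln (\<i> * Complex l x) = Ln \<i> + Ln (Complex l x)" using w by (simp add: Ln_times)
  moreover have "\<i> * complex_of_real l - complex_of_real x = \<i> * Complex l x" by (simp add: complex_eq_iff)
  ultimately show ?thesis using w by (simp add: kappa_minus_def powr_def exp_add distrib_left)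
qed

lemma weighted_fourier_eq:
  assumes l: "l > 0"
  shows "weighted_fourier l r f \<psi> = \<i> powr of_real r / (2 * pi) * (LINT x|lborel. Complex l x powr of_real r * of_real (f x) * ft \<psi> x)"
proof -
  have s: "complex_of_real (1 / sqrt (2 * pi)) * of_real (1 / sqrt (2 * pi)) = 1 / (2 * pi)" by (simp flip: of_real_mult)
  have "weighted_fourier l r f \<psi> = (LINT x|lborel. (of_real (1 / sqrt (2 * pi)) * of_real (1 / sqrt (2 * pi)) * \<i> powr of_real r) * (Complex l x powr of_real r * of_real (f x) * ft \<psi> x))"
    unfolding weighted_fourier_def distr_fourier_def distr_of_def kappa_minus_eq[OF l] fourier_eq_ft
    by (simp only: mult_ac)
  then show ?thesis unfolding s integral_mult_right_zero by simp
qed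

lemma wnorm_compact_finite:
  assumes a: "0 < a" and p: "\<And>t. norm (p t) \<le> B * indicator {a..b} t"
  shows "wnorm s p < \<infinity>"
proof -
  define M where "M = max (a powr (2 * s)) (b powr (2 * s)) * B\<^sup>2"
  have "wnorm s p \<le> (\<integral>\<^sup>+t. ennreal M * indicator {a..b} t \<partial>lborel)"
    unfolding wnorm_def
  proof (rule nn_integral_mono)
    fix t
    show "ennreal (t powr (2 * s) * (norm (p t))\<^sup>2) \<le> ennreal M * indicator {a..b} t"
    proof (cases "t \<in> {a..b}")
      case True
      have "t powr (2 * s) \<le> max (a powr (2 * s)) (b powr (2 * s))"
      proof (cases "s \<le> 0")
        case True
        then have "t powr (2 * s) \<le> a powr (2 * s)" using \<open>t \<in> {a..b}\<close> a by (intro powr_mono2') auto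
        then show ?thesis by simp
      next
        case False
        then have "t powr (2 * s) \<le> b powr (2 * s)" using \<open>t \<in> {a..b}\<close> a by (intro powr_mono2) auto
        then show ?thesis by simp
      qed
      moreover have "(norm (p t))\<^sup>2 \<le> B\<^sup>2" using p[of t] True by (intro power_mono) auto
      ultimately have "t powr (2 * s) * (norm (p t))\<^sup>2 \<le> M" unfolding M_def by (intro mult_mono) (auto simp: le_max_iff_disj)
      then show ?thesis using True by (simp add: ennreal_leI)
    next
      case False
      then have "p t = 0" using p[of t] by simp
      then show ?thesis by simp
    qed
  qed
  also have "\<dots> < \<infinity>" by (cases "a \<le> b") (simp_all add: nn_integral_cmult ennreal_mult_less_top)
  finally show ?thesis .
qed

lemma wnorm_finite_set_integrable:
  assumes [measurable]: "G \<in> borel_measurable borel" and W: "wnorm s G < \<infinity>" and a: "0 < a" "a \<le> b"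
  shows "set_integrable lborel {a..b} G"
proof -
  define p where "p t = complex_of_real (indicator {a..b} t)" for t
  have [measurable]: "p \<in> borel_measurable borel" unfolding p_def[abs_def] by measurable
  define H where "H t = (if t \<le> 0 then 0 else G t)" for t
  have [measurable]: "H \<in> borel_measurable borel" unfolding H_def[abs_def] by measurable
  have "wnorm s H \<le> wnorm s G" by (rule wnorm_mono) (simp add: H_def)
  then have WH: "wnorm s H < \<infinity>" using W by (rule le_less_trans)
  have "wnorm (- s) p < \<infinity>" by (rule wnorm_compact_finite[OF a(1), of _ 1 b]) (simp add: p_def)
  then have "integrable lborel (\<lambda>t. H t * p t)"
    by (intro wnorm_pair_integrable[of H p s] WH) (auto simp: H_def)
  moreover have "(\<lambda>t. H t * p t) = (\<lambda>t. indicator {a..b} t *\<^sub>R G t)"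
    using a by (auto simp: fun_eq_iff H_def p_def indicator_def)
  ultimately show ?thesis by (simp add: set_integrable_def)
qed

text \<open>This makes the arbitrary choice of a density in \<open>sobolev_norm\<close> harmless.
  Test functions have compact support in the open half line, so local integrability of both
  densities is enough to subtract them.\<close>

lemma restricts_to_fun_unique:
  assumes "restricts_to_fun T G" "restricts_to_fun T H"
  shows "AE t in lborel. 0 < t \<longrightarrow> G t = H t"
proof -
  have "AE t in lborel. 0 < t \<longrightarrow> G t - H t = 0"
  proof (rule AE_zero_if_test_functions)
    fix a b :: real assume "0 < a" "a \<le> b"
    then show "set_integrable lborel {a..b} (\<lambda>t. G t - H t)" using assms unfolding restricts_to_fun_def by (intro set_integral_diff) auto
  next
    fix \<psi> assume \<psi>: "\<psi> \<in> test_functions {0<..}"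
    obtain a b where ab: "0 < a" "a < b" "\<And>x. x < a \<or> b < x \<Longrightarrow> \<psi> x = 0" using test_functions_cases[OF \<psi>] by blast
    obtain B where B: "0 < B" "\<And>x. norm (\<psi> x) \<le> B" using test_functions_bounded[OF \<psi>] by blast
    have [measurable]: "\<psi> \<in> borel_measurable borel" using \<psi> by (rule test_functions_measurable)
    have i: "set_integrable lborel {0<..} (\<lambda>t. K t * \<psi> t)" if K: "restricts_to_fun T K" for K
    proof -
      have "set_integrable lborel {a..b} K" using K ab unfolding restricts_to_fun_def by auto
      then have "integrable lborel (\<lambda>t. (indicator {a..b} t *\<^sub>R K t) * \<psi> t)"
        unfolding set_integrable_def by (rule integrable_mult_bounded) (use B in auto)
      moreover have "(indicator {a..b} t *\<^sub>R K t) * \<psi> t = indicator {0<..} t *\<^sub>R (K t * \<psi> t)" for t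
        using ab(1,2) ab(3)[of t] by (cases "t < a \<or> b < t") (auto simp: indicator_def)
      ultimately show ?thesis by (simp only: set_integrable_def)
    qed
    have "(LINT t:{0<..}|lborel. (G t - H t) * \<psi> t) = (LINT t:{0<..}|lborel. G t * \<psi> t) - (LINT t:{0<..}|lborel. H t * \<psi> t)"
      unfolding left_diff_distrib by (rule set_integral_diff(2)[OF i[OF assms(1)] i[OF assms(2)]])
    also have "\<dots> = 0" using assms \<psi> unfolding restricts_to_fun_def by simp
    finally show "(LINT t:{0<..}|lborel. (G t - H t) * \<psi> t) = 0" .
  qed
  then show ?thesis by simp
qed

lemma spectral_restricts:
  assumes l: "l > 0" and spec: "spectral l r (\<lambda>x. of_real (f x)) G" and W: "wnorm s G < \<infinity>"
  shows "restricts_to_fun (weighted_fourier l r f) (\<lambda>t. \<i> powr of_real r / (2 * pi) * G t)"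
  unfolding restricts_to_fun_def
proof (intro conjI allI impI ballI)
  fix a b :: real assume "0 < a \<and> a \<le> b"
  then show "set_integrable lborel {a..b} (\<lambda>t. \<i> powr of_real r / (2 * pi) * G t)"
    using wnorm_finite_set_integrable[OF spectralD(1)[OF spec] W] by (intro set_integrable_mult_right) auto
next
  fix \<psi> assume \<psi>: "\<psi> \<in> test_functions {0<..}"
  have "(LINT t:{0<..}|lborel. \<i> powr of_real r / (2 * pi) * G t * \<psi> t) = (LINT t|lborel. \<i> powr of_real r / (2 * pi) * (G t * \<psi> t))"
    unfolding set_lebesgue_integral_def
    by (rule Bochner_Integration.integral_cong) (use spectralD(2)[OF spec] in \<open>auto simp: indicator_def not_less\<close>)
  then show "weighted_fourier l r f \<psi> = (LINT t:{0<..}|lborel. \<i> powr of_real r / (2 * pi) * G t * \<psi> t)"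
    unfolding weighted_fourier_eq[OF l] using spectralD(3)[OF spec \<psi>] by simp
qed

lemma restricts_spectral:
  assumes l: "l > 0" and G: "restricts_to_fun (weighted_fourier l r f) G"
  shows "spectral l r (\<lambda>x. of_real (f x)) (\<lambda>t. if 0 < t then 2 * pi / \<i> powr of_real r * G t else 0)"
  unfolding spectral_def
proof (intro conjI ballI)
  have ip: "\<i> powr of_real r \<noteq> 0" by simp
  \<comment> \<open>\<open>restricts_to_fun\<close> provides measurability on compact intervals of
    the half line only; the extension by 0 is a pointwise limit of such restrictions.\<close>
  have "(\<lambda>t. if 0 < t then G t else 0) \<in> borel_measurable borel"
  proof (rule borel_measurable_LIMSEQ_metric)
    fix n
    have "set_integrable lborel {inverse (real (Suc n))..real (Suc n)} G"
    proof -
      have "inverse (real (Suc n)) \<le> real (Suc n)" using inverse_le_1_iff[of "real (Suc n)"] by (auto intro: order_trans[of _ 1])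
      then show ?thesis using G unfolding restricts_to_fun_def by auto
    qed
    then show "(\<lambda>t. indicator {inverse (real (Suc n))..real (Suc n)} t *\<^sub>R G t) \<in> borel_measurable borel"
      unfolding set_integrable_def by (simp add: borel_measurable_integrable)
  next
    fix t :: real
    show "(\<lambda>n. indicator {inverse (real (Suc n))..real (Suc n)} t *\<^sub>R G t) \<longlonglongrightarrow> (if 0 < t then G t else 0)"
    proof (cases "0 < t")
      case True
      obtain n where n: "inverse (real (Suc n)) < t" using reals_Archimedean[OF True] by blast
      obtain k :: nat where k: "t \<le> k" using real_arch_simple by blast
      have "t \<in> {inverse (real (Suc m))..real (Suc m)}" if "m \<ge> max n k" for m
      proof -
        have "inverse (real (Suc m)) \<le> inverse (real (Suc n))" using that by simp
        then have "inverse (real (Suc m)) \<le> t" using n by linarith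
        then show ?thesis using k that by simp
      qed
      then have "eventually (\<lambda>m. G t = indicator {inverse (real (Suc m))..real (Suc m)} t *\<^sub>R G t) sequentially"
        unfolding eventually_sequentially by (intro exI[of _ "max n k"]) simp
      then show ?thesis using True by (simp add: Lim_transform_eventually[OF tendsto_const])
    next
      case False
      have "t \<notin> {inverse (real (Suc m))..real (Suc m)}" for m
      proof -
        have "0 < inverse (real (Suc m))" by simp
        then show ?thesis using False by (auto simp del: inverse_positive_iff_positive)
      qed
      then show ?thesis using False by simp
    qed
  qed
  then have "(\<lambda>t. 2 * pi / \<i> powr of_real r * (if 0 < t then G t else 0)) \<in> borel_measurable borel" by measurable
  moreover have "(\<lambda>t. 2 * pi / \<i> powr of_real r * (if 0 < t then G t else 0)) = (\<lambda>t. if 0 < t then 2 * pi / \<i> powr of_real r * G t else 0)"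
    by auto
  ultimately show "(\<lambda>t. if 0 < t then 2 * pi / \<i> powr of_real r * G t else 0) \<in> borel_measurable borel" by simp
  fix \<psi> assume \<psi>: "\<psi> \<in> test_functions {0<..}"
  have "(LINT t|lborel. (if 0 < t then 2 * pi / \<i> powr of_real r * G t else 0) * \<psi> t) = (LINT t|lborel. 2 * pi / \<i> powr of_real r * (indicator {0<..} t *\<^sub>R (G t * \<psi> t)))"
    by (rule Bochner_Integration.integral_cong) (auto simp: indicator_def)
  also have "\<dots> = 2 * pi / \<i> powr of_real r * weighted_fourier l r f \<psi>"
    using G \<psi> unfolding integral_mult_right_zero restricts_to_fun_def set_lebesgue_integral_def by simp
  also have "\<dots> = (LINT x|lborel. Complex l x powr of_real r * of_real (f x) * ft \<psi> x)"
    unfolding weighted_fourier_eq[OF l] using ip by simp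
  finally show "(LINT x|lborel. Complex l x powr of_real r * of_real (f x) * ft \<psi> x) = (LINT t|lborel. (if 0 < t then 2 * pi / \<i> powr of_real r * G t else 0) * \<psi> t)" by simp
qed auto

lemma norm_ii_powr: "norm (\<i> powr complex_of_real r) = 1"
  by (simp add: norm_powr_of_real)

lemma wnorm_cmult: "G \<in> borel_measurable borel \<Longrightarrow> wnorm s (\<lambda>t. c * G t) = ennreal ((norm c)\<^sup>2) * wnorm s G"
  unfolding wnorm_def by (simp add: nn_integral_cmult[symmetric] ennreal_mult[symmetric] norm_mult power_mult_distrib mult_ac)

text \<open>\<open>G\<close> differs from the density in \<open>sobolev_norm\<close> by the constant
  \<open>\<i> powr r / (2 * pi)\<close>; its first factor has modulus 1, the second one accounts for
  \<open>(2 * pi)^2\<close>.\<close>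

lemma sobolev_spaceI:
  assumes l: "l > 0" and spec: "spectral l r (\<lambda>x. of_real (f x)) G" and W: "wnorm s G < \<infinity>" and f: "sq_int (\<lambda>x. of_real (f x))"
  shows "f \<in> sobolev_space l s r"
    "(sobolev_norm l s r f)\<^sup>2 = 1 / 2 * (LINT x|lborel. (f x)\<^sup>2) + enn2real (wnorm s G) / (2 * pi)\<^sup>2" "sobolev_norm l s r f \<ge> 0"
proof -
  define c where "c = \<i> powr of_real r / (2 * pi)"
  have nc: "norm c = 1 / (2 * pi)" by (simp add: c_def norm_divide norm_ii_powr)
  note [measurable] = spectralD(1)[OF spec]
  note z = spectralD(2)[OF spec]
  define H where "H t = c * G t" for t
  have [measurable]: "H \<in> borel_measurable borel" unfolding H_def[abs_def] by measurable
  have R: "restricts_to_fun (weighted_fourier l r f) H" unfolding H_def c_def by (rule spectral_restricts[OF l spec W])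
  have WH: "wnorm s H = ennreal (1 / (2 * pi)\<^sup>2) * wnorm s G"
    unfolding H_def[abs_def] wnorm_cmult[OF spectralD(1)[OF spec]] nc by (simp add: power_divide)
  have WHf: "wnorm s H < \<infinity>" unfolding WH using W by (simp add: ennreal_mult_less_top)
  have Hi: "integrable lborel (\<lambda>t. t powr (2 * s) * (norm (H t))\<^sup>2)"
    by (rule integrableI_bounded) (use WHf in \<open>auto simp: wnorm_def abs_mult\<close>)
  have He: "indicator {0<..} t *\<^sub>R (t powr (2 * s) * (norm (H t))\<^sup>2) = t powr (2 * s) * (norm (H t))\<^sup>2" for t
    using z[of t] by (auto simp: indicator_def H_def not_less)
  have ff: "f \<in> borel_measurable borel" "integrable lborel (\<lambda>x. (f x)\<^sup>2)" using f by (auto simp: sq_int_of_real_iff)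
  have "set_integrable lborel {0<..} (\<lambda>t. t powr (2 * s) * (norm (H t))\<^sup>2)"
    unfolding set_integrable_def He by (rule Hi)
  then show "f \<in> sobolev_space l s r" unfolding sobolev_space_def using ff R by auto
  \<comment> \<open>The density picked by the choice operator need not be \<open>H\<close>, but it
    represents the same distribution and hence agrees with \<open>H\<close> almost everywhere on the
    half line.\<close>
  define K where "K = (SOME G. restricts_to_fun (weighted_fourier l r f) G)"
  have K: "restricts_to_fun (weighted_fourier l r f) K" unfolding K_def by (rule someI[of _ H]) (rule R)
  have "(LINT t:{0<..}|lborel. t powr (2 * s) * (norm (K t))\<^sup>2) = (LINT t:{0<..}|lborel. t powr (2 * s) * (norm (H t))\<^sup>2)"
    unfolding set_lebesgue_integral_def
  proof (rule integral_cong_AE)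
    have sK: "spectral l r (\<lambda>x. of_real (f x)) (\<lambda>t. if 0 < t then 2 * pi / \<i> powr of_real r * K t else 0)"
      by (rule restricts_spectral[OF l K])
    note [measurable] = spectralD(1)[OF sK]
    have "(\<lambda>t. t powr (2 * s) * (norm (c * (if 0 < t then 2 * pi / \<i> powr of_real r * K t else 0)))\<^sup>2) \<in> borel_measurable lborel" by measurable
    moreover have "(\<lambda>t. t powr (2 * s) * (norm (c * (if 0 < t then 2 * pi / \<i> powr of_real r * K t else 0)))\<^sup>2) = (\<lambda>t. indicator {0<..} t *\<^sub>R (t powr (2 * s) * (norm (K t))\<^sup>2))"
      by (auto simp: fun_eq_iff c_def indicator_def)
    ultimately show "(\<lambda>t. indicator {0<..} t *\<^sub>R (t powr (2 * s) * (norm (K t))\<^sup>2)) \<in> borel_measurable lborel" by simp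
    show "AE t in lborel. indicator {0<..} t *\<^sub>R (t powr (2 * s) * (norm (K t))\<^sup>2) = indicator {0<..} t *\<^sub>R (t powr (2 * s) * (norm (H t))\<^sup>2)"
      using restricts_to_fun_unique[OF K R] by eventually_elim (auto simp: indicator_def)
  qed measurable
  also have "\<dots> = (LINT t|lborel. t powr (2 * s) * (norm (H t))\<^sup>2)" unfolding set_lebesgue_integral_def He ..
  also have "\<dots> = enn2real (wnorm s H)" by (subst integral_eq_nn_integral) (auto simp: wnorm_def)
  also have "\<dots> = enn2real (wnorm s G) / (2 * pi)\<^sup>2" unfolding WH by (simp add: enn2real_mult)
  finally have I: "(LINT t:{0<..}|lborel. t powr (2 * s) * (norm (K t))\<^sup>2) = enn2real (wnorm s G) / (2 * pi)\<^sup>2" .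
  have sn: "sobolev_norm l s r f = sqrt (1 / 2 * (LINT x|lborel. (f x)\<^sup>2) + enn2real (wnorm s G) / (2 * pi)\<^sup>2)"
    unfolding sobolev_norm_def Let_def K_def[symmetric] I ..
  have nn: "0 \<le> 1 / 2 * (LINT x|lborel. (f x)\<^sup>2) + enn2real (wnorm s G) / (2 * pi)\<^sup>2" by (intro add_nonneg_nonneg) auto
  show "(sobolev_norm l s r f)\<^sup>2 = 1 / 2 * (LINT x|lborel. (f x)\<^sup>2) + enn2real (wnorm s G) / (2 * pi)\<^sup>2"
    unfolding sn using nn by simp
  show "sobolev_norm l s r f \<ge> 0" unfolding sn using nn by simp
qed

lemma sobolev_spaceE:
  assumes l: "l > 0" and f: "f \<in> sobolev_space l s r"
  obtains G where "spectral l r (\<lambda>x. of_real (f x)) G" "wnorm s G < \<infinity>" "sq_int (\<lambda>x. of_real (f x))"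
proof -
  obtain G where G: "restricts_to_fun (weighted_fourier l r f) G" "set_integrable lborel {0<..} (\<lambda>t. t powr (2 * s) * (norm (G t))\<^sup>2)"
    and f: "f \<in> borel_measurable borel" "integrable lborel (\<lambda>x. (f x)\<^sup>2)"
    using f unfolding sobolev_space_def by auto
  define H where "H t = (if 0 < t then 2 * pi / \<i> powr of_real r * G t else 0)" for t
  have "integrable lborel (\<lambda>t. (2 * pi)\<^sup>2 * (indicator {0<..} t *\<^sub>R (t powr (2 * s) * (norm (G t))\<^sup>2)))"
    using G(2) unfolding set_integrable_def by (rule integrable_mult_right)
  moreover have "(2 * pi)\<^sup>2 * (indicator {0<..} t *\<^sub>R (t powr (2 * s) * (norm (G t))\<^sup>2)) = t powr (2 * s) * (norm (H t))\<^sup>2" for t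
    by (auto simp: H_def indicator_def norm_mult norm_divide norm_ii_powr power_mult_distrib)
  ultimately have "integrable lborel (\<lambda>t. t powr (2 * s) * (norm (H t))\<^sup>2)" by (simp only:)
  then have "wnorm s H < \<infinity>" by (simp add: integrable_iff_bounded wnorm_def abs_mult)
  moreover have "spectral l r (\<lambda>x. of_real (f x)) H" unfolding H_def by (rule restricts_spectral[OF l G(1)])
  ultimately show ?thesis using that f by (simp add: sq_int_of_real_iff)
qed

subsection \<open>Spectral densities of series and interpolation errors\<close>

lemma spectral_add:
  assumes l: "l > 0" and "sq_int f" "sq_int g" "spectral l r f G" "spectral l r g H"
    and "wnorm s G < \<infinity>" "wnorm s H < \<infinity>"
  shows "spectral l r (\<lambda>x. f x + g x) (\<lambda>t. G t + H t)"
  unfolding spectral_def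
proof (intro conjI ballI)
  note [measurable] = spectralD(1)[OF assms(4)] spectralD(1)[OF assms(5)]
  show "(\<lambda>t. G t + H t) \<in> borel_measurable borel" by measurable
  show "\<forall>t\<le>0. G t + H t = 0" using spectralD(2)[OF assms(4)] spectralD(2)[OF assms(5)] by simp
  fix \<psi> assume \<psi>: "\<psi> \<in> test_functions {0<..}"
  obtain a b where ab: "0 < a" "a < b" "\<And>x. x < a \<or> b < x \<Longrightarrow> \<psi> x = 0" using test_functions_cases[OF \<psi>] by blast
  obtain B where B: "0 < B" "\<And>x. norm (\<psi> x) \<le> B" using test_functions_bounded[OF \<psi>] by blast
  have W: "wnorm (- s) \<psi> < \<infinity>"
  proof (rule wnorm_compact_finite[OF ab(1), of _ B b])
    show "norm (\<psi> t) \<le> B * indicator {a..b} t" for t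
      using B(2)[of t] ab(3)[of t] by (cases "t < a \<or> b < t") auto
  qed
  have m: "\<psi> \<in> borel_measurable borel" using \<psi> by (rule test_functions_measurable)
  have i: "integrable lborel (\<lambda>t. G t * \<psi> t)" "integrable lborel (\<lambda>t. H t * \<psi> t)"
    by (rule wnorm_pair_integrable[OF spectralD(1)[OF assms(4)] m spectralD(2)[OF assms(4)] assms(6) W], assumption)
      (rule wnorm_pair_integrable[OF spectralD(1)[OF assms(5)] m spectralD(2)[OF assms(5)] assms(7) W], assumption)
  show "(LINT x|lborel. Complex l x powr of_real r * (f x + g x) * ft \<psi> x) = (LINT t|lborel. (G t + H t) * \<psi> t)"
    using spectral_integrable[OF \<psi> l assms(2), of r] spectral_integrable[OF \<psi> l assms(3), of r] i
      spectralD(3)[OF assms(4) \<psi>] spectralD(3)[OF assms(5) \<psi>]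
    by (simp add: distrib_left distrib_right)
qed

lemma spectral_cmult:
  assumes "spectral l r f G" shows "spectral l r (\<lambda>x. c * f x) (\<lambda>t. c * G t)"
  unfolding spectral_def
proof (intro conjI ballI)
  note [measurable] = spectralD(1)[OF assms]
  show "(\<lambda>t. c * G t) \<in> borel_measurable borel" by measurable
  show "\<forall>t\<le>0. c * G t = 0" using spectralD(2)[OF assms] by simp
  fix \<psi> assume \<psi>: "\<psi> \<in> test_functions {0<..}"
  have "(LINT x|lborel. Complex l x powr of_real r * (c * f x) * ft \<psi> x) = (LINT x|lborel. c * (Complex l x powr of_real r * f x * ft \<psi> x))"
    by (simp only: mult_ac)
  also have "\<dots> = c * (LINT t|lborel. G t * \<psi> t)" unfolding integral_mult_right_zero spectralD(3)[OF assms \<psi>] ..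
  finally show "(LINT x|lborel. Complex l x powr of_real r * (c * f x) * ft \<psi> x) = (LINT t|lborel. c * G t * \<psi> t)"
    by (simp add: mult.assoc)
qed

lemma spectral_cong_AE:
  assumes l: "l > 0" and spec: "spectral l r f G" and m [measurable]: "f \<in> borel_measurable borel" "g \<in> borel_measurable borel"
    and ae: "AE x in lborel. f x = g x"
  shows "spectral l r g G"
  unfolding spectral_def
proof (intro conjI ballI spectralD(1)[OF spec])
  show "\<forall>t\<le>0. G t = 0" using spectralD(2)[OF spec] by blast
  fix \<psi> assume \<psi>: "\<psi> \<in> test_functions {0<..}"
  note [measurable] = measurable_Complex_powr[OF l] measurable_ft[OF test_functions_integrable[OF \<psi>]]
  have "(LINT x|lborel. Complex l x powr of_real r * g x * ft \<psi> x) = (LINT x|lborel. Complex l x powr of_real r * f x * ft \<psi> x)"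
    by (rule integral_cong_AE) (use ae in \<open>auto elim: eventually_mono\<close>)
  then show "(LINT x|lborel. Complex l x powr of_real r * g x * ft \<psi> x) = (LINT t|lborel. G t * \<psi> t)"
    using spectralD(3)[OF spec \<psi>] by simp
qed

lemma wnorm_add_le:
  assumes [measurable]: "G \<in> borel_measurable borel" "H \<in> borel_measurable borel"
  shows "wnorm s (\<lambda>t. G t + H t) \<le> 2 * wnorm s G + 2 * wnorm s H"
proof -
  have "wnorm s (\<lambda>t. G t + H t) \<le> (\<integral>\<^sup>+t. 2 * ennreal (t powr (2 * s) * (norm (G t))\<^sup>2) + 2 * ennreal (t powr (2 * s) * (norm (H t))\<^sup>2) \<partial>lborel)"
    unfolding wnorm_def
  proof (rule nn_integral_mono)
    fix t
    have "(norm (G t + H t))\<^sup>2 \<le> (norm (G t) + norm (H t))\<^sup>2" by (intro power_mono norm_triangle_ineq) simp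
    also have "\<dots> \<le> 2 * (norm (G t))\<^sup>2 + 2 * (norm (H t))\<^sup>2"
      using sum_squares_bound[of "norm (G t)" "norm (H t)"] by (simp add: power2_sum)
    finally have "t powr (2 * s) * (norm (G t + H t))\<^sup>2 \<le> t powr (2 * s) * (2 * (norm (G t))\<^sup>2 + 2 * (norm (H t))\<^sup>2)"
      by (intro mult_left_mono) auto
    then have "ennreal (t powr (2 * s) * (norm (G t + H t))\<^sup>2) \<le> ennreal (2 * (t powr (2 * s) * (norm (G t))\<^sup>2) + 2 * (t powr (2 * s) * (norm (H t))\<^sup>2))"
      by (intro ennreal_leI) (simp add: algebra_simps)
    also have "\<dots> = 2 * ennreal (t powr (2 * s) * (norm (G t))\<^sup>2) + 2 * ennreal (t powr (2 * s) * (norm (H t))\<^sup>2)"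
      by (simp add: ennreal_mult)
    finally show "ennreal (t powr (2 * s) * (norm (G t + H t))\<^sup>2) \<le> 2 * ennreal (t powr (2 * s) * (norm (G t))\<^sup>2) + 2 * ennreal (t powr (2 * s) * (norm (H t))\<^sup>2)" .
  qed
  also have "\<dots> = 2 * wnorm s G + 2 * wnorm s H"
    unfolding wnorm_def by (subst nn_integral_add) (auto simp: nn_integral_cmult)
  finally show ?thesis .
qed

lemma Cauchy_Schwarz_suminf_ennreal:
  fixes f g :: "nat \<Rightarrow> ennreal"
  shows "(\<Sum>j. f j * g j)\<^sup>2 \<le> (\<Sum>j. (f j)\<^sup>2) * (\<Sum>j. (g j)\<^sup>2)"
  using Cauchy_Schwarz_nn_integral[of f "count_space UNIV" g] by (simp add: nn_integral_count_space_nat)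

lemma mult_le_sum_squares_ennreal: "a * b \<le> a\<^sup>2 + (b\<^sup>2 :: ennreal)"
proof (cases "a \<le> b")
  case True
  then have "a * b \<le> b * b" by (rule mult_right_mono) simp
  also have "\<dots> \<le> a\<^sup>2 + b\<^sup>2" by (simp add: power2_eq_square)
  finally show ?thesis .
next
  case False
  then have "a * b \<le> a * a" by (intro mult_left_mono) auto
  also have "\<dots> \<le> a\<^sup>2 + b\<^sup>2" by (simp add: power2_eq_square)
  finally show ?thesis .
qed

text \<open>Minkowski's inequality for infinitely many densities, obtained from Cauchy-Schwarz with
  the weights \<open>\<bar>e j\<bar> * m j\<close> and \<open>\<bar>e j\<bar> / m j\<close>. That
  the series of densities belongs to the series of functions follows by termwise integration on both
  sides of the testing identity.\<close>

lemma spectral_mtc_series: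
  fixes e m :: "nat \<Rightarrow> real"
  assumes l: "l > 0" and m: "\<And>j. m j > 0"
    and Gs: "\<And>j. spectral l r (\<lambda>x. of_real (mtc l j x)) (G j)" and Gw: "\<And>j. wnorm s (G j) \<le> ennreal ((m j)\<^sup>2)"
    and e1: "summable (\<lambda>j. \<bar>e j\<bar>)" and e: "summable (\<lambda>j. \<bar>e j\<bar> * m j)"
  shows "\<exists>H. spectral l r (\<lambda>x. of_real (mtc_series l e x)) H \<and> wnorm s H \<le> ennreal ((\<Sum>j. \<bar>e j\<bar> * m j)\<^sup>2)"
proof -
  define S where "S = (\<Sum>j. \<bar>e j\<bar> * m j)"
  have em0: "\<bar>e j\<bar> * m j \<ge> 0" for j using m[of j] by simp
  have S0: "S \<ge> 0" unfolding S_def by (rule suminf_nonneg[OF e em0])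
  have Sen: "(\<Sum>j. ennreal (\<bar>e j\<bar> * m j)) = ennreal S" unfolding S_def by (rule suminf_ennreal2[OF em0 e])
  have [measurable]: "G j \<in> borel_measurable borel" for j by (rule spectralD(1)[OF Gs])
  have G0: "t \<le> 0 \<Longrightarrow> G j t = 0" for j t by (rule spectralD(2)[OF Gs])
  \<comment> \<open>The pointwise sum of absolute values in \<open>ennreal\<close>, meaningful also
    where the series of densities diverges.\<close>
  define X where "X t = (\<Sum>j. ennreal (\<bar>e j\<bar> * norm (G j t)))" for t
  have [measurable]: "X \<in> borel_measurable borel" unfolding X_def[abs_def] by measurable
  have X2: "(X t)\<^sup>2 \<le> ennreal S * (\<Sum>j. ennreal (\<bar>e j\<bar> / m j * (norm (G j t))\<^sup>2))" for t
  proof -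
    have "X t = (\<Sum>j. ennreal (sqrt (\<bar>e j\<bar> * m j)) * ennreal (sqrt (\<bar>e j\<bar> / m j) * norm (G j t)))"
      unfolding X_def
    proof (rule suminf_cong)
      fix j
      have "sqrt (\<bar>e j\<bar> * m j) * sqrt (\<bar>e j\<bar> / m j) = sqrt (\<bar>e j\<bar> * \<bar>e j\<bar>)"
        using m[of j] by (simp only: real_sqrt_mult[symmetric]) simp
      also have "\<dots> = \<bar>e j\<bar>" by simp
      finally have "\<bar>e j\<bar> * norm (G j t) = sqrt (\<bar>e j\<bar> * m j) * (sqrt (\<bar>e j\<bar> / m j) * norm (G j t))" by (simp only: mult.assoc[symmetric])
      then show "ennreal (\<bar>e j\<bar> * norm (G j t)) = ennreal (sqrt (\<bar>e j\<bar> * m j)) * ennreal (sqrt (\<bar>e j\<bar> / m j) * norm (G j t))"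
        using m[of j] by (simp only: ennreal_mult[symmetric] real_sqrt_ge_zero mult_nonneg_nonneg divide_nonneg_pos abs_ge_zero norm_ge_zero less_imp_le)
    qed
    then have "(X t)\<^sup>2 \<le> (\<Sum>j. (ennreal (sqrt (\<bar>e j\<bar> * m j)))\<^sup>2) * (\<Sum>j. (ennreal (sqrt (\<bar>e j\<bar> / m j) * norm (G j t)))\<^sup>2)"
      by (simp only: Cauchy_Schwarz_suminf_ennreal)
    also have "(\<Sum>j. (ennreal (sqrt (\<bar>e j\<bar> * m j)))\<^sup>2) = ennreal S"
      unfolding Sen[symmetric] using em0 by (intro suminf_cong) (simp add: ennreal_power)
    also have "(\<Sum>j. (ennreal (sqrt (\<bar>e j\<bar> / m j) * norm (G j t)))\<^sup>2) = (\<Sum>j. ennreal (\<bar>e j\<bar> / m j * (norm (G j t))\<^sup>2))"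
      using m by (intro suminf_cong) (simp add: ennreal_power power_mult_distrib less_imp_le)
    finally show ?thesis .
  qed
  have WX: "(\<integral>\<^sup>+t. ennreal (t powr (2 * s)) * (X t)\<^sup>2 \<partial>lborel) \<le> ennreal (S\<^sup>2)"
  proof -
    have "(\<integral>\<^sup>+t. ennreal (t powr (2 * s)) * (X t)\<^sup>2 \<partial>lborel) \<le>
        (\<integral>\<^sup>+t. ennreal S * (\<Sum>j. ennreal (\<bar>e j\<bar> / m j) * ennreal (t powr (2 * s) * (norm (G j t))\<^sup>2)) \<partial>lborel)"
    proof (rule nn_integral_mono)
      fix t
      have "ennreal (t powr (2 * s)) * (X t)\<^sup>2 \<le> ennreal (t powr (2 * s)) * (ennreal S * (\<Sum>j. ennreal (\<bar>e j\<bar> / m j * (norm (G j t))\<^sup>2)))"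
        by (intro mult_left_mono X2) simp
      also have "\<dots> = ennreal S * (\<Sum>j. ennreal (t powr (2 * s)) * ennreal (\<bar>e j\<bar> / m j * (norm (G j t))\<^sup>2))"
        by (simp add: mult.left_commute)
      also have "(\<Sum>j. ennreal (t powr (2 * s)) * ennreal (\<bar>e j\<bar> / m j * (norm (G j t))\<^sup>2)) = (\<Sum>j. ennreal (\<bar>e j\<bar> / m j) * ennreal (t powr (2 * s) * (norm (G j t))\<^sup>2))"
        using m by (intro suminf_cong) (simp add: ennreal_mult[symmetric] less_imp_le mult_ac)
      finally show "ennreal (t powr (2 * s)) * (X t)\<^sup>2 \<le> ennreal S * (\<Sum>j. ennreal (\<bar>e j\<bar> / m j) * ennreal (t powr (2 * s) * (norm (G j t))\<^sup>2))" .
    qed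
    also have "\<dots> = ennreal S * (\<Sum>j. ennreal (\<bar>e j\<bar> / m j) * wnorm s (G j))"
      unfolding wnorm_def by (simp add: nn_integral_cmult nn_integral_suminf)
    also have "\<dots> \<le> ennreal S * (\<Sum>j. ennreal (\<bar>e j\<bar> / m j) * ennreal ((m j)\<^sup>2))"
      by (intro mult_left_mono suminf_le Gw) auto
    also have "(\<Sum>j. ennreal (\<bar>e j\<bar> / m j) * ennreal ((m j)\<^sup>2)) = (\<Sum>j. ennreal (\<bar>e j\<bar> * m j))"
      using m by (intro suminf_cong) (simp add: ennreal_mult[symmetric] less_imp_le power2_eq_square)
    also have "ennreal S * \<dots> = ennreal (S\<^sup>2)" unfolding Sen using S0 by (simp add: ennreal_mult[symmetric] power2_eq_square)
    finally show ?thesis .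
  qed
  define H where "H t = (\<Sum>j. of_real (e j) * G j t)" for t
  have Hm [measurable]: "H \<in> borel_measurable borel" unfolding H_def[abs_def] by measurable
  have sumX: "summable (\<lambda>j. norm (of_real (e j) * G j t))" if "X t < \<infinity>" for t
  proof -
    have "summable (\<lambda>j. \<bar>e j\<bar> * norm (G j t))"
      by (rule summable_suminf_not_top) (use that in \<open>auto simp: X_def\<close>)
    then show ?thesis by (simp add: norm_mult)
  qed
  \<comment> \<open>Trivial where \<open>X t\<close> is infinite, whatever value the divergent sum
    \<open>H t\<close> is given there.\<close>
  have HX: "ennreal (norm (H t)) \<le> X t" for t
  proof (cases "X t < \<infinity>")
    case True
    have "norm (H t) \<le> (\<Sum>j. norm (of_real (e j) * G j t))" unfolding H_def by (rule summable_norm[OF sumX[OF True]])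
    then have "ennreal (norm (H t)) \<le> ennreal (\<Sum>j. norm (of_real (e j) * G j t))" by (rule ennreal_leI)
    also have "\<dots> = (\<Sum>j. ennreal (norm (of_real (e j) * G j t)))" by (rule suminf_ennreal2[symmetric]) (use sumX[OF True] in auto)
    also have "\<dots> = X t" by (simp add: X_def norm_mult)
    finally show ?thesis .
  next
    case False
    then have "X t = top" by (simp add: less_top[symmetric])
    then show ?thesis by simp
  qed
  have WH: "wnorm s H \<le> ennreal (S\<^sup>2)"
  proof -
    have "wnorm s H \<le> (\<integral>\<^sup>+t. ennreal (t powr (2 * s)) * (X t)\<^sup>2 \<partial>lborel)"
      unfolding wnorm_def
    proof (rule nn_integral_mono)
      fix t
      have "ennreal (t powr (2 * s) * (norm (H t))\<^sup>2) = ennreal (t powr (2 * s)) * (ennreal (norm (H t)))\<^sup>2"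
        by (simp add: ennreal_mult ennreal_power)
      also have "\<dots> \<le> ennreal (t powr (2 * s)) * (X t)\<^sup>2" by (intro mult_left_mono power_mono HX) auto
      finally show "ennreal (t powr (2 * s) * (norm (H t))\<^sup>2) \<le> ennreal (t powr (2 * s)) * (X t)\<^sup>2" .
    qed
    also note WX
    finally show ?thesis .
  qed
  have "spectral l r (\<lambda>x. of_real (mtc_series l e x)) H"
    unfolding spectral_def
  proof (intro conjI ballI Hm)
    show "\<forall>t\<le>0. H t = 0" by (simp add: H_def G0)
    fix \<psi> assume \<psi>: "\<psi> \<in> test_functions {0<..}"
    obtain a b where ab: "0 < a" "a < b" "\<And>x. x < a \<or> b < x \<Longrightarrow> \<psi> x = 0" using test_functions_cases[OF \<psi>] by blast
    obtain B where B: "0 < B" "\<And>x. norm (\<psi> x) \<le> B" using test_functions_bounded[OF \<psi>] by blast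
    have [measurable]: "\<psi> \<in> borel_measurable borel" using \<psi> by (rule test_functions_measurable)
    have W\<psi>: "wnorm (- s) \<psi> < \<infinity>"
    proof (rule wnorm_compact_finite[OF ab(1), of _ B b])
      show "norm (\<psi> t) \<le> B * indicator {a..b} t" for t
        using B(2)[of t] ab(3)[of t] by (cases "t < a \<or> b < t") auto
    qed
    have \<psi>0: "\<psi> t = 0" if "t \<le> 0" for t using ab that by auto
    have fin: "(\<integral>\<^sup>+t. X t * ennreal (norm (\<psi> t)) \<partial>lborel) < \<infinity>"
    proof -
      have "(\<integral>\<^sup>+t. X t * ennreal (norm (\<psi> t)) \<partial>lborel) \<le> (\<integral>\<^sup>+t. ennreal (t powr (2 * s)) * (X t)\<^sup>2 + ennreal (t powr (2 * (- s)) * (norm (\<psi> t))\<^sup>2) \<partial>lborel)"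
      proof (rule nn_integral_mono)
        fix t
        show "X t * ennreal (norm (\<psi> t)) \<le> ennreal (t powr (2 * s)) * (X t)\<^sup>2 + ennreal (t powr (2 * (- s)) * (norm (\<psi> t))\<^sup>2)"
        proof (cases "t \<le> 0")
          case False
          have one: "ennreal (t powr s) * ennreal (t powr (- s)) = 1" using False by (simp add: ennreal_mult[symmetric] powr_add[symmetric])
          have sq1: "(ennreal (t powr s))\<^sup>2 = ennreal (t powr (2 * s))" by (simp add: power2_eq_square ennreal_mult[symmetric] powr_add[symmetric])
          have sq2: "(ennreal (t powr (- s)))\<^sup>2 = ennreal (t powr (2 * (- s)))" by (simp add: power2_eq_square ennreal_mult[symmetric] powr_add[symmetric])
          have "X t * ennreal (norm (\<psi> t)) = (ennreal (t powr s) * ennreal (t powr (- s))) * (X t * ennreal (norm (\<psi> t)))" unfolding one by simp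
          also have "\<dots> = (ennreal (t powr s) * X t) * (ennreal (t powr (- s)) * ennreal (norm (\<psi> t)))" by (simp only: mult_ac)
          also have "\<dots> \<le> (ennreal (t powr s) * X t)\<^sup>2 + (ennreal (t powr (- s)) * ennreal (norm (\<psi> t)))\<^sup>2" by (rule mult_le_sum_squares_ennreal)
          also have "\<dots> = ennreal (t powr (2 * s)) * (X t)\<^sup>2 + ennreal (t powr (2 * (- s)) * (norm (\<psi> t))\<^sup>2)"
            unfolding power_mult_distrib sq1 sq2 by (simp add: ennreal_power ennreal_mult)
          finally show ?thesis .
        qed (simp add: \<psi>0)
      qed
      also have "\<dots> = (\<integral>\<^sup>+t. ennreal (t powr (2 * s)) * (X t)\<^sup>2 \<partial>lborel) + wnorm (- s) \<psi>"
        unfolding wnorm_def by (rule nn_integral_add) measurable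
      also have "\<dots> < \<infinity>" using WX W\<psi> by (simp add: order_le_less_trans)
      finally show ?thesis .
    qed
    define h where "h j t = of_real (e j) * (G j t * \<psi> t)" for j t
    have [measurable]: "h j \<in> borel_measurable borel" for j unfolding h_def[abs_def] by measurable
    have hn: "ennreal (norm (h j t)) = ennreal (\<bar>e j\<bar> * norm (G j t)) * ennreal (norm (\<psi> t))" for j t
      by (simp add: h_def norm_mult ennreal_mult mult.assoc)
    have hs: "(\<Sum>j. ennreal (norm (h j t))) = X t * ennreal (norm (\<psi> t))" for t
      unfolding hn X_def by simp
    have tot: "(\<Sum>j. (\<integral>\<^sup>+t. ennreal (norm (h j t)) \<partial>lborel)) < \<infinity>"
    proof -
      have "(\<Sum>j. (\<integral>\<^sup>+t. ennreal (norm (h j t)) \<partial>lborel)) = (\<integral>\<^sup>+t. X t * ennreal (norm (\<psi> t)) \<partial>lborel)"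
        unfolding hs[symmetric] by (rule nn_integral_suminf[symmetric]) measurable
      then show ?thesis using fin by simp
    qed
    have hi: "integrable lborel (h j)" for j
    proof (rule integrableI_bounded)
      have "(\<Sum>i\<in>{j}. (\<integral>\<^sup>+t. ennreal (norm (h i t)) \<partial>lborel)) \<le> (\<Sum>j. (\<integral>\<^sup>+t. ennreal (norm (h j t)) \<partial>lborel))" by (rule sum_le_suminf) auto
      then show "(\<integral>\<^sup>+t. ennreal (norm (h j t)) \<partial>lborel) < \<infinity>" using tot by (simp add: order_le_less_trans)
    qed simp
    have "(\<lambda>j. LINT t|lborel. h j t) sums (LINT t|lborel. (\<Sum>j. h j t))"
    proof (rule sums_integral[OF hi])
      have "AE t in lborel. X t * ennreal (norm (\<psi> t)) \<noteq> \<infinity>"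
        by (rule nn_integral_noteq_infinite) (use fin in auto)
      then show "AE t in lborel. summable (\<lambda>j. norm (h j t))"
      proof eventually_elim
        fix t assume "X t * ennreal (norm (\<psi> t)) \<noteq> \<infinity>"
        then have "(\<Sum>j. ennreal (norm (h j t))) \<noteq> top" unfolding hs by simp
        then show "summable (\<lambda>j. norm (h j t))" by (intro summable_suminf_not_top) auto
      qed
      show "summable (\<lambda>j. LINT t|lborel. norm (h j t))"
      proof (rule summable_suminf_not_top)
        have "ennreal (LINT t|lborel. norm (h j t)) = (\<integral>\<^sup>+t. ennreal (norm (h j t)) \<partial>lborel)" for j
          by (rule nn_integral_eq_integral[symmetric]) (use hi in auto)
        then show "(\<Sum>j. ennreal (LINT t|lborel. norm (h j t))) \<noteq> top" using tot by simp
      qed simp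
    qed
    \<comment> \<open>Almost everywhere either \<open>\<psi> t = 0\<close> or \<open>X t\<close> is
      finite; in the second case \<open>H t\<close> is a convergent sum and the factor can be pulled
      out.\<close>
    have eqae: "(LINT t|lborel. (\<Sum>j. h j t)) = (LINT t|lborel. H t * \<psi> t)"
    proof (rule integral_cong_AE)
      have "AE t in lborel. X t * ennreal (norm (\<psi> t)) \<noteq> \<infinity>"
        by (rule nn_integral_noteq_infinite) (use fin in auto)
      then show "AE t in lborel. (\<Sum>j. h j t) = H t * \<psi> t"
      proof eventually_elim
        fix t assume t: "X t * ennreal (norm (\<psi> t)) \<noteq> \<infinity>"
        show "(\<Sum>j. h j t) = H t * \<psi> t"
        proof (cases "\<psi> t = 0")
          case True then show ?thesis by (simp add: h_def)
        next
          case False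
          then have "X t < \<infinity>" using t by (auto simp: ennreal_mult_eq_top_iff top.not_eq_extremum)
          then have "summable (\<lambda>j. of_real (e j) * G j t)" using sumX by (metis summable_norm_cancel)
          from suminf_mult2[OF this, of "\<psi> t"] show ?thesis by (simp add: h_def H_def mult.assoc)
        qed
      qed
    qed measurable
    define D where "D x = Complex l x powr of_real r * ft \<psi> x" for x
    have Dsq: "sq_int D" unfolding D_def[abs_def] by (rule sq_int_weighted_ft[OF \<psi> l])
    have Dm [measurable]: "D \<in> borel_measurable borel" using Dsq by (simp add: sq_int_def)
    define c where "c x = sqrt (l / pi) / norm (Complex (l / 2) x)" for x
    have ci: "integrable lborel (\<lambda>x. norm (D x) * c x)"
    proof -
      have "sq_int (\<lambda>x. complex_of_real (c x))"
        by (rule sq_int_bound[where c = "l / 2" and C = "sqrt (l / pi)"]) (use l in \<open>auto simp: c_def norm_divide\<close>)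
      from integrable_norm[OF sq_int_mult_integrable[OF Dsq this]] show ?thesis using l by (simp add: norm_mult norm_divide c_def)
    qed
    define k where "k j x = of_real (e j * mtc l j x) * D x" for j x
    have ki: "integrable lborel (k j)" for j
      unfolding k_def[abs_def] of_real_mult mult.assoc
      by (intro integrable_mult_right sq_int_mult_integrable sq_int_mtc l Dsq)
    have kb: "norm (k j x) \<le> \<bar>e j\<bar> * (norm (D x) * c x)" for j x
    proof -
      have "norm (k j x) = \<bar>e j\<bar> * (\<bar>mtc l j x\<bar> * norm (D x))" by (simp only: k_def norm_mult norm_of_real abs_mult mult.assoc)
      also have "\<dots> \<le> \<bar>e j\<bar> * (c x * norm (D x))" unfolding c_def by (intro mult_left_mono mult_right_mono abs_mtc_le l) auto
      finally show ?thesis by (simp add: mult.commute)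
    qed
    have "(\<lambda>j. LINT x|lborel. k j x) sums (LINT x|lborel. (\<Sum>j. k j x))"
    proof (rule sums_integral[OF ki])
      show "AE x in lborel. summable (\<lambda>j. norm (k j x))"
        by (intro AE_I2 summable_comparison_test'[OF summable_mult2[OF e1], of 0]) (use kb in simp)
      show "summable (\<lambda>j. LINT x|lborel. norm (k j x))"
      proof (rule summable_comparison_test'[OF summable_mult2[OF e1], of 0])
        fix j
        have "(LINT x|lborel. norm (k j x)) \<le> (LINT x|lborel. \<bar>e j\<bar> * (norm (D x) * c x))"
          by (rule integral_mono) (use ki ci kb in auto)
        then show "norm (LINT x|lborel. norm (k j x)) \<le> \<bar>e j\<bar> * (LINT x|lborel. norm (D x) * c x)" by simp
      qed
    qed
    moreover have "(\<Sum>j. k j x) = Complex l x powr of_real r * of_real (mtc_series l e x) * ft \<psi> x" for x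
    proof -
      have "summable (\<lambda>j. complex_of_real (e j * mtc l j x))"
        by (rule summable_of_real) (rule summable_rabs_cancel[OF mtc_series_summable(1)[OF l e1]])
      then have "(\<Sum>j. k j x) = (\<Sum>j. complex_of_real (e j * mtc l j x)) * D x"
        unfolding k_def by (rule suminf_mult2[symmetric])
      also have "(\<Sum>j. complex_of_real (e j * mtc l j x)) = of_real (mtc_series l e x)"
        unfolding mtc_series_def
        by (rule suminf_of_real[symmetric]) (rule summable_rabs_cancel[OF mtc_series_summable(1)[OF l e1]])
      finally show ?thesis unfolding D_def by (simp only: mult_ac)
    qed
    moreover have "(LINT x|lborel. k j x) = (LINT t|lborel. h j t)" for j
    proof -
      have "(LINT x|lborel. k j x) = (LINT x|lborel. of_real (e j) * (Complex l x powr of_real r * of_real (mtc l j x) * ft \<psi> x))"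
        unfolding k_def D_def of_real_mult by (simp only: mult_ac)
      also have "\<dots> = (LINT t|lborel. h j t)"
        unfolding h_def integral_mult_right_zero spectralD(3)[OF Gs \<psi>] ..
      finally show ?thesis .
    qed
    ultimately have "(\<lambda>j. LINT t|lborel. h j t) sums (LINT x|lborel. Complex l x powr of_real r * of_real (mtc_series l e x) * ft \<psi> x)" by simp
    moreover have "(\<lambda>j. LINT t|lborel. h j t) sums (LINT t|lborel. H t * \<psi> t)"
      using \<open>(\<lambda>j. LINT t|lborel. h j t) sums (LINT t|lborel. (\<Sum>j. h j t))\<close> unfolding eqae .
    ultimately show "(LINT x|lborel. Complex l x powr of_real r * of_real (mtc_series l e x) * ft \<psi> x) = (LINT t|lborel. H t * \<psi> t)"
      by (rule sums_unique2)
  qed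
  with WH show ?thesis unfolding S_def by blast
qed

text \<open>Of the two Hardy parts of an MTC function only the conjugated one has a density on the
  half line. Its squared norm is a constant times \<open>Gamma (k + 1 + a) / fact k\<close> with
  \<open>a = 2 * \<rho>\<close>, which grows like \<open>(k + 1) powr a\<close>.\<close>

lemma spectral_mtc:
  assumes l: "l > 0" and \<rho>: "\<rho> > 0"
  obtains C where "C > 0" "\<And>j. \<exists>G. spectral (l / 2) (2 * \<rho>) (\<lambda>x. of_real (mtc l j x)) G \<and> wnorm \<rho> G \<le> ennreal (C * (real j + 1) powr (2 * \<rho>))"
proof -
  define d where "d = l / 2"
  have d: "d > 0" using l by (simp add: d_def)
  define a where "a = 2 * \<rho>"
  have a: "a > 0" "a \<ge> 0" using \<rho> by (auto simp: a_def)
  obtain C0 where C0: "C0 > 0" "\<And>k. Gamma (real k + 1 + a) / fact k \<le> C0 * (real k + 1) powr a"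
    by (rule Gamma_ratio_bounds[OF a(1)]) (rule that)
  define c where "c = sqrt (l / pi) / 2"
  define C where "C = c\<^sup>2 * ((2 * pi)\<^sup>2 * ((2 * d) powr a)\<^sup>2 * (2 * d) powr (- (1 + a))) * C0"
  have C: "C > 0" using l d C0 by (simp add: C_def c_def)
  have main: "\<exists>G. spectral (l / 2) (2 * \<rho>) (\<lambda>x. of_real (mtc l j x)) G \<and> wnorm \<rho> G \<le> ennreal (C * (real j + 1) powr (2 * \<rho>))" for j
  proof -
    define k where "k = j div 2"
    define p where "p = 2 * pi * (- 1) ^ k * (2 * d) powr a * Gamma (real k + 1 + a) / fact k"
    define L where "L t = complex_of_real (lag d a k t)" for t
    have Lm [measurable]: "L \<in> borel_measurable borel" unfolding L_def[abs_def] by measurable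
    have sc: "spectral d a (\<lambda>x. cnj (hardy_fun d k x)) (\<lambda>t. of_real p * L t)"
      using spectral_cnj_hardy_fun[OF d a(1), of k] unfolding p_def L_def by simp
    have sh: "spectral d a (hardy_fun d k) (\<lambda>_. 0)" by (rule spectral_hardy_fun[OF d a(2)])
    have WL: "wnorm \<rho> L = ennreal (lag_norm d a k)" using wnorm_lag[OF d a(2), of k] by (simp add: L_def[abs_def] a_def)
    define q where "q = of_real c * cnj (mtc_sign j) * of_real p"
    have W1: "wnorm \<rho> (\<lambda>t. q * L t) = ennreal (c\<^sup>2 * p\<^sup>2 * lag_norm d a k)"
    proof -
      have "norm q = \<bar>c\<bar> * \<bar>p\<bar>" by (simp add: q_def norm_mult)
      then show ?thesis unfolding wnorm_cmult[OF Lm] WL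
        using lag_norm_pos[OF d a(2), of k] by (simp add: ennreal_mult[symmetric] power_mult_distrib less_imp_le)
    qed
    have s1: "spectral d a (\<lambda>x. of_real c * cnj (mtc_sign j) * cnj (hardy_fun d k x)) (\<lambda>t. q * L t)"
      using spectral_cmult[OF sc, of "of_real c * cnj (mtc_sign j)"] by (simp add: q_def mult.assoc)
    have s2: "spectral d a (\<lambda>x. of_real c * mtc_sign j * hardy_fun d k x) (\<lambda>t. of_real c * mtc_sign j * 0)"
      by (rule spectral_cmult[OF sh])
    have "spectral d a (\<lambda>x. of_real c * mtc_sign j * hardy_fun d k x + of_real c * cnj (mtc_sign j) * cnj (hardy_fun d k x)) (\<lambda>t. of_real c * mtc_sign j * 0 + q * L t)"
    proof (rule spectral_add[OF d _ _ s2 s1])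
      show "sq_int (\<lambda>x. of_real c * mtc_sign j * hardy_fun d k x)" by (intro sq_int_cmult sq_int_hardy_fun d)
      show "sq_int (\<lambda>x. of_real c * cnj (mtc_sign j) * cnj (hardy_fun d k x))" by (intro sq_int_cmult sq_int_cnj sq_int_hardy_fun d)
      show "wnorm \<rho> (\<lambda>t. of_real c * mtc_sign j * 0) < \<infinity>" by (simp add: wnorm_def)
      show "wnorm \<rho> (\<lambda>t. q * L t) < \<infinity>" unfolding W1 by simp
    qed
    moreover have "of_real c * mtc_sign j * hardy_fun d k x + of_real c * cnj (mtc_sign j) * cnj (hardy_fun d k x) = of_real (mtc l j x)" for x
      unfolding of_real_mtc[OF l] c_def d_def k_def by (simp only: distrib_left mult.assoc)
    ultimately have "spectral d a (\<lambda>x. of_real (mtc l j x)) (\<lambda>t. q * L t)" by simp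
    moreover have "c\<^sup>2 * p\<^sup>2 * lag_norm d a k \<le> C * (real j + 1) powr a"
    proof -
      have G: "Gamma (real k + 1 + a) > 0" using a by (intro Gamma_real_pos) auto
      have "p\<^sup>2 * lag_norm d a k = ((2 * pi)\<^sup>2 * ((2 * d) powr a)\<^sup>2 * (2 * d) powr (- (1 + a))) * (Gamma (real k + 1 + a) / fact k)"
      proof -
        have sg: "((- 1) ^ k)\<^sup>2 = (1 :: real)" by (simp add: power_mult[symmetric] mult.commute)
        show ?thesis using G unfolding p_def lag_norm_def power_divide power_mult_distrib sg
          by (simp add: power2_eq_square)
      qed
      then have "c\<^sup>2 * p\<^sup>2 * lag_norm d a k = c\<^sup>2 * ((2 * pi)\<^sup>2 * ((2 * d) powr a)\<^sup>2 * (2 * d) powr (- (1 + a))) * (Gamma (real k + 1 + a) / fact k)"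
        by (simp only: mult.assoc)
      also have "\<dots> \<le> c\<^sup>2 * ((2 * pi)\<^sup>2 * ((2 * d) powr a)\<^sup>2 * (2 * d) powr (- (1 + a))) * (C0 * (real k + 1) powr a)"
        by (intro mult_left_mono C0) auto
      also have "\<dots> = C * (real k + 1) powr a" by (simp add: C_def)
      also have "\<dots> \<le> C * (real j + 1) powr a"
        using C a by (intro mult_left_mono powr_mono2) (auto simp: k_def)
      finally show ?thesis .
    qed
    ultimately show ?thesis using W1 by (auto simp: d_def a_def intro!: ennreal_leI)
  qed
  show ?thesis by (rule that[OF C main])
qed

section \<open>Passing between the scaling parameters\<close>

text \<open>The quotient of \<open>L / 2 + i x\<close> and \<open>L + i x\<close> has positive real
  part, so that taking powers is multiplicative (\<open>powr_mult_Re_pos\<close>).\<close>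

lemma Complex_half_powr:
  assumes L: "L > 0"
  shows "Complex (L / 2) x powr z = Complex L x powr z * (Complex (L / 2) x / Complex L x) powr z"
proof -
  have "L\<^sup>2 + x\<^sup>2 > 0" using L by (intro add_pos_nonneg) auto
  moreover have "L / 2 * L + x * x > 0" using L by (intro add_pos_nonneg) auto
  ultimately have "Re (Complex (L / 2) x / Complex L x) > 0" by (simp add: Re_divide)
  then have "(Complex L x * (Complex (L / 2) x / Complex L x)) powr z = Complex L x powr z * (Complex (L / 2) x / Complex L x) powr z"
    using L by (intro powr_mult_Re_pos) auto
  then show ?thesis using Complex_nonzero[OF L, of x] by simp
qed

text \<open>The norms of the MTC functions are known for parameter \<open>l / 2\<close> and weight
  exponent \<open>2 * \<rho>\<close>. The target weight is obtained from that one by the multiplier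
  of \<open>multiplier_kernel\<close> with \<open>q = - (2 * \<rho>)\<close>, whose order
  \<open>2 * \<rho> - r\<close> has to be positive.\<close>

lemma spectral_mtc_transfer:
  assumes l: "l > 0" and \<rho>: "\<rho> > 0" and r: "2 * \<rho> - r > 0" and adm: "schur_admissible (2 * \<rho> - r) \<rho> s"
  obtains M G where "M > 0" "\<And>j. spectral l r (\<lambda>x. of_real (mtc l j x)) (G j)"
    "\<And>j. wnorm s (G j) \<le> ennreal ((M * (real j + 1) powr \<rho>)\<^sup>2)"
proof -
  obtain k C where km: "k \<in> borel_measurable borel" and kb: "\<And>t. \<bar>k t\<bar> \<le> C * gk (2 * \<rho> - r) (l / 6) t"
    and kf: "\<And>x. ft (\<lambda>t. of_real (k t)) x = Complex l x powr (- of_real (2 * \<rho> - r)) * (Complex (l / 2) x / Complex l x) powr of_real (- (2 * \<rho>))"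
    by (rule multiplier_kernel[OF r l]) (rule that)
  have mult: "Complex l x powr of_real r = Complex (l / 2) x powr of_real (2 * \<rho>) * ft (\<lambda>t. of_real (k t)) x" for x
  proof -
    define R where "R = Complex (l / 2) x / Complex l x"
    have R: "R \<noteq> 0" using Complex_nonzero[of l x] Complex_nonzero[of "l / 2" x] l by (simp add: R_def)
    have "Complex (l / 2) x powr of_real (2 * \<rho>) * ft (\<lambda>t. of_real (k t)) x =
        (Complex l x powr of_real (2 * \<rho>) * Complex l x powr (- of_real (2 * \<rho> - r))) * (R powr of_real (2 * \<rho>) * R powr of_real (- (2 * \<rho>)))"
      unfolding kf Complex_half_powr[OF l] R_def[symmetric] by (simp only: mult_ac)
    also have "\<dots> = Complex l x powr of_real r" using R by (simp add: powr_add[symmetric])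
    finally show ?thesis ..
  qed
  have l2: "l / 2 > 0" "l / 6 > 0" using l by auto
  obtain A where A: "A > 0" "\<And>f G. spectral (l / 2) (2 * \<rho>) f G \<Longrightarrow> sq_int f \<Longrightarrow> wnorm \<rho> G < \<infinity> \<Longrightarrow>
     \<exists>H. spectral l r f H \<and> wnorm s H \<le> ennreal A * wnorm \<rho> G"
    by (rule spectral_transfer[OF l2(1) l km kb r l2(2) mult adm]) (rule that)
  obtain C1 where C1: "C1 > 0" "\<And>j. \<exists>G. spectral (l / 2) (2 * \<rho>) (\<lambda>x. of_real (mtc l j x)) G \<and> wnorm \<rho> G \<le> ennreal (C1 * (real j + 1) powr (2 * \<rho>))"
    by (rule spectral_mtc[OF l \<rho>]) (rule that)
  define M where "M = sqrt (A * C1)"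
  have M: "M > 0" using A C1 by (simp add: M_def)
  have "\<exists>G. spectral l r (\<lambda>x. of_real (mtc l j x)) G \<and> wnorm s G \<le> ennreal ((M * (real j + 1) powr \<rho>)\<^sup>2)" for j
  proof -
    obtain G where G: "spectral (l / 2) (2 * \<rho>) (\<lambda>x. of_real (mtc l j x)) G" "wnorm \<rho> G \<le> ennreal (C1 * (real j + 1) powr (2 * \<rho>))"
      using C1(2)[of j] by blast
    have fin: "wnorm \<rho> G < \<infinity>" using G(2) by (simp add: order_le_less_trans)
    obtain H where H: "spectral l r (\<lambda>x. of_real (mtc l j x)) H" "wnorm s H \<le> ennreal A * wnorm \<rho> G"
      using A(2)[OF G(1) sq_int_mtc[OF l] fin] by blast
    have "wnorm s H \<le> ennreal A * ennreal (C1 * (real j + 1) powr (2 * \<rho>))"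
      using H(2) mult_left_mono[OF G(2), of "ennreal A"] by (auto intro: order_trans)
    also have "\<dots> = ennreal ((M * (real j + 1) powr \<rho>)\<^sup>2)"
      using A C1 by (simp add: M_def ennreal_mult[symmetric] power_mult_distrib power2_eq_square[of "_ powr _"] powr_add[symmetric])
    finally show ?thesis using H(1) by blast
  qed
  then obtain G where "\<And>j. spectral l r (\<lambda>x. of_real (mtc l j x)) (G j) \<and> wnorm s (G j) \<le> ennreal ((M * (real j + 1) powr \<rho>)\<^sup>2)"
    by metis
  then show ?thesis using M by (intro that[of M G]) auto
qed

lemma sqrt_enn2real_le:
  assumes "H \<le> ennreal A * W" "W < \<infinity>" "A \<ge> 0"
  shows "sqrt (enn2real H) \<le> sqrt A * sqrt (enn2real W)"
proof -
  have "enn2real H \<le> enn2real (ennreal A * W)"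
    using assms by (intro enn2real_mono) (auto simp: ennreal_mult_less_top)
  also have "\<dots> = A * enn2real W" using assms by (simp add: enn2real_mult)
  finally show ?thesis by (simp add: real_sqrt_mult[symmetric])
qed

text \<open>The opposite change of weights, from parameter \<open>l\<close> to \<open>l / 2\<close>.
  A kernel of positive order forces a slight loss: the exponent \<open>r\<close> drops to
  \<open>q < r\<close>.\<close>

lemma mtc_coeff_summable_transfer:
  assumes l: "l > 0" and r: "r > 1 / 2" and mu: "0 \<le> \<mu>" "\<mu> < r - 1 / 2"
  obtains C where "C > 0" "\<And>f G. spectral l (2 * r) (\<lambda>x. of_real (f x)) G \<Longrightarrow> sq_int (\<lambda>x. of_real (f x)) \<Longrightarrow> wnorm r G < \<infinity> \<Longrightarrow>
     summable (\<lambda>j. (real j + 1) powr \<mu> * \<bar>LINT x|lborel. f x * mtc l j x\<bar>) \<and>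
     (\<Sum>j. (real j + 1) powr \<mu> * \<bar>LINT x|lborel. f x * mtc l j x\<bar>) \<le> C * sqrt (enn2real (wnorm r G))"
proof -
  \<comment> \<open>Half of the gap between \<mu> and \<open>r - 1 / 2\<close>, so that
    \<open>\<mu> < q - 1 / 2\<close> still holds for \<open>q = r - \<theta>\<close>.\<close>
  define \<theta> where "\<theta> = (r - 1 / 2 - \<mu>) / 2"
  define q where "q = r - \<theta>"
  have \<theta>: "\<theta> > 0" using mu by (simp add: \<theta>_def)
  have "2 * q = r + 1 / 2 + \<mu>" by (simp add: q_def \<theta>_def field_simps)
  then have q: "q > 0" "\<mu> < q - 1 / 2" using mu r by (auto simp: field_simps)
  have b: "2 * \<theta> > 0" using \<theta> by simp
  obtain k C where km: "k \<in> borel_measurable borel" and kb: "\<And>t. \<bar>k t\<bar> \<le> C * gk (2 * \<theta>) (l / 6) t"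
    and kf: "\<And>x. ft (\<lambda>t. of_real (k t)) x = Complex l x powr (- of_real (2 * \<theta>)) * (Complex (l / 2) x / Complex l x) powr of_real (2 * q)"
    by (rule multiplier_kernel[OF b l]) (rule that)
  have mult: "Complex (l / 2) x powr of_real (2 * q) = Complex l x powr of_real (2 * r) * ft (\<lambda>t. of_real (k t)) x" for x
  proof -
    have "Complex l x powr of_real (2 * r) * Complex l x powr (- of_real (2 * \<theta>)) = Complex l x powr of_real (2 * q)"
      by (simp add: powr_add[symmetric] q_def right_diff_distrib)
    then show ?thesis unfolding kf Complex_half_powr[OF l] by (simp only: mult.assoc[symmetric])
  qed
  have adm: "schur_admissible (2 * \<theta>) r q" using \<theta> q by (simp add: schur_admissible_def q_def)
  have l2: "l / 2 > 0" "l / 6 > 0" using l by auto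
  obtain A where A: "A > 0" "\<And>f G. spectral l (2 * r) f G \<Longrightarrow> sq_int f \<Longrightarrow> wnorm r G < \<infinity> \<Longrightarrow>
     \<exists>H. spectral (l / 2) (2 * q) f H \<and> wnorm q H \<le> ennreal A * wnorm r G"
    by (rule spectral_transfer[OF l l2(1) km kb b l2(2) mult adm]) (rule that)
  obtain C1 where C1: "C1 > 0" "\<And>f G. spectral (l / 2) (2 * q) (\<lambda>x. of_real (f x)) G \<Longrightarrow> sq_int (\<lambda>x. of_real (f x)) \<Longrightarrow> wnorm q G < \<infinity> \<Longrightarrow>
     summable (\<lambda>j. (real j + 1) powr \<mu> * \<bar>LINT x|lborel. f x * mtc l j x\<bar>) \<and>
     (\<Sum>j. (real j + 1) powr \<mu> * \<bar>LINT x|lborel. f x * mtc l j x\<bar>) \<le> C1 * sqrt (enn2real (wnorm q G))"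
    by (rule mtc_coeff_summable[OF l q(1) mu(1) q(2)]) (rule that)
  show ?thesis
  proof (rule that[of "C1 * sqrt A"])
    show "C1 * sqrt A > 0" using C1 A by simp
    fix f G assume f: "spectral l (2 * r) (\<lambda>x. of_real (f x)) G" "sq_int (\<lambda>x. of_real (f x))" "wnorm r G < \<infinity>"
    obtain H where H: "spectral (l / 2) (2 * q) (\<lambda>x. of_real (f x)) H" "wnorm q H \<le> ennreal A * wnorm r G"
      using A(2)[OF f] by blast
    have fin: "wnorm q H < \<infinity>" using H(2) f(3) by (auto simp: ennreal_mult_less_top intro: order_le_less_trans)
    have "C1 * sqrt (enn2real (wnorm q H)) \<le> C1 * (sqrt A * sqrt (enn2real (wnorm r G)))"
      using C1 A by (intro mult_left_mono sqrt_enn2real_le H(2) f(3)) auto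
    with C1(2)[OF H(1) f(2) fin]
    show "summable (\<lambda>j. (real j + 1) powr \<mu> * \<bar>LINT x|lborel. f x * mtc l j x\<bar>) \<and>
      (\<Sum>j. (real j + 1) powr \<mu> * \<bar>LINT x|lborel. f x * mtc l j x\<bar>) \<le> C1 * sqrt A * sqrt (enn2real (wnorm r G))"
      by (auto simp: mult.assoc)
  qed
qed

section \<open>Coefficient errors and the interpolation estimate\<close>

text \<open>From index \<open>P\<close> on, the quotient of the two weights is at most
  \<open>P powr (\<nu> - \<mu>)\<close>, because the exponent is not positive.\<close>

lemma powr_tail_le:
  fixes a :: "nat \<Rightarrow> real"
  assumes a: "summable (\<lambda>j. (real j + 1) powr \<mu> * \<bar>a j\<bar>)" and \<nu>: "\<nu> \<le> \<mu>" and P: "P \<ge> 1"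
  shows "summable (\<lambda>j. (real j + 1) powr \<nu> * \<bar>a j\<bar>)"
    "(\<Sum>j. (real (j + P) + 1) powr \<nu> * \<bar>a (j + P)\<bar>) \<le> real P powr (\<nu> - \<mu>) * (\<Sum>j. (real j + 1) powr \<mu> * \<bar>a j\<bar>)"
proof -
  show s: "summable (\<lambda>j. (real j + 1) powr \<nu> * \<bar>a j\<bar>)"
    by (rule summable_comparison_test'[OF a, of 0]) (use \<nu> in \<open>auto intro!: mult_right_mono powr_mono\<close>)
  have "(\<Sum>j. (real (j + P) + 1) powr \<nu> * \<bar>a (j + P)\<bar>) \<le> (\<Sum>j. real P powr (\<nu> - \<mu>) * ((real (j + P) + 1) powr \<mu> * \<bar>a (j + P)\<bar>))"
  proof (rule suminf_le)
    fix j
    have "(real (j + P) + 1) powr \<nu> = (real (j + P) + 1) powr (\<nu> - \<mu>) * (real (j + P) + 1) powr \<mu>"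
      by (simp add: powr_add[symmetric])
    also have "\<dots> \<le> real P powr (\<nu> - \<mu>) * (real (j + P) + 1) powr \<mu>"
      using \<nu> P by (intro mult_right_mono powr_mono2') auto
    finally show "(real (j + P) + 1) powr \<nu> * \<bar>a (j + P)\<bar> \<le> real P powr (\<nu> - \<mu>) * ((real (j + P) + 1) powr \<mu> * \<bar>a (j + P)\<bar>)"
      unfolding mult.assoc[symmetric] by (rule mult_right_mono) simp
  next
    show "summable (\<lambda>j. (real (j + P) + 1) powr \<nu> * \<bar>a (j + P)\<bar>)" using s by (subst summable_iff_shift[where k = P and f = "\<lambda>j. (real j + 1) powr \<nu> * \<bar>a j\<bar>"])
    show "summable (\<lambda>j. real P powr (\<nu> - \<mu>) * ((real (j + P) + 1) powr \<mu> * \<bar>a (j + P)\<bar>))"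
      using a by (intro summable_mult) (subst summable_iff_shift[where k = P and f = "\<lambda>j. (real j + 1) powr \<mu> * \<bar>a j\<bar>"])
  qed
  also have "\<dots> = real P powr (\<nu> - \<mu>) * (\<Sum>j. (real (j + P) + 1) powr \<mu> * \<bar>a (j + P)\<bar>)"
    using a by (intro suminf_mult) (subst summable_iff_shift[where k = P and f = "\<lambda>j. (real j + 1) powr \<mu> * \<bar>a j\<bar>"])
  also have "\<dots> \<le> real P powr (\<nu> - \<mu>) * (\<Sum>j. (real j + 1) powr \<mu> * \<bar>a j\<bar>)"
  proof (rule mult_left_mono)
    have "0 \<le> (\<Sum>j<P. (real j + 1) powr \<mu> * \<bar>a j\<bar>)" by (intro sum_nonneg) auto
    then show "(\<Sum>j. (real (j + P) + 1) powr \<mu> * \<bar>a (j + P)\<bar>) \<le> (\<Sum>j. (real j + 1) powr \<mu> * \<bar>a j\<bar>)"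
      using suminf_split_initial_segment[OF a, of P] by simp
  qed simp
  finally show "(\<Sum>j. (real (j + P) + 1) powr \<nu> * \<bar>a (j + P)\<bar>) \<le> real P powr (\<nu> - \<mu>) * (\<Sum>j. (real j + 1) powr \<mu> * \<bar>a j\<bar>)" .
qed

text \<open>The square of the common majorant of the MTC functions has the integral
  \<open>l / pi * (2 * pi / l) = 2\<close>.\<close>

lemma integral_mtc_series_square:
  assumes l: "l > 0" and e: "summable (\<lambda>j. \<bar>e j\<bar>)"
  shows "(LINT x|lborel. (mtc_series l e x)\<^sup>2) \<le> 2 * (\<Sum>j. \<bar>e j\<bar>)\<^sup>2"
proof -
  define S where "S = (\<Sum>j. \<bar>e j\<bar>)"
  have l2: "l / 2 > 0" using l by simp
  have "(LINT x|lborel. (mtc_series l e x)\<^sup>2) \<le> (LINT x|lborel. (S\<^sup>2 * (l / pi)) * (1 / (norm (Complex (l / 2) x))\<^sup>2))"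
  proof (rule integral_mono)
    show "integrable lborel (\<lambda>x. (mtc_series l e x)\<^sup>2)" using sq_int_mtc_series[OF l e] by (simp add: sq_int_of_real_iff)
    show "integrable lborel (\<lambda>x. (S\<^sup>2 * (l / pi)) * (1 / (norm (Complex (l / 2) x))\<^sup>2))"
      using integrable_inverse_norm_Complex[OF l2] by (intro integrable_mult_right) (simp add: inverse_eq_divide)
    fix x
    have "(mtc_series l e x)\<^sup>2 \<le> (S * (sqrt (l / pi) / norm (Complex (l / 2) x)))\<^sup>2"
      using power_mono[OF mtc_series_summable(2)[OF l e, of x] abs_ge_zero, of 2] unfolding S_def by simp
    also have "\<dots> = (S\<^sup>2 * (l / pi)) * (1 / (norm (Complex (l / 2) x))\<^sup>2)"
      using l by (simp add: power_mult_distrib power_divide)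
    finally show "(mtc_series l e x)\<^sup>2 \<le> (S\<^sup>2 * (l / pi)) * (1 / (norm (Complex (l / 2) x))\<^sup>2)" .
  qed
  also have "\<dots> = S\<^sup>2 * (l / pi) * (pi / (l / 2))" unfolding integral_mult_right_zero inverse_norm_integral[OF l2] ..
  also have "\<dots> = 2 * S\<^sup>2" using l by simp
  finally show ?thesis unfolding S_def .
qed

lemma sobolev_norm_le:
  assumes l: "l > 0" and spec: "spectral l r (\<lambda>x. of_real (f x)) G" and f: "sq_int (\<lambda>x. of_real (f x))"
    and W: "wnorm s G \<le> ennreal W" "W \<ge> 0" and V: "(LINT x|lborel. (f x)\<^sup>2) \<le> V" and c: "V + W \<le> c\<^sup>2" "c \<ge> 0"
  shows "f \<in> sobolev_space l s r \<and> sobolev_norm l s r f \<le> c"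
proof -
  have fin: "wnorm s G < \<infinity>" using W(1) by (simp add: order_le_less_trans)
  note I = sobolev_spaceI[OF l spec fin f]
  have "enn2real (wnorm s G) \<le> W" using enn2real_mono[OF W(1)] W(2) by simp
  moreover have "enn2real (wnorm s G) / (2 * pi)\<^sup>2 \<le> enn2real (wnorm s G)"
  proof -
    have "(2 * pi)\<^sup>2 \<ge> 1" using pi_gt3 by (intro one_le_power) simp
    then show ?thesis using mult_left_mono[of 1 "(2 * pi)\<^sup>2" "enn2real (wnorm s G)"] by (simp add: divide_le_eq)
  qed
  moreover have "(LINT x|lborel. (f x)\<^sup>2) \<ge> 0" by simp
  ultimately have "(sobolev_norm l s r f)\<^sup>2 \<le> c\<^sup>2" using I(2) V c(1) by linarith
  then show ?thesis using I(1) c(2) power2_le_imp_le by blast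
qed

text \<open>Padding with zeros from index \<open>2 * p\<close> on makes the interpolant an instance
  of \<open>mtc_series\<close>, so that results about series cover it and the error alike.\<close>

definition mtc_interp_coeff :: "real \<Rightarrow> nat \<Rightarrow> (nat \<Rightarrow> real) \<Rightarrow> nat \<Rightarrow> real" where
  "mtc_interp_coeff l p a j = (if j < 2 * p then mtc_coeff l p (mtc_series l a) j else 0)"

lemma summable_mtc_interp_coeff: "summable (\<lambda>j. \<bar>mtc_interp_coeff l p a j\<bar> * w j)"
  by (rule summable_finite[of "{..<2 * p}"]) (auto simp: mtc_interp_coeff_def)

lemma mtc_interp_mtc_series:
  assumes p: "p \<ge> 1" shows "mtc_interp l p (mtc_series l a) x = mtc_series l (mtc_interp_coeff l p a) x"
proof -
  have "{0..2 * p - 1} = {..<2 * p}" using p by auto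
  then have "mtc_interp l p (mtc_series l a) x = (\<Sum>j<2 * p. mtc_interp_coeff l p a j * mtc l j x)"
    by (simp add: mtc_interp_def mtc_interp_coeff_def)
  also have "\<dots> = mtc_series l (mtc_interp_coeff l p a) x"
    unfolding mtc_series_def by (rule suminf_finite[symmetric]) (auto simp: mtc_interp_coeff_def)
  finally show ?thesis .
qed

text \<open>Each of the \<open>P = 2 * p\<close> low coefficients is wrong by at most twice the
  tail, that is by \<open>2 * P powr (- \<mu>) * B\<close>, and carries a weight of at most
  \<open>P powr \<rho>\<close>: together \<open>2 * X * B\<close>. The tail itself adds
  \<open>X * B\<close>, hence the factor 3. For \<open>\<rho> > \<mu>\<close> the weighted tail may
  be infinite, and only the interpolant is bounded; then the low coefficients of \<open>a\<close>
  take the place of the tail.\<close>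

lemma mtc_interp_coeff_bounds:
  fixes a :: "nat \<Rightarrow> real"
  assumes l: "l > 0" and p: "p \<ge> 1" and mu: "\<mu> \<ge> 0" and rho: "\<rho> \<ge> 0"
    and a: "summable (\<lambda>j. (real j + 1) powr \<mu> * \<bar>a j\<bar>)"
  defines "B \<equiv> (\<Sum>j. (real j + 1) powr \<mu> * \<bar>a j\<bar>)" and "X \<equiv> real (2 * p) powr (1 + \<rho> - \<mu>)"
  shows "\<rho> \<le> \<mu> \<Longrightarrow> summable (\<lambda>j. \<bar>a j - mtc_interp_coeff l p a j\<bar> * (real j + 1) powr \<rho>)"
    "\<rho> \<le> \<mu> \<Longrightarrow> (\<Sum>j. \<bar>a j - mtc_interp_coeff l p a j\<bar> * (real j + 1) powr \<rho>) \<le> 3 * X * B"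
    "\<rho> > \<mu> \<Longrightarrow> (\<Sum>j. \<bar>mtc_interp_coeff l p a j\<bar> * (real j + 1) powr \<rho>) \<le> 3 * X * B"
proof -
  define P where "P = 2 * p"
  define b where "b = mtc_interp_coeff l p a"
  have P: "P \<ge> 1" using p by (simp add: P_def)
  have B0: "B \<ge> 0" unfolding B_def by (intro suminf_nonneg a) auto
  have Xs: "real P powr (\<rho> - \<mu>) \<le> X" using P unfolding X_def P_def by (intro powr_mono) auto
  have a1: "summable (\<lambda>j. \<bar>a j\<bar>)" using powr_tail_le(1)[OF a mu P] by simp
  have tau: "(\<Sum>j. \<bar>a (j + P)\<bar>) \<le> real P powr (- \<mu>) * B"
  proof -
    have "(real (j + P) + 1) powr 0 = 1" for j by (subst powr_zero_eq_one) auto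
    then show ?thesis using powr_tail_le(2)[OF a mu P] by (simp add: B_def)
  qed
  have d: "\<bar>b j - a j\<bar> \<le> 2 * (real P powr (- \<mu>) * B)" if "j < P" for j
    using mtc_aliasing[OF l p a1, of j] tau that unfolding b_def P_def mtc_interp_coeff_def by simp
  have XP: "real P * (2 * (real P powr (- \<mu>) * B) * real P powr \<rho>) = 2 * X * B"
  proof -
    have "X = real P powr (1 + (- \<mu> + \<rho>))" proof -
      have "1 + \<rho> - \<mu> = 1 + (- \<mu> + \<rho>)" by simp
      then show ?thesis by (simp only: X_def P_def)
    qed
    also have "\<dots> = real P * (real P powr (- \<mu>) * real P powr \<rho>)" using P by (subst powr_add, subst powr_add) simp
    finally show ?thesis by simp
  qed
  have low: "(\<Sum>j<P. \<bar>b j - a j\<bar> * (real j + 1) powr \<rho>) \<le> 2 * X * B"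
  proof -
    have "(\<Sum>j<P. \<bar>b j - a j\<bar> * (real j + 1) powr \<rho>) \<le> (\<Sum>j<P. 2 * (real P powr (- \<mu>) * B) * real P powr \<rho>)"
      using d rho B0 by (intro sum_mono mult_mono powr_mono2) auto
    also have "\<dots> = 2 * X * B" unfolding XP[symmetric] by simp
    finally show ?thesis .
  qed
  {
    assume le: "\<rho> \<le> \<mu>"
    define f where "f j = \<bar>a j - b j\<bar> * (real j + 1) powr \<rho>" for j
    have sh: "f (j + P) = (real (j + P) + 1) powr \<rho> * \<bar>a (j + P)\<bar>" for j
      by (simp add: f_def b_def mtc_interp_coeff_def P_def mult.commute)
    have "summable (\<lambda>j. f (j + P))"
      unfolding sh using powr_tail_le(1)[OF a le P] by (subst summable_iff_shift[where k = P and f = "\<lambda>j. (real j + 1) powr \<rho> * \<bar>a j\<bar>"])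
    then have s: "summable f" by (simp only: summable_iff_shift)
    then show "summable (\<lambda>j. \<bar>a j - mtc_interp_coeff l p a j\<bar> * (real j + 1) powr \<rho>)" by (simp add: f_def[abs_def] b_def)
    have "suminf f = (\<Sum>j. f (j + P)) + (\<Sum>j<P. f j)" by (rule suminf_split_initial_segment[OF s])
    also have "\<dots> \<le> X * B + 2 * X * B"
    proof (rule add_mono)
      have "(\<Sum>j. f (j + P)) \<le> real P powr (\<rho> - \<mu>) * B" unfolding sh B_def by (rule powr_tail_le(2)[OF a le P])
      also have "\<dots> \<le> X * B" by (intro mult_right_mono Xs B0)
      finally show "(\<Sum>j. f (j + P)) \<le> X * B" .
      show "(\<Sum>j<P. f j) \<le> 2 * X * B" using low by (simp add: f_def abs_minus_commute)
    qed
    finally show "(\<Sum>j. \<bar>a j - mtc_interp_coeff l p a j\<bar> * (real j + 1) powr \<rho>) \<le> 3 * X * B"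
      by (simp add: f_def[abs_def] b_def mult_ac)
  next
    assume gt: "\<rho> > \<mu>"
    have "(\<Sum>j. \<bar>b j\<bar> * (real j + 1) powr \<rho>) = (\<Sum>j<P. \<bar>b j\<bar> * (real j + 1) powr \<rho>)"
      by (rule suminf_finite) (auto simp: b_def mtc_interp_coeff_def P_def)
    also have "\<dots> \<le> (\<Sum>j<P. \<bar>b j - a j\<bar> * (real j + 1) powr \<rho> + real P powr (\<rho> - \<mu>) * ((real j + 1) powr \<mu> * \<bar>a j\<bar>))"
    proof (rule sum_mono)
      fix j assume j: "j \<in> {..<P}"
      have "\<bar>b j\<bar> * (real j + 1) powr \<rho> \<le> (\<bar>b j - a j\<bar> + \<bar>a j\<bar>) * (real j + 1) powr \<rho>"
        by (intro mult_right_mono) auto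
      also have "\<dots> = \<bar>b j - a j\<bar> * (real j + 1) powr \<rho> + (real j + 1) powr (\<rho> - \<mu>) * ((real j + 1) powr \<mu> * \<bar>a j\<bar>)"
        by (simp add: distrib_right mult.assoc[symmetric] powr_add[symmetric])
      also have "\<dots> \<le> \<bar>b j - a j\<bar> * (real j + 1) powr \<rho> + real P powr (\<rho> - \<mu>) * ((real j + 1) powr \<mu> * \<bar>a j\<bar>)"
        using gt j by (intro add_left_mono mult_right_mono powr_mono2) auto
      finally show "\<bar>b j\<bar> * (real j + 1) powr \<rho> \<le> \<bar>b j - a j\<bar> * (real j + 1) powr \<rho> + real P powr (\<rho> - \<mu>) * ((real j + 1) powr \<mu> * \<bar>a j\<bar>)" .
    qed
    also have "\<dots> = (\<Sum>j<P. \<bar>b j - a j\<bar> * (real j + 1) powr \<rho>) + real P powr (\<rho> - \<mu>) * (\<Sum>j<P. (real j + 1) powr \<mu> * \<bar>a j\<bar>)"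
      by (simp add: sum.distrib sum_distrib_left)
    also have "\<dots> \<le> 2 * X * B + X * B"
    proof (intro add_mono low mult_mono Xs)
      show "(\<Sum>j<P. (real j + 1) powr \<mu> * \<bar>a j\<bar>) \<le> B" unfolding B_def by (rule sum_le_suminf[OF a]) auto
    qed (auto simp: X_def intro!: sum_nonneg)
    finally show "(\<Sum>j. \<bar>mtc_interp_coeff l p a j\<bar> * (real j + 1) powr \<rho>) \<le> 3 * X * B" by (simp add: b_def mult_ac)
  }
qed

lemma weight_one_le:
  assumes "summable (\<lambda>j. \<bar>e j\<bar> * (real j + 1) powr \<rho>)" "\<rho> \<ge> 0"
  shows "summable (\<lambda>j. \<bar>e j\<bar>)" "(\<Sum>j. \<bar>e j\<bar>) \<le> (\<Sum>j. \<bar>e j\<bar> * (real j + 1) powr \<rho>)"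
proof -
  have le: "\<bar>e j\<bar> \<le> \<bar>e j\<bar> * (real j + 1) powr \<rho>" for j
    using mult_left_mono[of 1 "(real j + 1) powr \<rho>" "\<bar>e j\<bar>"] ge_one_powr_ge_zero[of "real j + 1" \<rho>] assms(2) by simp
  show s: "summable (\<lambda>j. \<bar>e j\<bar>)" by (rule summable_comparison_test'[OF assms(1), of 0]) (use le in simp)
  show "(\<Sum>j. \<bar>e j\<bar>) \<le> (\<Sum>j. \<bar>e j\<bar> * (real j + 1) powr \<rho>)" by (rule suminf_le[OF le s assms(1)])
qed

lemma integral_square_diff_le:
  fixes u v :: "real \<Rightarrow> real"
  assumes u: "u \<in> borel_measurable borel" "integrable lborel (\<lambda>x. (u x)\<^sup>2)" and v: "v \<in> borel_measurable borel" "integrable lborel (\<lambda>x. (v x)\<^sup>2)"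
  shows "(LINT x|lborel. (u x - v x)\<^sup>2) \<le> 2 * (LINT x|lborel. (u x)\<^sup>2) + 2 * (LINT x|lborel. (v x)\<^sup>2)"
proof -
  have le: "(u x - v x)\<^sup>2 \<le> 2 * (u x)\<^sup>2 + 2 * (v x)\<^sup>2" for x
    using zero_le_power2[of "u x + v x"] by (simp add: power2_eq_square algebra_simps)
  have int: "integrable lborel (\<lambda>x. 2 * (u x)\<^sup>2 + 2 * (v x)\<^sup>2)" using u(2) v(2) by simp
  have "integrable lborel (\<lambda>x. (u x - v x)\<^sup>2)"
    by (rule Bochner_Integration.integrable_bound[OF int]) (use u v le in auto)
  from integral_mono[OF this int le] show ?thesis using u(2) v(2) by simp
qed

text \<open>For \<open>\<rho> \<le> \<mu>\<close> the error is a single MTC series with coefficients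
  controlled in the weight \<rho>. Otherwise the power \<open>X\<close> grows with \<open>p\<close>,
  and it is enough to bound \<open>f\<close> by an embedding and the interpolant by its own
  coefficients.\<close>

lemma interpolation_error:
  assumes l: "l > 0" and s: "s > - 1 / 2" and r0: "r0 \<ge> 0" and r1: "r1 \<ge> r0 + \<bar>s\<bar>" "r1 > 1 / 2"
    and mu: "0 \<le> \<mu>" "\<mu> < r1 - 1 / 2" and rho: "\<rho> > r0 + \<bar>s\<bar>"
  obtains K where "K > 0" "\<And>p f. p \<ge> 1 \<Longrightarrow> f \<in> sobolev_space l r1 (2 * r1) \<Longrightarrow>
     (\<lambda>x. f x - mtc_interp l p (cont_rep f) x) \<in> sobolev_space l s r0 \<and>
     sobolev_norm l s r0 (\<lambda>x. f x - mtc_interp l p (cont_rep f) x) \<le> K * real (2 * p) powr (1 + \<rho> - \<mu>) * sobolev_norm l r1 (2 * r1) f"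
proof -
  have rho0: "\<rho> > 0" "\<rho> \<ge> 0" "2 * \<rho> - r0 > 0" using rho r0 by auto
  have adm1: "schur_admissible (2 * \<rho> - r0) \<rho> s" using rho r0 s unfolding schur_admissible_def by auto
  have b: "2 * r1 - r0 > 0" using r0 r1 by auto
  \<comment> \<open>For \<open>s \<le> 0\<close> the last condition of
    \<open>schur_admissible\<close> reads exactly \<open>r1 \<ge> r0 + \<bar>s\<bar>\<close>;
    equality is the homogeneous Hardy case.\<close>
  have adm2: "schur_admissible (2 * r1 - r0) r1 s" using r1 r0 s unfolding schur_admissible_def by auto
  obtain M Gm where M: "M > 0" and Gm: "\<And>j. spectral l r0 (\<lambda>x. of_real (mtc l j x)) (Gm j)"
    "\<And>j. wnorm s (Gm j) \<le> ennreal ((M * (real j + 1) powr \<rho>)\<^sup>2)"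
    by (rule spectral_mtc_transfer[OF l rho0(1) rho0(3) adm1]) (rule that)
  obtain C where C: "C > 0" "\<And>f G. spectral l (2 * r1) (\<lambda>x. of_real (f x)) G \<Longrightarrow> sq_int (\<lambda>x. of_real (f x)) \<Longrightarrow> wnorm r1 G < \<infinity> \<Longrightarrow>
     summable (\<lambda>j. (real j + 1) powr \<mu> * \<bar>LINT x|lborel. f x * mtc l j x\<bar>) \<and>
     (\<Sum>j. (real j + 1) powr \<mu> * \<bar>LINT x|lborel. f x * mtc l j x\<bar>) \<le> C * sqrt (enn2real (wnorm r1 G))"
    by (rule mtc_coeff_summable_transfer[OF l r1(2) mu]) (rule that)
  \<comment> \<open>The embedding of the given space into the target space. The parameter
    \<open>l\<close> is the same on both sides, so the quotient of the weights is a pure power and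
    its kernel a Gamma kernel.\<close>
  obtain A where A: "A > 0" "\<And>f G. spectral l (2 * r1) f G \<Longrightarrow> sq_int f \<Longrightarrow> wnorm r1 G < \<infinity> \<Longrightarrow>
     \<exists>H. spectral l r0 f H \<and> wnorm s H \<le> ennreal A * wnorm r1 G"
  proof (rule spectral_transfer[OF l l _ _ b l _ adm2, where k = "\<lambda>t. gk (2 * r1 - r0) l t / Gamma (2 * r1 - r0)" and C = "1 / Gamma (2 * r1 - r0)" and \<sigma> = r0 and \<rho> = "2 * r1"])
    have G: "Gamma (2 * r1 - r0) > 0" using b by (rule Gamma_real_pos)
    show "(\<lambda>t. gk (2 * r1 - r0) l t / Gamma (2 * r1 - r0)) \<in> borel_measurable borel" by measurable
    show "\<bar>gk (2 * r1 - r0) l t / Gamma (2 * r1 - r0)\<bar> \<le> 1 / Gamma (2 * r1 - r0) * gk (2 * r1 - r0) l t" for t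
      using G by (simp add: gk_def)
    show "Complex l x powr of_real r0 = Complex l x powr of_real (2 * r1) * ft (\<lambda>t. of_real (gk (2 * r1 - r0) l t / Gamma (2 * r1 - r0))) x" for x
      using gamma_kernel(2)[OF b l, of x] unfolding gamma_kernel_def[abs_def]
      by (simp add: powr_add[symmetric])
  qed (rule that)
  define C' where "C' = 2 * pi * C"
  have C': "C' > 0" using C by (simp add: C'_def)
  \<comment> \<open>The first two terms bound \<open>f\<close> itself, which enters when
    \<open>\<rho> > \<mu>\<close>; the last one bounds the error series or the interpolant through
    the coefficient estimate.\<close>
  define K where "K = sqrt (4 + 2 * A * (2 * pi)\<^sup>2 + (4 + 2 * M\<^sup>2) * (3 * C')\<^sup>2)"
  have K2: "K\<^sup>2 = 4 + 2 * A * (2 * pi)\<^sup>2 + (4 + 2 * M\<^sup>2) * (3 * C')\<^sup>2" unfolding K_def using A by simp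
  have K: "K > 0" unfolding K_def using A by (simp add: add_pos_nonneg)
  show ?thesis
  proof (rule that[OF K])
    fix p :: nat and f assume p: "p \<ge> 1" and f: "f \<in> sobolev_space l r1 (2 * r1)"
    define N where "N = sobolev_norm l r1 (2 * r1) f"
    obtain G where G: "spectral l (2 * r1) (\<lambda>x. of_real (f x)) G" "wnorm r1 G < \<infinity>" "sq_int (\<lambda>x. of_real (f x))"
      by (rule sobolev_spaceE[OF l f])
    have fm [measurable]: "f \<in> borel_measurable borel" and fi: "integrable lborel (\<lambda>x. (f x)\<^sup>2)" using G(3) by (auto simp: sq_int_of_real_iff)
    note N2 = sobolev_spaceI(2)[OF l G, folded N_def]
    have N0: "N \<ge> 0" using sobolev_spaceI(3)[OF l G] by (simp add: N_def)
    have f2: "(LINT x|lborel. (f x)\<^sup>2) \<le> 2 * N\<^sup>2" unfolding N2 by (simp add: enn2real_nonneg)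
    have WG: "enn2real (wnorm r1 G) \<le> (2 * pi)\<^sup>2 * N\<^sup>2"
    proof -
      have "enn2real (wnorm r1 G) / (2 * pi)\<^sup>2 \<le> N\<^sup>2" unfolding N2 by simp
      then show ?thesis by (simp add: divide_le_eq mult.commute)
    qed
    define a where "a j = (LINT x|lborel. f x * mtc l j x)" for j
    define B where "B = (\<Sum>j. (real j + 1) powr \<mu> * \<bar>a j\<bar>)"
    have as: "summable (\<lambda>j. (real j + 1) powr \<mu> * \<bar>a j\<bar>)" using C(2)[OF G(1,3,2)] by (simp add: a_def)
    have a1: "summable (\<lambda>j. \<bar>a j\<bar>)" using powr_tail_le(1)[OF as mu(1), of 1] by simp
    have B: "B \<le> C' * N"
    proof -
      have "B \<le> C * sqrt (enn2real (wnorm r1 G))" using C(2)[OF G(1,3,2)] by (simp add: a_def B_def)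
      also have "sqrt (enn2real (wnorm r1 G)) \<le> 2 * pi * N"
        using real_sqrt_le_mono[OF WG] N0 by (simp add: real_sqrt_mult)
      finally show ?thesis using C(1) by (simp add: C'_def mult_ac)
    qed
    have fae: "AE x in lborel. f x = mtc_series l a x"
      using mtc_expansion[OF l G(3)] a1 unfolding a_def by simp
    have rep: "cont_rep f = mtc_series l a" by (rule cont_rep_eq[OF continuous_mtc_series[OF l a1] fae])
    define c where "c = mtc_interp_coeff l p a"
    have interp: "mtc_interp l p (cont_rep f) x = mtc_series l c x" for x
      unfolding rep c_def by (rule mtc_interp_mtc_series[OF p])
    have c\<rho>: "summable (\<lambda>j. \<bar>c j\<bar> * (real j + 1) powr \<rho>)" unfolding c_def by (rule summable_mtc_interp_coeff)
    have c1: "summable (\<lambda>j. \<bar>c j\<bar>)" by (rule weight_one_le(1)[OF c\<rho> rho0(2)])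
    have [measurable]: "mtc_series l u \<in> borel_measurable borel" for u by (rule measurable_mtc_series[OF l])
    define X where "X = real (2 * p) powr (1 + \<rho> - \<mu>)"
    have X0: "X \<ge> 0" by (simp add: X_def)
    note bounds = mtc_interp_coeff_bounds[OF l p mu(1) rho0(2) as, folded B_def X_def c_def]
    have series: "\<exists>H. spectral l r0 (\<lambda>x. of_real (mtc_series l e x)) H \<and> wnorm s H \<le> ennreal (M\<^sup>2 * (\<Sum>j. \<bar>e j\<bar> * (real j + 1) powr \<rho>)\<^sup>2)"
        "(LINT x|lborel. (mtc_series l e x)\<^sup>2) \<le> 2 * (\<Sum>j. \<bar>e j\<bar> * (real j + 1) powr \<rho>)\<^sup>2"
      if e: "summable (\<lambda>j. \<bar>e j\<bar> * (real j + 1) powr \<rho>)" for e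
    proof -
      have e1: "summable (\<lambda>j. \<bar>e j\<bar>)" by (rule weight_one_le(1)[OF e rho0(2)])
      have "(\<Sum>j. \<bar>e j\<bar> * (M * (real j + 1) powr \<rho>)) = M * (\<Sum>j. \<bar>e j\<bar> * (real j + 1) powr \<rho>)"
        using suminf_mult[OF e, of M] by (simp add: mult.left_commute)
      moreover have "summable (\<lambda>j. \<bar>e j\<bar> * (M * (real j + 1) powr \<rho>))"
        using summable_mult[OF e, of M] by (simp add: mult.left_commute)
      ultimately show "\<exists>H. spectral l r0 (\<lambda>x. of_real (mtc_series l e x)) H \<and> wnorm s H \<le> ennreal (M\<^sup>2 * (\<Sum>j. \<bar>e j\<bar> * (real j + 1) powr \<rho>)\<^sup>2)"
        using spectral_mtc_series[OF l _ Gm e1] M by (simp add: power_mult_distrib)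
      have "(LINT x|lborel. (mtc_series l e x)\<^sup>2) \<le> 2 * (\<Sum>j. \<bar>e j\<bar>)\<^sup>2" by (rule integral_mtc_series_square[OF l e1])
      also have "(\<Sum>j. \<bar>e j\<bar>)\<^sup>2 \<le> (\<Sum>j. \<bar>e j\<bar> * (real j + 1) powr \<rho>)\<^sup>2"
        by (intro power_mono weight_one_le(2)[OF e rho0(2)] suminf_nonneg e1) auto
      finally show "(LINT x|lborel. (mtc_series l e x)\<^sup>2) \<le> 2 * (\<Sum>j. \<bar>e j\<bar> * (real j + 1) powr \<rho>)\<^sup>2" by simp
    qed
    have S2: "S\<^sup>2 \<le> (3 * C')\<^sup>2 * (X * N)\<^sup>2" if "S \<le> 3 * X * B" "S \<ge> 0" for S
    proof -
      have "S \<le> 3 * X * (C' * N)" using that(1) mult_left_mono[OF B, of "3 * X"] X0 by simp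
      then have "S\<^sup>2 \<le> (3 * X * (C' * N))\<^sup>2" using that(2) by (intro power_mono)
      then show ?thesis by (simp add: power_mult_distrib mult_ac)
    qed
    have "(\<lambda>x. f x - mtc_series l c x) \<in> sobolev_space l s r0 \<and> sobolev_norm l s r0 (\<lambda>x. f x - mtc_series l c x) \<le> K * (X * N)"
    proof (cases "\<rho> \<le> \<mu>")
      case True
      define e where "e j = a j - c j" for j
      define S where "S = (\<Sum>j. \<bar>e j\<bar> * (real j + 1) powr \<rho>)"
      have es: "summable (\<lambda>j. \<bar>e j\<bar> * (real j + 1) powr \<rho>)" using bounds(1)[OF True] by (simp add: e_def)
      have S0: "S \<ge> 0" unfolding S_def by (intro suminf_nonneg es) auto
      have SS: "S\<^sup>2 \<le> (3 * C')\<^sup>2 * (X * N)\<^sup>2" using bounds(2)[OF True] S0 by (intro S2) (auto simp: S_def e_def)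
      have diff: "mtc_series l a x - mtc_series l c x = mtc_series l e x" for x
        unfolding mtc_series_def e_def left_diff_distrib
        by (intro suminf_diff summable_rabs_cancel[OF mtc_series_summable(1)[OF l]] a1 c1)
      have ae: "AE x in lborel. f x - mtc_series l c x = mtc_series l e x"
        using fae by eventually_elim (simp add: diff)
      obtain H where H: "spectral l r0 (\<lambda>x. of_real (mtc_series l e x)) H" "wnorm s H \<le> ennreal (M\<^sup>2 * S\<^sup>2)"
        using series(1)[OF es] unfolding S_def by blast
      have H': "spectral l r0 (\<lambda>x. of_real (f x - mtc_series l c x)) H"
      proof (rule spectral_cong_AE[OF l H(1)])
        show "AE x in lborel. complex_of_real (mtc_series l e x) = complex_of_real (f x - mtc_series l c x)"
          using ae by eventually_elim simp
      qed measurable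
      have ei: "integrable lborel (\<lambda>x. (mtc_series l e x)\<^sup>2)"
        using sq_int_mtc_series[OF l weight_one_le(1)[OF es rho0(2)]] by (simp add: sq_int_of_real_iff)
      have eqi: "(LINT x|lborel. (f x - mtc_series l c x)\<^sup>2) = (LINT x|lborel. (mtc_series l e x)\<^sup>2)"
        by (rule integral_cong_AE) (use ae in \<open>auto elim: eventually_mono\<close>)
      show ?thesis
      proof (rule sobolev_norm_le[OF l H' _ H(2)])
        have "integrable lborel (\<lambda>x. (f x - mtc_series l c x)\<^sup>2)"
          by (rule integrable_cong_AE_imp[OF ei]) (use ae in \<open>auto elim: eventually_mono\<close>)
        then show "sq_int (\<lambda>x. of_real (f x - mtc_series l c x))" unfolding sq_int_of_real_iff by simp
        show "(LINT x|lborel. (f x - mtc_series l c x)\<^sup>2) \<le> 2 * S\<^sup>2" unfolding eqi S_def by (rule series(2)[OF es])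
        have "2 * S\<^sup>2 + M\<^sup>2 * S\<^sup>2 \<le> (4 + 2 * M\<^sup>2) * S\<^sup>2" by (simp add: algebra_simps)
        also have "\<dots> \<le> (4 + 2 * M\<^sup>2) * ((3 * C')\<^sup>2 * (X * N)\<^sup>2)" by (intro mult_left_mono SS) auto
        also have "\<dots> \<le> K\<^sup>2 * (X * N)\<^sup>2" unfolding K2 using A by (simp add: algebra_simps)
        finally show "2 * S\<^sup>2 + M\<^sup>2 * S\<^sup>2 \<le> (K * (X * N))\<^sup>2" by (simp add: power_mult_distrib)
      qed (use K X0 N0 in auto)
    next
      case False
      define S where "S = (\<Sum>j. \<bar>c j\<bar> * (real j + 1) powr \<rho>)"
      have S0: "S \<ge> 0" unfolding S_def by (intro suminf_nonneg c\<rho>) auto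
      have SS: "S\<^sup>2 \<le> (3 * C')\<^sup>2 * (X * N)\<^sup>2" using bounds(3) False S0 by (intro S2) (auto simp: S_def)
      \<comment> \<open>The exponent of \<open>X\<close> exceeds 1 in this case, so the norm of
        \<open>f\<close> may be replaced by \<open>X * N\<close>.\<close>
      have X1: "X \<ge> 1" unfolding X_def using False p by (intro ge_one_powr_ge_zero) auto
      have NX: "N\<^sup>2 \<le> (X * N)\<^sup>2" using X1 N0 mult_right_mono[OF X1 N0] by (intro power_mono) auto
      obtain H where H: "spectral l r0 (\<lambda>x. of_real (mtc_series l c x)) H" "wnorm s H \<le> ennreal (M\<^sup>2 * S\<^sup>2)"
        using series(1)[OF c\<rho>] unfolding S_def by blast
      have Hfin: "wnorm s H < \<infinity>" using H(2) by (simp add: order_le_less_trans)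
      obtain F where F: "spectral l r0 (\<lambda>x. of_real (f x)) F" "wnorm s F \<le> ennreal A * wnorm r1 G"
        using A(2)[OF G(1,3,2)] by blast
      have WF: "wnorm s F \<le> ennreal (A * ((2 * pi)\<^sup>2 * N\<^sup>2))"
      proof -
        have "ennreal A * wnorm r1 G = ennreal (A * enn2real (wnorm r1 G))" using A G(2) by (simp add: ennreal_mult)
        also have "\<dots> \<le> ennreal (A * ((2 * pi)\<^sup>2 * N\<^sup>2))" using A by (intro ennreal_leI mult_left_mono WG) auto
        finally show ?thesis using F(2) by (rule order_trans[rotated])
      qed
      have Ffin: "wnorm s F < \<infinity>" using WF by (simp add: order_le_less_trans)
      have sc: "sq_int (\<lambda>x. complex_of_real (mtc_series l c x))" by (rule sq_int_mtc_series[OF l c1])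
      have ci: "integrable lborel (\<lambda>x. (mtc_series l c x)\<^sup>2)" using sc by (simp add: sq_int_of_real_iff)
      note [measurable] = spectralD(1)[OF F(1)] spectralD(1)[OF H(1)]
      have neg: "wnorm s (\<lambda>t. - 1 * H t) = wnorm s H" by (simp add: wnorm_def)
      have "spectral l r0 (\<lambda>x. of_real (f x) + - 1 * of_real (mtc_series l c x)) (\<lambda>t. F t + - 1 * H t)"
        by (rule spectral_add[OF l G(3) sq_int_cmult[OF sc] F(1) spectral_cmult[OF H(1)] Ffin]) (simp only: neg Hfin)
      then have D: "spectral l r0 (\<lambda>x. of_real (f x - mtc_series l c x)) (\<lambda>t. F t + - 1 * H t)" by simp
      have WD: "wnorm s (\<lambda>t. F t + - 1 * H t) \<le> ennreal (2 * (A * ((2 * pi)\<^sup>2 * N\<^sup>2)) + 2 * (M\<^sup>2 * S\<^sup>2))"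
      proof -
        have "wnorm s (\<lambda>t. F t + - 1 * H t) \<le> 2 * wnorm s F + 2 * wnorm s H"
          using wnorm_add_le[of F "\<lambda>t. - 1 * H t" s] unfolding neg by measurable
        also have "\<dots> \<le> 2 * ennreal (A * ((2 * pi)\<^sup>2 * N\<^sup>2)) + 2 * ennreal (M\<^sup>2 * S\<^sup>2)"
          by (intro add_mono mult_left_mono WF H(2)) auto
        also have "\<dots> = ennreal (2 * (A * ((2 * pi)\<^sup>2 * N\<^sup>2)) + 2 * (M\<^sup>2 * S\<^sup>2))"
        proof -
          have "2 * ennreal u + 2 * ennreal v = ennreal (2 * u + 2 * v)" if "u \<ge> 0" "v \<ge> 0" for u v
            using that by (simp add: ennreal_mult)
          then show ?thesis using A by simp
        qed
        finally show ?thesis .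
      qed
      show ?thesis
      proof (rule sobolev_norm_le[OF l D _ WD])
        have "sq_int (\<lambda>x. of_real (f x) + - 1 * complex_of_real (mtc_series l c x))"
          by (intro sq_int_add G(3) sq_int_cmult sc)
        then show "sq_int (\<lambda>x. of_real (f x - mtc_series l c x))" by simp
        show "2 * (A * ((2 * pi)\<^sup>2 * N\<^sup>2)) + 2 * (M\<^sup>2 * S\<^sup>2) \<ge> 0" using A by simp
        have "(LINT x|lborel. (f x - mtc_series l c x)\<^sup>2) \<le> 2 * (LINT x|lborel. (f x)\<^sup>2) + 2 * (LINT x|lborel. (mtc_series l c x)\<^sup>2)"
          by (rule integral_square_diff_le) (use fi ci in auto)
        also have "\<dots> \<le> 2 * (2 * N\<^sup>2) + 2 * (2 * S\<^sup>2)"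
          using f2 series(2)[OF c\<rho>] by (intro add_mono mult_left_mono) (auto simp: S_def)
        finally show "(LINT x|lborel. (f x - mtc_series l c x)\<^sup>2) \<le> 4 * N\<^sup>2 + 4 * S\<^sup>2" by simp
        have "4 * N\<^sup>2 + 4 * S\<^sup>2 + (2 * (A * ((2 * pi)\<^sup>2 * N\<^sup>2)) + 2 * (M\<^sup>2 * S\<^sup>2)) = (4 + 2 * A * (2 * pi)\<^sup>2) * N\<^sup>2 + (4 + 2 * M\<^sup>2) * S\<^sup>2"
          by (simp add: algebra_simps)
        also have "\<dots> \<le> (4 + 2 * A * (2 * pi)\<^sup>2) * (X * N)\<^sup>2 + (4 + 2 * M\<^sup>2) * ((3 * C')\<^sup>2 * (X * N)\<^sup>2)"
          using A by (intro add_mono mult_left_mono NX SS) auto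
        also have "\<dots> = (K * (X * N))\<^sup>2" unfolding power_mult_distrib[of K] K2 by (simp only: distrib_right mult.assoc)
        finally show "4 * N\<^sup>2 + 4 * S\<^sup>2 + (2 * (A * ((2 * pi)\<^sup>2 * N\<^sup>2)) + 2 * (M\<^sup>2 * S\<^sup>2)) \<le> (K * (X * N))\<^sup>2" .
      qed (use K X0 N0 in auto)
    qed
    then show "(\<lambda>x. f x - mtc_interp l p (cont_rep f) x) \<in> sobolev_space l s r0 \<and>
     sobolev_norm l s r0 (\<lambda>x. f x - mtc_interp l p (cont_rep f) x) \<le> K * real (2 * p) powr (1 + \<rho> - \<mu>) * sobolev_norm l r1 (2 * r1) f"
      unfolding interp N_def X_def by (simp only: mult.assoc)
  qed
qed

theorem corollary3p4:
  fixes l s r0 r1 \<epsilon> :: real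
  assumes "l > 0" and "s > - 1 / 2" and "r0 \<ge> 0" and "\<epsilon> > 0"
    and "r1 \<ge> r0 + \<bar>s\<bar>" and "r1 > 1 / 2"
  shows "\<exists>c>0. \<forall>(p::nat) (n::nat) f. p \<ge> 1 \<and> n = 2 * p - 1 \<and> f \<in> sobolev_space l r1 (2 * r1) \<longrightarrow>
     (\<lambda>x. f x - mtc_interp l p (cont_rep f) x) \<in> sobolev_space l s r0 \<and>
     sobolev_norm l s r0 (\<lambda>x. f x - mtc_interp l p (cont_rep f) x)
       \<le> c * (l * real n / 2) powr (3 / 2 + \<epsilon> + r0 + \<bar>s\<bar> - min 0 (2 * s) - r1)
           * sobolev_norm l r1 (2 * r1) f"
proof -
  \<comment> \<open>\<mu> gives away \<open>2 * \<theta>\<close> and \<rho> gives away \<theta>, in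
    total at most \<epsilon>; the second bound keeps
    \<open>\<mu> = r1 - 1 / 2 - 2 * \<theta>\<close> nonnegative.\<close>
  define \<theta> where "\<theta> = min (\<epsilon> / 3) ((r1 - 1 / 2) / 2)"
  have \<theta>: "\<theta> > 0" "3 * \<theta> \<le> \<epsilon>" "2 * \<theta> \<le> r1 - 1 / 2" using assms by (auto simp: \<theta>_def min_def)
  define \<mu> where "\<mu> = r1 - 1 / 2 - 2 * \<theta>"
  define \<rho> where "\<rho> = r0 + \<bar>s\<bar> + \<theta>"
  define E where "E = 3 / 2 + \<epsilon> + r0 + \<bar>s\<bar> - min 0 (2 * s) - r1"
  have mu: "0 \<le> \<mu>" "\<mu> < r1 - 1 / 2" and rho: "\<rho> > r0 + \<bar>s\<bar>" using \<theta> by (auto simp: \<mu>_def \<rho>_def)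
  \<comment> \<open>The exponent reached is
    \<open>3 / 2 + 3 * \<theta> + r0 + \<bar>s\<bar> - r1\<close>; both
    \<open>3 * \<theta> \<le> \<epsilon>\<close> and \<open>min 0 (2 * s) \<le> 0\<close> work in
    favour of \<open>E\<close>.\<close>
  have E: "1 + \<rho> - \<mu> \<le> E" using \<theta>(2) by (simp add: \<mu>_def \<rho>_def E_def min_def)
  obtain K where K: "K > 0" "\<And>p f. p \<ge> 1 \<Longrightarrow> f \<in> sobolev_space l r1 (2 * r1) \<Longrightarrow>
     (\<lambda>x. f x - mtc_interp l p (cont_rep f) x) \<in> sobolev_space l s r0 \<and>
     sobolev_norm l s r0 (\<lambda>x. f x - mtc_interp l p (cont_rep f) x) \<le> K * real (2 * p) powr (1 + \<rho> - \<mu>) * sobolev_norm l r1 (2 * r1) f"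
    by (rule interpolation_error[OF assms(1-3,5,6) mu rho]) (rule that)
  \<comment> \<open>From \<open>n \<le> 2 * p \<le> 2 * n\<close>, powers of \<open>2 * p\<close>
    and of \<open>n\<close> differ by at most \<open>2 powr \<bar>E\<bar>\<close>, whatever the sign
    of \<open>E\<close>; the division by \<open>(l / 2) powr E\<close> introduces the scale
    \<open>l * n / 2\<close>.\<close>
  define c where "c = K * (2 powr \<bar>E\<bar> / (l / 2) powr E)"
  have c: "c > 0" using K(1) assms(1) by (simp add: c_def)
  have main: "(\<lambda>x. f x - mtc_interp l p (cont_rep f) x) \<in> sobolev_space l s r0 \<and>
     sobolev_norm l s r0 (\<lambda>x. f x - mtc_interp l p (cont_rep f) x) \<le> c * (l * real n / 2) powr E * sobolev_norm l r1 (2 * r1) f"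
    if p: "p \<ge> 1" and n: "n = 2 * p - 1" and f: "f \<in> sobolev_space l r1 (2 * r1)" for p n f
  proof -
    have P: "real (2 * p) \<ge> 1" "real n \<ge> 1" "real n \<le> real (2 * p)" "real (2 * p) \<le> 2 * real n" using p n by auto
    have N0: "sobolev_norm l r1 (2 * r1) f \<ge> 0"
      by (rule sobolev_spaceE[OF assms(1) f]) (rule sobolev_spaceI(3)[OF assms(1)])
    have "real (2 * p) powr (1 + \<rho> - \<mu>) \<le> real (2 * p) powr E" using P E by (intro powr_mono)
    also have "\<dots> \<le> 2 powr \<bar>E\<bar> * real n powr E"
    proof (cases "E \<ge> 0")
      case True
      then have "real (2 * p) powr E \<le> (2 * real n) powr E" using P by (intro powr_mono2) auto
      then show ?thesis using True by (simp add: powr_mult)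
    next
      case False
      then have "real (2 * p) powr E \<le> real n powr E" using P by (intro powr_mono2') auto
      also have "\<dots> \<le> 2 powr \<bar>E\<bar> * real n powr E"
        using mult_right_mono[of 1 "2 powr \<bar>E\<bar>" "real n powr E"] ge_one_powr_ge_zero[of 2 "\<bar>E\<bar>"] by simp
      finally show ?thesis .
    qed
    finally have "K * real (2 * p) powr (1 + \<rho> - \<mu>) * sobolev_norm l r1 (2 * r1) f \<le>
        K * (2 powr \<bar>E\<bar> * real n powr E) * sobolev_norm l r1 (2 * r1) f"
      using K(1) N0 by (intro mult_right_mono mult_left_mono) auto
    also have "K * (2 powr \<bar>E\<bar> * real n powr E) = c * (l * real n / 2) powr E"
      using assms(1) by (simp add: c_def powr_mult powr_divide)
    finally show ?thesis using K(2)[OF p f] by linarith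
  qed
  show ?thesis using c main unfolding E_def by blast
qed

end
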